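(* Let $d\ge 2$ and let $\Omega\subset\mathbb{R}^d$ be a bounded, connected domain with smooth boundary. Let $c_1,\dots,c_N$ (with associated potential $\Phi$) be a classical solution on $\Omega\times[0,\infty)$ of the Nernst-Planck system $$\partial_t c_i=D_i\,\mathrm{div}(\nabla c_i+z_ic_i\nabla\Phi),\quad i=1,\dots,N,\qquad -\epsilon\Delta\Phi=\rho=\sum_{i=1}^N z_ic_i,$$ with boundary conditions $\partial_n c_i|_{\partial\Omega}=0$ ($i=1,\dots,N$) and $\partial_n\Phi|_{\partial\Omega}=0$, normalization $\int_\Omega\Phi\,dx=0$ for all times, and with initial concentrations satisfying net electroneutrality $\sum_{i=1}^N z_i\bar c_i=0$, where $\bar c_i=\frac{1}{|\Omega|}\int_\Omega c_i(x,0)\,dx$. Let $$\mathcal{E}(t)=\sum_{i=1}^N\int_\Omega c_i\ln\frac{c_i}{\bar c_i}\,dx+\frac{\epsilon}{2}\int_\Omega|\nabla\Phi|^2\,dx .$$ Then the concentrations $c_1,\dots,c_N$ converge to $\bar c_1,\dots,\bar c_N$ in relative entropy and $\nabla\Phi$ converges to $0$ in $L^2(\Omega)$ as $t\to\infty$; that is, for all $t\ge 0$, $$\mathcal{E}(t)\le\mathcal{E}(0)e^{-rt},$$ where $r>0$ depends only on the dimension $d$, the diffusion coefficients $D_i$ and $\Omega$. In particular, $c_i$ converges to $\bar c_i$ in $L^1(\Omega)$: for all $t\ge 0$, $$\sum_{i=1}^N\frac{\|c_i(t)-\bar c_i\|_{L^1(\Omega)}^2}{\bar c_i}\le C_\Omega\,\mathcal{E}(0)e^{-rt},$$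 where $C_\Omega>0$ depends only on $\Omega$.
   Context: The $c_i\ge 0$ are ionic concentrations; $D_i>0$ are constant diffusion coefficients; $\epsilon>0$ is a constant (dielectric permittivity); $z_i\in\mathbb{R}$ are constant valences (of either sign); $\partial_n$ is the outward normal derivative on $\partial\Omega$. The solutions are assumed globally regular in time (existence and regularity of solutions is assumed, not part of the claim). Usual reading of formulas: $0\ln 0=0$, and expressions with $\bar c_i$ in a denominator are meaningful when $\bar c_i>0$. *)

theory Defs
  imports "HOL-Analysis.Analysis"
begin

definition grad :: "('a::euclidean_space \<Rightarrow> real) \<Rightarrow> 'a \<Rightarrow> 'a" where
  "grad f x = (\<Sum>b\<in>Basis. frechet_derivative f (at x) b *\<^sub>R b)"

definition divergence :: "('a::euclidean_space \<Rightarrow> 'a) \<Rightarrow> 'a \<Rightarrow> real" where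
  "divergence F x = (\<Sum>b\<in>Basis. frechet_derivative F (at x) b \<bullet> b)"

definition laplacian :: "('a::euclidean_space \<Rightarrow> real) \<Rightarrow> 'a \<Rightarrow> real" where
  "laplacian f = divergence (grad f)"

fun Ck_on :: "nat \<Rightarrow> 'a::euclidean_space set \<Rightarrow> ('a \<Rightarrow> real) \<Rightarrow> bool" where
  "Ck_on 0 U f \<longleftrightarrow> continuous_on U f"
| "Ck_on (Suc k) U f \<longleftrightarrow>
     (\<forall>x\<in>U. f differentiable (at x)) \<and>
     (\<forall>b\<in>Basis. Ck_on k U (\<lambda>x. frechet_derivative f (at x) b))"

definition smooth_on :: "'a::euclidean_space set \<Rightarrow> ('a \<Rightarrow> real) \<Rightarrow> bool" where
  "smooth_on U f \<longleftrightarrow> (\<forall>k. Ck_on k U f)"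

text \<open>Since the gradient of \<open>\<psi>\<close> vanishes nowhere on \<open>U\<close>, the frontier of \<open>\<Omega>\<close> inside \<open>U\<close>
  is the hypersurface \<open>\<psi> = 0\<close>, and \<open>\<Omega>\<close> lies on one side of it.\<close>

definition local_defining_function ::
  "'a::euclidean_space set \<Rightarrow> 'a set \<Rightarrow> ('a \<Rightarrow> real) \<Rightarrow> bool" where
  "local_defining_function \<Omega> U \<psi> \<longleftrightarrow>
     open U \<and> smooth_on U \<psi> \<and> (\<forall>x\<in>U. grad \<psi> x \<noteq> 0) \<and> \<Omega> \<inter> U = {x \<in> U. \<psi> x < 0}"

definition smooth_boundary :: "'a::euclidean_space set \<Rightarrow> bool" where
  "smooth_boundary \<Omega> \<longleftrightarrow>
     (\<forall>x\<in>frontier \<Omega>. \<exists>U \<psi>. x \<in> U \<and> local_defining_function \<Omega> U \<psi>)"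

definition smooth_bounded_domain :: "'a::euclidean_space set \<Rightarrow> bool" where
  "smooth_bounded_domain \<Omega> \<longleftrightarrow>
     \<Omega> \<noteq> {} \<and> open \<Omega> \<and> connected \<Omega> \<and> bounded \<Omega> \<and> smooth_boundary \<Omega>"

text \<open>The vector chosen here does not depend on the defining function.\<close>

definition outward_normal :: "'a::euclidean_space set \<Rightarrow> 'a \<Rightarrow> 'a" where
  "outward_normal \<Omega> x =
     (SOME \<nu>. \<exists>U \<psi>. x \<in> U \<and> local_defining_function \<Omega> U \<psi> \<and>
        \<nu> = grad \<psi> x /\<^sub>R norm (grad \<psi> x))"

text \<open>Functions are only relevant on \<open>\<Omega>\<close>, so the gradient at a boundary point is the limit of
  the gradient from inside. The limit exists for functions that are \<open>C\<^sup>1\<close> up to the boundary,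
  the only ones to which this notion is applied.\<close>

definition normal_derivative :: "'a::euclidean_space set \<Rightarrow> ('a \<Rightarrow> real) \<Rightarrow> 'a \<Rightarrow> real" where
  "normal_derivative \<Omega> f x = outward_normal \<Omega> x \<bullet> Lim (at x within \<Omega>) (grad f)"

text \<open>Joint continuity in time \<open>t \<in> T\<close> and space, up to the boundary of \<open>\<Omega>\<close>.\<close>

definition continuous_up_to_boundary ::
  "real set \<Rightarrow> 'a::euclidean_space set \<Rightarrow> (real \<Rightarrow> 'a \<Rightarrow> 'b::topological_space) \<Rightarrow> bool" where
  "continuous_up_to_boundary T \<Omega> u \<longleftrightarrow>
     (\<exists>v. continuous_on (T \<times> closure \<Omega>) (\<lambda>(t, x). v t x) \<and>
          (\<forall>t\<in>T. \<forall>x\<in>\<Omega>. v t x = u t x))"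

definition C2_in_space ::
  "real set \<Rightarrow> 'a::euclidean_space set \<Rightarrow> (real \<Rightarrow> 'a \<Rightarrow> real) \<Rightarrow> bool" where
  "C2_in_space T \<Omega> u \<longleftrightarrow>
     (\<forall>t\<in>T. \<forall>x\<in>\<Omega>. u t differentiable (at x) \<and> grad (u t) differentiable (at x)) \<and>
     (\<forall>b\<in>Basis. continuous_on (T \<times> \<Omega>)
        (\<lambda>(t, x). frechet_derivative (grad (u t)) (at x) b))"

text \<open>Classical solutions: the concentrations \<open>c i\<close>, \<open>i < N\<close>, are \<open>C\<^sup>2\<close> in space and \<open>C\<^sup>1\<close> in
  time on \<open>\<Omega> \<times> (0,\<infinity>)\<close>, have gradients continuous up to the boundary for positive times, and
  are continuous up to the boundary and down to time \<open>0\<close>. Continuity of the time derivative is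
  not listed since it follows from the equation. As \<open>\<nabla>\<Phi>\<close> enters the energy at time \<open>0\<close>, the
  potential and its gradient are required to be continuous down to time \<open>0\<close>.\<close>

definition nernst_planck_solution ::
  "'a::euclidean_space set \<Rightarrow> nat \<Rightarrow> (nat \<Rightarrow> real) \<Rightarrow> real \<Rightarrow> (nat \<Rightarrow> real) \<Rightarrow>
   (nat \<Rightarrow> real \<Rightarrow> 'a \<Rightarrow> real) \<Rightarrow> (real \<Rightarrow> 'a \<Rightarrow> real) \<Rightarrow> bool" where
  "nernst_planck_solution \<Omega> N D \<epsilon> z c \<Phi> \<longleftrightarrow>
     (\<forall>i<N. C2_in_space {0<..} \<Omega> (c i) \<and>
            continuous_up_to_boundary {0<..} \<Omega> (\<lambda>t. grad (c i t)) \<and>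
            continuous_up_to_boundary {0..} \<Omega> (c i)) \<and>
     C2_in_space {0<..} \<Omega> \<Phi> \<and>
     (\<forall>x\<in>\<Omega>. \<Phi> 0 differentiable (at x)) \<and>
     continuous_up_to_boundary {0..} \<Omega> (\<lambda>t. grad (\<Phi> t)) \<and>
     continuous_up_to_boundary {0..} \<Omega> \<Phi> \<and>
     (\<forall>i<N. \<forall>t\<ge>0. \<forall>x\<in>\<Omega>. c i t x \<ge> 0) \<and>
     (\<forall>i<N. \<forall>t>0. \<forall>x\<in>\<Omega>.
        ((\<lambda>s. c i s x) has_real_derivative
          D i * divergence (\<lambda>y. grad (c i t) y + (z i * c i t y) *\<^sub>R grad (\<Phi> t) y) x) (at t)) \<and>
     (\<forall>t>0. \<forall>x\<in>\<Omega>. - \<epsilon> * laplacian (\<Phi> t) x = (\<Sum>i<N. z i * c i t x)) \<and>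
     (\<forall>i<N. \<forall>t>0. \<forall>x\<in>frontier \<Omega>. normal_derivative \<Omega> (c i t) x = 0) \<and>
     (\<forall>t>0. \<forall>x\<in>frontier \<Omega>. normal_derivative \<Omega> (\<Phi> t) x = 0) \<and>
     (\<forall>t\<ge>0. (LINT x:\<Omega>|lborel. \<Phi> t x) = 0)"

definition mean :: "'a::euclidean_space set \<Rightarrow> ('a \<Rightarrow> real) \<Rightarrow> real" where
  "mean \<Omega> f = (LINT x:\<Omega>|lborel. f x) / measure lborel \<Omega>"

text \<open>The integrand is \<open>0\<close> wherever \<open>f\<close> vanishes, in accordance with \<open>0 ln 0 = 0\<close>. In
  particular, a species with mean \<open>m = 0\<close>, being absent for all times, has entropy \<open>0\<close>.\<close>

definition relative_entropy :: "'a::euclidean_space set \<Rightarrow> ('a \<Rightarrow> real) \<Rightarrow> real \<Rightarrow> real" where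
  "relative_entropy \<Omega> f m = (LINT x:\<Omega>|lborel. f x * ln (f x / m))"

definition L1_norm :: "'a::euclidean_space set \<Rightarrow> ('a \<Rightarrow> real) \<Rightarrow> real" where
  "L1_norm \<Omega> f = (LINT x:\<Omega>|lborel. \<bar>f x\<bar>)"

definition L2_norm :: "'a::euclidean_space set \<Rightarrow> ('a \<Rightarrow> 'a) \<Rightarrow> real" where
  "L2_norm \<Omega> F = sqrt (LINT x:\<Omega>|lborel. (norm (F x))\<^sup>2)"

definition energy ::
  "'a::euclidean_space set \<Rightarrow> nat \<Rightarrow> real \<Rightarrow> (nat \<Rightarrow> real \<Rightarrow> 'a \<Rightarrow> real) \<Rightarrow>
   (real \<Rightarrow> 'a \<Rightarrow> real) \<Rightarrow> real \<Rightarrow> real" where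
  "energy \<Omega> N \<epsilon> c \<Phi> t =
     (\<Sum>i<N. relative_entropy \<Omega> (c i t) (mean \<Omega> (c i 0))) +
     \<epsilon> / 2 * (LINT x:\<Omega>|lborel. (norm (grad (\<Phi> t) x))\<^sup>2)"

end

theory Submission imports Defs begin

text \<open>Along a solution, the energy \<open>\<E>\<close> satisfies
  \<open>d\<E>/dt = - \<Sum>\<^sub>i D\<^sub>i \<integral> c\<^sub>i \<bar>\<nabla> ln c\<^sub>i + z\<^sub>i \<nabla>\<Phi>\<bar>\<^sup>2\<close>. With all \<open>D\<^sub>i\<close> replaced by their minimum, the square
  expands into the Fisher informations \<open>\<integral> \<bar>\<nabla>c\<^sub>i\<bar>\<^sup>2 / c\<^sub>i\<close>, a nonnegative term, and the cross term
  \<open>2 \<integral> \<nabla>\<rho> \<bullet> \<nabla>\<Phi> = (2/\<epsilon>) \<integral> \<rho>\<^sup>2\<close>. The logarithmic Sobolev inequality of \<open>\<Omega>\<close> bounds the entropies by the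
  Fisher informations and the Poincare inequality bounds \<open>\<epsilon> \<integral> \<bar>\<nabla>\<Phi>\<bar>\<^sup>2\<close> by \<open>\<integral> \<rho>\<^sup>2 / \<epsilon>\<close>, so that \<open>\<E>\<close> decays
  exponentially; the \<open>L\<^sup>1\<close> estimate is the Csiszar-Kullback inequality. As the \<open>c\<^sub>i\<close> may vanish, \<open>c\<^sub>i\<close> is
  replaced by \<open>c\<^sub>i + \<delta>\<close> in the entropy, at the price of a defect of order \<open>\<delta>\<close>.

  The logarithmic Sobolev inequality is local: \<open>\<Omega>\<close> is covered by sets \<open>V\<close> each of whose points sees
  a fixed box \<open>B\<close> along segments inside \<open>\<Omega>\<close>. The averages \<open>u\<^sub>s(x)\<close> of \<open>g((1 - s) x + s y)\<close> over \<open>y \<in> B\<close>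
  interpolate between \<open>g\<close> and a constant, and \<open>u\<^sub>s \<le> C s\<^sup>-\<^sup>d \<integral> g\<close> costs only a factor \<open>ln (1/s)\<close>, which is
  integrable. The local means are compared by an \<open>L\<^sup>1\<close> Poincare inequality and connectedness.

  Integration by parts uses cutoffs \<open>\<kappa>\<^sub>n\<close> instead of surface integrals: if the field \<open>F\<close> is tangential
  at the boundary, then \<open>\<integral> \<bar>F \<bullet> \<nabla>\<kappa>\<^sub>n\<bar> \<rightarrow> 0\<close>, because \<open>F \<bullet> \<nabla>\<psi>\<close> is small where \<open>\<nabla>\<kappa>\<^sub>n\<close> is large.\<close>

section \<open>Entropy density and changes of variables\<close>

text \<open>Nothing controls second derivatives of a solution near the boundary, so the divergence
  of a flux need not be integrable over \<Omega>. Time derivatives of integrals are therefore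
  reached through identities integrated in time, in which only first derivatives survive the removal
  of the cutoffs; the gradients of the cutoffs are bounded in \<open>L\<^sup>1\<close> uniformly in
  \<open>n\<close>, and this supplies the dominating function in time. The entropy is taken in its
  Bregman form: \<open>u * ln (u / t)\<close> has the same integral when \<open>t\<close> is the
  mean of \<open>u\<close>, but the Bregman form is nonnegative pointwise, so it can be estimated
  piecewise on an overlapping cover. In the logarithmic Sobolev inequality the constants are
  arranged so that the entropy of the averages is bounded by data plus half of its own supremum over
  \<open>s\<close>; the supremum is finite and can be absorbed. The rate depends on neither
  \<epsilon> nor the valences because two powers match: the cross term contributes a multiple of
  \<open>\<integral> \<rho>\<^sup>2 / \<epsilon>\<close>, and the electric energy is at most a
  multiple of the same quantity.\<close>

definition entropy_density :: "real \<Rightarrow> real \<Rightarrow> real" where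
  "entropy_density t u = u * ln (u / t) - u + t"

text \<open>\<open>ln y \<le> y - 1\<close> at \<open>y = sqrt (t / u)\<close>, multiplied by
  \<open>2 * u\<close>. The Poincare and Csiszar-Kullback inequalities both extract from the entropy
  exactly this squared difference of square roots.\<close>

lemma sqrt_diff_le_entropy_density:
  assumes "t > 0" "u \<ge> 0"
  shows "(sqrt u - sqrt t)\<^sup>2 \<le> entropy_density t u"
proof (cases "u = 0")
  case True
  then show ?thesis using assms by (simp add: entropy_density_def)
next
  case False
  then have u: "u > 0" using assms by simp
  have "ln (sqrt (t / u)) \<le> sqrt (t / u) - 1"
    using u assms by (intro ln_le_minus_one) auto
  moreover have "ln (sqrt (t / u)) = - ln (u / t) / 2"
    using u assms by (simp add: ln_sqrt ln_div)
  ultimately have "u * (2 - 2 * sqrt (t / u)) \<le> u * ln (u / t)"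
    using u by (intro mult_left_mono) auto
  moreover have "u * sqrt (t / u) = sqrt u * sqrt t"
  proof -
    have "u * sqrt (t / u) = (sqrt u * sqrt u) * (sqrt t / sqrt u)"
      using u by (simp add: real_sqrt_divide)
    also have "\<dots> = sqrt u * sqrt t"
      using u by (simp del: real_sqrt_mult_self)
    finally show ?thesis .
  qed
  ultimately have "2 * u - 2 * (sqrt u * sqrt t) \<le> u * ln (u / t)"
    by (simp add: algebra_simps)
  then show ?thesis
    using u assms by (simp add: entropy_density_def power2_diff)
qed

lemma entropy_density_nonneg: "t > 0 \<Longrightarrow> u \<ge> 0 \<Longrightarrow> entropy_density t u \<ge> 0"
  using sqrt_diff_le_entropy_density[of t u] by (meson order_trans zero_le_power2)

text \<open>\<open>ln y \<le> y - 1\<close> at \<open>y = u / t\<close>. This turns control of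
  differences of means into control of their entropy.\<close>

lemma entropy_density_le:
  assumes "t > 0" "u \<ge> 0"
  shows "entropy_density t u \<le> (u - t)\<^sup>2 / t"
proof (cases "u = 0")
  case True
  then show ?thesis using assms by (simp add: entropy_density_def power2_eq_square)
next
  case False
  then have "u * ln (u / t) \<le> u * (u / t - 1)"
    using assms by (intro mult_left_mono ln_le_minus_one) auto
  also have "\<dots> = (u - t)\<^sup>2 / t + u - t"
    using assms by (simp add: field_simps power2_eq_square)
  finally show ?thesis by (simp add: entropy_density_def)
qed

text \<open>With \<open>a = ln (u / t)\<close> the entropy density is
  \<open>u * (a - 1 + exp (- a))\<close>, and the claim becomes an inequality in \<open>a\<close>
  alone. The left side is what Young's inequality produces from the derivative of the entropy; the
  price of returning to the entropy is only logarithmic in \<open>u / t\<close>.\<close>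

lemma mult_ln_squared_le_entropy_density:
  assumes "t > 0" "u > 0"
  shows "u * (ln (u / t))\<^sup>2 \<le> (2 + max 0 (ln (u / t))) * entropy_density t u"
proof -
  define a where "a = ln (u / t)"
  have ea: "exp (- a) = t / u"
    using assms by (simp add: a_def exp_minus)
  have ent: "entropy_density t u = u * (a - 1 + exp (- a))"
    using assms by (simp add: entropy_density_def a_def[symmetric] ea field_simps)
  have "a\<^sup>2 \<le> (2 + max 0 a) * (a - 1 + exp (- a))"
  proof (cases "a \<ge> 0")
    case False
    then have "1 + (- a) + (- a)\<^sup>2 / 2 \<le> exp (- a)"
      by (intro exp_lower_Taylor_quadratic) auto
    then show ?thesis using False by (simp add: max_def)
  next
    case True
    \<comment> \<open>\<open>k a\<close> is the difference of the two sides for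
      \<open>a \<ge> 0\<close>; it vanishes at 0 and has derivative
      \<open>1 - (x + 1) * exp (- x)\<close>.\<close>
    define k where "k = (\<lambda>x. (x + 2) * exp (- x) + x - 2 :: real)"
    have "k 0 \<le> k a"
    proof (rule DERIV_nonneg_imp_nondecreasing[OF True])
      fix x :: real assume "0 \<le> x" "x \<le> a"
      have "(k has_real_derivative 1 - (x + 1) * exp (- x)) (at x)"
        unfolding k_def by (auto intro!: derivative_eq_intros simp: algebra_simps)
      moreover have "(x + 1) * exp (- x) \<le> 1"
        using exp_ge_add_one_self[of x] by (simp add: exp_minus field_simps)
      ultimately show "\<exists>y. (k has_real_derivative y) (at x) \<and> 0 \<le> y"
        by (intro exI[of _ "1 - (x + 1) * exp (- x)"]) auto
    qed
    then show ?thesis using True by (simp add: k_def max_def algebra_simps power2_eq_square)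
  qed
  then have "u * a\<^sup>2 \<le> u * ((2 + max 0 a) * (a - 1 + exp (- a)))"
    using assms by (intro mult_left_mono) auto
  then show ?thesis
    unfolding ent a_def[symmetric] by (simp add: mult_ac)
qed

lemma entropy_density_has_derivative:
  assumes "t > 0" "u > 0"
  shows "(entropy_density t has_real_derivative ln (u / t)) (at u)"
  unfolding entropy_density_def using assms
  by (auto intro!: derivative_eq_intros simp: field_simps)

text \<open>The critical point is 0, where the formal value 0 is also the limit: the substitution
  \<open>x = 1 / y\<close> reduces it to the decay of \<open>ln y / y\<close>.\<close>

lemma continuous_on_mult_ln: "continuous_on {0..} (\<lambda>x::real. x * ln (x / m))"
proof (cases "m = 0")
  \<comment> \<open>Division by 0 yields 0, and so does \<open>ln 0\<close>; the function is
    constantly 0.\<close>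
  case True
  then show ?thesis by simp
next
  case False
  have "continuous (at x within {0..}) (\<lambda>x::real. x * ln (x / m))" if "x \<ge> 0" for x
  proof (cases "x = 0")
    case False
    with that \<open>m \<noteq> 0\<close> show ?thesis
      by (intro continuous_intros) auto
  next
    case True
    have "((\<lambda>x::real. x * ln x) \<longlongrightarrow> 0) (at_right 0)"
      unfolding filterlim_at_right_to_top
    proof (rule Lim_transform_eventually)
      show "((\<lambda>x::real. - (ln x / x)) \<longlongrightarrow> 0) at_top"
        using tendsto_minus[OF ln_x_over_x_tendsto_0] by simp
      show "\<forall>\<^sub>F x::real in at_top. - (ln x / x) = inverse x * ln (inverse x)"
        using eventually_gt_at_top[of 0] by eventually_elim (simp add: ln_inverse divide_inverse mult.commute)
    qed
    then have "((\<lambda>x::real. x * ln x - x * ln m) \<longlongrightarrow> 0 - 0 * ln m) (at_right 0)"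
      by (intro tendsto_intros)
    then have "((\<lambda>x::real. x * ln x - x * ln m) \<longlongrightarrow> 0) (at_right 0)"
      by simp
    moreover have "\<forall>\<^sub>F x in at_right 0. x * ln x - x * ln m = x * ln (x / m)"
      using \<open>m \<noteq> 0\<close> by (intro eventually_at_rightI[of 0 1]) (auto simp: ln_div algebra_simps)
    ultimately have "((\<lambda>x::real. x * ln (x / m)) \<longlongrightarrow> 0) (at_right 0)"
      by (rule Lim_transform_eventually)
    moreover have "at (0::real) within {0..} = at_right 0"
      by (rule at_within_nhd[of _ UNIV]) auto
    ultimately show ?thesis using True by (simp add: continuous_within)
  qed
  then show ?thesis by (auto simp: continuous_on_eq_continuous_within)
qed

section \<open>Changes of variables and integrability on bounded sets\<close>

lemma nn_integral_lborel_affine: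
  fixes f :: "'a::euclidean_space \<Rightarrow> ennreal"
  assumes [measurable]: "f \<in> borel_measurable borel" and c: "c > 0"
  shows "(\<integral>\<^sup>+x. f (t + c *\<^sub>R x) \<partial>lborel) = ennreal (1 / c ^ DIM('a)) * (\<integral>\<^sup>+x. f x \<partial>lborel)"
proof -
  have "(\<integral>\<^sup>+x. f x \<partial>lborel) = (\<integral>\<^sup>+x. f x \<partial>density (distr lborel borel (\<lambda>x. t + c *\<^sub>R x)) (\<lambda>_. \<bar>c\<bar>^DIM('a)))"
    using c by (subst lborel_affine[of c t]) auto
  also have "\<dots> = ennreal (c ^ DIM('a)) * (\<integral>\<^sup>+x. f (t + c *\<^sub>R x) \<partial>lborel)"
    using c by (simp add: nn_integral_density nn_integral_distr nn_integral_cmult)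
  finally have *: "(\<integral>\<^sup>+x. f x \<partial>lborel) = ennreal (c ^ DIM('a)) * (\<integral>\<^sup>+x. f (t + c *\<^sub>R x) \<partial>lborel)" .
  have "ennreal (1 / c ^ DIM('a)) * ennreal (c ^ DIM('a)) = 1"
    using c by (simp add: ennreal_mult[symmetric])
  then show ?thesis unfolding * mult.assoc[symmetric] by simp
qed

text \<open>The Jacobian of \<open>x \<mapsto> (1 - s) x + s y\<close> degenerates as \<open>s \<rightarrow> 1\<close> and that of
  \<open>y \<mapsto> (1 - s) x + s y\<close> as \<open>s \<rightarrow> 0\<close>; one of the two always suffices.\<close>

lemma nn_integral_convex_combinations_le:
  fixes J :: "'a::euclidean_space \<Rightarrow> ennreal"
  assumes [measurable]: "J \<in> borel_measurable borel" "V \<in> sets borel" "B \<in> sets borel"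
    and s: "0 \<le> s" "s \<le> 1"
  shows "(\<integral>\<^sup>+x\<in>V. (\<integral>\<^sup>+y\<in>B. J ((1 - s) *\<^sub>R x + s *\<^sub>R y) \<partial>lborel) \<partial>lborel)
    \<le> 2 ^ DIM('a) * max (emeasure lborel V) (emeasure lborel B) * (\<integral>\<^sup>+x. J x \<partial>lborel)"
    (is "?L \<le> ?c * max ?v ?b * ?I")
proof (cases "s \<ge> 1/2")
  \<comment> \<open>Whichever variable is substituted, its coefficient \<open>c\<close> is at least
    1/2; this is the origin of the factor \<open>2 ^ DIM('a)\<close>.\<close>
  have pw: "ennreal (1 / c ^ DIM('a)) \<le> ?c" if "c \<ge> 1/2" for c :: real
  proof -
    have "(1/2) ^ DIM('a) \<le> c ^ DIM('a)"
      using that by (intro power_mono) auto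
    then have "1 / c ^ DIM('a) \<le> 2 ^ DIM('a)"
      using that by (simp add: field_simps power_divide)
    then have "ennreal (1 / c ^ DIM('a)) \<le> ennreal (2 ^ DIM('a))"
      by (rule ennreal_leI)
    then show ?thesis by (simp add: ennreal_power[symmetric])
  qed
  {
    case True
    have "?L \<le> (\<integral>\<^sup>+x\<in>V. ?c * ?I \<partial>lborel)"
    proof (intro nn_integral_mono mult_right_mono)
      fix x
      have "(\<integral>\<^sup>+y\<in>B. J ((1 - s) *\<^sub>R x + s *\<^sub>R y) \<partial>lborel) \<le> (\<integral>\<^sup>+y. J ((1 - s) *\<^sub>R x + s *\<^sub>R y) \<partial>lborel)"
        by (intro nn_integral_mono) (auto split: split_indicator)
      also have "\<dots> = ennreal (1 / s ^ DIM('a)) * ?I"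
        using True by (intro nn_integral_lborel_affine) auto
      also have "\<dots> \<le> ?c * ?I" using True by (intro mult_right_mono pw) auto
      finally show "(\<integral>\<^sup>+y\<in>B. J ((1 - s) *\<^sub>R x + s *\<^sub>R y) \<partial>lborel) \<le> ?c * ?I" .
    qed auto
    also have "\<dots> = ?c * ?v * ?I"
      by (subst nn_integral_cmult_indicator) (auto simp: mult_ac)
    also have "\<dots> \<le> ?c * max ?v ?b * ?I"
      by (intro mult_right_mono mult_left_mono) auto
    finally show ?thesis .
  next
    case False
    have "?L = (\<integral>\<^sup>+x. (\<integral>\<^sup>+y. J ((1 - s) *\<^sub>R x + s *\<^sub>R y) * indicator B y * indicator V x \<partial>lborel) \<partial>lborel)"
      by (intro nn_integral_cong) (simp add: nn_integral_multc)
    also have "\<dots> = (\<integral>\<^sup>+y. (\<integral>\<^sup>+x. J ((1 - s) *\<^sub>R x + s *\<^sub>R y) * indicator B y * indicator V x \<partial>lborel) \<partial>lborel)"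
      by (rule lborel_pair.Fubini') measurable
    also have "\<dots> \<le> (\<integral>\<^sup>+y\<in>B. ?c * ?I \<partial>lborel)"
    proof (intro nn_integral_mono)
      fix y
      have "(\<integral>\<^sup>+x. J ((1 - s) *\<^sub>R x + s *\<^sub>R y) * indicator B y * indicator V x \<partial>lborel)
         \<le> (\<integral>\<^sup>+x. J (s *\<^sub>R y + (1 - s) *\<^sub>R x) * indicator B y \<partial>lborel)"
        by (intro nn_integral_mono) (auto simp: add.commute split: split_indicator)
      also have "\<dots> = (\<integral>\<^sup>+x. J (s *\<^sub>R y + (1 - s) *\<^sub>R x) \<partial>lborel) * indicator B y"
        by (simp add: nn_integral_multc)
      also have "\<dots> \<le> ?c * ?I * indicator B y"
      proof (rule mult_right_mono)
        have "(\<integral>\<^sup>+x. J (s *\<^sub>R y + (1 - s) *\<^sub>R x) \<partial>lborel) = ennreal (1 / (1 - s) ^ DIM('a)) * ?I"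
          using False by (intro nn_integral_lborel_affine) auto
        also have "\<dots> \<le> ?c * ?I" using False by (intro mult_right_mono pw) auto
        finally show "(\<integral>\<^sup>+x. J (s *\<^sub>R y + (1 - s) *\<^sub>R x) \<partial>lborel) \<le> ?c * ?I" .
      qed simp
      finally show "(\<integral>\<^sup>+x. J ((1 - s) *\<^sub>R x + s *\<^sub>R y) * indicator B y * indicator V x \<partial>lborel)
         \<le> ?c * ?I * indicator B y" .
    qed
    also have "\<dots> = ?c * ?b * ?I"
      by (subst nn_integral_cmult_indicator) (auto simp: mult_ac)
    also have "\<dots> \<le> ?c * max ?v ?b * ?I"
      by (intro mult_right_mono mult_left_mono) auto
    finally show ?thesis .
  }
qed

lemma set_integrable_bounded:
  fixes f :: "'a::euclidean_space \<Rightarrow> 'b::{banach, second_countable_topology}"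
  assumes "set_borel_measurable lborel A f" "A \<in> sets borel" "bounded A" "\<And>x. x \<in> A \<Longrightarrow> norm (f x) \<le> K"
  shows "set_integrable lborel A f"
proof (rule set_integrable_bound)
  show "set_integrable lborel A (\<lambda>_. K)"
    using assms(2,3) emeasure_bounded_finite[of A]
    by (auto simp: set_integrable_def intro!: integrable_mult_left integrable_real_indicator)
  show "AE x in lborel. x \<in> A \<longrightarrow> norm (f x) \<le> norm K"
    using assms(4) by (fastforce intro!: AE_I2)
qed fact

lemma set_borel_measurable_continuous:
  fixes f :: "'a::euclidean_space \<Rightarrow> 'b::{real_normed_vector, second_countable_topology}"
  assumes "A \<in> sets borel" "continuous_on A f"
  shows "set_borel_measurable lborel A f"
  using borel_measurable_continuous_on_indicator[OF assms] by (simp add: set_borel_measurable_def)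

lemma set_integrable_continuous_bounded:
  fixes f :: "'a::euclidean_space \<Rightarrow> 'b::{banach, second_countable_topology}"
  assumes "A \<in> sets borel" "bounded A" "continuous_on A f" "bounded (f ` A)"
  shows "set_integrable lborel A f"
proof -
  from assms(4) obtain K where "\<And>x. x \<in> A \<Longrightarrow> norm (f x) \<le> K"
    by (auto simp: bounded_iff)
  then show ?thesis
    using assms by (intro set_integrable_bounded set_borel_measurable_continuous)
qed

lemma nn_integral_set_eq_ennreal:
  fixes f :: "'a \<Rightarrow> real"
  assumes "set_integrable M A f" "\<And>x. x \<in> A \<Longrightarrow> 0 \<le> f x"
  shows "(\<integral>\<^sup>+x\<in>A. ennreal (f x) \<partial>M) = ennreal (LINT x:A|M. f x)"
proof -
  have "(\<integral>\<^sup>+x\<in>A. ennreal (f x) \<partial>M) = (\<integral>\<^sup>+x. ennreal (indicator A x *\<^sub>R f x) \<partial>M)"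
    by (intro nn_integral_cong) (auto split: split_indicator)
  also have "\<dots> = ennreal (LINT x:A|M. f x)"
    unfolding set_lebesgue_integral_def using assms
    by (intro nn_integral_eq_integral) (auto simp: set_integrable_def split: split_indicator)
  finally show ?thesis .
qed

lemma set_integral_ennreal_le:
  fixes f :: "'a \<Rightarrow> real"
  assumes "set_integrable M A f"
  shows "ennreal \<bar>LINT x:A|M. f x\<bar> \<le> (\<integral>\<^sup>+x\<in>A. ennreal \<bar>f x\<bar> \<partial>M)"
proof -
  have "ennreal \<bar>LINT x:A|M. f x\<bar> \<le> (\<integral>\<^sup>+x. ennreal (norm (indicator A x *\<^sub>R f x)) \<partial>M)"
    unfolding set_lebesgue_integral_def real_norm_def[symmetric] using assms
    by (intro integral_norm_bound_ennreal) (auto simp: set_integrable_def)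
  also have "\<dots> = (\<integral>\<^sup>+x\<in>A. ennreal \<bar>f x\<bar> \<partial>M)"
    by (intro nn_integral_cong) (auto split: split_indicator)
  finally show ?thesis .
qed

lemma set_integral_mono_on:
  fixes f g :: "'a \<Rightarrow> real"
  assumes "set_integrable M A f" "set_integrable M A g" "\<And>x. x \<in> A \<Longrightarrow> f x \<le> g x"
  shows "(LINT x:A|M. f x) \<le> (LINT x:A|M. g x)"
  using assms by (intro set_integral_mono) auto

text \<open>The bound is asked only for \<open>s > a\<close>: in the logarithmic Sobolev estimate
  \<open>k\<close> contains \<open>s powr (- 1 / 2)\<close>, whose formal value at 0 is 0 instead of
  infinity. The missing point is a null set.\<close>

lemma ennreal_increment_le_nn_integral:
  fixes F h :: "real \<Rightarrow> real"
  assumes "a \<le> b"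
    and der: "\<And>s. s \<in> {a..b} \<Longrightarrow> (F has_real_derivative h s) (at s within {a..b})"
    and cont: "continuous_on {a..b} h"
    and k: "\<And>s. a < s \<Longrightarrow> s \<le> b \<Longrightarrow> ennreal \<bar>h s\<bar> \<le> k s"
  shows "ennreal \<bar>F b - F a\<bar> \<le> (\<integral>\<^sup>+s\<in>{a..b}. k s \<partial>lborel)"
proof -
  have int: "set_integrable lborel {a..b} h"
    using cont by (intro set_integrable_continuous_bounded compact_imp_bounded compact_continuous_image) auto
  have "(h has_integral (F b - F a)) {a..b}"
    using der \<open>a \<le> b\<close>
    by (intro fundamental_theorem_of_calculus) (auto simp: has_real_derivative_iff_has_vector_derivative)
  then have "F b - F a = (LBINT s:{a..b}. h s)"
    using set_borel_integral_eq_integral(2)[OF int] integral_unique by metis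
  then have "ennreal \<bar>F b - F a\<bar> \<le> (\<integral>\<^sup>+s\<in>{a..b}. ennreal \<bar>h s\<bar> \<partial>lborel)"
    using set_integral_ennreal_le[OF int] by simp
  also have "\<dots> \<le> (\<integral>\<^sup>+s\<in>{a..b}. k s \<partial>lborel)"
  proof (rule nn_integral_mono_AE)
    show "AE s in lborel. ennreal \<bar>h s\<bar> * indicator {a..b} s \<le> k s * indicator {a..b} s"
      using AE_lborel_singleton[of a]
      by eventually_elim (auto split: split_indicator intro: k)
  qed
  finally show ?thesis .
qed

text \<open>Tonelli twice. With the segment parameter outermost, the change of variables for a fixed
  parameter becomes applicable.\<close>

lemma nn_integral_rotate:
  fixes f :: "'b::euclidean_space \<times> 'a::euclidean_space \<times> 'a \<Rightarrow> ennreal"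
  assumes [measurable]: "f \<in> borel_measurable (borel \<Otimes>\<^sub>M borel \<Otimes>\<^sub>M borel)"
    and [measurable]: "V \<in> sets borel" "B \<in> sets borel" "S \<in> sets borel"
  shows "(\<integral>\<^sup>+x\<in>V. (\<integral>\<^sup>+y\<in>B. (\<integral>\<^sup>+s\<in>S. f (s, x, y) \<partial>lborel) \<partial>lborel) \<partial>lborel) =
    (\<integral>\<^sup>+s\<in>S. (\<integral>\<^sup>+x\<in>V. (\<integral>\<^sup>+y\<in>B. f (s, x, y) \<partial>lborel) \<partial>lborel) \<partial>lborel)"
proof -
  have "(\<integral>\<^sup>+x\<in>V. (\<integral>\<^sup>+y\<in>B. (\<integral>\<^sup>+s\<in>S. f (s, x, y) \<partial>lborel) \<partial>lborel) \<partial>lborel) =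
    (\<integral>\<^sup>+x. (\<integral>\<^sup>+y. (\<integral>\<^sup>+s. f (s, x, y) * indicator S s * indicator B y * indicator V x \<partial>lborel) \<partial>lborel) \<partial>lborel)"
    by (simp add: nn_integral_multc)
  also have "\<dots> = (\<integral>\<^sup>+x. (\<integral>\<^sup>+s. (\<integral>\<^sup>+y. f (s, x, y) * indicator S s * indicator B y * indicator V x \<partial>lborel) \<partial>lborel) \<partial>lborel)"
    by (intro nn_integral_cong lborel_pair.Fubini') measurable
  also have "\<dots> = (\<integral>\<^sup>+s. (\<integral>\<^sup>+x. (\<integral>\<^sup>+y. f (s, x, y) * indicator S s * indicator B y * indicator V x \<partial>lborel) \<partial>lborel) \<partial>lborel)"
    by (intro lborel_pair.Fubini') measurable
  also have "\<dots> = (\<integral>\<^sup>+s. (\<integral>\<^sup>+x. (\<integral>\<^sup>+y. f (s, x, y) * indicator B y * indicator V x * indicator S s \<partial>lborel) \<partial>lborel) \<partial>lborel)"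
    by (intro nn_integral_cong) (simp split: split_indicator)
  also have "\<dots> = (\<integral>\<^sup>+s\<in>S. (\<integral>\<^sup>+x\<in>V. (\<integral>\<^sup>+y\<in>B. f (s, x, y) \<partial>lborel) \<partial>lborel) \<partial>lborel)"
    by (simp add: nn_integral_multc)
  finally show ?thesis .
qed

section \<open>Star-shaped pairs and their Poincare inequality\<close>

text \<open>Every point of \<open>V\<close> sees all of \<open>B\<close> inside \<Omega>.
  \<open>B\<close> is a closed box because averages over it are differentiated by the Leibniz rule
  for boxes; its nonempty interior gives the positive measure by which averages are divided.\<close>

definition star_pair :: "'a::euclidean_space set \<Rightarrow> 'a set \<Rightarrow> 'a set \<Rightarrow> bool" where
  "star_pair \<Omega> V B \<longleftrightarrow> open V \<and> V \<noteq> {} \<and> V \<subseteq> \<Omega> \<and> (\<exists>a b. B = cbox a b \<and> box a b \<noteq> {}) \<and>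
     (\<forall>x\<in>V. \<forall>y\<in>B. closed_segment x y \<subseteq> \<Omega>)"

text \<open>The gradient is an argument of its own, so that the continuous extension of a gradient
  to the closure can take its place. Boundedness provides integrability on bounded sets.\<close>

definition C1_bounded :: "'a::euclidean_space set \<Rightarrow> ('a \<Rightarrow> real) \<Rightarrow> ('a \<Rightarrow> 'a) \<Rightarrow> bool" where
  "C1_bounded \<Omega> g g' \<longleftrightarrow> (\<forall>x\<in>\<Omega>. (g has_derivative (\<lambda>h. g' x \<bullet> h)) (at x)) \<and>
     continuous_on \<Omega> g' \<and> bounded (g ` \<Omega>) \<and> bounded (g' ` \<Omega>)"

lemma C1_bounded_continuous: "C1_bounded \<Omega> g g' \<Longrightarrow> continuous_on \<Omega> g"
  unfolding C1_bounded_def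
  by (meson continuous_at_imp_continuous_on has_derivative_continuous)

lemma star_pairD:
  assumes "star_pair \<Omega> V B"
  shows "open V" "V \<noteq> {}" "V \<subseteq> \<Omega>" "compact B" "B \<subseteq> \<Omega>" "measure lborel B > 0" "B \<in> sets borel" "V \<in> sets borel"
    and "\<And>x y s. x \<in> V \<Longrightarrow> y \<in> B \<Longrightarrow> 0 \<le> s \<Longrightarrow> s \<le> 1 \<Longrightarrow> (1 - s) *\<^sub>R x + s *\<^sub>R y \<in> \<Omega>"
proof -
  from assms obtain a b where ab: "B = cbox a b" "box a b \<noteq> {}" and "open V"
    and seg: "\<And>x y. x \<in> V \<Longrightarrow> y \<in> B \<Longrightarrow> closed_segment x y \<subseteq> \<Omega>"
    by (auto simp: star_pair_def)
  show "open V" "V \<noteq> {}" "V \<subseteq> \<Omega>" using assms by (auto simp: star_pair_def)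
  then show "compact B" "B \<subseteq> \<Omega>" "B \<in> sets borel" "V \<in> sets borel"
    using seg ab ends_in_segment by (auto simp: compact_cbox)
  show "measure lborel B > 0" using ab by (simp add: content_pos_lt_eq box_ne_empty)
  fix x y s assume "x \<in> V" "y \<in> B" "0 \<le> s" "s \<le> (1::real)"
  then show "(1 - s) *\<^sub>R x + s *\<^sub>R y \<in> \<Omega>"
    using seg[of x y] by (force simp: closed_segment_def)
qed

lemma C1_bounded_along_segment:
  assumes "star_pair \<Omega> V B" "C1_bounded \<Omega> g g'" "x \<in> V" "y \<in> B" "0 \<le> s" "s \<le> 1"
  shows "((\<lambda>s. g ((1 - s) *\<^sub>R x + s *\<^sub>R y)) has_real_derivative g' ((1 - s) *\<^sub>R x + s *\<^sub>R y) \<bullet> (y - x)) (at s within S)"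
proof -
  have "(g has_derivative (\<lambda>h. g' ((1 - s) *\<^sub>R x + s *\<^sub>R y) \<bullet> h)) (at ((1 - s) *\<^sub>R x + s *\<^sub>R y))"
    using assms star_pairD(9)[OF assms(1)] by (auto simp: C1_bounded_def)
  then have "((\<lambda>s. g ((1 - s) *\<^sub>R x + s *\<^sub>R y)) has_derivative
      (\<lambda>d. g' ((1 - s) *\<^sub>R x + s *\<^sub>R y) \<bullet> (- d *\<^sub>R x + d *\<^sub>R y))) (at s within S)"
    by (auto intro!: has_derivative_compose[where g=g] derivative_eq_intros)
  moreover have "(\<lambda>d. g' ((1 - s) *\<^sub>R x + s *\<^sub>R y) \<bullet> (- d *\<^sub>R x + d *\<^sub>R y)) = (*) (g' ((1 - s) *\<^sub>R x + s *\<^sub>R y) \<bullet> (y - x))"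
    by (auto simp: inner_simps algebra_simps)
  ultimately show ?thesis
    by (simp add: has_field_derivative_def)
qed

text \<open>The deviation from the mean over \<open>B\<close> is an average of
  \<open>g x - g y\<close>, and each difference is at most the diameter of \<Omega> times the
  integral of \<open>norm g'\<close> along the segment. Integrated over \<open>x\<close> and
  \<open>y\<close> for a fixed position \<open>s\<close> on the segment, the latter costs only a
  bounded Jacobian.\<close>

lemma star_pair_L1_poincare:
  fixes \<Omega> :: "'a::euclidean_space set"
  assumes sp: "star_pair \<Omega> V B" and \<Omega>: "open \<Omega>" "bounded \<Omega>"
  obtains C where "C \<ge> 0"
    "\<And>g g'. C1_bounded \<Omega> g g' \<Longrightarrow> (LBINT x:V. \<bar>g x - mean B g\<bar>) \<le> C * (LBINT x:\<Omega>. norm (g' x))"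
proof
  note spD = star_pairD[OF sp]
  note [measurable] = spD(7,8) borel_open[OF \<Omega>(1)]
  have bV: "bounded V" "bounded B"
    using \<Omega>(2) spD(3,5) bounded_subset by blast+
  define R where "R = diameter \<Omega>"
  have R: "R \<ge> 0" using \<Omega> by (simp add: R_def diameter_ge_0)
  have Rb: "norm (y - x) \<le> R" if "x \<in> V" "y \<in> B" for x y
    using diameter_bounded_bound[OF \<Omega>(2), of y x] that spD by (auto simp: R_def dist_norm)
  define K where "K = R * 2 ^ DIM('a) * max (measure lborel V) (measure lborel B)"
  have K: "K \<ge> 0" using R by (simp add: K_def le_max_iff_disj)
  show "K / measure lborel B \<ge> 0" using K spD(6) by simp
  fix g g' assume g: "C1_bounded \<Omega> g g'"
  have cg': "continuous_on \<Omega> g'" and cg: "continuous_on \<Omega> g" and bg: "bounded (g ` \<Omega>)" "bounded (g' ` \<Omega>)"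
    using g C1_bounded_continuous by (auto simp: C1_bounded_def)
  \<comment> \<open>Extension by 0 makes the integrand Borel on the whole space; the segments stay
    in \<Omega>, where nothing changes.\<close>
  define J where "J z = ennreal (norm (indicator \<Omega> z *\<^sub>R g' z))" for z
  have mJ [measurable]: "J \<in> borel_measurable borel"
    using borel_measurable_continuous_on_indicator[OF _ cg'] unfolding J_def by measurable
  define g0 where "g0 z = indicator \<Omega> z *\<^sub>R g z" for z
  have [measurable]: "g0 \<in> borel_measurable borel"
    using borel_measurable_continuous_on_indicator[OF _ cg] unfolding g0_def by measurable
  have igV: "set_integrable lborel V (\<lambda>x. \<bar>g x - mean B g\<bar>)"
  proof (rule set_integrable_continuous_bounded)
    show "continuous_on V (\<lambda>x. \<bar>g x - mean B g\<bar>)"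
      using spD(3) cg by (intro continuous_intros) (auto intro: continuous_on_subset)
    obtain L where "\<And>x. x \<in> \<Omega> \<Longrightarrow> \<bar>g x\<bar> \<le> L" using bg(1) by (auto simp: bounded_iff)
    then show "bounded ((\<lambda>x. \<bar>g x - mean B g\<bar>) ` V)"
      using spD(3) by (intro boundedI[of _ "L + \<bar>mean B g\<bar>"]) fastforce
  qed (use bV in auto)
  have igB: "set_integrable lborel B g"
    using spD cg continuous_on_subset[OF cg]
    by (intro set_integrable_continuous_bounded compact_imp_bounded compact_continuous_image) auto
  have 1: "ennreal \<bar>g x - mean B g\<bar> * ennreal (measure lborel B) \<le> (\<integral>\<^sup>+y\<in>B. ennreal \<bar>g0 x - g0 y\<bar> \<partial>lborel)"
    if x: "x \<in> V" for x
  proof -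
    have "(LBINT y:B. g x - g y) = (g x - mean B g) * measure lborel B"
      using igB spD(6) bV emeasure_bounded_finite[OF bV(2)]
      by (subst set_integral_diff) (auto simp: mean_def algebra_simps set_integrable_def set_lebesgue_integral_def)
    then have "ennreal \<bar>g x - mean B g\<bar> * ennreal (measure lborel B) = ennreal \<bar>LBINT y:B. g x - g y\<bar>"
      using spD(6) by (simp add: abs_mult ennreal_mult)
    also have "\<dots> \<le> (\<integral>\<^sup>+y\<in>B. ennreal \<bar>g x - g y\<bar> \<partial>lborel)"
      using igB emeasure_bounded_finite[OF bV(2)]
      by (intro set_integral_ennreal_le set_integral_diff) (auto simp: set_integrable_def)
    also have "\<dots> = (\<integral>\<^sup>+y\<in>B. ennreal \<bar>g0 x - g0 y\<bar> \<partial>lborel)"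
      using x spD(3,5) by (intro nn_integral_cong) (auto simp: g0_def split: split_indicator)
    finally show ?thesis .
  qed
  have 2: "ennreal \<bar>g0 x - g0 y\<bar> \<le> (\<integral>\<^sup>+s\<in>{0..1}. ennreal R * J ((1 - s) *\<^sub>R x + s *\<^sub>R y) \<partial>lborel)"
    if x: "x \<in> V" and y: "y \<in> B" for x y
  proof -
    have "ennreal \<bar>g ((1 - 1) *\<^sub>R x + 1 *\<^sub>R y) - g ((1 - 0) *\<^sub>R x + 0 *\<^sub>R y)\<bar>
      \<le> (\<integral>\<^sup>+s\<in>{0..1}. ennreal R * J ((1 - s) *\<^sub>R x + s *\<^sub>R y) \<partial>lborel)"
    proof (rule ennreal_increment_le_nn_integral)
      show "((\<lambda>s. g ((1 - s) *\<^sub>R x + s *\<^sub>R y)) has_real_derivative g' ((1 - s) *\<^sub>R x + s *\<^sub>R y) \<bullet> (y - x)) (at s within {0..1})"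
        if "s \<in> {0..1}" for s
        using that x y by (intro C1_bounded_along_segment[OF sp g]) auto
      show "continuous_on {0..1} (\<lambda>s. g' ((1 - s) *\<^sub>R x + s *\<^sub>R y) \<bullet> (y - x))"
        using x y spD(9) by (intro continuous_intros continuous_on_compose2[OF cg']) auto
      fix s :: real assume s: "0 < s" "s \<le> 1"
      let ?z = "(1 - s) *\<^sub>R x + s *\<^sub>R y"
      have "?z \<in> \<Omega>" using s x y by (intro spD(9)) auto
      have "\<bar>g' ?z \<bullet> (y - x)\<bar> \<le> norm (g' ?z) * norm (y - x)" by (rule Cauchy_Schwarz_ineq2)
      also have "\<dots> \<le> norm (g' ?z) * R" by (intro mult_left_mono Rb x y) auto
      finally show "ennreal \<bar>g' ?z \<bullet> (y - x)\<bar> \<le> ennreal R * J ?z"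
        using R \<open>?z \<in> \<Omega>\<close> by (simp add: J_def ennreal_mult[symmetric] mult.commute)
    qed auto
    then show ?thesis using x y spD(3,5) by (simp add: g0_def abs_minus_commute subset_iff)
  qed
  have "ennreal (LBINT x:V. \<bar>g x - mean B g\<bar>) * ennreal (measure lborel B) =
      (\<integral>\<^sup>+x\<in>V. ennreal \<bar>g x - mean B g\<bar> \<partial>lborel) * ennreal (measure lborel B)"
    using igV by (simp add: nn_integral_set_eq_ennreal)
  also have "\<dots> = (\<integral>\<^sup>+x. ennreal \<bar>g x - mean B g\<bar> * indicator V x * ennreal (measure lborel B) \<partial>lborel)"
  proof (rule nn_integral_multc[symmetric])
    have "(\<lambda>x. ennreal \<bar>g x - mean B g\<bar> * indicator V x) = (\<lambda>x. ennreal \<bar>g0 x - mean B g\<bar> * indicator V x)"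
      using spD(3) by (auto simp: g0_def fun_eq_iff split: split_indicator)
    then show "(\<lambda>x. ennreal \<bar>g x - mean B g\<bar> * indicator V x) \<in> borel_measurable lborel" by simp
  qed
  also have "\<dots> \<le> (\<integral>\<^sup>+x\<in>V. (\<integral>\<^sup>+y\<in>B. ennreal \<bar>g0 x - g0 y\<bar> \<partial>lborel) \<partial>lborel)"
    using 1 by (intro nn_integral_mono) (auto split: split_indicator)
  also have "\<dots> \<le> (\<integral>\<^sup>+x\<in>V. (\<integral>\<^sup>+y\<in>B. (\<integral>\<^sup>+s\<in>{0..1}. ennreal R * J ((1 - s) *\<^sub>R x + s *\<^sub>R y) \<partial>lborel) \<partial>lborel) \<partial>lborel)"
    using 2 by (auto intro!: nn_integral_mono split: split_indicator)
  also have "\<dots> = (\<integral>\<^sup>+s\<in>{0..1}. (\<integral>\<^sup>+x\<in>V. (\<integral>\<^sup>+y\<in>B. ennreal R * J ((1 - s) *\<^sub>R x + s *\<^sub>R y) \<partial>lborel) \<partial>lborel) \<partial>lborel)"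
    using nn_integral_rotate[of "\<lambda>(s, x, y). ennreal R * J ((1 - s) *\<^sub>R x + s *\<^sub>R y)" V B "{0..1}"] by simp
  also have "\<dots> = (\<integral>\<^sup>+s\<in>{0..1}. ennreal R * (\<integral>\<^sup>+x\<in>V. (\<integral>\<^sup>+y\<in>B. J ((1 - s) *\<^sub>R x + s *\<^sub>R y) \<partial>lborel) \<partial>lborel) \<partial>lborel)"
    by (simp add: nn_integral_cmult mult.assoc)
  also have "\<dots> \<le> (\<integral>\<^sup>+s\<in>{0..1::real}. ennreal R * (2 ^ DIM('a) * max (emeasure lborel V) (emeasure lborel B) * (\<integral>\<^sup>+x. J x \<partial>lborel)) \<partial>lborel)"
    by (intro nn_integral_mono) (auto split: split_indicator intro!: mult_left_mono nn_integral_convex_combinations_le)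
  also have "\<dots> = ennreal R * (2 ^ DIM('a) * max (emeasure lborel V) (emeasure lborel B) * (\<integral>\<^sup>+x. J x \<partial>lborel))"
    by (simp add: nn_integral_cmult_indicator)
  also have "emeasure lborel V = measure lborel V"
    using emeasure_bounded_finite[OF bV(1)] by (simp add: emeasure_eq_ennreal_measure less_top)
  also have "emeasure lborel B = measure lborel B"
    using emeasure_bounded_finite[OF bV(2)] by (simp add: emeasure_eq_ennreal_measure less_top)
  also have "(\<integral>\<^sup>+x. J x \<partial>lborel) = ennreal (LBINT x:\<Omega>. norm (g' x))"
  proof -
    have "(\<integral>\<^sup>+x. J x \<partial>lborel) = (\<integral>\<^sup>+x\<in>\<Omega>. ennreal (norm (g' x)) \<partial>lborel)"
      by (intro nn_integral_cong) (auto simp: J_def split: split_indicator)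
    moreover have "bounded ((\<lambda>x. norm (g' x)) ` \<Omega>)"
      using bg(2) by (simp add: bounded_iff)
    ultimately show ?thesis using cg' \<Omega>
      by (simp add: nn_integral_set_eq_ennreal set_integrable_continuous_bounded continuous_on_norm)
  qed
  also have "ennreal R * (2 ^ DIM('a) * max (ennreal (measure lborel V)) (ennreal (measure lborel B)) *
      ennreal (LBINT x:\<Omega>. norm (g' x))) = ennreal (K * (LBINT x:\<Omega>. norm (g' x)))"
  proof -
    have "(LBINT x:\<Omega>. norm (g' x)) \<ge> 0"
      by (auto simp: set_lebesgue_integral_def intro!: integral_nonneg)
    moreover have "(2::ennreal) ^ DIM('a) = ennreal (2 ^ DIM('a))"
      by (simp add: ennreal_power[symmetric])
    moreover have "max (ennreal (measure lborel V)) (ennreal (measure lborel B)) = ennreal (max (measure lborel V) (measure lborel B))"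
      by (simp add: max_def ennreal_le_iff)
    ultimately show ?thesis using R
      by (simp add: K_def ennreal_mult[symmetric] le_max_iff_disj mult.assoc)
  qed
  finally have "ennreal ((LBINT x:V. \<bar>g x - mean B g\<bar>) * measure lborel B) \<le> ennreal (K * (LBINT x:\<Omega>. norm (g' x)))"
    by (subst ennreal_mult) (auto simp: set_lebesgue_integral_def intro!: integral_nonneg)
  then have "(LBINT x:V. \<bar>g x - mean B g\<bar>) * measure lborel B \<le> K * (LBINT x:\<Omega>. norm (g' x))"
    using K by (subst (asm) ennreal_le_iff) (auto simp: set_lebesgue_integral_def intro!: integral_nonneg mult_nonneg_nonneg)
  then show "(LBINT x:V. \<bar>g x - mean B g\<bar>) \<le> K / measure lborel B * (LBINT x:\<Omega>. norm (g' x))"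
    using spD(6) by (simp add: field_simps)
qed

section \<open>Logarithmic Sobolev inequality on a star-shaped pair\<close>

text \<open>The value 2, multiplied by the coefficient 1/4 left by Young's inequality, yields the
  factor 1/2 on which the absorption argument rests.\<close>

lemma nn_integral_inverse_sqrt:
  "(\<integral>\<^sup>+r\<in>{0..1}. ennreal (r powr (- 1 / 2)) \<partial>lborel) = ennreal 2"
proof -
  have "((\<lambda>r::real. r powr (- 1 / 2)) has_integral 2) {0..1}"
    using has_integral_powr_from_0[of "- 1 / 2" 1] by simp
  then have "((\<lambda>r::real. if r \<in> {0..1} then r powr (- 1 / 2) else 0) has_integral 2) UNIV"
    by (subst has_integral_restrict_UNIV)
  then have "(\<integral>\<^sup>+r. ennreal (if r \<in> {0..1::real} then r powr (- 1 / 2) else 0) \<partial>lborel) = ennreal 2"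
    by (intro nn_integral_has_integral_lborel) auto
  moreover have "(\<integral>\<^sup>+r\<in>{0..1}. ennreal (r powr (- 1 / 2)) \<partial>lborel) =
      (\<integral>\<^sup>+r. ennreal (if r \<in> {0..1::real} then r powr (- 1 / 2) else 0) \<partial>lborel)"
    by (intro nn_integral_cong) (auto split: split_indicator)
  ultimately show ?thesis by simp
qed

text \<open>Expansion of \<open>(\<bar>l\<bar> * g - 2 * K * R * n)\<^sup>2 \<ge> 0\<close>. The
  weight \<open>1 / (4 * K)\<close> in front of \<open>l\<^sup>2 * g\<close> cancels the constant
  \<open>K\<close> of the logarithmic growth bound and leaves 1/4.\<close>

lemma young_weighted:
  fixes l R n g K :: real
  assumes "g > 0" "K > 0" "R \<ge> 0" "n \<ge> 0"
  shows "\<bar>l\<bar> * (n * R) \<le> l\<^sup>2 * g / (4 * K) + R\<^sup>2 * K * (n\<^sup>2 / g)"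
proof -
  have "0 \<le> (\<bar>l\<bar> * g - 2 * K * R * n)\<^sup>2" by simp
  also have "\<dots> = l\<^sup>2 * g\<^sup>2 - 4 * K * R * n * \<bar>l\<bar> * g + 4 * K\<^sup>2 * R\<^sup>2 * n\<^sup>2"
    by (simp add: power2_diff power_mult_distrib)
  finally have "4 * K * R * n * \<bar>l\<bar> * g \<le> 4 * K\<^sup>2 * R\<^sup>2 * n\<^sup>2 + l\<^sup>2 * g\<^sup>2" by simp
  moreover have "4 * K\<^sup>2 * R\<^sup>2 * n\<^sup>2 + l\<^sup>2 * g\<^sup>2 = 4 * K * g * (l\<^sup>2 * g / (4 * K) + R\<^sup>2 * K * (n\<^sup>2 / g))"
    using assms by (simp add: field_simps power2_eq_square)
  ultimately have "4 * K * g * (\<bar>l\<bar> * (n * R)) \<le> 4 * K * g * (l\<^sup>2 * g / (4 * K) + R\<^sup>2 * K * (n\<^sup>2 / g))"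
    by (simp add: mult_ac)
  then show ?thesis using assms by (simp add: mult_le_cancel_left_pos)
qed

text \<open>The entropy of the average \<open>u s x\<close> differs from that of
  \<open>u 1 x\<close> by an integral over \<open>r\<close>, whose integrand is at most
  \<open>r powr (- 1 / 2) / 4\<close> times the entropy of \<open>u r x\<close> plus a Fisher term.
  Integrated over \<open>V\<close>, this bounds the entropy at every \<open>s\<close> by its value
  at \<open>s = 1\<close>, half the supremum over all positions, and the Fisher information.
  Absorbing the finite supremum doubles the other two terms.\<close>

lemma star_pair_log_sobolev:
  fixes \<Omega> :: "'a::euclidean_space set"
  assumes sp: "star_pair \<Omega> V B" and \<Omega>: "open \<Omega>" "bounded \<Omega>"
  obtains C where "C \<ge> 0"
    "\<And>g g'. C1_bounded \<Omega> g g' \<Longrightarrow> \<exists>\<delta>>0. \<forall>x\<in>\<Omega>. \<delta> \<le> g x \<Longrightarrow>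
       (LBINT x:V. entropy_density (mean \<Omega> g) (g x)) \<le>
         2 * measure lborel V * entropy_density (mean \<Omega> g) (mean B g) + C * (LBINT x:\<Omega>. (norm (g' x))\<^sup>2 / g x)"
proof
  note spD = star_pairD[OF sp]
  note [measurable] = spD(7,8) borel_open[OF \<Omega>(1)]
  have bV: "bounded V" "bounded B"
    using \<Omega>(2) spD(3,5) bounded_subset by blast+
  define R where "R = diameter \<Omega>"
  have R: "R \<ge> 0" using \<Omega> by (simp add: R_def diameter_ge_0)
  have Rb: "norm (y - x) \<le> R" if "x \<in> V" "y \<in> B" for x y
    using diameter_bounded_bound[OF \<Omega>(2), of y x] that spD by (auto simp: R_def dist_norm)
  define vB where "vB = measure lborel B"
  have vB: "vB > 0" using spD(6) by (simp add: vB_def)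
  have mle: "vB \<le> measure lborel \<Omega>"
    unfolding vB_def using spD(5) emeasure_bounded_finite[OF \<Omega>(2)]
    by (intro measure_mono_fmeasurable) (auto simp: fmeasurable_def)
  \<comment> \<open>\<open>K * r powr (- 1 / 2)\<close> is to dominate
    \<open>2 + max 0 (ln (u r x / t))\<close>. Conservation of the mass of \<open>g\<close> gives
    \<open>u r x / t \<le> (measure lborel \<Omega> / vB) / r ^ DIM('a)\<close>, and
    \<open>ln (1 / r) \<le> 2 * r powr (- 1 / 2)\<close> explains the last summand.\<close>
  define K where "K = 2 + ln (measure lborel \<Omega> / vB) + 2 * DIM('a)"
  have lnK: "ln (measure lborel \<Omega> / vB) \<ge> 0" using mle vB by simp
  have K: "K > 0" using lnK by (simp add: K_def)
  define M where "M = 2 ^ DIM('a) * max (measure lborel V) (measure lborel B)"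
  have M: "M \<ge> 0" by (simp add: M_def le_max_iff_disj)
  define C where "C = R\<^sup>2 * K * M / vB"
  have C: "C \<ge> 0" using K M vB by (simp add: C_def)
  \<comment> \<open>The factor 2 is the price of absorbing the supremum.\<close>
  show "2 * C \<ge> 0" using C by simp
  fix g g' assume g: "C1_bounded \<Omega> g g'" and "\<exists>\<delta>>0. \<forall>x\<in>\<Omega>. \<delta> \<le> g x"
  then obtain \<delta> where \<delta>: "\<delta> > 0" "\<And>x. x \<in> \<Omega> \<Longrightarrow> \<delta> \<le> g x" by auto
  have cg': "continuous_on \<Omega> g'" and cg: "continuous_on \<Omega> g" and bg: "bounded (g ` \<Omega>)" "bounded (g' ` \<Omega>)"
    using g C1_bounded_continuous by (auto simp: C1_bounded_def)
  from bg(1) obtain G where "\<And>x. x \<in> \<Omega> \<Longrightarrow> \<bar>g x\<bar> \<le> G" by (auto simp: bounded_iff)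
  then have G: "g x \<le> G" if "x \<in> \<Omega>" for x using that by force
  from bg(2) obtain G' where G': "\<And>x. x \<in> \<Omega> \<Longrightarrow> norm (g' x) \<le> G'" by (auto simp: bounded_iff)
  have gpos: "g x > 0" if "x \<in> \<Omega>" for x using \<delta> that by force
  define t where "t = mean \<Omega> g"
  have igO: "set_integrable lborel \<Omega> g"
    using \<Omega> cg bg by (intro set_integrable_continuous_bounded) auto
  have fin\<Omega>: "emeasure lborel \<Omega> < \<infinity>" using emeasure_bounded_finite[OF \<Omega>(2)] .
  have finB: "emeasure lborel B < \<infinity>" using emeasure_bounded_finite[OF bV(2)] .
  have icB: "set_integrable lborel B (\<lambda>_. c::real)" for c
    using finB by (auto simp: set_integrable_def)
  have "(LBINT x:\<Omega>. \<delta>) \<le> (LBINT x:\<Omega>. g x)"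
    using \<delta> igO fin\<Omega> by (intro set_integral_mono_on) (auto simp: set_integrable_def)
  then have "\<delta> * measure lborel \<Omega> \<le> (LBINT x:\<Omega>. g x)"
    by (simp add: set_lebesgue_integral_def mult.commute)
  then have t: "t > 0"
    unfolding t_def mean_def using mle vB \<delta>(1)
    by (intro divide_pos_pos) (auto intro: less_le_trans[of 0 "\<delta> * measure lborel \<Omega>"])
  define g0 where "g0 z = indicator \<Omega> z *\<^sub>R g z" for z
  have [measurable]: "g0 \<in> borel_measurable borel"
    using borel_measurable_continuous_on_indicator[OF _ cg] unfolding g0_def by measurable
  define j where "j z = (norm (g' z))\<^sup>2 / g z" for z
  have cj: "continuous_on \<Omega> j"
    unfolding j_def using gpos by (intro continuous_intros cg cg') force
  have jnn: "j z \<ge> 0" if "z \<in> \<Omega>" for z using gpos[OF that] by (simp add: j_def)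
  have bj: "bounded (j ` \<Omega>)"
  proof (rule boundedI)
    fix y assume "y \<in> j ` \<Omega>"
    then obtain z where z: "z \<in> \<Omega>" "y = j z" by auto
    have "j z \<le> G'\<^sup>2 / \<delta>"
      unfolding j_def using G' \<delta> z by (intro frac_le power_mono) auto
    then show "norm y \<le> G'\<^sup>2 / \<delta>" using z jnn by simp
  qed
  define J where "J z = indicator \<Omega> z *\<^sub>R j z" for z
  have mJ [measurable]: "J \<in> borel_measurable borel"
    using borel_measurable_continuous_on_indicator[OF _ cj] unfolding J_def by measurable
  have Jnn: "J z \<ge> 0" for z using jnn by (auto simp: J_def split: split_indicator)
  have I: "(\<integral>\<^sup>+x. ennreal (J x) \<partial>lborel) = ennreal (LBINT x:\<Omega>. j x)"
  proof -
    have "(\<integral>\<^sup>+x. ennreal (J x) \<partial>lborel) = (\<integral>\<^sup>+x\<in>\<Omega>. ennreal (j x) \<partial>lborel)"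
      by (intro nn_integral_cong) (auto simp: J_def split: split_indicator)
    then show ?thesis
      using \<Omega> cj bj jnn by (simp add: nn_integral_set_eq_ennreal set_integrable_continuous_bounded)
  qed
  define z where "z r x y = (1 - r) *\<^sub>R x + r *\<^sub>R y" for r and x y :: 'a
  have zO: "z r x y \<in> \<Omega>" if "x \<in> V" "y \<in> B" "r \<in> {0..1}" for r x y
    unfolding z_def using that by (intro spD(9)) auto
  define u where "u r x = (LBINT y:B. g0 (z r x y)) / vB" for r x
  define A where "A r x = (LBINT y:B. J (z r x y)) / vB" for r x
  define du where "du r x = (LBINT y:B. g' (z r x y) \<bullet> (y - x)) / vB" for r x
  have uA: "(\<lambda>p. u (fst p) (snd p)) \<in> borel_measurable (borel \<Otimes>\<^sub>M borel)"
    "(\<lambda>p. A (fst p) (snd p)) \<in> borel_measurable (borel \<Otimes>\<^sub>M borel)"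
    unfolding u_def A_def z_def set_lebesgue_integral_def by measurable
  have [measurable (raw)]: "(\<lambda>p. u (f p) (h p)) \<in> borel_measurable N" "(\<lambda>p. A (f p) (h p)) \<in> borel_measurable N"
    if "f \<in> borel_measurable N" "h \<in> borel_measurable N" for N :: "'c measure" and f h
    using measurable_compose[OF measurable_Pair[OF that] uA(1)] measurable_compose[OF measurable_Pair[OF that] uA(2)]
    by simp_all
  have contB: "continuous_on B (z r x)" for r x
    unfolding z_def by (intro continuous_intros)
  have comp: "continuous_on B (\<lambda>y. f (z r x y))" if "x \<in> V" "r \<in> {0..1}" "continuous_on \<Omega> f"
    for f :: "'a \<Rightarrow> 'b::euclidean_space" and r x
    using that zO contB by (intro continuous_on_compose2[OF that(3)]) auto
  have iB: "set_integrable lborel B f" if "continuous_on B f" for f :: "'a \<Rightarrow> real"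
    using that spD(4,7) by (intro set_integrable_continuous_bounded compact_imp_bounded compact_continuous_image) auto
  have gB: "set_integrable lborel B (\<lambda>y. g (z r x y))" and jB: "set_integrable lborel B (\<lambda>y. j (z r x y))"
    and dB: "set_integrable lborel B (\<lambda>y. g' (z r x y) \<bullet> (y - x))"
    if "x \<in> V" "r \<in> {0..1}" for r x
    using that by (auto intro!: iB comp cg cj cg' continuous_intros)
  have u_eq: "u r x = (LBINT y:B. g (z r x y)) / vB" and A_eq: "A r x = (LBINT y:B. j (z r x y)) / vB"
    if "x \<in> V" "r \<in> {0..1}" for r x
    unfolding u_def A_def using zO[OF that(1) _ that(2)]
    by (auto intro!: set_lebesgue_integral_cong simp: g0_def J_def)
  have u_lower: "\<delta> \<le> u r x" and u_upper: "u r x \<le> G" if x: "x \<in> V" "r \<in> {0..1}" for r x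
  proof -
    have "(LBINT y:B. \<delta>) \<le> (LBINT y:B. g (z r x y))"
      "(LBINT y:B. g (z r x y)) \<le> (LBINT y:B. G)"
      using icB gB[OF x] zO[OF x(1) _ x(2)] \<delta>(2) G by (auto intro!: set_integral_mono_on)
    then have "\<delta> * vB \<le> (LBINT y:B. g (z r x y))" "(LBINT y:B. g (z r x y)) \<le> G * vB"
      by (simp_all add: set_lebesgue_integral_def mult.commute vB_def)
    then show "\<delta> \<le> u r x" "u r x \<le> G"
      using vB by (simp_all add: u_eq[OF x] field_simps)
  qed
  have u_pos: "u r x > 0" if "x \<in> V" "r \<in> {0..1}" for r x
    using u_lower[OF that] \<delta> by simp
  \<comment> \<open>Dropping the restriction to \<open>B\<close> and substituting in
    \<open>y\<close> leaves the whole mass \<open>t * measure lborel \<Omega>\<close>, so no bound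
    on \<open>g\<close> itself enters.\<close>
  have u_log: "2 + max 0 (ln (u r x / t)) \<le> K * r powr (- 1 / 2)" if x: "x \<in> V" "0 < r" "r \<le> 1" for r x
  proof -
    have x': "x \<in> V" "r \<in> {0..1}" using x by auto
    have "ennreal (LBINT y:B. g (z r x y)) = (\<integral>\<^sup>+y\<in>B. ennreal (g (z r x y)) \<partial>lborel)"
      using gB[OF x'] zO[OF x'(1) _ x'(2)] gpos
      by (subst nn_integral_set_eq_ennreal) (auto intro: less_imp_le)
    also have "\<dots> \<le> (\<integral>\<^sup>+y. ennreal (g0 ((1 - r) *\<^sub>R x + r *\<^sub>R y)) \<partial>lborel)"
      using zO[OF x'(1) _ x'(2)] by (intro nn_integral_mono) (auto simp: g0_def z_def split: split_indicator)
    also have "\<dots> = ennreal (1 / r ^ DIM('a)) * (\<integral>\<^sup>+y. ennreal (g0 y) \<partial>lborel)"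
      using x by (intro nn_integral_lborel_affine) auto
    also have "(\<integral>\<^sup>+y. ennreal (g0 y) \<partial>lborel) = (\<integral>\<^sup>+y\<in>\<Omega>. ennreal (g y) \<partial>lborel)"
      by (intro nn_integral_cong) (auto simp: g0_def split: split_indicator)
    also have "\<dots> = ennreal (LBINT y:\<Omega>. g y)"
      using igO gpos by (intro nn_integral_set_eq_ennreal) (auto intro: less_imp_le)
    also have "(LBINT y:\<Omega>. g y) = t * measure lborel \<Omega>"
      using mle vB by (simp add: t_def mean_def)
    finally have "(LBINT y:B. g (z r x y)) \<le> 1 / r ^ DIM('a) * (t * measure lborel \<Omega>)"
      using t x mle vB by (simp add: ennreal_mult[symmetric] del: times_divide_eq_left)
    then have "u r x / t \<le> (measure lborel \<Omega> / vB) * (1 / r ^ DIM('a))"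
      using t vB x by (simp add: u_eq[OF x'] field_simps)
    then have "ln (u r x / t) \<le> ln ((measure lborel \<Omega> / vB) * (1 / r ^ DIM('a)))"
      using u_pos[OF x'] t vB mle x by (subst ln_le_cancel_iff) auto
    also have "\<dots> = ln (measure lborel \<Omega> / vB) + DIM('a) * ln (1 / r)"
      using vB mle x by (subst ln_mult) (auto simp: ln_div ln_realpow)
    finally have 1: "ln (u r x / t) \<le> ln (measure lborel \<Omega> / vB) + DIM('a) * ln (1 / r)" .
    define q where "q = r powr (- 1 / 2)"
    have q1: "q \<ge> 1"
      unfolding q_def using powr_mono2'[of "- 1 / 2" r 1] x by simp
    have "ln (1 / r) = 2 * ln q"
      using x by (simp add: q_def ln_powr ln_div)
    also have "ln q \<le> q" using ln_le_minus_one[of q] q1 by simp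
    finally have 2: "ln (1 / r) \<le> 2 * q" by simp
    have 3: "ln (1 / r) \<ge> 0" using x by simp
    have "2 + max 0 (ln (u r x / t)) \<le> 2 + ln (measure lborel \<Omega> / vB) + DIM('a) * ln (1 / r)"
      using 1 3 lnK by (simp add: max_def)
    also have "\<dots> \<le> (2 + ln (measure lborel \<Omega> / vB)) * q + DIM('a) * (2 * q)"
    proof (rule add_mono)
      show "2 + ln (measure lborel \<Omega> / vB) \<le> (2 + ln (measure lborel \<Omega> / vB)) * q"
        using q1 lnK by (simp add: mult_le_cancel_left1)
    qed (use 2 in \<open>auto intro: mult_left_mono\<close>)
    also have "\<dots> = K * q" by (simp add: K_def algebra_simps)
    finally show ?thesis by (simp add: q_def)
  qed
  have u_du: "continuous_on {s..1} (\<lambda>r. du r x) \<and> (\<forall>r\<in>{s..1}. ((\<lambda>r. u r x) has_real_derivative du r x) (at r within {s..1}))"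
    if x: "x \<in> V" and s: "0 \<le> s" for s x
  proof -
    from sp obtain a b where B: "B = cbox a b" by (auto simp: star_pair_def)
    have cz: "continuous_on ({s..1} \<times> B) (\<lambda>p. z (fst p) x (snd p))"
      unfolding z_def by (intro continuous_intros)
    have "continuous_on ({s..1} \<times> B) (\<lambda>p. g' (z (fst p) x (snd p)) \<bullet> (snd p - x))"
      using zO[OF x] s by (intro continuous_intros continuous_on_compose2[OF cg' cz]) auto
    then have cont: "continuous_on ({s..1} \<times> cbox a b) (\<lambda>(r, y). g' (z r x y) \<bullet> (y - x))"
      by (simp add: split_beta B)
    have du_eq: "du r x = integral B (\<lambda>y. g' (z r x y) \<bullet> (y - x)) / vB" if "r \<in> {s..1}" for r
      unfolding du_def using set_borel_integral_eq_integral(2)[OF dB[OF x]] that s by simp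
    have u_int: "u r x = integral B (\<lambda>y. g (z r x y)) / vB" if "r \<in> {s..1}" for r
      using set_borel_integral_eq_integral(2)[OF gB[OF x]] that s by (subst u_eq[OF x]) auto
    have "continuous_on {s..1} (\<lambda>r. integral B (\<lambda>y. g' (z r x y) \<bullet> (y - x)) / vB)"
      using vB integral_continuous_on_param[OF cont] by (intro continuous_intros) (auto simp: B)
    then have "continuous_on {s..1} (\<lambda>r. du r x)"
      by (rule continuous_on_eq) (use du_eq in auto)
    moreover have "((\<lambda>r. u r x) has_real_derivative du r x) (at r within {s..1})" if r: "r \<in> {s..1}" for r
    proof (rule has_field_derivative_transform_within[where d = 1 and f = "\<lambda>r. integral B (\<lambda>y. g (z r x y)) / vB"])
      have "((\<lambda>r. integral (cbox a b) (\<lambda>y. g (z r x y))) has_real_derivative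
          integral (cbox a b) (\<lambda>y. g' (z r x y) \<bullet> (y - x))) (at r within {s..1})"
      proof (rule leibniz_rule_field_derivative[OF _ _ cont r])
        fix r' y assume "r' \<in> {s..1}" "y \<in> cbox a b"
        then show "((\<lambda>r. g (z r x y)) has_real_derivative g' (z r' x y) \<bullet> (y - x)) (at r' within {s..1})"
          unfolding z_def using s x by (intro C1_bounded_along_segment[OF sp g]) (auto simp: B)
      next
        fix r' assume "r' \<in> {s..1}"
        then show "(\<lambda>y. g (z r' x y)) integrable_on cbox a b"
          unfolding B[symmetric] using s by (intro set_borel_integral_eq_integral(1) gB x) auto
      qed auto
      then show "((\<lambda>r. integral B (\<lambda>y. g (z r x y)) / vB) has_real_derivative du r x) (at r within {s..1})"
        unfolding du_eq[OF r] B by (rule DERIV_cdivide)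
    qed (use u_int r in auto)
    ultimately show ?thesis by blast
  qed
  have du_cont: "continuous_on {s..1} (\<lambda>r. du r x)" if "x \<in> V" "0 \<le> s" for s x
    using u_du[OF that] by blast
  have u_der: "((\<lambda>r. u r x) has_real_derivative du r x) (at r within {s..1})"
    if "x \<in> V" "0 \<le> s" "r \<in> {s..1}" for r s x
    using u_du[OF that(1,2)] that(3) by blast
  \<comment> \<open>Integration of the derivative \<open>ln (u / t) * du\<close> from
    \<open>s\<close> to 1. For fixed \<open>r\<close>, Young's inequality under the average over
    \<open>B\<close> separates the logarithm from the gradient.\<close>
  have pw: "ennreal (entropy_density t (u s x)) \<le> ennreal (entropy_density t (u 1 x)) +
      (\<integral>\<^sup>+r\<in>{0..1}. ennreal (r powr (- 1 / 2) / 4) * ennreal (entropy_density t (u r x)) + ennreal (R\<^sup>2 * K) * ennreal (A r x) \<partial>lborel)"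
    if x: "x \<in> V" and s: "s \<in> {0..1}" for s x
  proof -
    let ?k = "\<lambda>r. ennreal (r powr (- 1 / 2) / 4) * ennreal (entropy_density t (u r x)) + ennreal (R\<^sup>2 * K) * ennreal (A r x)"
    have "ennreal \<bar>entropy_density t (u 1 x) - entropy_density t (u s x)\<bar> \<le> (\<integral>\<^sup>+r\<in>{s..1}. ?k r \<partial>lborel)"
    proof (rule ennreal_increment_le_nn_integral)
      show "((\<lambda>r. entropy_density t (u r x)) has_real_derivative ln (u r x / t) * du r x) (at r within {s..1})"
        if "r \<in> {s..1}" for r
        using that s x u_pos[OF x, of r] t
        by (intro DERIV_chain2[OF entropy_density_has_derivative u_der]) auto
      have "continuous_on {s..1} (\<lambda>r. u r x)"
        using u_der[OF x, of s] s by (intro DERIV_continuous_on) auto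
      then show "continuous_on {s..1} (\<lambda>r. ln (u r x / t) * du r x)"
        using s x u_pos[OF x] t du_cont[OF x, of s]
        by (intro continuous_intros) (auto simp: less_imp_neq[symmetric] order_less_imp_not_eq2)
    next
      fix r assume r: "s < r" "r \<le> 1"
      then have r': "r \<in> {0..1}" and r0: "0 < r" using s by auto
      define l where "l = ln (u r x / t)"
      have sl: "set_integrable lborel B (\<lambda>y. l * (g' (z r x y) \<bullet> (y - x)))"
        using dB[OF x r'] by simp
      have "\<bar>l * du r x\<bar> = \<bar>LBINT y:B. l * (g' (z r x y) \<bullet> (y - x))\<bar> / vB"
        using vB by (simp add: du_def abs_mult)
      also have "\<bar>LBINT y:B. l * (g' (z r x y) \<bullet> (y - x))\<bar> \<le> (LBINT y:B. \<bar>l * (g' (z r x y) \<bullet> (y - x))\<bar>)"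
        using set_integral_norm_bound[OF sl] by simp
      also have "\<dots> \<le> (LBINT y:B. l\<^sup>2 / (4 * K) * g (z r x y) + R\<^sup>2 * K * j (z r x y))"
      proof (rule set_integral_mono_on)
        fix y assume y: "y \<in> B"
        have "\<bar>g' (z r x y) \<bullet> (y - x)\<bar> \<le> norm (g' (z r x y)) * norm (y - x)" by (rule Cauchy_Schwarz_ineq2)
        also have "\<dots> \<le> norm (g' (z r x y)) * R" by (intro mult_left_mono Rb x y) auto
        finally have "\<bar>l * (g' (z r x y) \<bullet> (y - x))\<bar> \<le> \<bar>l\<bar> * (norm (g' (z r x y)) * R)"
          by (auto simp: abs_mult intro: mult_left_mono)
        also have "\<dots> \<le> l\<^sup>2 * g (z r x y) / (4 * K) + R\<^sup>2 * K * ((norm (g' (z r x y)))\<^sup>2 / g (z r x y))"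
          using gpos zO[OF x y r'] K R by (intro young_weighted) auto
        finally show "\<bar>l * (g' (z r x y) \<bullet> (y - x))\<bar> \<le> l\<^sup>2 / (4 * K) * g (z r x y) + R\<^sup>2 * K * j (z r x y)"
          by (simp add: j_def)
      qed (use dB[OF x r'] gB[OF x r'] jB[OF x r'] in \<open>auto intro!: set_integrable_abs set_integral_add set_integrable_mult_right\<close>)
      also have "\<dots> = l\<^sup>2 / (4 * K) * (LBINT y:B. g (z r x y)) + R\<^sup>2 * K * (LBINT y:B. j (z r x y))"
        using gB[OF x r'] jB[OF x r'] by (subst set_integral_add) auto
      finally have "\<bar>l * du r x\<bar> \<le> 1 / (4 * K) * (u r x * l\<^sup>2) + R\<^sup>2 * K * A r x"
        using vB by (simp add: u_eq[OF x r'] A_eq[OF x r'] field_simps)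
      moreover have "1 / (4 * K) * (u r x * l\<^sup>2) \<le> r powr (- 1 / 2) / 4 * entropy_density t (u r x)"
      proof -
        have "u r x * l\<^sup>2 \<le> (2 + max 0 l) * entropy_density t (u r x)"
          unfolding l_def by (intro mult_ln_squared_le_entropy_density t u_pos x r')
        also have "\<dots> \<le> (K * r powr (- 1 / 2)) * entropy_density t (u r x)"
          unfolding l_def using u_pos[OF x r'] t by (intro mult_right_mono u_log x r0 r entropy_density_nonneg) auto
        finally have "1 / (4 * K) * (u r x * l\<^sup>2) \<le> 1 / (4 * K) * ((K * r powr (- 1 / 2)) * entropy_density t (u r x))"
          using K by (intro mult_left_mono) auto
        then show ?thesis using K by simp
      qed
      ultimately have "\<bar>l * du r x\<bar> \<le> r powr (- 1 / 2) / 4 * entropy_density t (u r x) + R\<^sup>2 * K * A r x"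
        by linarith
      moreover have "A r x \<ge> 0"
        unfolding A_def set_lebesgue_integral_def using Jnn vB by (auto intro!: divide_nonneg_pos integral_nonneg)
      moreover have "entropy_density t (u r x) \<ge> 0" using u_pos[OF x r'] t by (intro entropy_density_nonneg) auto
      ultimately show "ennreal \<bar>ln (u r x / t) * du r x\<bar> \<le> ?k r"
        using K by (simp add: l_def[symmetric] ennreal_mult[symmetric] ennreal_plus[symmetric] del: ennreal_plus)
    qed (use s in auto)
    also have "\<dots> \<le> (\<integral>\<^sup>+r\<in>{0..1}. ?k r \<partial>lborel)"
      using s by (intro nn_set_integral_set_mono) auto
    finally have *: "ennreal \<bar>entropy_density t (u 1 x) - entropy_density t (u s x)\<bar> \<le> (\<integral>\<^sup>+r\<in>{0..1}. ?k r \<partial>lborel)" .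
    have "ennreal (entropy_density t (u s x)) \<le> ennreal (entropy_density t (u 1 x) + \<bar>entropy_density t (u 1 x) - entropy_density t (u s x)\<bar>)"
      by (intro ennreal_leI) linarith
    also have "\<dots> = ennreal (entropy_density t (u 1 x)) + ennreal \<bar>entropy_density t (u 1 x) - entropy_density t (u s x)\<bar>"
      using u_pos[OF x, of 1] t by (intro ennreal_plus entropy_density_nonneg) auto
    finally show ?thesis using * by (meson add_left_mono order_trans)
  qed
  \<comment> \<open>The estimates stay in \<open>ennreal\<close> until the supremum \<open>S\<close>
    of these quantities is known to be finite; only then is a multiple of it subtracted.\<close>
  define E where "E s = (\<integral>\<^sup>+x\<in>V. ennreal (entropy_density t (u s x)) \<partial>lborel)" for s
  have [measurable]: "entropy_density t \<in> borel_measurable borel"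
    unfolding entropy_density_def by measurable
  define S where "S = (SUP s\<in>{0..1}. E s)"
  have ES: "E s \<le> S" if "s \<in> {0..1}" for s unfolding S_def using that by (rule SUP_upper)
  have u1: "u 1 x = mean B g" if "x \<in> V" for x
    using that by (subst u_eq) (auto simp: z_def mean_def vB_def)
  have u0: "u 0 x = g x" if "x \<in> V" for x
    using that vB by (subst u_eq) (auto simp: z_def set_lebesgue_integral_def vB_def)
  obtain x0 where x0: "x0 \<in> V" using spD(2) by auto
  have mB: "mean B g > 0" using u1[OF x0] u_pos[OF x0, of 1] by simp
  have finV: "emeasure lborel V = measure lborel V"
    using emeasure_bounded_finite[OF bV(1)] by (simp add: emeasure_eq_ennreal_measure less_top)
  have finB': "emeasure lborel B = measure lborel B"
    using finB by (simp add: emeasure_eq_ennreal_measure less_top)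
  define e1 where "e1 = measure lborel V * entropy_density t (mean B g)"
  have e1: "e1 \<ge> 0" using mB t by (auto simp: e1_def intro!: mult_nonneg_nonneg entropy_density_nonneg)
  have E1: "E 1 = ennreal e1"
  proof -
    have "E 1 = (\<integral>\<^sup>+x\<in>V. ennreal (entropy_density t (mean B g)) \<partial>lborel)"
      unfolding E_def using u1 by (intro nn_integral_cong) (auto split: split_indicator)
    also have "\<dots> = ennreal (entropy_density t (mean B g)) * emeasure lborel V"
      by (intro nn_integral_cmult_indicator) auto
    finally show ?thesis using mB t
      by (simp add: finV e1_def ennreal_mult[symmetric] entropy_density_nonneg mult.commute)
  qed
  define I' where "I' = (LBINT x:\<Omega>. j x)"
  have I': "I' \<ge> 0" unfolding I'_def set_lebesgue_integral_def using jnn by (auto intro!: integral_nonneg split: split_indicator)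
  have Abound: "(\<integral>\<^sup>+x\<in>V. ennreal (A r x) \<partial>lborel) \<le> ennreal (M / vB * I')" if r: "r \<in> {0..1}" for r
  proof -
    have "(\<integral>\<^sup>+x\<in>V. ennreal (A r x) \<partial>lborel) = (\<integral>\<^sup>+x\<in>V. ennreal (1 / vB) * (\<integral>\<^sup>+y\<in>B. ennreal (J (z r x y)) \<partial>lborel) \<partial>lborel)"
    proof (intro nn_integral_cong)
      fix x
      have "ennreal (A r x) = ennreal (1 / vB) * (\<integral>\<^sup>+y\<in>B. ennreal (J (z r x y)) \<partial>lborel)" if x: "x \<in> V"
      proof -
        have "(\<integral>\<^sup>+y\<in>B. ennreal (J (z r x y)) \<partial>lborel) = (\<integral>\<^sup>+y\<in>B. ennreal (j (z r x y)) \<partial>lborel)"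
          using zO[OF x _ r] by (intro nn_integral_cong) (auto simp: J_def split: split_indicator)
        also have "\<dots> = ennreal (LBINT y:B. j (z r x y))"
          using jB[OF x r] jnn zO[OF x _ r] by (intro nn_integral_set_eq_ennreal) auto
        finally show ?thesis using vB by (simp add: A_eq[OF x r] ennreal_mult'[symmetric])
      qed
      then show "ennreal (A r x) * indicator V x = ennreal (1 / vB) * (\<integral>\<^sup>+y\<in>B. ennreal (J (z r x y)) \<partial>lborel) * indicator V x"
        by (auto split: split_indicator)
    qed
    also have "\<dots> = ennreal (1 / vB) * (\<integral>\<^sup>+x\<in>V. (\<integral>\<^sup>+y\<in>B. ennreal (J ((1 - r) *\<^sub>R x + r *\<^sub>R y)) \<partial>lborel) \<partial>lborel)"
      unfolding z_def by (simp add: nn_integral_cmult mult.assoc)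
    also have "\<dots> \<le> ennreal (1 / vB) * (2 ^ DIM('a) * max (emeasure lborel V) (emeasure lborel B) * (\<integral>\<^sup>+x. ennreal (J x) \<partial>lborel))"
      using r by (intro mult_left_mono nn_integral_convex_combinations_le) auto
    also have "\<dots> = ennreal (1 / vB) * (ennreal M * ennreal I')"
    proof -
      have "(2::ennreal) ^ DIM('a) = ennreal (2 ^ DIM('a))"
        by (simp add: ennreal_power[symmetric])
      moreover have "max (ennreal (measure lborel V)) (ennreal (measure lborel B)) = ennreal (max (measure lborel V) (measure lborel B))"
        by (simp add: max_def ennreal_le_iff)
      ultimately have "2 ^ DIM('a) * max (emeasure lborel V) (emeasure lborel B) = ennreal M"
        unfolding finV finB' by (simp add: M_def ennreal_mult[symmetric] le_max_iff_disj)
      then show ?thesis unfolding I I'_def by simp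
    qed
    also have "\<dots> = ennreal (M / vB * I')"
      using vB M I' by (simp add: ennreal_mult[symmetric])
    finally show ?thesis .
  qed
  have main: "E s \<le> ennreal e1 + (ennreal (1 / 2) * S + ennreal (C * I'))" if s: "s \<in> {0..1}" for s
  proof -
    let ?k = "\<lambda>r x. ennreal (r powr (- 1 / 2) / 4) * ennreal (entropy_density t (u r x)) + ennreal (R\<^sup>2 * K) * ennreal (A r x)"
    have "E s \<le> (\<integral>\<^sup>+x\<in>V. (ennreal (entropy_density t (u 1 x)) + (\<integral>\<^sup>+r\<in>{0..1}. ?k r x \<partial>lborel)) \<partial>lborel)"
      unfolding E_def using pw s by (intro nn_integral_mono) (auto split: split_indicator)
    also have "\<dots> = E 1 + (\<integral>\<^sup>+x\<in>V. (\<integral>\<^sup>+r\<in>{0..1}. ?k r x \<partial>lborel) \<partial>lborel)"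
      unfolding E_def by (intro nn_set_integral_add) auto
    also have "(\<integral>\<^sup>+x\<in>V. (\<integral>\<^sup>+r\<in>{0..1}. ?k r x \<partial>lborel) \<partial>lborel) = (\<integral>\<^sup>+x. (\<integral>\<^sup>+r. ?k r x * indicator {0..1} r * indicator V x \<partial>lborel) \<partial>lborel)"
      by (simp add: nn_integral_multc)
    also have "\<dots> = (\<integral>\<^sup>+r. (\<integral>\<^sup>+x. ?k r x * indicator {0..1} r * indicator V x \<partial>lborel) \<partial>lborel)"
      by (rule lborel_pair.Fubini') measurable
    also have "\<dots> = (\<integral>\<^sup>+r. (\<integral>\<^sup>+x. ?k r x * indicator V x * indicator {0..1} r \<partial>lborel) \<partial>lborel)"
      by (simp add: mult.assoc mult.commute[of "indicator {0..1} _"])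
    also have "\<dots> = (\<integral>\<^sup>+r\<in>{0..1}. (\<integral>\<^sup>+x\<in>V. ?k r x \<partial>lborel) \<partial>lborel)"
      by (simp add: nn_integral_multc)
    also have "\<dots> \<le> (\<integral>\<^sup>+r\<in>{0..1}. (ennreal (1 / 4) * S * ennreal (r powr (- 1 / 2)) + ennreal (C * I')) \<partial>lborel)"
    proof (intro nn_integral_mono)
      fix r
      have "(\<integral>\<^sup>+x\<in>V. ?k r x \<partial>lborel) \<le> ennreal (1 / 4) * S * ennreal (r powr (- 1 / 2)) + ennreal (C * I')" if r: "r \<in> {0..1}"
      proof -
        have "(\<integral>\<^sup>+x\<in>V. ?k r x \<partial>lborel) = ennreal (r powr (- 1 / 2) / 4) * E r + ennreal (R\<^sup>2 * K) * (\<integral>\<^sup>+x\<in>V. ennreal (A r x) \<partial>lborel)"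
          unfolding E_def by (simp add: nn_set_integral_add nn_integral_cmult mult.assoc)
        also have "\<dots> \<le> ennreal (r powr (- 1 / 2) / 4) * S + ennreal (R\<^sup>2 * K) * ennreal (M / vB * I')"
          using r by (intro add_mono mult_left_mono ES Abound) auto
        also have "\<dots> = ennreal (1 / 4) * S * ennreal (r powr (- 1 / 2)) + ennreal (C * I')"
        proof -
          have 1: "ennreal (r powr (- 1 / 2) / 4) = ennreal (1 / 4) * ennreal (r powr (- 1 / 2))"
            by (simp add: ennreal_mult[symmetric])
          have 2: "ennreal (R\<^sup>2 * K) * ennreal (M / vB * I') = ennreal (C * I')"
            using K M vB I' by (simp add: ennreal_mult[symmetric] C_def)
          show ?thesis unfolding 1 2 by (simp only: mult_ac)
        qed
        finally show ?thesis .
      qed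
      then show "(\<integral>\<^sup>+x\<in>V. ?k r x \<partial>lborel) * indicator {0..1} r \<le>
          (ennreal (1 / 4) * S * ennreal (r powr (- 1 / 2)) + ennreal (C * I')) * indicator {0..1} r"
        by (auto split: split_indicator)
    qed
    also have "\<dots> = ennreal (1 / 4) * S * ennreal 2 + ennreal (C * I')"
      by (subst nn_set_integral_add)
        (use nn_integral_inverse_sqrt in \<open>auto simp: nn_integral_cmult mult.assoc nn_integral_cmult_indicator\<close>)
    also have "ennreal (1 / 4) * S * ennreal 2 = ennreal (1 / 2) * S"
    proof -
      have "ennreal (1 / 4) * S * ennreal 2 = (ennreal (1 / 4) * ennreal 2) * S" by (simp add: mult_ac)
      also have "ennreal (1 / 4) * ennreal 2 = ennreal (1 / 2)" by (subst ennreal_mult[symmetric]) auto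
      finally show ?thesis .
    qed
    finally show ?thesis unfolding E1 by (simp add: add_left_mono)
  qed
  then have Sle: "S \<le> ennreal e1 + (ennreal (1 / 2) * S + ennreal (C * I'))"
    unfolding S_def by (intro SUP_least) auto
  \<comment> \<open>A crude bound from the boundedness of \<open>g\<close>. It yields finiteness and
    integrability and does not enter the final constant.\<close>
  define Em where "Em = (G + t)\<^sup>2 / t"
  have "E s \<le> ennreal Em * emeasure lborel V" if s: "s \<in> {0..1}" for s
  proof -
    have "E s \<le> (\<integral>\<^sup>+x\<in>V. ennreal Em \<partial>lborel)"
      unfolding E_def
    proof (intro nn_integral_mono)
      fix x
      have "entropy_density t (u s x) \<le> Em" if x: "x \<in> V"
      proof -
        have "entropy_density t (u s x) \<le> (u s x - t)\<^sup>2 / t"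
          using u_pos[OF x s] t by (intro entropy_density_le) auto
        also have "\<dots> \<le> Em"
          unfolding Em_def using u_pos[OF x s] u_upper[OF x s] t
          by (intro divide_right_mono power2_le_iff_abs_le[THEN iffD2]) auto
        finally show ?thesis .
      qed
      then show "ennreal (entropy_density t (u s x)) * indicator V x \<le> ennreal Em * indicator V x"
        by (auto split: split_indicator intro: ennreal_leI)
    qed
    then show ?thesis by (simp add: nn_integral_cmult_indicator)
  qed
  then have "S \<le> ennreal Em * emeasure lborel V" unfolding S_def by (rule SUP_least)
  also have "\<dots> < top" unfolding finV by (simp add: ennreal_mult_less_top)
  finally obtain \<sigma> where \<sigma>: "S = ennreal \<sigma>" "\<sigma> \<ge> 0" by (cases S) auto
  have "ennreal \<sigma> \<le> ennreal (e1 + (1 / 2 * \<sigma> + C * I'))"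
  proof -
    have "ennreal (1 / 2) * S = ennreal (1 / 2 * \<sigma>)"
      unfolding \<sigma>(1) using \<sigma>(2) by (subst ennreal_mult) auto
    then show ?thesis
      using Sle e1 \<sigma> C I' by (simp only: ennreal_plus mult_nonneg_nonneg add_nonneg_nonneg)
  qed
  then have "\<sigma> \<le> e1 + (1 / 2 * \<sigma> + C * I')"
    using e1 \<sigma>(2) C I' by (subst (asm) ennreal_le_iff) auto
  then have \<sigma>le: "\<sigma> \<le> 2 * e1 + 2 * C * I'" by simp
  have "ennreal (LBINT x:V. entropy_density t (g x)) \<le> ennreal \<sigma>"
  proof -
    have gV: "g x > 0" if "x \<in> V" for x using gpos spD(3) that by auto
    have "ennreal (LBINT x:V. entropy_density t (g x)) = (\<integral>\<^sup>+x\<in>V. ennreal (entropy_density t (g x)) \<partial>lborel)"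
    proof (rule nn_integral_set_eq_ennreal[symmetric])
      show "set_integrable lborel V (\<lambda>x. entropy_density t (g x))"
      proof (rule set_integrable_continuous_bounded)
        show "continuous_on V (\<lambda>x. entropy_density t (g x))"
          unfolding entropy_density_def using gV t continuous_on_subset[OF cg spD(3)]
          by (intro continuous_intros) (auto simp: less_imp_neq[symmetric] order_less_imp_not_eq2)
        show "bounded ((\<lambda>x. entropy_density t (g x)) ` V)"
        proof (rule boundedI)
          fix y assume "y \<in> (\<lambda>x. entropy_density t (g x)) ` V"
          then obtain x where x: "x \<in> V" "y = entropy_density t (g x)" by auto
          have "y \<le> (g x - t)\<^sup>2 / t"
            using gV[OF x(1)] t x by (auto intro: entropy_density_le)
          also have "\<dots> \<le> Em"
            unfolding Em_def using gV[OF x(1)] G[of x] x spD(3) t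
            by (intro divide_right_mono power2_le_iff_abs_le[THEN iffD2]) auto
          finally show "norm y \<le> Em" using x gV[OF x(1)] t entropy_density_nonneg[of t "g x"] by simp
        qed
      qed (use bV in auto)
      show "0 \<le> entropy_density t (g x)" if "x \<in> V" for x
        using gV[OF that] t by (intro entropy_density_nonneg) auto
    qed
    also have "\<dots> = E 0"
      unfolding E_def using u0 by (intro nn_integral_cong) (auto split: split_indicator)
    also have "\<dots> \<le> ennreal \<sigma>" using ES[of 0] \<sigma> by simp
    finally show ?thesis .
  qed
  then have "(LBINT x:V. entropy_density t (g x)) \<le> \<sigma>"
    using \<sigma>(2) by (subst (asm) ennreal_le_iff) auto
  then show "(LBINT x:V. entropy_density (mean \<Omega> g) (g x)) \<le>
      2 * measure lborel V * entropy_density (mean \<Omega> g) (mean B g) + 2 * C * (LBINT x:\<Omega>. (norm (g' x))\<^sup>2 / g x)"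
    using \<sigma>le unfolding t_def[symmetric] e1_def I'_def j_def by simp
qed

section \<open>Logarithmic Sobolev and Poincare inequalities\<close>

lemma has_derivative_grad:
  assumes "f differentiable (at x)"
  shows "(f has_derivative (\<lambda>h. grad f x \<bullet> h)) (at x)"
proof -
  have D: "(f has_derivative frechet_derivative f (at x)) (at x)"
    using assms by (rule frechet_derivative_works[THEN iffD1])
  then have lin: "linear (frechet_derivative f (at x))"
    by (rule has_derivative_linear)
  have "frechet_derivative f (at x) h = grad f x \<bullet> h" for h
  proof -
    have "frechet_derivative f (at x) h = frechet_derivative f (at x) (\<Sum>b\<in>Basis. (h \<bullet> b) *\<^sub>R b)"
      by (simp add: euclidean_representation)
    also have "\<dots> = grad f x \<bullet> h"
      by (simp add: linear_sum[OF lin] linear_cmul[OF lin] grad_def inner_sum_right inner_commute mult.commute)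
    finally show ?thesis .
  qed
  then have "frechet_derivative f (at x) = (\<lambda>h. grad f x \<bullet> h)" by auto
  with D show ?thesis by simp
qed

lemma local_defining_functionD:
  assumes "local_defining_function \<Omega> U \<psi>"
  shows "open U" "\<And>x. x \<in> U \<Longrightarrow> (\<psi> has_derivative (\<lambda>h. grad \<psi> x \<bullet> h)) (at x)"
    "continuous_on U (grad \<psi>)" "\<And>x. x \<in> U \<Longrightarrow> grad \<psi> x \<noteq> 0"
    "\<And>x. x \<in> U \<Longrightarrow> x \<in> \<Omega> \<longleftrightarrow> \<psi> x < 0"
proof -
  have sm: "Ck_on (Suc 0) U \<psi>" using assms by (auto simp: local_defining_function_def smooth_on_def)
  then show "(\<psi> has_derivative (\<lambda>h. grad \<psi> x \<bullet> h)) (at x)" if "x \<in> U" for x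
    using that by (intro has_derivative_grad) auto
  from sm show "continuous_on U (grad \<psi>)"
    unfolding grad_def by (intro continuous_intros) auto
qed (use assms in \<open>auto simp: local_defining_function_def\<close>)

lemma local_defining_function_continuous:
  "local_defining_function \<Omega> U \<psi> \<Longrightarrow> continuous_on U \<psi>"
  by (meson continuous_at_imp_continuous_on has_derivative_continuous local_defining_functionD(2))

text \<open>Where \<psi> is positive, a whole neighbourhood misses \<Omega>, so the point is not in
  the closure; where \<psi> is negative, the point lies in the open set \<Omega> and not on its
  frontier.\<close>

lemma local_defining_function_frontier:
  assumes ldf: "local_defining_function \<Omega> U \<psi>" and "x \<in> U" "x \<in> frontier \<Omega>" "open \<Omega>"
  shows "\<psi> x = 0"
proof (rule antisym)
  note D = local_defining_functionD[OF ldf]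
  show "\<psi> x \<ge> 0"
    using assms D(5)[of x] by (auto simp: frontier_def interior_open)
  show "\<psi> x \<le> 0"
  proof (rule ccontr)
    assume "\<not> \<psi> x \<le> 0"
    then have "x \<in> {y \<in> U. \<psi> y > 0}" using assms by auto
    moreover have "open {y \<in> U. \<psi> y > 0}"
      using continuous_open_preimage[OF local_defining_function_continuous[OF ldf] D(1) open_greaterThan, of 0]
      by (simp add: vimage_def Int_def)
    ultimately have "{y \<in> U. \<psi> y > 0} \<inter> \<Omega> \<noteq> {}"
      using assms(3) open_Int_closure_eq_empty[of "{y \<in> U. \<psi> y > 0}" \<Omega>] by (auto simp: frontier_def)
    then show False using D(5) by force
  qed
qed

text \<open>At a boundary point the box is placed around \<open>x0 - \<eta> *\<^sub>R n'\<close>, a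
  step inward along the normal, and is small compared with \<eta>. All segments to it from
  \<open>\<Omega> \<inter> ball x0 r\<close> point so nearly along \<open>- grad \<psi> x0\<close>
  that \<psi> does not increase along them and stays negative. At an interior point convexity of a
  ball suffices.\<close>

lemma star_pair_nbhd:
  fixes \<Omega> :: "'a::euclidean_space set"
  assumes dom: "smooth_bounded_domain \<Omega>" and x0: "x0 \<in> closure \<Omega>"
  shows "\<exists>V B r. r > 0 \<and> star_pair \<Omega> V B \<and> \<Omega> \<inter> ball x0 r \<subseteq> V"
proof (cases "x0 \<in> \<Omega>")
  case True
  then obtain r where r: "r > 0" "ball x0 r \<subseteq> \<Omega>"
    using dom open_contains_ball unfolding smooth_bounded_domain_def by blast
  obtain a b where ab: "cbox a b \<subseteq> ball x0 r" "x0 \<in> box a b"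
    by (rule open_contains_cbox[of "ball x0 r" x0]) (use r in auto)
  have "star_pair \<Omega> (ball x0 r) (cbox a b)"
    unfolding star_pair_def using ab r closed_segment_subset[OF _ _ convex_ball, of _ x0 r]
    by (auto; blast)
  then show ?thesis using r by blast
next
  case False
  have op: "open \<Omega>" using dom by (simp add: smooth_bounded_domain_def)
  with False x0 have "x0 \<in> frontier \<Omega>" by (auto simp: frontier_def interior_open)
  then obtain U \<psi> where xU: "x0 \<in> U" and ldf: "local_defining_function \<Omega> U \<psi>"
    using dom unfolding smooth_bounded_domain_def smooth_boundary_def by blast
  note D = local_defining_functionD[OF ldf]
  define n where "n = grad \<psi> x0"
  have n: "norm n > 0" using D(4)[OF xU] by (simp add: n_def)
  obtain \<rho> where \<rho>: "\<rho> > 0" "ball x0 \<rho> \<subseteq> U" "\<And>z. z \<in> ball x0 \<rho> \<Longrightarrow> norm (grad \<psi> z - n) \<le> norm n / 4"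
  proof -
    obtain \<rho>1 where 1: "\<rho>1 > 0" "ball x0 \<rho>1 \<subseteq> U" using D(1) xU open_contains_ball by blast
    have "isCont (grad \<psi>) x0" using D(1,3) xU continuous_on_eq_continuous_at by blast
    then obtain \<rho>2 where 2: "\<rho>2 > 0" "\<And>z. dist z x0 < \<rho>2 \<Longrightarrow> dist (grad \<psi> z) n < norm n / 4"
      unfolding continuous_at_eps_delta n_def using n by (metis divide_pos_pos n_def zero_less_numeral)
    show ?thesis
      by (rule that[of "min \<rho>1 \<rho>2"]) (use 1 2 in \<open>auto simp: dist_norm norm_minus_commute less_imp_le\<close>)
  qed
  \<comment> \<open>These choices keep both ends of a segment in \<open>ball x0 \<rho>\<close> and
    make the deviation of its direction from \<open>- \<eta> *\<^sub>R n'\<close> at most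
    \<open>\<eta> / 5\<close>. In units of \<open>\<eta> * norm n\<close>, the four contributions to
    \<open>grad \<psi> z \<bullet> w\<close> are then at most 1/5, -1, 1/20 and 1/4, with sum
    -1/2.\<close>
  define \<eta> where "\<eta> = \<rho> / 2"
  define r where "r = \<eta> / 10"
  have \<eta>: "\<eta> > 0" and r: "r > 0" using \<rho> by (simp_all add: \<eta>_def r_def)
  define n' where "n' = n /\<^sub>R norm n"
  have n': "norm n' = 1" "n \<bullet> n' = norm n" using n by (simp_all add: n'_def dot_square_norm power2_eq_square)
  define y0 where "y0 = x0 - \<eta> *\<^sub>R n'"
  obtain a b where ab: "cbox a b \<subseteq> ball y0 r" "y0 \<in> box a b"
    by (rule open_contains_cbox[of "ball y0 r" y0]) (use r in auto)
  have "closed_segment x y \<subseteq> \<Omega>" if x: "x \<in> \<Omega> \<inter> ball x0 r" and y: "y \<in> ball y0 r" for x y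
  proof
    fix p assume "p \<in> closed_segment x y"
    then obtain s where s: "0 \<le> s" "s \<le> 1" "p = (1 - s) *\<^sub>R x + s *\<^sub>R y" by (auto simp: closed_segment_def)
    have "dist x0 y0 = \<eta>" using \<eta> n' by (simp add: y0_def dist_norm)
    then have "dist x0 y \<le> \<eta> + r" using y dist_triangle[of x0 y y0] by (simp add: dist_commute)
    moreover have "\<eta> + r < \<rho>" using \<rho> by (simp add: \<eta>_def r_def)
    ultimately have xy: "x \<in> ball x0 \<rho>" "y \<in> ball x0 \<rho>" using x \<eta> by (auto simp: r_def \<eta>_def)
    have pb: "(1 - q) *\<^sub>R x + q *\<^sub>R y \<in> ball x0 \<rho>" if "0 \<le> q" "q \<le> 1" for q
      using xy that by (intro convexD[OF convex_ball]) auto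
    define w where "w = y - x"
    define f where "f = w + \<eta> *\<^sub>R n'"
    have "f = (y - y0) + (x0 - x)" by (simp add: f_def w_def y0_def)
    also have "norm \<dots> \<le> r + r" using x y
      by (intro norm_triangle_le add_mono) (auto simp: dist_norm norm_minus_commute)
    finally have f: "norm f \<le> \<eta> / 5" by (simp add: r_def)
    have neg: "grad \<psi> z \<bullet> w \<le> 0" if "z \<in> ball x0 \<rho>" for z
    proof -
      define e where "e = grad \<psi> z - n"
      have e: "norm e \<le> norm n / 4" using \<rho>(3)[OF that] by (simp add: e_def)
      have "grad \<psi> z \<bullet> w = (n + e) \<bullet> (f - \<eta> *\<^sub>R n')" by (simp add: e_def f_def)
      also have "\<dots> = n \<bullet> f - \<eta> * norm n + e \<bullet> f - \<eta> * (e \<bullet> n')"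
        using n' by (simp add: inner_simps algebra_simps)
      finally have *: "grad \<psi> z \<bullet> w = n \<bullet> f - \<eta> * norm n + e \<bullet> f - \<eta> * (e \<bullet> n')" .
      have "n \<bullet> f \<le> norm n * (\<eta> / 5)"
        using f norm_cauchy_schwarz[of n f] mult_left_mono[OF f, of "norm n"] by simp
      moreover have "e \<bullet> f \<le> (norm n / 4) * (\<eta> / 5)"
        using norm_cauchy_schwarz[of e f] mult_mono[OF e f] by simp
      moreover have "\<bar>e \<bullet> n'\<bar> \<le> norm n / 4" using Cauchy_Schwarz_ineq2[of e n'] e n' by simp
      then have "- (norm n / 4) \<le> e \<bullet> n'" by simp
      then have "\<eta> * - (norm n / 4) \<le> \<eta> * (e \<bullet> n')"
        using \<eta> by (intro mult_left_mono) auto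
      ultimately show ?thesis using * mult_pos_pos[OF \<eta> n] by (simp add: algebra_simps)
    qed
    define F where "F q = \<psi> ((1 - q) *\<^sub>R x + q *\<^sub>R y)" for q
    have "F s \<le> F 0"
    proof (rule DERIV_nonpos_imp_nonincreasing[OF s(1)])
      fix q assume q: "0 \<le> q" "q \<le> s"
      let ?z = "(1 - q) *\<^sub>R x + q *\<^sub>R y"
      have zb: "?z \<in> ball x0 \<rho>" using q s by (intro pb) auto
      then have "(\<psi> has_derivative (\<lambda>h. grad \<psi> ?z \<bullet> h)) (at ?z)" using D(2) \<rho>(2) by auto
      then have "(F has_derivative (\<lambda>d. grad \<psi> ?z \<bullet> (- d *\<^sub>R x + d *\<^sub>R y))) (at q)"
        unfolding F_def by (auto intro!: has_derivative_compose[where g=\<psi>] derivative_eq_intros)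
      moreover have "(\<lambda>d. grad \<psi> ?z \<bullet> (- d *\<^sub>R x + d *\<^sub>R y)) = (*) (grad \<psi> ?z \<bullet> w)"
        by (auto simp: inner_simps algebra_simps w_def)
      ultimately show "\<exists>d. (F has_real_derivative d) (at q) \<and> d \<le> 0"
        using neg[OF zb] by (auto simp: has_field_derivative_def)
    qed
    also have "F 0 < 0" using D(5)[of x] x xy \<rho>(2) by (auto simp: F_def)
    finally have "\<psi> p < 0" by (simp add: F_def s)
    then show "p \<in> \<Omega>" using D(5)[of p] pb[OF s(1,2)] s \<rho>(2) by auto
  qed
  moreover have "\<Omega> \<inter> ball x0 r \<noteq> {}"
    using x0 r by (metis closure_approachable disjoint_iff mem_ball dist_commute)
  ultimately have "star_pair \<Omega> (\<Omega> \<inter> ball x0 r) (cbox a b)"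
    using ab op unfolding star_pair_def by blast
  then show ?thesis using r by blast
qed

lemma star_pair_cover:
  fixes \<Omega> :: "'a::euclidean_space set"
  assumes dom: "smooth_bounded_domain \<Omega>"
  obtains I :: "'a set" and V B where "finite I" "\<And>i. i \<in> I \<Longrightarrow> star_pair \<Omega> (V i) (B i)" "\<Omega> = (\<Union>i\<in>I. V i)"
proof -
  have "\<forall>x. \<exists>V B r. x \<in> closure \<Omega> \<longrightarrow> r > 0 \<and> star_pair \<Omega> V B \<and> \<Omega> \<inter> ball x r \<subseteq> V"
    using star_pair_nbhd[OF dom] by blast
  then obtain V B r where VBr: "\<And>x. x \<in> closure \<Omega> \<Longrightarrow> r x > 0 \<and> star_pair \<Omega> (V x) (B x) \<and> \<Omega> \<inter> ball x (r x) \<subseteq> V x"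
    by metis
  have "compact (closure \<Omega>)" using dom by (simp add: smooth_bounded_domain_def compact_closure)
  moreover have "closure \<Omega> \<subseteq> (\<Union>x\<in>closure \<Omega>. ball x (r x))" using VBr by force
  ultimately obtain I where I: "I \<subseteq> closure \<Omega>" "finite I" "closure \<Omega> \<subseteq> (\<Union>x\<in>I. ball x (r x))"
    using compactE_image[of "closure \<Omega>" "closure \<Omega>" "\<lambda>x. ball x (r x)"] by (metis open_ball)
  have "\<Omega> = (\<Union>i\<in>I. V i)"
  proof
    show "(\<Union>i\<in>I. V i) \<subseteq> \<Omega>" using VBr I star_pairD(3) by blast
    show "\<Omega> \<subseteq> (\<Union>i\<in>I. V i)"
    proof
      fix x assume x: "x \<in> \<Omega>"
      then have "x \<in> closure \<Omega>" using closure_subset by blast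
      then obtain i where "i \<in> I" "x \<in> ball i (r i)" using I by blast
      then show "x \<in> (\<Union>i\<in>I. V i)" using x VBr I by blast
    qed
  qed
  then show ?thesis using that[of I V B] I VBr by blast
qed

section \<open>From local to global inequalities\<close>

lemma set_integral_UN_le:
  fixes f :: "'a \<Rightarrow> real"
  assumes "finite I" "set_integrable M A f" "A = (\<Union>i\<in>I. V i)" "\<And>i. i \<in> I \<Longrightarrow> V i \<in> sets M"
    and nn: "\<And>x. x \<in> A \<Longrightarrow> 0 \<le> f x"
  shows "(LINT x:A|M. f x) \<le> (\<Sum>i\<in>I. LINT x:V i|M. f x)"
proof -
  have i: "set_integrable M (V i) f" if "i \<in> I" for i
    using that assms by (intro set_integrable_subset[OF assms(2)]) auto
  have "(LINT x:A|M. f x) \<le> (LINT x|M. (\<Sum>i\<in>I. indicator (V i) x *\<^sub>R f x))"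
    unfolding set_lebesgue_integral_def
  proof (rule integral_mono)
    show "integrable M (\<lambda>x. \<Sum>i\<in>I. indicator (V i) x *\<^sub>R f x)"
      using i by (intro Bochner_Integration.integrable_sum) (auto simp: set_integrable_def)
    show "integrable M (\<lambda>x. indicator A x *\<^sub>R f x)" using assms(2) by (simp add: set_integrable_def)
    fix x
    have sn: "0 \<le> indicator (V i) x *\<^sub>R f x" if "i \<in> I" for i
      using that nn assms(3) by (auto split: split_indicator)
    show "indicator A x *\<^sub>R f x \<le> (\<Sum>i\<in>I. indicator (V i) x *\<^sub>R f x)"
    proof (cases "x \<in> A")
      case True
      then obtain i where "i \<in> I" "x \<in> V i" using assms(3) by auto
      then show ?thesis
        using member_le_sum[of i I "\<lambda>i. indicator (V i) x *\<^sub>R f x"] sn \<open>finite I\<close> True by auto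
    next
      case False
      then show ?thesis using sn by (auto intro: sum_nonneg)
    qed
  qed
  also have "\<dots> = (\<Sum>i\<in>I. LINT x:V i|M. f x)"
    using i by (simp add: set_lebesgue_integral_def set_integrable_def)
  finally show ?thesis .
qed

text \<open>The integral of \<open>(l * f - h)\<^sup>2\<close> is a nonnegative quadratic polynomial
  in \<open>l\<close>, evaluated at its minimum \<open>R / P\<close>.\<close>

lemma set_integral_Cauchy_Schwarz:
  fixes f h :: "'a \<Rightarrow> real"
  assumes "set_integrable M A (\<lambda>x. (f x)\<^sup>2)" "set_integrable M A (\<lambda>x. (h x)\<^sup>2)" "set_integrable M A (\<lambda>x. f x * h x)"
  shows "(LINT x:A|M. f x * h x)\<^sup>2 \<le> (LINT x:A|M. (f x)\<^sup>2) * (LINT x:A|M. (h x)\<^sup>2)"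
proof -
  define P where "P = (LINT x:A|M. (f x)\<^sup>2)"
  define Q where "Q = (LINT x:A|M. (h x)\<^sup>2)"
  define R where "R = (LINT x:A|M. f x * h x)"
  have quad: "0 \<le> l\<^sup>2 * P - 2 * l * R + Q" for l
  proof -
    have "0 \<le> (LINT x:A|M. (l * f x - h x)\<^sup>2)"
      by (simp add: set_lebesgue_integral_def)
    also have "\<dots> = (LINT x:A|M. l\<^sup>2 * (f x)\<^sup>2 - 2 * l * (f x * h x) + (h x)\<^sup>2)"
      by (simp add: power2_diff power_mult_distrib algebra_simps)
    also have "\<dots> = l\<^sup>2 * P - 2 * l * R + Q"
      unfolding P_def Q_def R_def using assms
      by (subst set_integral_add set_integral_diff; auto intro!: set_integral_diff)+
    finally show ?thesis .
  qed
  have "R\<^sup>2 \<le> P * Q"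
  proof (cases "P = 0")
    case False
    have "P \<ge> 0" by (simp add: P_def set_lebesgue_integral_def)
    with False show ?thesis using quad[of "R / P"] by (simp add: field_simps power2_eq_square)
  next
    case True
    have "R = 0"
    proof (rule ccontr)
      assume "R \<noteq> 0"
      \<comment> \<open>For \<open>P = 0\<close> the polynomial is affine in \<open>l\<close>; at
        this \<open>l\<close> its value is -1.\<close>
      then show False using quad[of "(Q + 1) / (2 * R)"] True by simp
    qed
    then show ?thesis using True by simp
  qed
  then show ?thesis by (simp add: P_def Q_def R_def)
qed


lemma measure_open_pos:
  fixes A :: "'a::euclidean_space set"
  assumes "open A" "A \<noteq> {}" "bounded A"
  shows "measure lborel A > 0"
proof -
  have "emeasure lborel A \<noteq> 0"
    using assms(1,2) open_not_negligible[of A] negligible_iff_emeasure0[of A]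
    by (auto simp: emeasure_completion)
  then show ?thesis
    using emeasure_bounded_finite[OF assms(3)]
    by (metis emeasure_eq_ennreal_measure ennreal_eq_0_iff infinity_ennreal_def less_top measure_le_0_iff not_le)
qed

lemma C1_bounded_subset:
  assumes "C1_bounded \<Omega> g g'" "W \<subseteq> \<Omega>"
  shows "C1_bounded W g g'"
  unfolding C1_bounded_def
proof (intro conjI)
  show "\<forall>x\<in>W. (g has_derivative (\<bullet>) (g' x)) (at x)" using assms by (auto simp: C1_bounded_def)
  show "continuous_on W g'" using assms by (auto simp: C1_bounded_def intro: continuous_on_subset)
  show "bounded (g ` W)" "bounded (g' ` W)"
    using assms(1) bounded_subset[OF _ image_mono[OF assms(2)]] by (auto simp: C1_bounded_def)
qed

lemma C1_bounded_integrable: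
  assumes "C1_bounded \<Omega> g g'" "open \<Omega>" "bounded \<Omega>"
  shows "set_integrable lborel \<Omega> g" "set_integrable lborel \<Omega> (\<lambda>x. \<bar>g x - m\<bar>)" "set_integrable lborel \<Omega> (\<lambda>x. norm (g' x))"
    "set_integrable lborel \<Omega> (\<lambda>x. (g x)\<^sup>2)" "set_integrable lborel \<Omega> (\<lambda>x. (norm (g' x))\<^sup>2)"
proof -
  have c: "continuous_on \<Omega> g" "continuous_on \<Omega> g'" and b: "bounded (g ` \<Omega>)" "bounded (g' ` \<Omega>)"
    using assms(1) C1_bounded_continuous by (auto simp: C1_bounded_def)
  from b obtain K L where K: "\<And>x. x \<in> \<Omega> \<Longrightarrow> \<bar>g x\<bar> \<le> K" and L: "\<And>x. x \<in> \<Omega> \<Longrightarrow> norm (g' x) \<le> L"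
    by (auto simp: bounded_iff)
  have "\<bar>g x - m\<bar> \<le> K + \<bar>m\<bar>" "\<bar>(g x)\<^sup>2\<bar> \<le> K\<^sup>2" "\<bar>(norm (g' x))\<^sup>2\<bar> \<le> L\<^sup>2" if "x \<in> \<Omega>" for x
    using K[OF that] L[OF that] power_mono[OF K[OF that], of 2] power_mono[OF L[OF that], of 2] by auto
  then show "set_integrable lborel \<Omega> g" "set_integrable lborel \<Omega> (\<lambda>x. \<bar>g x - m\<bar>)" "set_integrable lborel \<Omega> (\<lambda>x. norm (g' x))"
    "set_integrable lborel \<Omega> (\<lambda>x. (g x)\<^sup>2)" "set_integrable lborel \<Omega> (\<lambda>x. (norm (g' x))\<^sup>2)"
    using assms c K L
    by (auto intro!: set_integrable_bounded[OF set_borel_measurable_continuous] continuous_intros)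
qed

lemma L1_norm_deviation_ge:
  fixes \<Omega> :: "'a::euclidean_space set"
  assumes "C1_bounded \<Omega> g g'" "open \<Omega>" "bounded \<Omega>"
  shows "measure lborel \<Omega> * \<bar>mean \<Omega> g - m\<bar> \<le> (LBINT x:\<Omega>. \<bar>g x - m\<bar>)"
proof -
  note i = C1_bounded_integrable[OF assms]
  have ci: "set_integrable lborel \<Omega> (\<lambda>_. m)"
    using assms emeasure_bounded_finite[of \<Omega>] by (auto simp: set_integrable_def)
  have "(LBINT x:\<Omega>. g x - m) = measure lborel \<Omega> * (mean \<Omega> g - m)" if "measure lborel \<Omega> \<noteq> 0"
    using i(1) ci that
    by (subst set_integral_diff) (auto simp: mean_def algebra_simps set_lebesgue_integral_def)
  moreover have "\<bar>LBINT x:\<Omega>. g x - m\<bar> \<le> (LBINT x:\<Omega>. \<bar>g x - m\<bar>)"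
    using set_integral_norm_bound[OF set_integral_diff(1)[OF i(1) ci]] by simp
  moreover have "0 \<le> (LBINT x:\<Omega>. \<bar>g x - m\<bar>)"
    by (simp add: set_lebesgue_integral_def)
  ultimately show ?thesis by (cases "measure lborel \<Omega> = 0") (auto simp: abs_mult)
qed

lemma set_integral_mono_set:
  fixes f :: "'a \<Rightarrow> real"
  assumes "set_integrable M A f" "W \<subseteq> A" "W \<in> sets M" "\<And>x. x \<in> A \<Longrightarrow> 0 \<le> f x"
  shows "(LINT x:W|M. f x) \<le> (LINT x:A|M. f x)"
proof -
  have "set_integrable M W f" using assms by (intro set_integrable_subset[OF assms(1)]) auto
  then show ?thesis
    using assms unfolding set_lebesgue_integral_def set_integrable_def
    by (intro integral_mono) (auto split: split_indicator)
qed

text \<open>The mean over the overlap \<open>W = V \<inter> V'\<close> is close to both box means,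
  each by the \<open>L\<^sup>1\<close> Poincare inequality on its own pair. The overlap is open and
  nonempty, hence of positive measure.\<close>

lemma star_pairs_overlap:
  fixes \<Omega> :: "'a::euclidean_space set"
  assumes sp: "star_pair \<Omega> V B" "star_pair \<Omega> V' B'" and ne: "V \<inter> V' \<noteq> {}" and \<Omega>: "open \<Omega>" "bounded \<Omega>"
  shows "\<exists>C\<ge>0. \<forall>g g'. C1_bounded \<Omega> g g' \<longrightarrow> \<bar>mean B g - mean B' g\<bar> \<le> C * (LBINT x:\<Omega>. norm (g' x))"
proof -
  obtain C where C: "C \<ge> 0" "\<And>g g'. C1_bounded \<Omega> g g' \<Longrightarrow> (LBINT x:V. \<bar>g x - mean B g\<bar>) \<le> C * (LBINT x:\<Omega>. norm (g' x))"
    using star_pair_L1_poincare[OF sp(1) \<Omega>] by blast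
  obtain C' where C': "C' \<ge> 0" "\<And>g g'. C1_bounded \<Omega> g g' \<Longrightarrow> (LBINT x:V'. \<bar>g x - mean B' g\<bar>) \<le> C' * (LBINT x:\<Omega>. norm (g' x))"
    using star_pair_L1_poincare[OF sp(2) \<Omega>] by blast
  note D = star_pairD[OF sp(1)] and D' = star_pairD[OF sp(2)]
  define W where "W = V \<inter> V'"
  have W: "open W" "bounded W" "W \<subseteq> \<Omega>"
    using D(1,3) D'(1) \<Omega>(2) bounded_subset by (auto simp: W_def)
  then have mW: "measure lborel W > 0" using measure_open_pos ne W_def by blast
  show ?thesis
  proof (intro exI[of _ "(C + C') / measure lborel W"] conjI allI impI)
    show "(C + C') / measure lborel W \<ge> 0" using C(1) C'(1) mW by simp
    fix g g' assume g: "C1_bounded \<Omega> g g'"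
    note i = C1_bounded_integrable[OF g \<Omega>]
    have gW: "C1_bounded W g g'"
      using g W(3) by (rule C1_bounded_subset)
    have "measure lborel W * \<bar>mean B g - mean B' g\<bar> \<le>
      measure lborel W * (\<bar>mean W g - mean B g\<bar> + \<bar>mean W g - mean B' g\<bar>)"
      by (intro mult_left_mono) auto
    also have "\<dots> \<le> (LBINT x:W. \<bar>g x - mean B g\<bar>) + (LBINT x:W. \<bar>g x - mean B' g\<bar>)"
      using L1_norm_deviation_ge[OF gW W(1,2)] by (simp add: distrib_left add_mono)
    also have "\<dots> \<le> (LBINT x:V. \<bar>g x - mean B g\<bar>) + (LBINT x:V'. \<bar>g x - mean B' g\<bar>)"
    proof (rule add_mono)
      show "(LBINT x:W. \<bar>g x - mean B g\<bar>) \<le> (LBINT x:V. \<bar>g x - mean B g\<bar>)"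
        using set_integrable_subset[OF i(2), of V] D(3,8)
        W(1) by (intro set_integral_mono_set) (auto simp: W_def)
      show "(LBINT x:W. \<bar>g x - mean B' g\<bar>) \<le> (LBINT x:V'. \<bar>g x - mean B' g\<bar>)"
        using set_integrable_subset[OF i(2), of V'] D'(3,8)
        W(1) by (intro set_integral_mono_set) (auto simp: W_def)
    qed
    also have "\<dots> \<le> (C + C') * (LBINT x:\<Omega>. norm (g' x))"
      using C(2)[OF g] C'(2)[OF g] by (simp add: algebra_simps)
    finally show "\<bar>mean B g - mean B' g\<bar> \<le> (C + C') / measure lborel W * (LBINT x:\<Omega>. norm (g' x))"
      using mW by (simp add: field_simps)
  qed
qed


text \<open>Comparability of box means is transitive and holds for overlapping members of the cover.
  If some index were not comparable with \<open>i\<close>, the members comparable with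
  \<open>i\<close> and the remaining ones would split \<Omega> into two disjoint nonempty open
  parts. The sum of the constants over all pairs of indices serves all pairs at once.\<close>

lemma connected_domain_means_comparable:
  fixes \<Omega> :: "'a::euclidean_space set"
  assumes I: "finite I" "\<And>i. i \<in> I \<Longrightarrow> star_pair \<Omega> (V i) (B i)" "\<Omega> = (\<Union>i\<in>I. V i)"
    and \<Omega>: "open \<Omega>" "bounded \<Omega>" "connected \<Omega>"
  shows "\<exists>C\<ge>0. \<forall>i\<in>I. \<forall>j\<in>I. \<forall>g g'. C1_bounded \<Omega> g g' \<longrightarrow>
    \<bar>mean (B i) g - mean (B j) g\<bar> \<le> C * (LBINT x:\<Omega>. norm (g' x))"
proof -
  define rel where "rel i j \<longleftrightarrow> (\<exists>C\<ge>0. \<forall>g g'. C1_bounded \<Omega> g g' \<longrightarrow>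
    \<bar>mean (B i) g - mean (B j) g\<bar> \<le> C * (LBINT x:\<Omega>. norm (g' x)))" for i j
  have rel_trans: "rel i k" if "rel i j" "rel j k" for i j k
  proof -
    from that obtain C C' where C: "C \<ge> 0" "C' \<ge> 0" "\<And>g g'. C1_bounded \<Omega> g g' \<Longrightarrow>
        \<bar>mean (B i) g - mean (B j) g\<bar> \<le> C * (LBINT x:\<Omega>. norm (g' x))"
      "\<And>g g'. C1_bounded \<Omega> g g' \<Longrightarrow>
        \<bar>mean (B j) g - mean (B k) g\<bar> \<le> C' * (LBINT x:\<Omega>. norm (g' x))"
      unfolding rel_def by blast
    show ?thesis unfolding rel_def
    proof (intro exI[of _ "C + C'"] conjI allI impI)
      fix g g' assume "C1_bounded \<Omega> g g'"
      from C(3,4)[OF this] show "\<bar>mean (B i) g - mean (B k) g\<bar> \<le> (C + C') * (LBINT x:\<Omega>. norm (g' x))"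
        by (simp add: algebra_simps)
    qed (use C in auto)
  qed
  have rel_all: "rel i j" if i: "i \<in> I" and j: "j \<in> I" for i j
  proof (rule ccontr)
    assume "\<not> rel i j"
    define S where "S = {k \<in> I. rel i k}"
    have refl: "rel i i" unfolding rel_def by (intro exI[of _ 0]) auto
    let ?A = "\<Union>k\<in>S. V k" and ?A' = "\<Union>k\<in>I - S. V k"
    have op: "open (V k)" if "k \<in> I" for k using star_pairD(1)[OF I(2)[OF that]] .
    have "open ?A" "open ?A'" using op by (auto simp: S_def)
    moreover have "\<Omega> \<subseteq> ?A \<union> ?A'" using I(3) by auto
    moreover have "?A \<inter> \<Omega> \<noteq> {}" using i refl star_pairD(2,3)[OF I(2)[OF i]] by (force simp: S_def)
    moreover have "?A' \<inter> \<Omega> \<noteq> {}" using j \<open>\<not> rel i j\<close> star_pairD(2,3)[OF I(2)[OF j]] by (force simp: S_def)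
    ultimately have "?A \<inter> ?A' \<inter> \<Omega> \<noteq> {}" using connectedD[OF \<Omega>(3), of ?A ?A'] by metis
    then obtain k l where kl: "k \<in> S" "l \<in> I - S" "V k \<inter> V l \<noteq> {}" by blast
    then have "rel k l" unfolding rel_def
      by (intro star_pairs_overlap[OF I(2) I(2) _ \<Omega>(1,2)]) (auto simp: S_def)
    then show False using kl rel_trans[of i k l] by (auto simp: S_def)
  qed
  then have "\<forall>p. \<exists>C. p \<in> I \<times> I \<longrightarrow> C \<ge> 0 \<and> (\<forall>g g'. C1_bounded \<Omega> g g' \<longrightarrow>
    \<bar>mean (B (fst p)) g - mean (B (snd p)) g\<bar> \<le> C * (LBINT x:\<Omega>. norm (g' x)))"
    unfolding rel_def by auto
  then obtain C where C: "\<And>p. p \<in> I \<times> I \<Longrightarrow> C p \<ge> 0 \<and> (\<forall>g g'. C1_bounded \<Omega> g g' \<longrightarrow>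
    \<bar>mean (B (fst p)) g - mean (B (snd p)) g\<bar> \<le> C p * (LBINT x:\<Omega>. norm (g' x)))"
    by metis
  show ?thesis
  proof (intro exI[of _ "\<Sum>p\<in>I \<times> I. C p"] conjI ballI allI impI)
    show "0 \<le> (\<Sum>p\<in>I \<times> I. C p)" using C by (intro sum_nonneg) auto
    fix i j g g' assume ij: "i \<in> I" "j \<in> I" and g: "C1_bounded \<Omega> g g'"
    then have "\<bar>mean (B i) g - mean (B j) g\<bar> \<le> C (i, j) * (LBINT x:\<Omega>. norm (g' x))"
      using C[of "(i, j)"] by auto
    also have "\<dots> \<le> (\<Sum>p\<in>I \<times> I. C p) * (LBINT x:\<Omega>. norm (g' x))"
      using C ij I(1) by (intro mult_right_mono member_le_sum) (auto simp: set_lebesgue_integral_def)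
    finally show "\<bar>mean (B i) g - mean (B j) g\<bar> \<le> (\<Sum>p\<in>I \<times> I. C p) * (LBINT x:\<Omega>. norm (g' x))" .
  qed
qed

text \<open>On each \<open>V k\<close> the deviation from \<open>mean (B j) g\<close> is split at
  \<open>mean (B k) g\<close>: one part is the local Poincare inequality, the other the comparison
  of box means.\<close>

lemma mean_local_mean_diff:
  fixes \<Omega> :: "'a::euclidean_space set"
  assumes I: "finite I" "\<And>i. i \<in> I \<Longrightarrow> star_pair \<Omega> (V i) (B i)" "\<Omega> = (\<Union>i\<in>I. V i)"
    and \<Omega>: "open \<Omega>" "bounded \<Omega>" "connected \<Omega>" "\<Omega> \<noteq> {}"
  obtains C where "C \<ge> 0" "\<And>i g g'. i \<in> I \<Longrightarrow> C1_bounded \<Omega> g g' \<Longrightarrow>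
    \<bar>mean (B i) g - mean \<Omega> g\<bar> \<le> C * (LBINT x:\<Omega>. norm (g' x))"
proof -
  have m\<Omega>: "measure lborel \<Omega> > 0" using measure_open_pos \<Omega> by blast
  obtain C where C: "C \<ge> 0" "\<And>i j g g'. i \<in> I \<Longrightarrow> j \<in> I \<Longrightarrow> C1_bounded \<Omega> g g' \<Longrightarrow>
    \<bar>mean (B i) g - mean (B j) g\<bar> \<le> C * (LBINT x:\<Omega>. norm (g' x))"
    using connected_domain_means_comparable[OF I \<Omega>(1-3)] by blast
  have "\<forall>i. \<exists>L. i \<in> I \<longrightarrow> L \<ge> 0 \<and> (\<forall>g g'. C1_bounded \<Omega> g g' \<longrightarrow>
      (LBINT x:V i. \<bar>g x - mean (B i) g\<bar>) \<le> L * (LBINT x:\<Omega>. norm (g' x)))"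
    using star_pair_L1_poincare[OF I(2) \<Omega>(1,2)] by metis
  then obtain L where L: "\<And>i. i \<in> I \<Longrightarrow> L i \<ge> 0" "\<And>i g g'. i \<in> I \<Longrightarrow> C1_bounded \<Omega> g g' \<Longrightarrow>
      (LBINT x:V i. \<bar>g x - mean (B i) g\<bar>) \<le> L i * (LBINT x:\<Omega>. norm (g' x))"
    by metis
  define T where "T = (\<Sum>i\<in>I. L i + measure lborel (V i) * C) / measure lborel \<Omega>"
  show ?thesis
  proof (rule that[of T])
    show "T \<ge> 0" unfolding T_def using L(1) C(1) m\<Omega> by (intro divide_nonneg_pos sum_nonneg) auto
    fix j g g' assume j: "j \<in> I" and g: "C1_bounded \<Omega> g g'"
    note i = C1_bounded_integrable[OF g \<Omega>(1,2)]
    define G where "G = (LBINT x:\<Omega>. norm (g' x))"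
    have "measure lborel \<Omega> * \<bar>mean \<Omega> g - mean (B j) g\<bar> \<le> (LBINT x:\<Omega>. \<bar>g x - mean (B j) g\<bar>)"
      by (rule L1_norm_deviation_ge[OF g \<Omega>(1,2)])
    also have "\<dots> \<le> (\<Sum>i\<in>I. LBINT x:V i. \<bar>g x - mean (B j) g\<bar>)"
    proof (rule set_integral_UN_le[OF I(1) i(2) I(3)])
      show "V i \<in> sets lborel" if "i \<in> I" for i using star_pairD(8)[OF I(2)[OF that]] by simp
    qed simp
    also have "\<dots> \<le> (\<Sum>i\<in>I. (L i + measure lborel (V i) * C) * G)"
    proof (rule sum_mono)
      fix k assume k: "k \<in> I"
      note D = star_pairD[OF I(2)[OF k]]
      have iV: "set_integrable lborel (V k) (\<lambda>x. \<bar>g x - m\<bar>)" for m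
        using D by (intro set_integrable_subset[OF i(2)]) auto
      have cV: "set_integrable lborel (V k) (\<lambda>_. m :: real)" for m
        using D \<Omega>(2) emeasure_bounded_finite[OF bounded_subset[OF \<Omega>(2) D(3)]] by (auto simp: set_integrable_def)
      have "(LBINT x:V k. \<bar>g x - mean (B j) g\<bar>) \<le>
          (LBINT x:V k. \<bar>g x - mean (B k) g\<bar> + \<bar>mean (B k) g - mean (B j) g\<bar>)"
        by (intro set_integral_mono_on iV cV set_integral_add) auto
      also have "\<dots> = (LBINT x:V k. \<bar>g x - mean (B k) g\<bar>) + measure lborel (V k) * \<bar>mean (B k) g - mean (B j) g\<bar>"
        using iV cV by (subst set_integral_add) (auto simp: set_lebesgue_integral_def)
      also have "\<dots> \<le> L k * G + measure lborel (V k) * (C * G)"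
        unfolding G_def using L(2)[OF k g] C(2)[OF k j g] by (intro add_mono mult_left_mono) auto
      finally show "(LBINT x:V k. \<bar>g x - mean (B j) g\<bar>) \<le> (L k + measure lborel (V k) * C) * G"
        by (simp add: algebra_simps)
    qed
    also have "\<dots> = measure lborel \<Omega> * (T * G)"
      using m\<Omega> by (simp add: T_def sum_distrib_right[symmetric])
    finally show "\<bar>mean (B j) g - mean \<Omega> g\<bar> \<le> T * (LBINT x:\<Omega>. norm (g' x))"
      using m\<Omega> by (simp add: G_def abs_minus_commute)
  qed
qed

text \<open>Summation of the local inequalities leaves the entropies of the box means relative to
  the global mean \<open>t\<close>. They are at most the squared difference of the means divided by
  \<open>t\<close>; that difference is controlled by the integral of \<open>norm g'\<close>, and
  Cauchy-Schwarz produces a factor \<open>t\<close> that cancels the division.\<close>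

lemma log_sobolev_inequality:
  fixes \<Omega> :: "'a::euclidean_space set"
  assumes dom: "smooth_bounded_domain \<Omega>"
  obtains K where "K > 0" "\<And>g g'. C1_bounded \<Omega> g g' \<Longrightarrow> \<exists>\<delta>>0. \<forall>x\<in>\<Omega>. \<delta> \<le> g x \<Longrightarrow>
    (LBINT x:\<Omega>. entropy_density (mean \<Omega> g) (g x)) \<le> K * (LBINT x:\<Omega>. (norm (g' x))\<^sup>2 / g x)"
proof -
  have \<Omega>: "open \<Omega>" "bounded \<Omega>" "connected \<Omega>" "\<Omega> \<noteq> {}" using dom by (auto simp: smooth_bounded_domain_def)
  have m\<Omega>: "measure lborel \<Omega> > 0" using measure_open_pos \<Omega> by blast
  obtain I :: "'a set" and V B where I: "finite I" "\<And>i. i \<in> I \<Longrightarrow> star_pair \<Omega> (V i) (B i)" "\<Omega> = (\<Union>i\<in>I. V i)"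
    using star_pair_cover[OF dom] by blast
  obtain T where T: "T \<ge> 0" "\<And>i g g'. i \<in> I \<Longrightarrow> C1_bounded \<Omega> g g' \<Longrightarrow>
    \<bar>mean (B i) g - mean \<Omega> g\<bar> \<le> T * (LBINT x:\<Omega>. norm (g' x))"
    using mean_local_mean_diff[OF I \<Omega>] by blast
  define lsi where "lsi i L \<longleftrightarrow> L \<ge> 0 \<and> (\<forall>g g'. C1_bounded \<Omega> g g' \<longrightarrow> (\<exists>\<delta>>0. \<forall>x\<in>\<Omega>. \<delta> \<le> g x) \<longrightarrow>
       (LBINT x:V i. entropy_density (mean \<Omega> g) (g x)) \<le>
         2 * measure lborel (V i) * entropy_density (mean \<Omega> g) (mean (B i) g) + L * (LBINT x:\<Omega>. (norm (g' x))\<^sup>2 / g x))"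
    for i L
  have "\<exists>L. lsi i L" if iI: "i \<in> I" for i
  proof (rule star_pair_log_sobolev[OF I(2)[OF iI] \<Omega>(1,2)])
    fix C :: real assume "C \<ge> 0" "\<And>g g'. C1_bounded \<Omega> g g' \<Longrightarrow> \<exists>\<delta>>0. \<forall>x\<in>\<Omega>. \<delta> \<le> g x \<Longrightarrow>
       (LBINT x:V i. entropy_density (mean \<Omega> g) (g x)) \<le>
         2 * measure lborel (V i) * entropy_density (mean \<Omega> g) (mean (B i) g) + C * (LBINT x:\<Omega>. (norm (g' x))\<^sup>2 / g x)"
    then show "\<exists>L. lsi i L" unfolding lsi_def by (intro exI[of _ C] conjI allI impI)
  qed
  then obtain L where "\<And>i. i \<in> I \<Longrightarrow> lsi i (L i)" by metis
  then have L: "\<And>i. i \<in> I \<Longrightarrow> L i \<ge> 0" "\<And>i g g'. i \<in> I \<Longrightarrow> C1_bounded \<Omega> g g' \<Longrightarrow> \<exists>\<delta>>0. \<forall>x\<in>\<Omega>. \<delta> \<le> g x \<Longrightarrow>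
       (LBINT x:V i. entropy_density (mean \<Omega> g) (g x)) \<le>
         2 * measure lborel (V i) * entropy_density (mean \<Omega> g) (mean (B i) g) + L i * (LBINT x:\<Omega>. (norm (g' x))\<^sup>2 / g x)"
    unfolding lsi_def by simp_all
  define c where "c i = 2 * measure lborel (V i) * (T\<^sup>2 * measure lborel \<Omega>) + L i" for i
  have c: "c i \<ge> 0" if "i \<in> I" for i using L(1)[OF that] m\<Omega> by (simp add: c_def)
  show ?thesis
  proof (rule that[of "(\<Sum>i\<in>I. c i) + 1"])
    show "(\<Sum>i\<in>I. c i) + 1 > 0" using sum_nonneg[of I c] c by (simp add: add_nonneg_pos)
    fix g g' assume g: "C1_bounded \<Omega> g g'" and d: "\<exists>\<delta>>0. \<forall>x\<in>\<Omega>. \<delta> \<le> g x"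
    note i = C1_bounded_integrable[OF g \<Omega>(1,2)]
    from d obtain \<delta> where \<delta>: "\<delta> > 0" "\<And>x. x \<in> \<Omega> \<Longrightarrow> \<delta> \<le> g x" by blast
    have gp: "g x > 0" if "x \<in> \<Omega>" for x using \<delta>(1) \<delta>(2)[OF that] by simp
    have cg: "continuous_on \<Omega> g" "continuous_on \<Omega> g'" and b: "bounded (g ` \<Omega>)" "bounded (g' ` \<Omega>)"
      using g C1_bounded_continuous by (auto simp: C1_bounded_def)
    from b obtain A A' where A: "\<And>x. x \<in> \<Omega> \<Longrightarrow> \<bar>g x\<bar> \<le> A" and A': "\<And>x. x \<in> \<Omega> \<Longrightarrow> norm (g' x) \<le> A'"
      by (auto simp: bounded_iff)
    define t where "t = mean \<Omega> g"
    have ci: "set_integrable lborel \<Omega> (\<lambda>_. m :: real)" for m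
      using \<Omega>(1) emeasure_bounded_finite[OF \<Omega>(2)] by (auto simp: set_integrable_def)
    have "\<delta> * measure lborel \<Omega> \<le> (LBINT x:\<Omega>. g x)"
      using set_integral_mono_on[OF ci i(1) \<delta>(2)] by (simp add: set_lebesgue_integral_def mult.commute)
    then have tp: "t > 0"
      unfolding t_def mean_def using m\<Omega> \<delta>(1)
      by (intro divide_pos_pos) (auto intro: less_le_trans[of 0 "\<delta> * measure lborel \<Omega>"])
    define J where "J = (LBINT x:\<Omega>. (norm (g' x))\<^sup>2 / g x)"
    have Jb: "\<bar>(norm (g' x))\<^sup>2 / g x\<bar> \<le> A'\<^sup>2 / \<delta>" if "x \<in> \<Omega>" for x
    proof -
      have "(norm (g' x))\<^sup>2 / g x \<le> A'\<^sup>2 / \<delta>"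
        using A'[OF that] \<delta> that by (intro frac_le power_mono) auto
      then show ?thesis using gp[OF that] by simp
    qed
    have iJ: "set_integrable lborel \<Omega> (\<lambda>x. (norm (g' x))\<^sup>2 / g x)"
      using \<Omega> cg gp Jb by (intro set_integrable_bounded[OF set_borel_measurable_continuous] continuous_intros) force+
    have J: "J \<ge> 0" unfolding J_def set_lebesgue_integral_def using gp
      by (intro Bochner_Integration.integral_nonneg) (auto split: split_indicator intro!: divide_nonneg_pos)
    \<comment> \<open>\<open>norm g'\<close> is written as
      \<open>sqrt g * (norm g' / sqrt g)\<close>; the first factor contributes the mass
      \<open>t * measure lborel \<Omega>\<close>.\<close>
    have CS: "(LBINT x:\<Omega>. norm (g' x))\<^sup>2 \<le> t * measure lborel \<Omega> * J"
    proof -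
      have e: "sqrt (g x) * (norm (g' x) / sqrt (g x)) = norm (g' x)" "(sqrt (g x))\<^sup>2 = g x"
          "(norm (g' x) / sqrt (g x))\<^sup>2 = (norm (g' x))\<^sup>2 / g x" if "x \<in> \<Omega>" for x
        using gp[OF that] by (auto simp: power_divide)
      have "(LBINT x:\<Omega>. sqrt (g x) * (norm (g' x) / sqrt (g x)))\<^sup>2 \<le>
          (LBINT x:\<Omega>. (sqrt (g x))\<^sup>2) * (LBINT x:\<Omega>. (norm (g' x) / sqrt (g x))\<^sup>2)"
        using i iJ e by (intro set_integral_Cauchy_Schwarz) (simp_all cong: set_integrable_cong)
      moreover have "(LBINT x:\<Omega>. sqrt (g x) * (norm (g' x) / sqrt (g x))) = (LBINT x:\<Omega>. norm (g' x))"
        "(LBINT x:\<Omega>. (sqrt (g x))\<^sup>2) = t * measure lborel \<Omega>"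
        "(LBINT x:\<Omega>. (norm (g' x) / sqrt (g x))\<^sup>2) = J"
      proof -
        show "(LBINT x:\<Omega>. sqrt (g x) * (norm (g' x) / sqrt (g x))) = (LBINT x:\<Omega>. norm (g' x))"
          using \<Omega>(1) e(1) by (intro set_lebesgue_integral_cong) auto
        have "(LBINT x:\<Omega>. (sqrt (g x))\<^sup>2) = (LBINT x:\<Omega>. g x)"
          using \<Omega>(1) e(2) by (intro set_lebesgue_integral_cong) auto
        then show "(LBINT x:\<Omega>. (sqrt (g x))\<^sup>2) = t * measure lborel \<Omega>"
          using m\<Omega> by (simp add: t_def mean_def)
        show "(LBINT x:\<Omega>. (norm (g' x) / sqrt (g x))\<^sup>2) = J"
          unfolding J_def using \<Omega>(1) e(3) by (intro set_lebesgue_integral_cong) auto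
      qed
      ultimately show ?thesis by simp
    qed
    have ie: "set_integrable lborel \<Omega> (\<lambda>x. entropy_density t (g x))"
    proof (rule set_integrable_bounded[OF set_borel_measurable_continuous])
      show "continuous_on \<Omega> (\<lambda>x. entropy_density t (g x))"
        unfolding entropy_density_def using gp tp cg by (intro continuous_intros) force+
      show "norm (entropy_density t (g x)) \<le> (A + t)\<^sup>2 / t" if "x \<in> \<Omega>" for x
      proof -
        have "entropy_density t (g x) \<le> (g x - t)\<^sup>2 / t"
          using gp[OF that] tp by (intro entropy_density_le) auto
        also have "\<dots> \<le> (A + t)\<^sup>2 / t"
          using gp[OF that] A[OF that] tp by (intro divide_right_mono power2_le_iff_abs_le[THEN iffD2]) auto
        finally show ?thesis using entropy_density_nonneg[of t "g x"] gp[OF that] tp by simp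
      qed
    qed (use \<Omega> in auto)
    have "(LBINT x:\<Omega>. entropy_density t (g x)) \<le> (\<Sum>i\<in>I. LBINT x:V i. entropy_density t (g x))"
    proof (rule set_integral_UN_le[OF I(1) ie I(3)])
      show "V i \<in> sets lborel" if "i \<in> I" for i using star_pairD(8)[OF I(2)[OF that]] by simp
      show "0 \<le> entropy_density t (g x)" if "x \<in> \<Omega>" for x
        using gp[OF that] tp by (intro entropy_density_nonneg) auto
    qed
    also have "\<dots> \<le> (\<Sum>i\<in>I. c i * J)"
    proof (rule sum_mono)
      fix k assume k: "k \<in> I"
      note D = star_pairD[OF I(2)[OF k]]
      have "set_integrable lborel (B k) g"
        using D by (intro set_integrable_subset[OF i(1)]) auto
      moreover have "set_integrable lborel (B k) (\<lambda>_. 0 :: real)" by (simp add: set_integrable_def)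
      ultimately have "0 \<le> (LBINT x:B k. g x)"
        using set_integral_mono_on[of lborel "B k" "\<lambda>_. 0" g] D(5) gp by (force simp: set_lebesgue_integral_def)
      then have mB: "mean (B k) g \<ge> 0" by (simp add: mean_def)
      have "entropy_density t (mean (B k) g) \<le> (mean (B k) g - t)\<^sup>2 / t"
        using mB tp by (rule entropy_density_le[rotated])
      also have "\<dots> \<le> (T * (LBINT x:\<Omega>. norm (g' x)))\<^sup>2 / t"
        using T(2)[OF k g] tp by (intro divide_right_mono power2_le_iff_abs_le[THEN iffD2]) (auto simp: t_def intro: order_trans[OF abs_ge_zero])
      also have "\<dots> \<le> T\<^sup>2 * (t * measure lborel \<Omega> * J) / t"
        unfolding power_mult_distrib using CS tp by (intro divide_right_mono mult_left_mono) auto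
      also have "\<dots> = T\<^sup>2 * measure lborel \<Omega> * J" using tp by simp
      finally have "2 * measure lborel (V k) * entropy_density t (mean (B k) g) \<le> 2 * measure lborel (V k) * (T\<^sup>2 * measure lborel \<Omega> * J)"
        by (intro mult_left_mono) auto
      then show "(LBINT x:V k. entropy_density t (g x)) \<le> c k * J"
        using L(2)[OF k g d] unfolding t_def[symmetric] J_def[symmetric] c_def by (simp add: algebra_simps)
    qed
    also have "\<dots> \<le> ((\<Sum>i\<in>I. c i) + 1) * J" using J by (simp add: sum_distrib_right[symmetric] distrib_right)
    finally show "(LBINT x:\<Omega>. entropy_density (mean \<Omega> g) (g x)) \<le>
        ((\<Sum>i\<in>I. c i) + 1) * (LBINT x:\<Omega>. (norm (g' x))\<^sup>2 / g x)"
      by (simp add: t_def J_def)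
  qed
qed

text \<open>Linearisation of the logarithmic Sobolev inequality at large constants.\<close>

lemma poincare_inequality:
  fixes \<Omega> :: "'a::euclidean_space set"
  assumes dom: "smooth_bounded_domain \<Omega>"
  obtains K where "K > 0" "\<And>f f'. C1_bounded \<Omega> f f' \<Longrightarrow> (LBINT x:\<Omega>. f x) = 0 \<Longrightarrow>
    (LBINT x:\<Omega>. (f x)\<^sup>2) \<le> K * (LBINT x:\<Omega>. (norm (f' x))\<^sup>2)"
proof -
  have \<Omega>: "open \<Omega>" "bounded \<Omega>" "connected \<Omega>" "\<Omega> \<noteq> {}" using dom by (auto simp: smooth_bounded_domain_def)
  have m\<Omega>: "measure lborel \<Omega> > 0" using measure_open_pos \<Omega> by blast
  obtain K where K: "K > 0" "\<And>g g'. C1_bounded \<Omega> g g' \<Longrightarrow> \<exists>\<delta>>0. \<forall>x\<in>\<Omega>. \<delta> \<le> g x \<Longrightarrow>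
    (LBINT x:\<Omega>. entropy_density (mean \<Omega> g) (g x)) \<le> K * (LBINT x:\<Omega>. (norm (g' x))\<^sup>2 / g x)"
    using log_sobolev_inequality[OF dom] by blast
  \<comment> \<open>The 8 is the quotient of \<open>16 * A\<close>, from the lower bound on the
    entropy, and \<open>2 * A\<close>, from the lower bound on \<open>g\<close>; the scale
    \<open>A\<close> of \<open>f\<close> disappears.\<close>
  show ?thesis
  proof (rule that[of "8 * K"])
    fix f f' assume f: "C1_bounded \<Omega> f f'" and f0: "(LBINT x:\<Omega>. f x) = 0"
    note i = C1_bounded_integrable[OF f \<Omega>(1,2)]
    have cf: "continuous_on \<Omega> f" "continuous_on \<Omega> f'" and b: "bounded (f ` \<Omega>)" "bounded (f' ` \<Omega>)"
      using f C1_bounded_continuous by (auto simp: C1_bounded_def)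
    from b(1) obtain A0 where A0: "\<And>x. x \<in> \<Omega> \<Longrightarrow> \<bar>f x\<bar> \<le> A0" by (auto simp: bounded_iff)
    define A where "A = max A0 1"
    have A: "A > 0" "\<And>x. x \<in> \<Omega> \<Longrightarrow> \<bar>f x\<bar> \<le> A" using A0 by (force simp: A_def)+
    \<comment> \<open>The shift puts \<open>g = M + f\<close> between \<open>2 * A\<close> and
      \<open>4 * A\<close>, and the mean of \<open>g\<close> is exactly \<open>M\<close> because
      \<open>f\<close> has integral 0.\<close>
    define M where "M = 3 * A"
    define g where "g x = M + f x" for x
    have gb: "2 * A \<le> g x" "g x \<le> 4 * A" if "x \<in> \<Omega>" for x using A(2)[OF that] by (auto simp: g_def M_def)
    have g: "C1_bounded \<Omega> g f'"
      unfolding C1_bounded_def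
    proof (intro conjI)
      show "\<forall>x\<in>\<Omega>. (g has_derivative (\<bullet>) (f' x)) (at x)"
        using f unfolding g_def C1_bounded_def by (auto intro!: derivative_eq_intros)
      show "bounded (g ` \<Omega>)" using gb A(1) by (intro boundedI[of _ "4 * A"]) force
    qed (use cf b in auto)
    have ci: "set_integrable lborel \<Omega> (\<lambda>_. m :: real)" for m
      using \<Omega>(1) emeasure_bounded_finite[OF \<Omega>(2)] by (auto simp: set_integrable_def)
    have "mean \<Omega> g = M"
      unfolding mean_def g_def using i(1) ci m\<Omega> f0
      by (subst set_integral_add) (auto simp: set_lebesgue_integral_def)
    then have LS: "(LBINT x:\<Omega>. entropy_density M (g x)) \<le> K * (LBINT x:\<Omega>. (norm (f' x))\<^sup>2 / g x)"
      using K(2)[OF g] gb(1) A(1) by (metis mult_pos_pos zero_less_numeral)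
    have pl: "(f x)\<^sup>2 / (16 * A) \<le> entropy_density M (g x)" if x: "x \<in> \<Omega>" for x
    proof -
      have gp: "g x \<ge> 0" using gb[OF x] A(1) by simp
      have "(f x)\<^sup>2 = ((sqrt (g x) - sqrt M) * (sqrt (g x) + sqrt M))\<^sup>2"
        using gp A(1) by (simp add: algebra_simps g_def M_def)
      also have "\<dots> = (sqrt (g x) - sqrt M)\<^sup>2 * (sqrt (g x) + sqrt M)\<^sup>2"
        by (simp add: power_mult_distrib)
      also have "\<dots> \<le> (sqrt (g x) - sqrt M)\<^sup>2 * (16 * A)"
      proof (rule mult_left_mono)
        have "(sqrt (g x) + sqrt M)\<^sup>2 \<le> 2 * (g x + M)"
          using sum_squares_ge_zero[of "sqrt (g x) - sqrt M" 0] gp A(1)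
          by (simp add: power2_eq_square algebra_simps M_def)
        then show "(sqrt (g x) + sqrt M)\<^sup>2 \<le> 16 * A" using gb[OF x] A(1) by (simp add: M_def)
      qed simp
      also have "\<dots> \<le> entropy_density M (g x) * (16 * A)"
        using gp A(1) by (intro mult_right_mono sqrt_diff_le_entropy_density) (auto simp: M_def)
      finally show ?thesis using A(1) by (simp add: field_simps)
    qed
    have cont: "continuous_on \<Omega> (\<lambda>x. entropy_density M (g x))"
      unfolding entropy_density_def g_def using gb A(1)
      by (intro continuous_intros cf) (force simp: M_def g_def)+
    have ub: "norm (entropy_density M (g x)) \<le> A" if x: "x \<in> \<Omega>" for x
    proof -
      have gp: "g x \<ge> 0" using gb[OF x] A(1) by simp
      have "entropy_density M (g x) \<le> (g x - M)\<^sup>2 / M" using gp A(1) by (intro entropy_density_le) (auto simp: M_def)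
      also have "\<dots> \<le> A\<^sup>2 / M"
        using A x by (intro divide_right_mono power2_le_iff_abs_le[THEN iffD2]) (auto simp: g_def M_def)
      also have "\<dots> \<le> A" using A(1) by (simp add: M_def power2_eq_square)
      finally show ?thesis using entropy_density_nonneg[of M "g x"] gp A(1) by (simp add: M_def)
    qed
    have ie: "set_integrable lborel \<Omega> (\<lambda>x. entropy_density M (g x))"
      using \<Omega> ub by (intro set_integrable_bounded[OF set_borel_measurable_continuous[OF _ cont]]) auto
    have "(LBINT x:\<Omega>. (f x)\<^sup>2) / (16 * A) = (LBINT x:\<Omega>. (f x)\<^sup>2 / (16 * A))" by simp
    also have "\<dots> \<le> (LBINT x:\<Omega>. entropy_density M (g x))"
      using i(4) ie pl by (intro set_integral_mono_on) auto
    also have "\<dots> \<le> K * (LBINT x:\<Omega>. (norm (f' x))\<^sup>2 / g x)" by (rule LS)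
    also have "\<dots> \<le> K * (LBINT x:\<Omega>. (norm (f' x))\<^sup>2 / (2 * A))"
    proof (intro mult_left_mono set_integral_mono_on)
      show "set_integrable lborel \<Omega> (\<lambda>x. (norm (f' x))\<^sup>2 / (2 * A))" using i(5) by simp
      have le: "(norm (f' x))\<^sup>2 / g x \<le> (norm (f' x))\<^sup>2 / (2 * A)" if "x \<in> \<Omega>" for x
        using gb[OF that] A(1) by (intro divide_left_mono) auto
      then show "(norm (f' x))\<^sup>2 / g x \<le> (norm (f' x))\<^sup>2 / (2 * A)" if "x \<in> \<Omega>" for x
        using that by blast
      show "set_integrable lborel \<Omega> (\<lambda>x. (norm (f' x))\<^sup>2 / g x)"
      proof (rule set_integrable_bound[OF \<open>set_integrable lborel \<Omega> (\<lambda>x. (norm (f' x))\<^sup>2 / (2 * A))\<close>])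
        have "continuous_on \<Omega> (\<lambda>x. (norm (f' x))\<^sup>2 / g x)"
          using gb A(1) C1_bounded_continuous[OF g] by (intro continuous_intros cf) force+
        then show "set_borel_measurable lborel \<Omega> (\<lambda>x. (norm (f' x))\<^sup>2 / g x)"
          using \<Omega> by (intro set_borel_measurable_continuous) auto
        have "norm ((norm (f' x))\<^sup>2 / g x) \<le> norm ((norm (f' x))\<^sup>2 / (2 * A))" if "x \<in> \<Omega>" for x
          using le[OF that] gb[OF that] A(1) by simp
        then show "AE x in lborel. x \<in> \<Omega> \<longrightarrow> norm ((norm (f' x))\<^sup>2 / g x) \<le> norm ((norm (f' x))\<^sup>2 / (2 * A))"
          by simp
      qed
    qed (use K(1) in auto)
    also have "\<dots> = K * (LBINT x:\<Omega>. (norm (f' x))\<^sup>2) / (2 * A)" by simp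
    finally show "(LBINT x:\<Omega>. (f x)\<^sup>2) \<le> 8 * K * (LBINT x:\<Omega>. (norm (f' x))\<^sup>2)"
      using A(1) by (simp add: field_simps)
  qed (use K in auto)
qed

section \<open>Integration by parts with vanishing normal flux\<close>

lemma integrable_continuous_bounded_support:
  fixes f :: "'a::euclidean_space \<Rightarrow> real"
  assumes "continuous_on UNIV f" "bounded S" "\<And>x. x \<notin> S \<Longrightarrow> f x = 0"
  shows "integrable lborel f"
proof -
  obtain r where r: "S \<subseteq> cball 0 r" using assms(2) by (auto simp: bounded_iff subset_iff)
  have "set_integrable lborel (cball 0 r) f"
    using continuous_on_subset[OF assms(1)]
    by (intro set_integrable_continuous_bounded compact_imp_bounded compact_continuous_image) auto
  moreover have "(\<lambda>x. indicator (cball 0 r) x *\<^sub>R f x) = f"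
    using r assms(3) by (auto simp: fun_eq_iff subset_iff split: split_indicator)
  ultimately show ?thesis by (simp add: set_integrable_def)
qed

lemma lborel_integral_translate:
  fixes p :: "'a::euclidean_space \<Rightarrow> real"
  assumes "p \<in> borel_measurable borel"
  shows "(\<integral>x. p (x + a) \<partial>lborel) = (\<integral>x. p x \<partial>lborel)"
proof -
  have "(\<integral>x. p x \<partial>lborel) = (\<integral>x. p x \<partial>distr lborel borel ((+) a))"
    by (simp add: lborel_distr_plus)
  also have "\<dots> = (\<integral>x. p (x + a) \<partial>lborel)"
    using assms by (subst integral_distr) (auto simp: add.commute)
  finally show ?thesis by simp
qed

text \<open>By translation invariance every difference quotient of \<open>p\<close> has integral 0.
  The mean value theorem bounds the quotients on a fixed ball by a bound of \<open>q\<close>, so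
  dominated convergence applies. This plays the role of the divergence theorem for bounded
  support.\<close>

lemma integral_directional_derivative_eq_0:
  fixes p :: "'a::euclidean_space \<Rightarrow> real"
  assumes der: "\<And>x. ((\<lambda>s. p (x + s *\<^sub>R v)) has_real_derivative q x) (at 0)"
    and cp: "continuous_on UNIV p" and cq: "continuous_on UNIV q"
    and S: "bounded S" "\<And>x. x \<notin> S \<Longrightarrow> p x = 0" "\<And>x. x \<notin> S \<Longrightarrow> q x = 0"
  shows "(\<integral>x. q x \<partial>lborel) = 0"
proof -
  have ip: "integrable lborel p" using cp S by (intro integrable_continuous_bounded_support)
  have [measurable]: "p \<in> borel_measurable borel" "q \<in> borel_measurable borel"
    using cp cq by (simp_all add: borel_measurable_continuous_onI)
  obtain r where r: "S \<subseteq> cball 0 r" using S(1) by (auto simp: bounded_iff subset_iff)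
  have "bounded (q ` cball 0 r)"
    using continuous_on_subset[OF cq] by (intro compact_imp_bounded compact_continuous_image) auto
  then obtain Q0 where Q0: "\<And>x. x \<in> cball 0 r \<Longrightarrow> \<bar>q x\<bar> \<le> Q0"
    by (metis bounded_iff imageI real_norm_def)
  define Q where "Q = max Q0 0"
  have Q: "\<bar>q x\<bar> \<le> Q" for x
    using Q0[of x] S(3)[of x] r by (cases "x \<in> cball 0 r") (force simp: Q_def)+
  have Q_nn: "Q \<ge> 0" by (simp add: Q_def)
  have der': "((\<lambda>s. p (x + s *\<^sub>R v)) has_real_derivative q (x + s *\<^sub>R v)) (at s)" for x s
    using der[of "x + s *\<^sub>R v"] DERIV_at_within_shift[of "\<lambda>s. p (x + s *\<^sub>R v)" "q (x + s *\<^sub>R v)" s 0 UNIV]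
    by (simp add: scaleR_add_left add.assoc add.commute add.left_commute)
  define f where "f n x = (p (x + (1 / Suc n) *\<^sub>R v) - p x) / (1 / Suc n)" for n x
  \<comment> \<open>All step lengths \<open>1 / Suc n\<close> are at most 1, so the quotients vanish
    outside the ball of radius \<open>r + norm v\<close>.\<close>
  define R where "R = r + norm v"
  have fb: "norm (f n x) \<le> indicator (cball 0 R) x *\<^sub>R Q" for n x
  proof (cases "x \<in> cball 0 R")
    case True
    obtain \<xi> where "p (x + (1 / Suc n) *\<^sub>R v) - p (x + 0 *\<^sub>R v) = (1 / Suc n - 0) * q (x + \<xi> *\<^sub>R v)"
      using MVT2[of 0 "1 / Suc n" "\<lambda>s. p (x + s *\<^sub>R v)" "\<lambda>s. q (x + s *\<^sub>R v)"] der' by auto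
    then have "f n x = q (x + \<xi> *\<^sub>R v)" by (simp add: f_def)
    then show ?thesis using True Q by simp
  next
    case False
    have "norm ((1 / Suc n) *\<^sub>R v) \<le> norm v"
      using mult_right_mono[of "1 / Suc n" 1 "norm v"] by simp
    then have "norm (x + (1 / Suc n) *\<^sub>R v) > r"
      using False norm_triangle_ineq2[of x "- ((1 / Suc n) *\<^sub>R v)"] by (auto simp: R_def)
    then have "x + (1 / Suc n) *\<^sub>R v \<notin> S" using r by auto
    moreover have "x \<notin> S" using False r by (auto simp: R_def subset_iff) (smt (verit) norm_ge_zero)
    ultimately show ?thesis using S(2) by (simp add: f_def Q_nn)
  qed
  have lim: "(\<lambda>n. f n x) \<longlonglongrightarrow> q x" for x
  proof -
    have "((\<lambda>h. (p (x + h *\<^sub>R v) - p x) / h) \<longlongrightarrow> q x) (at 0)"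
      using der[of x] by (simp add: DERIV_def)
    moreover have "filterlim (\<lambda>n. 1 / real (Suc n)) (at 0) sequentially"
      using LIMSEQ_Suc[OF lim_const_over_n[of 1]] by (auto simp: filterlim_at)
    ultimately show ?thesis unfolding f_def by (rule filterlim_compose)
  qed
  have "(\<lambda>n. \<integral>x. f n x \<partial>lborel) \<longlonglongrightarrow> (\<integral>x. q x \<partial>lborel)"
  proof (rule integral_dominated_convergence)
    show "integrable lborel (\<lambda>x. indicator (cball 0 R) x *\<^sub>R Q)"
      using emeasure_bounded_finite[of "cball 0 R"] by (intro integrable_scaleR_left integrable_real_indicator) auto
    show "f n \<in> borel_measurable lborel" for n unfolding f_def by measurable
  qed (use fb lim in auto)
  moreover have "(\<integral>x. f n x \<partial>lborel) = 0" for n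
  proof -
    have "integrable lborel (\<lambda>x. p (x + (1 / Suc n) *\<^sub>R v))"
    proof (rule integrable_continuous_bounded_support)
      show "continuous_on UNIV (\<lambda>x. p (x + (1 / Suc n) *\<^sub>R v))"
        by (intro continuous_intros continuous_on_compose2[OF cp]) auto
      show "bounded ((\<lambda>x. x - (1 / Suc n) *\<^sub>R v) ` S)"
        using S(1) by (rule bounded_translation_minus)
      show "p (x + (1 / Suc n) *\<^sub>R v) = 0" if "x \<notin> (\<lambda>x. x - (1 / Suc n) *\<^sub>R v) ` S" for x
        using that by (intro S(2)) (metis add_diff_cancel imageI)
    qed
    then show ?thesis
      unfolding f_def using ip by (simp add: lborel_integral_translate)
  qed
  ultimately show ?thesis by (simp add: LIMSEQ_const_iff)
qed

lemma has_directional_derivative: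
  assumes "(f has_derivative f') (at x)"
  shows "((\<lambda>s. f (x + s *\<^sub>R v)) has_real_derivative f' v) (at 0)"
proof -
  have "((\<lambda>s. x + s *\<^sub>R v) has_derivative (\<lambda>d. d *\<^sub>R v)) (at 0)"
    by (auto intro!: derivative_eq_intros)
  from has_derivative_compose[OF this, of f f'] assms
  have "((\<lambda>s. f (x + s *\<^sub>R v)) has_derivative (\<lambda>d. f' (d *\<^sub>R v))) (at 0)" by simp
  moreover have "(\<lambda>d. f' (d *\<^sub>R v)) = (*) (f' v)"
    using linear_cmul[OF has_derivative_linear[OF assms]] by (auto simp: mult.commute)
  ultimately show ?thesis by (simp add: has_field_derivative_def)
qed

section \<open>The outward normal\<close>

text \<open>If the unit normals \<open>n\<close> and \<open>n'\<close> differed, a small step from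
  \<open>x\<close> in the direction \<open>n' - n\<close> would decrease \<open>\<psi>\<close> and
  increase \<open>\<psi>'\<close>, both of which vanish at \<open>x\<close>. The point reached would
  lie in \<Omega> by the first function and outside it by the second.\<close>

lemma boundary_normals_agree:
  assumes ldf: "local_defining_function \<Omega> U \<psi>" "local_defining_function \<Omega> U' \<psi>'"
    and x: "x \<in> U" "x \<in> U'" "x \<in> frontier \<Omega>" and op: "open \<Omega>"
  shows "grad \<psi> x /\<^sub>R norm (grad \<psi> x) = grad \<psi>' x /\<^sub>R norm (grad \<psi>' x)"
proof (rule ccontr)
  note D = local_defining_functionD[OF ldf(1)] and D' = local_defining_functionD[OF ldf(2)]
  define n where "n = grad \<psi> x /\<^sub>R norm (grad \<psi> x)"
  define n' where "n' = grad \<psi>' x /\<^sub>R norm (grad \<psi>' x)"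
  assume "\<not> ?thesis"
  then have ne: "n \<noteq> n'" by (simp add: n_def n'_def)
  have a: "norm (grad \<psi> x) > 0" "norm (grad \<psi>' x) > 0" using D(4) D'(4) x by auto
  have un: "norm n = 1" "norm n' = 1" using a by (simp_all add: n_def n'_def)
  define v where "v = n' - n"
  have "0 < (norm (n - n'))\<^sup>2" using ne by simp
  also have "\<dots> = 2 - 2 * (n \<bullet> n')"
    using un by (simp add: power2_norm_eq_inner inner_diff inner_commute norm_eq_1)
  finally have lt: "n \<bullet> n' < 1" by simp
  have nv: "n \<bullet> v < 0" "n' \<bullet> v > 0"
    using lt un by (simp_all add: v_def inner_diff_right inner_commute norm_eq_1)
  have gv: "grad \<psi> x \<bullet> v < 0" "grad \<psi>' x \<bullet> v > 0"
    using nv a by (auto simp: n_def n'_def mult_less_0_iff zero_less_mult_iff divide_less_0_iff zero_less_divide_iff inverse_eq_divide)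
  have z: "\<psi> x = 0" "\<psi>' x = 0"
    using local_defining_function_frontier ldf x op by blast+
  obtain d where d: "d > 0" "\<And>h. 0 < h \<Longrightarrow> h < d \<Longrightarrow> \<psi> (x + h *\<^sub>R v) < 0"
    using DERIV_neg_dec_right[OF has_directional_derivative[OF D(2)[OF x(1)]] gv(1)] z by auto
  obtain d' where d': "d' > 0" "\<And>h. 0 < h \<Longrightarrow> h < d' \<Longrightarrow> \<psi>' (x + h *\<^sub>R v) > 0"
    using DERIV_pos_inc_right[OF has_directional_derivative[OF D'(2)[OF x(2)]] gv(2)] z by auto
  have "open (U \<inter> U')" "x \<in> U \<inter> U'" using D(1) D'(1) x by auto
  then obtain e where e: "e > 0" "ball x e \<subseteq> U \<inter> U'" by (meson open_contains_ball)
  have np: "norm v + 1 > 0" by (simp add: add_nonneg_pos)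
  define m where "m = e / (norm v + 1)"
  have m: "m > 0" using e(1) np by (simp add: m_def)
  define h where "h = min (min d d') m / 2"
  have h: "0 < h" "h < d" "h < d'" "h < m"
    using d(1) d'(1) m by (auto simp: h_def)
  have "h * norm v < e"
  proof -
    have "h * norm v \<le> h * (norm v + 1)" using h(1) by simp
    also have "\<dots> < e" using h(4) np by (simp add: m_def pos_less_divide_eq)
    finally show ?thesis .
  qed
  then have "x + h *\<^sub>R v \<in> U \<inter> U'" using e(2) h(1) by (intro subsetD[OF e(2)]) (simp add: dist_norm)
  then show False using d(2)[OF h(1,2)] d'(2)[OF h(1,3)] D(5) D'(5) by fastforce
qed

text \<open>The choice operator may have picked another defining function, but unit normals of
  different defining functions agree.\<close>

lemma outward_normal_eq:
  assumes ldf: "local_defining_function \<Omega> U \<psi>" and x: "x \<in> U" "x \<in> frontier \<Omega>" and op: "open \<Omega>"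
  shows "outward_normal \<Omega> x = grad \<psi> x /\<^sub>R norm (grad \<psi> x)"
proof -
  let ?P = "\<lambda>\<nu>. \<exists>U \<psi>. x \<in> U \<and> local_defining_function \<Omega> U \<psi> \<and> \<nu> = grad \<psi> x /\<^sub>R norm (grad \<psi> x)"
  have "?P (grad \<psi> x /\<^sub>R norm (grad \<psi> x))" using ldf x by blast
  then have "?P (outward_normal \<Omega> x)" unfolding outward_normal_def by (rule someI)
  then obtain U' \<psi>' where "x \<in> U'" "local_defining_function \<Omega> U' \<psi>'" "outward_normal \<Omega> x = grad \<psi>' x /\<^sub>R norm (grad \<psi>' x)"
    by blast
  then show ?thesis using boundary_normals_agree[OF ldf _ x(1) _ x(2) op] by metis
qed

section \<open>Cutoff functions near the boundary\<close>

text \<open>The squared positive part is the \<open>C\<^sup>1\<close> truncation from which bumps,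
  boundary profiles and cutoffs are all built.\<close>

lemma max0_square_has_derivative:
  "((\<lambda>u::real. (max 0 u)\<^sup>2) has_real_derivative 2 * max 0 u) (at u)"
proof -
  consider "u > 0" | "u < 0" | "u = 0" by linarith
  then show ?thesis
  proof cases
    case 1
    have "((\<lambda>u::real. u\<^sup>2) has_real_derivative 2 * max 0 u) (at u)"
      using 1 by (auto intro!: derivative_eq_intros simp: max_def)
    then show ?thesis
      by (rule has_field_derivative_transform_within_open[where S = "{0<..}"]) (use 1 in \<open>auto simp: max_def\<close>)
  next
    case 2
    have "((\<lambda>u::real. 0) has_real_derivative 2 * max 0 u) (at u)"
      using 2 by (auto intro!: derivative_eq_intros simp: max_def)
    then show ?thesis
      by (rule has_field_derivative_transform_within_open[where S = "{..<0}"]) (use 2 in \<open>auto simp: max_def\<close>)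
  next
    case 3
    have "((\<lambda>h::real. (max 0 h)\<^sup>2 / h) \<longlongrightarrow> 0) (at 0)"
    proof (rule Lim_null_comparison)
      show "\<forall>\<^sub>F h::real in at 0. norm ((max 0 h)\<^sup>2 / h) \<le> \<bar>h\<bar>"
        by (intro always_eventually allI) (auto simp: max_def power2_eq_square)
      show "((\<lambda>h::real. \<bar>h\<bar>) \<longlongrightarrow> 0) (at 0)" by (rule tendsto_eq_intros refl | simp)+
    qed
    then show ?thesis using 3 by (simp add: DERIV_def)
  qed
qed

text \<open>Zero outside the ball of radius \<open>2 * \<rho>\<close> and at least 1 on the ball of
  radius \<open>\<rho>\<close>: the inner balls will cover the boundary, while the outer ones stay
  in the domain of the defining function.\<close>

definition bump :: "'a::euclidean_space \<Rightarrow> real \<Rightarrow> 'a \<Rightarrow> real" where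
  "bump x0 \<rho> x = (max 0 (4 - (norm (x - x0))\<^sup>2 / \<rho>\<^sup>2))\<^sup>2"

definition bump_grad :: "'a::euclidean_space \<Rightarrow> real \<Rightarrow> 'a \<Rightarrow> 'a" where
  "bump_grad x0 \<rho> x = (- 4 * max 0 (4 - (norm (x - x0))\<^sup>2 / \<rho>\<^sup>2) / \<rho>\<^sup>2) *\<^sub>R (x - x0)"

lemma bump_has_derivative: "(bump x0 \<rho> has_derivative (\<lambda>h. bump_grad x0 \<rho> x \<bullet> h)) (at x)"
proof -
  have "((\<lambda>x. 4 - ((x - x0) \<bullet> (x - x0)) / \<rho>\<^sup>2) has_derivative (\<lambda>h. - (2 * ((x - x0) \<bullet> h)) / \<rho>\<^sup>2)) (at x)"
    by (auto intro!: derivative_eq_intros simp: divide_inverse inner_commute algebra_simps)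
  then have d: "((\<lambda>x. 4 - (norm (x - x0))\<^sup>2 / \<rho>\<^sup>2) has_derivative (\<lambda>h. - (2 * ((x - x0) \<bullet> h)) / \<rho>\<^sup>2)) (at x)"
    by (simp add: power2_norm_eq_inner)
  show ?thesis
    using DERIV_compose_FDERIV[OF max0_square_has_derivative d]
    unfolding bump_def bump_grad_def by (simp add: mult_ac)
qed

lemma bump_continuous [continuous_intros]:
  "continuous_on S (bump x0 \<rho>)" "continuous_on S (bump_grad x0 \<rho>)"
  unfolding bump_def bump_grad_def divide_inverse by (intro continuous_intros)+

lemma bump_outside:
  assumes "\<rho> > 0" "x \<notin> ball x0 (2 * \<rho>)"
  shows "bump x0 \<rho> x = 0" "bump_grad x0 \<rho> x = 0"
proof -
  have "(2 * \<rho>)\<^sup>2 \<le> (norm (x - x0))\<^sup>2"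
    using assms by (intro power_mono) (auto simp: dist_norm norm_minus_commute)
  then have "4 - (norm (x - x0))\<^sup>2 / \<rho>\<^sup>2 \<le> 0" using assms(1) by (simp add: field_simps power_mult_distrib)
  then show "bump x0 \<rho> x = 0" "bump_grad x0 \<rho> x = 0" by (simp_all add: bump_def bump_grad_def max_def)
qed

lemma bump_nonneg: "0 \<le> bump x0 \<rho> x"
  by (simp add: bump_def)

lemma bump_ge_1:
  assumes "\<rho> > 0" "x \<in> ball x0 \<rho>"
  shows "bump x0 \<rho> x \<ge> 1"
proof -
  have "(norm (x - x0))\<^sup>2 \<le> \<rho>\<^sup>2"
    using assms by (intro power_mono) (auto simp: dist_norm norm_minus_commute)
  then have "(norm (x - x0))\<^sup>2 / \<rho>\<^sup>2 \<le> 1" using assms(1) by (simp add: field_simps)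
  then have "max 0 (4 - (norm (x - x0))\<^sup>2 / \<rho>\<^sup>2) \<ge> 1" by simp
  then show ?thesis unfolding bump_def by simp
qed

text \<open>The vector \<open>v\<close> is one direction transversal to all level sets of \<psi> in
  the ball; differentiation along it measures the mass of the layer near the boundary.\<close>

definition boundary_patch :: "'a::euclidean_space set \<Rightarrow> 'a set \<Rightarrow> ('a \<Rightarrow> real) \<Rightarrow> 'a \<Rightarrow> real \<Rightarrow> bool" where
  "boundary_patch \<Omega> U \<psi> x0 \<rho> \<longleftrightarrow> local_defining_function \<Omega> U \<psi> \<and> \<rho> > 0 \<and> cball x0 (2 * \<rho>) \<subseteq> U \<and>
     (\<exists>v c. c > 0 \<and> (\<forall>x\<in>cball x0 (2 * \<rho>). c \<le> grad \<psi> x \<bullet> v))"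

lemma boundary_patch_exists:
  assumes ldf: "local_defining_function \<Omega> U \<psi>" and "x0 \<in> U"
  shows "\<exists>\<rho>. boundary_patch \<Omega> U \<psi> x0 \<rho>"
proof -
  note D = local_defining_functionD[OF ldf]
  define v where "v = grad \<psi> x0"
  have v: "norm v > 0" using D(4) \<open>x0 \<in> U\<close> by (simp add: v_def)
  obtain r1 where 1: "r1 > 0" "ball x0 r1 \<subseteq> U" using D(1) \<open>x0 \<in> U\<close> open_contains_ball by blast
  have "isCont (grad \<psi>) x0" using D(1,3) \<open>x0 \<in> U\<close> continuous_on_eq_continuous_at by blast
  then obtain r2 where 2: "r2 > 0" "\<And>z. dist z x0 < r2 \<Longrightarrow> dist (grad \<psi> z) v < norm v / 2"
    unfolding continuous_at_eps_delta v_def using v by (metis half_gt_zero v_def)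
  define \<rho> where "\<rho> = min r1 r2 / 4"
  have sub: "z \<in> ball x0 r1" "dist z x0 < r2" if "z \<in> cball x0 (2 * \<rho>)" for z
    using that 1(1) 2(1) by (auto simp: \<rho>_def dist_commute min_def split: if_splits)
  have "(norm v)\<^sup>2 / 2 \<le> grad \<psi> z \<bullet> v" if "z \<in> cball x0 (2 * \<rho>)" for z
  proof -
    have "norm (grad \<psi> z - v) \<le> norm v / 2" using 2(2)[OF sub(2)[OF that]] by (simp add: dist_norm)
    then have "\<bar>(grad \<psi> z - v) \<bullet> v\<bar> \<le> norm v / 2 * norm v"
      using Cauchy_Schwarz_ineq2[of "grad \<psi> z - v" v] mult_right_mono[of _ _ "norm v"] by (meson norm_ge_zero order_trans)
    then have "- (norm v / 2 * norm v) \<le> (grad \<psi> z - v) \<bullet> v" by linarith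
    then show ?thesis by (simp add: inner_diff_left power2_eq_square dot_square_norm)
  qed
  moreover have "\<rho> > 0" using 1(1) 2(1) by (simp add: \<rho>_def)
  ultimately have "boundary_patch \<Omega> U \<psi> x0 \<rho>"
    unfolding boundary_patch_def using ldf v 1(2) sub(1)
    by (intro conjI exI[of _ v] exI[of _ "(norm v)\<^sup>2 / 2"]) auto
  then show ?thesis ..
qed

text \<open>A profile \<open>E\<close> of the defining function, localised by a bump and extended by
  0. It is used with \<open>arctan (n s)\<close> to measure the layer and with \<open>rise n\<close>
  to build the cutoffs.\<close>

definition patch_fun :: "'a::euclidean_space set \<Rightarrow> ('a \<Rightarrow> real) \<Rightarrow> 'a \<Rightarrow> real \<Rightarrow> (real \<Rightarrow> real) \<Rightarrow> 'a \<Rightarrow> real" where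
  "patch_fun U \<psi> x0 \<rho> E x = (if x \<in> U then bump x0 \<rho> x * E (\<psi> x) else 0)"

definition patch_grad :: "'a::euclidean_space set \<Rightarrow> ('a \<Rightarrow> real) \<Rightarrow> 'a \<Rightarrow> real \<Rightarrow> (real \<Rightarrow> real) \<Rightarrow> (real \<Rightarrow> real) \<Rightarrow> 'a \<Rightarrow> 'a" where
  "patch_grad U \<psi> x0 \<rho> E E' x =
     (if x \<in> U then E (\<psi> x) *\<^sub>R bump_grad x0 \<rho> x + (bump x0 \<rho> x * E' (\<psi> x)) *\<^sub>R grad \<psi> x else 0)"

lemma patch_outside:
  assumes "boundary_patch \<Omega> U \<psi> x0 \<rho>" "x \<notin> ball x0 (2 * \<rho>)"
  shows "patch_fun U \<psi> x0 \<rho> E x = 0" "patch_grad U \<psi> x0 \<rho> E E' x = 0"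
  using assms(1) bump_outside[OF _ assms(2)] by (simp_all add: boundary_patch_def patch_fun_def patch_grad_def)

lemma patch_has_derivative:
  assumes bp: "boundary_patch \<Omega> U \<psi> x0 \<rho>" and E: "\<And>s. (E has_real_derivative E' s) (at s)"
  shows "(patch_fun U \<psi> x0 \<rho> E has_derivative (\<lambda>h. patch_grad U \<psi> x0 \<rho> E E' x \<bullet> h)) (at x)"
proof (cases "x \<in> U")
  case True
  note D = local_defining_functionD[of \<Omega> U \<psi>]
  have ldf: "local_defining_function \<Omega> U \<psi>" using bp by (simp add: boundary_patch_def)
  have "((\<lambda>x. E (\<psi> x)) has_derivative (\<lambda>h. (grad \<psi> x \<bullet> h) * E' (\<psi> x))) (at x)"
    by (rule DERIV_compose_FDERIV[OF E D(2)[OF ldf True]])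
  from has_derivative_mult[OF bump_has_derivative[of x0 \<rho> x] this]
  have "((\<lambda>x. bump x0 \<rho> x * E (\<psi> x)) has_derivative (\<lambda>h. patch_grad U \<psi> x0 \<rho> E E' x \<bullet> h)) (at x)"
    by (rule has_derivative_eq_rhs) (auto simp: patch_grad_def True inner_add_left algebra_simps)
  then show ?thesis
    by (rule has_derivative_transform_within_open[OF _ D(1)[OF ldf] True]) (auto simp: patch_fun_def)
next
  case False
  have o: "open (- cball x0 (2 * \<rho>))" "x \<in> - cball x0 (2 * \<rho>)"
    using bp False by (auto simp: boundary_patch_def)
  have "((\<lambda>x. 0) has_derivative (\<lambda>h. patch_grad U \<psi> x0 \<rho> E E' x \<bullet> h)) (at x)"
    using False by (simp add: patch_grad_def)
  then show ?thesis
    by (rule has_derivative_transform_within_open[OF _ o]) (use patch_outside(1)[OF bp, of _ E] in auto)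
qed

lemma patch_continuous:
  assumes bp: "boundary_patch \<Omega> U \<psi> x0 \<rho>"
    and E: "continuous_on UNIV E" "continuous_on UNIV E'"
  shows "continuous_on UNIV (patch_fun U \<psi> x0 \<rho> E)" "continuous_on UNIV (patch_grad U \<psi> x0 \<rho> E E')"
proof -
  have ldf: "local_defining_function \<Omega> U \<psi>" and cb: "cball x0 (2 * \<rho>) \<subseteq> U" using bp by (simp_all add: boundary_patch_def)
  note D = local_defining_functionD[OF ldf]
  have UN: "UNIV = U \<union> - cball x0 (2 * \<rho>)" using cb by auto
  have c\<psi>: "continuous_on U \<psi>" by (rule local_defining_function_continuous[OF ldf])
  have c: "continuous_on U (\<lambda>x. E (\<psi> x))" "continuous_on U (\<lambda>x. E' (\<psi> x))"
    using E by (auto intro: continuous_on_compose2[OF _ c\<psi>])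
  have "continuous_on U (patch_fun U \<psi> x0 \<rho> E)"
    by (rule continuous_on_eq[of _ "\<lambda>x. bump x0 \<rho> x * E (\<psi> x)"]) (auto intro!: continuous_intros c simp: patch_fun_def)
  moreover have "continuous_on (- cball x0 (2 * \<rho>)) (patch_fun U \<psi> x0 \<rho> E)"
    by (rule continuous_on_eq[of _ "\<lambda>x. 0"]) (use patch_outside(1)[OF bp, of _ E] in auto)
  ultimately show "continuous_on UNIV (patch_fun U \<psi> x0 \<rho> E)"
    unfolding UN using D(1) by (intro continuous_on_open_Un) auto
  have "continuous_on U (patch_grad U \<psi> x0 \<rho> E E')"
    by (rule continuous_on_eq[of _ "\<lambda>x. E (\<psi> x) *\<^sub>R bump_grad x0 \<rho> x + (bump x0 \<rho> x * E' (\<psi> x)) *\<^sub>R grad \<psi> x"])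
      (auto intro!: continuous_intros c D(3) simp: patch_grad_def)
  moreover have "continuous_on (- cball x0 (2 * \<rho>)) (patch_grad U \<psi> x0 \<rho> E E')"
    by (rule continuous_on_eq[of _ "\<lambda>x. 0"]) (use patch_outside(2)[OF bp, of _ E E'] in auto)
  ultimately show "continuous_on UNIV (patch_grad U \<psi> x0 \<rho> E E')"
    unfolding UN using D(1) by (intro continuous_on_open_Un) auto
qed

text \<open>The strip of thickness of order \<open>1 / n\<close> inside \<Omega> on which the
  profile \<open>rise n\<close> is not yet 0. The product form also makes sense for
  \<open>n = 0\<close>.\<close>

definition layer :: "('a::euclidean_space \<Rightarrow> real) \<Rightarrow> 'a \<Rightarrow> real \<Rightarrow> nat \<Rightarrow> 'a set" where
  "layer \<psi> x0 \<rho> n = {x \<in> cball x0 (2 * \<rho>). - 2 < n * \<psi> x \<and> \<psi> x < 0}"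

lemma layer_borel:
  assumes bp: "boundary_patch \<Omega> U \<psi> x0 \<rho>"
  shows "layer \<psi> x0 \<rho> n \<in> sets borel"
proof -
  have ldf: "local_defining_function \<Omega> U \<psi>" and cb: "cball x0 (2 * \<rho>) \<subseteq> U" using bp by (simp_all add: boundary_patch_def)
  have c\<psi>: "continuous_on U \<psi>" by (rule local_defining_function_continuous[OF ldf])
  have "open (U \<inter> (\<lambda>x. n * \<psi> x) -` {- 2 <..})" "open (U \<inter> \<psi> -` {..<0})"
    by (intro continuous_open_preimage continuous_intros c\<psi> local_defining_functionD(1)[OF ldf] open_greaterThan open_lessThan)+
  then have "cball x0 (2 * \<rho>) \<inter> (U \<inter> (\<lambda>x. n * \<psi> x) -` {- 2 <..}) \<inter> (U \<inter> \<psi> -` {..<0}) \<in> sets borel" by auto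
  moreover have "layer \<psi> x0 \<rho> n = cball x0 (2 * \<rho>) \<inter> (U \<inter> (\<lambda>x. n * \<psi> x) -` {- 2 <..}) \<inter> (U \<inter> \<psi> -` {..<0})"
    using cb by (auto simp: layer_def)
  ultimately show ?thesis by simp
qed

lemma integrable_bump:
  assumes "\<rho> > 0"
  shows "integrable lborel (bump x0 \<rho>)" "integrable lborel (\<lambda>x. norm (bump_grad x0 \<rho> x))"
  using assms bump_outside
  by (auto intro!: integrable_continuous_bounded_support[where S = "ball x0 (2 * \<rho>)"] continuous_intros)

text \<open>The integral of \<open>\<partial>\<^sub>v (\<theta> arctan (n \<psi>))\<close> vanishes, which bounds the mass of \<open>n \<theta> / (1 + (n \<psi>)\<^sup>2)\<close>.\<close>

lemma layer_bound:
  assumes bp: "boundary_patch \<Omega> U \<psi> x0 \<rho>"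
  shows "\<exists>C. \<forall>n. (\<integral>x. indicator (layer \<psi> x0 \<rho> n) x * (real n * bump x0 \<rho> x) \<partial>lborel) \<le> C"
proof -
  have ldf: "local_defining_function \<Omega> U \<psi>" and cb: "cball x0 (2 * \<rho>) \<subseteq> U" and \<rho>: "\<rho> > 0"
    using bp by (simp_all add: boundary_patch_def)
  obtain v c where c: "c > 0" "\<And>x. x \<in> cball x0 (2 * \<rho>) \<Longrightarrow> c \<le> grad \<psi> x \<bullet> v"
    using bp unfolding boundary_patch_def by blast
  define T where "T = (\<integral>x. norm (bump_grad x0 \<rho> x) \<partial>lborel)"
  note [measurable] = layer_borel[OF bp]
  \<comment> \<open>5 bounds \<open>1 + (n \<psi>)\<^sup>2\<close> on the layer, where
    \<open>\<bar>n \<psi>\<bar> \<le> 2\<close>; 2 bounds the arctangent; \<open>c\<close> bounds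
    the derivative of \<psi> along \<open>v\<close> from below.\<close>
  show ?thesis
  proof (intro exI[of _ "5 / c * (2 * norm v * T)"] allI)
    fix n :: nat
    define E where "E s = arctan (real n * s)" for s
    define E' where "E' s = real n / (1 + (real n * s)\<^sup>2)" for s
    have E: "(E has_real_derivative E' s) (at s)" for s
      unfolding E_def E'_def by (auto intro!: derivative_eq_intros simp: divide_inverse)
    have nz: "1 + (real n * s)\<^sup>2 \<noteq> 0" for s
      using zero_le_power2[of "real n * s"] by linarith
    have cE: "continuous_on UNIV E" "continuous_on UNIV E'"
      unfolding E_def E'_def using nz by (auto intro!: continuous_intros)
    let ?p = "patch_fun U \<psi> x0 \<rho> E" and ?g = "patch_grad U \<psi> x0 \<rho> E E'"
    note pc = patch_continuous[OF bp cE]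
    have cg: "continuous_on UNIV (\<lambda>x. ?g x \<bullet> v)" by (intro continuous_intros pc)
    have I0: "(\<integral>x. ?g x \<bullet> v \<partial>lborel) = 0"
    proof (rule integral_directional_derivative_eq_0[where S = "ball x0 (2 * \<rho>)" and v = v])
      show "((\<lambda>s. ?p (x + s *\<^sub>R v)) has_real_derivative ?g x \<bullet> v) (at 0)" for x
        by (rule has_directional_derivative[OF patch_has_derivative[OF bp E]])
    qed (use pc cg patch_outside[OF bp] in auto)
    have ig: "integrable lborel (\<lambda>x. ?g x \<bullet> v)"
      using patch_outside[OF bp] by (intro integrable_continuous_bounded_support[OF cg, of "ball x0 (2 * \<rho>)"]) auto
    let ?l = "\<lambda>x. indicator (layer \<psi> x0 \<rho> n) x * (real n * bump x0 \<rho> x)"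
    have il: "integrable lborel ?l"
    proof (rule Bochner_Integration.integrable_bound)
      show "integrable lborel (\<lambda>x. real n * bump x0 \<rho> x)" using integrable_bump(1)[OF \<rho>, of x0] by simp
      show "?l \<in> borel_measurable lborel"
        using borel_measurable_integrable[OF integrable_bump(1)[OF \<rho>, of x0]] by measurable
    qed (auto split: split_indicator)
    have pw: "c / 5 * ?l x \<le> ?g x \<bullet> v + 2 * norm v * norm (bump_grad x0 \<rho> x)" for x
    proof (cases "x \<in> ball x0 (2 * \<rho>)")
      case False
      then have "bump x0 \<rho> x = 0" "?g x = 0" using bump_outside[OF \<rho>] patch_outside[OF bp] by auto
      then show ?thesis by simp
    next
      case True
      then have xU: "x \<in> U" and xc: "x \<in> cball x0 (2 * \<rho>)" using cb by auto
      have g: "?g x \<bullet> v = E (\<psi> x) * (bump_grad x0 \<rho> x \<bullet> v) + bump x0 \<rho> x * E' (\<psi> x) * (grad \<psi> x \<bullet> v)"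
        using xU by (simp add: patch_grad_def inner_add_left)
      have "\<bar>E (\<psi> x) * (bump_grad x0 \<rho> x \<bullet> v)\<bar> \<le> 2 * (norm (bump_grad x0 \<rho> x) * norm v)"
        unfolding abs_mult
      proof (rule mult_mono)
        show "\<bar>E (\<psi> x)\<bar> \<le> 2"
          unfolding E_def using arctan_bounded[of "real n * \<psi> x"] pi_less_4 by linarith
      qed (auto simp: Cauchy_Schwarz_ineq2)
      then have 1: "- (2 * norm v * norm (bump_grad x0 \<rho> x)) \<le> E (\<psi> x) * (bump_grad x0 \<rho> x \<bullet> v)"
        by (simp add: abs_le_iff mult_ac)
      have E'nn: "E' (\<psi> x) \<ge> 0" unfolding E'_def by (simp add: add_nonneg_nonneg)
      have gv: "grad \<psi> x \<bullet> v \<ge> c" using c(2)[OF xc] .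
      have 2: "c / 5 * ?l x \<le> bump x0 \<rho> x * E' (\<psi> x) * (grad \<psi> x \<bullet> v)"
      proof (cases "x \<in> layer \<psi> x0 \<rho> n")
        case True
        then have "\<bar>real n * \<psi> x\<bar> \<le> 2" by (auto simp: layer_def abs_le_iff mult_nonneg_nonpos)
        then have "(real n * \<psi> x)\<^sup>2 \<le> 2\<^sup>2" by (rule power2_le_iff_abs_le[THEN iffD2, rotated]) simp
        then have "real n / 5 \<le> E' (\<psi> x)"
          unfolding E'_def by (intro divide_left_mono) (auto intro: add_pos_nonneg)
        then have "bump x0 \<rho> x * (real n / 5) * c \<le> bump x0 \<rho> x * E' (\<psi> x) * (grad \<psi> x \<bullet> v)"
          using gv c(1) E'nn bump_nonneg by (intro mult_mono mult_left_mono mult_nonneg_nonneg) auto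
        then show ?thesis using True by (simp add: mult_ac)
      next
        case False
        have "0 \<le> bump x0 \<rho> x * E' (\<psi> x) * (grad \<psi> x \<bullet> v)"
          using bump_nonneg E'nn gv c(1) by (intro mult_nonneg_nonneg) auto
        then show ?thesis using False by simp
      qed
      show ?thesis using 1 2 g by linarith
    qed
    have "c / 5 * (\<integral>x. ?l x \<partial>lborel) = (\<integral>x. c / 5 * ?l x \<partial>lborel)" by simp
    also have "\<dots> \<le> (\<integral>x. ?g x \<bullet> v + 2 * norm v * norm (bump_grad x0 \<rho> x) \<partial>lborel)"
      using il ig integrable_bump(2)[OF \<rho>, of x0] pw by (intro integral_mono) auto
    also have "\<dots> = 2 * norm v * T"
      using ig integrable_bump(2)[OF \<rho>, of x0] I0 by (simp add: T_def)
    finally show "(\<integral>x. ?l x \<partial>lborel) \<le> 5 / c * (2 * norm v * T)"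
      using c(1) by (simp add: field_simps)
  qed
qed


text \<open>A profile that is 0 where \<open>n s \<le> - 2\<close> and equal to 4 at
  \<open>s = 0\<close> for every \<open>n\<close>, with slope at most \<open>4 * n\<close> at
  negative arguments. The value at 0 makes the sum of the patches exceed 1 on the boundary.\<close>

definition rise :: "nat \<Rightarrow> real \<Rightarrow> real" where "rise n s = (max 0 (2 + real n * s))\<^sup>2"

definition rise' :: "nat \<Rightarrow> real \<Rightarrow> real" where "rise' n s = 2 * max 0 (2 + real n * s) * real n"

lemma rise_has_derivative: "(rise n has_real_derivative rise' n s) (at s)"
proof -
  have "((\<lambda>s. 2 + real n * s) has_real_derivative real n) (at s)" by (auto intro!: derivative_eq_intros)
  from DERIV_chain2[OF max0_square_has_derivative this] show ?thesis
    unfolding rise_def rise'_def .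
qed

lemma rise_continuous: "continuous_on UNIV (rise n)" "continuous_on UNIV (rise' n)"
  unfolding rise_def rise'_def by (intro continuous_intros)+

lemma rise_le: "s < 0 \<Longrightarrow> \<bar>rise n s\<bar> \<le> 4"
  unfolding rise_def using power_mono[of "max 0 (2 + real n * s)" 2 2] by (auto simp: max_def mult_nonneg_nonpos)

lemma rise_eventually_0:
  assumes "s < 0" shows "\<forall>\<^sub>F n in sequentially. rise n s = 0"
proof -
  obtain N :: nat where N: "2 / (- s) < real N" using reals_Archimedean2 by blast
  have "rise n s = 0" if "n \<ge> N" for n
  proof -
    have "2 / (- s) < real n" using N that by (meson less_le_trans of_nat_mono)
    then have "2 + real n * s < 0" using assms by (simp add: field_simps)
    then show ?thesis by (simp add: rise_def)
  qed
  then show ?thesis by (auto simp: eventually_sequentially)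
qed

text \<open>The product rule splits the gradient of the patch into a multiple of the bump gradient
  and a multiple of \<open>grad \<psi>\<close> whose coefficient is of order \<open>n\<close> and
  lives on the layer only. The seminorm \<open>w\<close> covers two uses: the norm itself and
  \<open>\<bar>F x \<bullet> y\<bar>\<close> as a function of \<open>y\<close>.\<close>

lemma patch_flux_bound:
  assumes bp: "boundary_patch \<Omega> U \<psi> x0 \<rho>" and x: "x \<in> \<Omega>"
    and w: "\<And>y. w y = norm (L y)" "linear L"
    and b: "w (bump_grad x0 \<rho> x) \<le> M * norm (bump_grad x0 \<rho> x)" "x \<in> layer \<psi> x0 \<rho> n \<Longrightarrow> w (grad \<psi> x) \<le> e" "e \<ge> 0"
  shows "w (patch_grad U \<psi> x0 \<rho> (rise n) (rise' n) x) \<le>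
    M * ((if x \<in> U then \<bar>rise n (\<psi> x)\<bar> else 0) * norm (bump_grad x0 \<rho> x)) +
    4 * e * (indicator (layer \<psi> x0 \<rho> n) x * (real n * bump x0 \<rho> x))"
proof (cases "x \<in> U")
  case False
  have "L 0 = 0" using w(2) by (rule linear_0)
  moreover have "0 \<le> 4 * e * (indicator (layer \<psi> x0 \<rho> n) x * (real n * bump x0 \<rho> x))"
    using b(3) bump_nonneg[of x0 \<rho> x] by (auto split: split_indicator)
  ultimately show ?thesis using False w(1) by (simp add: patch_grad_def)
next
  case True
  have ldf: "local_defining_function \<Omega> U \<psi>" and \<rho>: "\<rho> > 0"
    using bp by (simp_all add: boundary_patch_def)
  have neg: "\<psi> x < 0" using local_defining_functionD(5)[OF ldf True] x by simp
  have tri: "w (a *\<^sub>R y + b *\<^sub>R z) \<le> \<bar>a\<bar> * w y + \<bar>b\<bar> * w z" for a b y z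
    using norm_triangle_ineq[of "a *\<^sub>R L y" "b *\<^sub>R L z"]
    by (simp add: w(1) linear_add[OF w(2)] linear_cmul[OF w(2)])
  have "w (patch_grad U \<psi> x0 \<rho> (rise n) (rise' n) x) \<le>
      \<bar>rise n (\<psi> x)\<bar> * w (bump_grad x0 \<rho> x) + \<bar>bump x0 \<rho> x * rise' n (\<psi> x)\<bar> * w (grad \<psi> x)"
    using True tri by (simp add: patch_grad_def)
  also have "\<dots> \<le> \<bar>rise n (\<psi> x)\<bar> * (M * norm (bump_grad x0 \<rho> x)) +
      4 * e * (indicator (layer \<psi> x0 \<rho> n) x * (real n * bump x0 \<rho> x))"
  proof (rule add_mono)
    show "\<bar>rise n (\<psi> x)\<bar> * w (bump_grad x0 \<rho> x) \<le> \<bar>rise n (\<psi> x)\<bar> * (M * norm (bump_grad x0 \<rho> x))"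
      by (intro mult_left_mono b) auto
    show "\<bar>bump x0 \<rho> x * rise' n (\<psi> x)\<bar> * w (grad \<psi> x) \<le>
        4 * e * (indicator (layer \<psi> x0 \<rho> n) x * (real n * bump x0 \<rho> x))"
    proof (cases "x \<in> layer \<psi> x0 \<rho> n")
      case True
      have "\<bar>rise' n (\<psi> x)\<bar> \<le> 4 * real n"
        using neg mult_right_mono[of "2 * max 0 (2 + real n * \<psi> x)" 4 "real n"]
        by (auto simp: rise'_def max_def mult_nonneg_nonpos)
      then have "\<bar>bump x0 \<rho> x * rise' n (\<psi> x)\<bar> \<le> bump x0 \<rho> x * (4 * real n)"
        using bump_nonneg[of x0 \<rho> x] by (simp add: abs_mult mult_left_mono)
      then have "\<bar>bump x0 \<rho> x * rise' n (\<psi> x)\<bar> * w (grad \<psi> x) \<le> bump x0 \<rho> x * (4 * real n) * e"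
        using b(2)[OF True] w(1) bump_nonneg[of x0 \<rho> x] by (intro mult_mono) auto
      then show ?thesis using True by (simp add: mult_ac)
    next
      case False
      then have "x \<notin> ball x0 (2 * \<rho>) \<or> real n * \<psi> x \<le> - 2" using neg by (auto simp: layer_def)
      then have "bump x0 \<rho> x * rise' n (\<psi> x) = 0"
        using bump_outside(1)[OF \<rho>] by (auto simp: rise'_def max_def)
      then have "\<bar>bump x0 \<rho> x * rise' n (\<psi> x)\<bar> * w (grad \<psi> x) = 0"
        by (simp only: abs_zero mult_zero_left)
      moreover have "indicator (layer \<psi> x0 \<rho> n) x = (0::real)" using False by simp
      ultimately show ?thesis by (simp only: mult_zero_left mult_zero_right order_refl)
    qed
  qed
  finally show ?thesis using True by (simp add: mult_ac)
qed

text \<open>On the frontier \<open>grad \<psi>\<close> is a multiple of the outward normal, to which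
  \<open>F\<close> is orthogonal. The points of the closed patch with
  \<open>\<bar>F \<bullet> grad \<psi>\<bar> \<ge> e\<close> therefore form a compact set on which
  \<psi> is negative, hence bounded away from 0, and thin layers avoid it.\<close>

lemma patch_flux_small:
  fixes \<Omega> :: "'a::euclidean_space set"
  assumes bp: "boundary_patch \<Omega> U \<psi> x0 \<rho>" and op: "open \<Omega>" and F: "continuous_on (closure \<Omega>) F"
    and N: "\<And>x. x \<in> frontier \<Omega> \<Longrightarrow> F x \<bullet> outward_normal \<Omega> x = 0" and e: "e > 0"
  shows "\<forall>\<^sub>F n in sequentially. \<forall>x\<in>\<Omega> \<inter> layer \<psi> x0 \<rho> n. \<bar>F x \<bullet> grad \<psi> x\<bar> \<le> e"
proof -
  have ldf: "local_defining_function \<Omega> U \<psi>" and cb: "cball x0 (2 * \<rho>) \<subseteq> U" and \<rho>: "\<rho> > 0"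
    using bp by (simp_all add: boundary_patch_def)
  note D = local_defining_functionD[OF ldf]
  define K where "K = closure \<Omega> \<inter> cball x0 (2 * \<rho>)"
  have K: "compact K" "K \<subseteq> U" "K \<subseteq> closure \<Omega>" using cb by (auto simp: K_def)
  have c\<psi>: "continuous_on K \<psi>" using continuous_on_subset[OF local_defining_function_continuous[OF ldf] K(2)] .
  have cG: "continuous_on K (\<lambda>x. \<bar>F x \<bullet> grad \<psi> x\<bar>)"
    using continuous_on_subset[OF F K(3)] continuous_on_subset[OF D(3) K(2)] by (intro continuous_intros)
  define S where "S = {x \<in> K. \<bar>F x \<bullet> grad \<psi> x\<bar> \<ge> e}"
  have S: "compact S"
  proof -
    have "closedin (top_of_set K) (K \<inter> (\<lambda>x. \<bar>F x \<bullet> grad \<psi> x\<bar>) -` {e..})"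
      by (rule continuous_closedin_preimage[OF cG]) simp
    moreover have "S = K \<inter> (\<lambda>x. \<bar>F x \<bullet> grad \<psi> x\<bar>) -` {e..}" by (auto simp: S_def)
    ultimately show ?thesis using K(1) by (auto intro: closedin_compact)
  qed
  have neg: "\<psi> x < 0" if "x \<in> S" for x
  proof (rule ccontr)
    assume "\<not> \<psi> x < 0"
    have xK: "x \<in> K" "x \<in> U" using that K by (auto simp: S_def)
    then have "x \<notin> \<Omega>" using D(5) \<open>\<not> \<psi> x < 0\<close> by blast
    then have fr: "x \<in> frontier \<Omega>" using xK op by (auto simp: K_def frontier_def interior_open)
    have "F x \<bullet> grad \<psi> x = norm (grad \<psi> x) * (F x \<bullet> outward_normal \<Omega> x)"
      using D(4)[OF xK(2)] by (simp add: outward_normal_eq[OF ldf xK(2) fr op])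
    then show False using N[OF fr] that e by (simp add: S_def)
  qed
  obtain m where m: "m > 0" "\<And>x. x \<in> S \<Longrightarrow> \<psi> x \<le> - m"
  proof (cases "S = {}")
    case True
    then show ?thesis using that[of 1] by auto
  next
    case False
    have "continuous_on S \<psi>" using c\<psi> by (rule continuous_on_subset) (auto simp: S_def)
    then obtain y where "y \<in> S" "\<And>x. x \<in> S \<Longrightarrow> \<psi> x \<le> \<psi> y" using continuous_attains_sup[OF S False] by blast
    then show ?thesis using that[of "- \<psi> y"] neg by auto
  qed
  obtain n0 :: nat where n0: "2 / m < real n0" using reals_Archimedean2 by blast
  have "\<bar>F x \<bullet> grad \<psi> x\<bar> \<le> e" if n: "n \<ge> n0" and x: "x \<in> \<Omega> \<inter> layer \<psi> x0 \<rho> n" for n x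
  proof (rule ccontr)
    assume "\<not> \<bar>F x \<bullet> grad \<psi> x\<bar> \<le> e"
    then have "x \<in> S" using x closure_subset by (auto simp: S_def K_def layer_def)
    then have "real n * \<psi> x \<le> real n * (- m)" using m(2) by (intro mult_left_mono) auto
    moreover have "2 / m < real n" using n0 n by (meson less_le_trans of_nat_mono)
    then have "2 < real n * m" using m(1) by (simp add: field_simps)
    ultimately show False using x by (simp add: layer_def)
  qed
  then show ?thesis unfolding eventually_sequentially by blast
qed

lemma set_integrable_continuous_closure:
  fixes f :: "'a::euclidean_space \<Rightarrow> real"
  assumes "open \<Omega>" "bounded \<Omega>" "continuous_on (closure \<Omega>) f"
  shows "set_integrable lborel \<Omega> f"
proof (rule set_integrable_continuous_bounded)
  show "continuous_on \<Omega> f" using assms(3) closure_subset by (rule continuous_on_subset)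
  have "bounded (f ` closure \<Omega>)"
    using assms by (intro compact_imp_bounded compact_continuous_image) (auto simp: compact_closure)
  then show "bounded (f ` \<Omega>)" using closure_subset by (metis bounded_subset image_mono)
qed (use assms in auto)

lemma set_lebesgue_integral_finite_sum:
  fixes f :: "'i \<Rightarrow> 'a \<Rightarrow> real"
  assumes "\<And>i. i \<in> I \<Longrightarrow> set_integrable M A (f i)"
  shows "(LINT x:A|M. (\<Sum>i\<in>I. f i x)) = (\<Sum>i\<in>I. LINT x:A|M. f i x)"
  using assms unfolding set_lebesgue_integral_def set_integrable_def scaleR_sum_right
  by (rule Bochner_Integration.integral_sum)

text \<open>The layer shrinks while its weight grows like \<open>n\<close>; the product is bounded
  by \<open>C\<close>, and \<open>e\<close> measures the size of \<open>w\<close> in the normal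
  direction.\<close>

lemma patch_flux_integral:
  fixes \<Omega> :: "'a::euclidean_space set"
  assumes bp: "boundary_patch \<Omega> U \<psi> x0 \<rho>" and \<Omega>: "open \<Omega>" "bounded \<Omega>"
    and C: "\<And>n. (\<integral>x. indicator (layer \<psi> x0 \<rho> n) x * (real n * bump x0 \<rho> x) \<partial>lborel) \<le> C"
    and w: "\<And>x y. w x y = norm (L x y)" "\<And>x. linear (L x)"
    and M: "\<And>x y. x \<in> \<Omega> \<Longrightarrow> w x y \<le> M * norm y" "M \<ge> 0"
    and e: "\<And>x. x \<in> \<Omega> \<inter> layer \<psi> x0 \<rho> n \<Longrightarrow> w x (grad \<psi> x) \<le> e" "e \<ge> 0"
    and int: "set_integrable lborel \<Omega> (\<lambda>x. w x (patch_grad U \<psi> x0 \<rho> (rise n) (rise' n) x))"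
  shows "(LBINT x:\<Omega>. w x (patch_grad U \<psi> x0 \<rho> (rise n) (rise' n) x)) \<le>
    M * (LBINT x:\<Omega>. (if x \<in> U then \<bar>rise n (\<psi> x)\<bar> else 0) * norm (bump_grad x0 \<rho> x)) + 4 * e * C"
proof -
  have ldf: "local_defining_function \<Omega> U \<psi>" and \<rho>: "\<rho> > 0"
    using bp by (simp_all add: boundary_patch_def)
  note D = local_defining_functionD[OF ldf]
  note ib = integrable_bump[OF \<rho>, of x0]
  note lb [measurable] = layer_borel[OF bp]
  let ?a = "\<lambda>x. (if x \<in> U then \<bar>rise n (\<psi> x)\<bar> else 0) * norm (bump_grad x0 \<rho> x)"
  let ?l = "\<lambda>x. indicator (layer \<psi> x0 \<rho> n) x * (real n * bump x0 \<rho> x)"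
  have il: "integrable lborel ?l"
  proof (rule Bochner_Integration.integrable_bound)
    show "integrable lborel (\<lambda>x. real n * bump x0 \<rho> x)" using ib(1) by simp
    show "?l \<in> borel_measurable lborel"
      using borel_measurable_integrable[OF ib(1)] by measurable
  qed (auto split: split_indicator)
  have il': "set_integrable lborel \<Omega> ?l"
    using integrable_mult_indicator[OF _ il, of \<Omega>] \<Omega>(1) by (simp add: set_integrable_def)
  have ia: "set_integrable lborel \<Omega> ?a"
  proof (rule set_integrable_bound)
    have "set_integrable lborel \<Omega> (\<lambda>x. norm (bump_grad x0 \<rho> x))"
      using integrable_mult_indicator[OF _ ib(2), of \<Omega>] \<Omega>(1) by (simp add: set_integrable_def)
    then show "set_integrable lborel \<Omega> (\<lambda>x. 4 * norm (bump_grad x0 \<rho> x))" by simp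
    have "continuous_on U (\<lambda>x. \<bar>rise n (\<psi> x)\<bar>)"
      by (intro continuous_intros continuous_on_compose2[OF rise_continuous(1) local_defining_function_continuous[OF ldf]]) auto
    then have "(\<lambda>x. indicator U x *\<^sub>R \<bar>rise n (\<psi> x)\<bar>) \<in> borel_measurable borel"
      using D(1) by (intro borel_measurable_continuous_on_indicator) auto
    moreover have "(\<lambda>x. indicator U x *\<^sub>R \<bar>rise n (\<psi> x)\<bar>) = (\<lambda>x. if x \<in> U then \<bar>rise n (\<psi> x)\<bar> else 0)"
      by (auto simp: fun_eq_iff)
    ultimately have "(\<lambda>x. if x \<in> U then \<bar>rise n (\<psi> x)\<bar> else 0) \<in> borel_measurable borel" by simp
    then show "set_borel_measurable lborel \<Omega> ?a"
      unfolding set_borel_measurable_def using \<Omega>(1) borel_measurable_integrable[OF ib(2)]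
      by (intro borel_measurable_scaleR borel_measurable_times) auto
    have "norm (?a x) \<le> norm (4 * norm (bump_grad x0 \<rho> x))" if "x \<in> \<Omega>" for x
    proof -
      have "(if x \<in> U then \<bar>rise n (\<psi> x)\<bar> else 0) \<le> 4" using rise_le D(5)[of x] that by auto
      then have "?a x \<le> 4 * norm (bump_grad x0 \<rho> x)" by (intro mult_right_mono) auto
      then show ?thesis by auto
    qed
    then show "AE x in lborel. x \<in> \<Omega> \<longrightarrow> norm (?a x) \<le> norm (4 * norm (bump_grad x0 \<rho> x))" by blast
  qed
  have "(LBINT x:\<Omega>. w x (patch_grad U \<psi> x0 \<rho> (rise n) (rise' n) x)) \<le> (LBINT x:\<Omega>. M * ?a x + 4 * e * ?l x)"
  proof (rule set_integral_mono_on[OF int])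
    show "set_integrable lborel \<Omega> (\<lambda>x. M * ?a x + 4 * e * ?l x)"
      using ia il' by (intro set_integral_add set_integrable_mult_right) auto
    fix x assume x: "x \<in> \<Omega>"
    show "w x (patch_grad U \<psi> x0 \<rho> (rise n) (rise' n) x) \<le> M * ?a x + 4 * e * ?l x"
      by (rule patch_flux_bound[OF bp x w(1) w(2)]) (use M(1)[OF x] e x in auto)
  qed
  also have "\<dots> = M * (LBINT x:\<Omega>. ?a x) + 4 * e * (LBINT x:\<Omega>. ?l x)"
    using ia il' by (subst set_integral_add) auto
  also have "(LBINT x:\<Omega>. ?l x) \<le> C"
  proof -
    have "(LBINT x:\<Omega>. ?l x) \<le> (\<integral>x. ?l x \<partial>lborel)"
      unfolding set_lebesgue_integral_def using il il' bump_nonneg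
      by (intro integral_mono) (auto simp: set_integrable_def split: split_indicator intro!: mult_nonneg_nonneg)
    with C[of n] show ?thesis by linarith
  qed
  finally show ?thesis using e(2) by (simp add: mult_left_mono)
qed

text \<open>At a point of \<Omega> the profile vanishes once \<open>n\<close> is large, and it is at
  most 4 there for every \<open>n\<close>.\<close>

lemma patch_rise_vanishes:
  assumes bp: "boundary_patch \<Omega> U \<psi> x0 \<rho>" and \<Omega>: "open \<Omega>"
  shows "(\<lambda>n. LBINT x:\<Omega>. (if x \<in> U then \<bar>rise n (\<psi> x)\<bar> else 0) * norm (bump_grad x0 \<rho> x)) \<longlonglongrightarrow> 0"
proof -
  have ldf: "local_defining_function \<Omega> U \<psi>" and \<rho>: "\<rho> > 0"
    using bp by (simp_all add: boundary_patch_def)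
  note D = local_defining_functionD[OF ldf]
  note ib = integrable_bump[OF \<rho>, of x0]
  let ?a = "\<lambda>n x. (if x \<in> U then \<bar>rise n (\<psi> x)\<bar> else 0) * norm (bump_grad x0 \<rho> x)"
  have "(\<lambda>n. \<integral>x. indicator \<Omega> x *\<^sub>R ?a n x \<partial>lborel) \<longlonglongrightarrow> (\<integral>x. 0 \<partial>(lborel :: 'a measure))"
  proof (rule integral_dominated_convergence)
    show "integrable lborel (\<lambda>x. 4 * norm (bump_grad x0 \<rho> x))" using ib(2) by simp
    show "(\<lambda>x. indicator \<Omega> x *\<^sub>R ?a n x) \<in> borel_measurable lborel" for n
    proof -
      have "continuous_on U (\<lambda>x. \<bar>rise n (\<psi> x)\<bar>)"
        by (intro continuous_intros continuous_on_compose2[OF rise_continuous(1) local_defining_function_continuous[OF ldf]]) auto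
      then have "(\<lambda>x. indicator U x *\<^sub>R \<bar>rise n (\<psi> x)\<bar>) \<in> borel_measurable borel"
        using D(1) by (intro borel_measurable_continuous_on_indicator) auto
      moreover have "(\<lambda>x. indicator U x *\<^sub>R \<bar>rise n (\<psi> x)\<bar>) = (\<lambda>x. if x \<in> U then \<bar>rise n (\<psi> x)\<bar> else 0)"
        by (auto simp: fun_eq_iff)
      ultimately have "(\<lambda>x. if x \<in> U then \<bar>rise n (\<psi> x)\<bar> else 0) \<in> borel_measurable borel" by simp
      then show ?thesis
        using \<Omega> borel_measurable_integrable[OF ib(2)]
        by (intro borel_measurable_scaleR borel_measurable_times) auto
    qed
    show "AE x in lborel. (\<lambda>n. indicator \<Omega> x *\<^sub>R ?a n x) \<longlonglongrightarrow> 0"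
    proof (intro AE_I2 tendsto_eventually)
      fix x
      show "\<forall>\<^sub>F n in sequentially. indicator \<Omega> x *\<^sub>R ?a n x = 0"
      proof (cases "x \<in> \<Omega> \<inter> U")
        case True
        then have "\<forall>\<^sub>F n in sequentially. rise n (\<psi> x) = 0" using rise_eventually_0 D(5) by blast
        then show ?thesis by eventually_elim auto
      next
        case False
        then have "indicator \<Omega> x *\<^sub>R ?a n x = 0" for n by (auto split: split_indicator)
        then show ?thesis by simp
      qed
    qed
    show "AE x in lborel. norm (indicator \<Omega> x *\<^sub>R ?a n x) \<le> 4 * norm (bump_grad x0 \<rho> x)" for n
    proof (intro AE_I2)
      fix x
      have "(if x \<in> U then \<bar>rise n (\<psi> x)\<bar> else 0) \<le> 4" if "x \<in> \<Omega>" using rise_le D(5)[of x] that by auto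
      then have "?a n x \<le> 4 * norm (bump_grad x0 \<rho> x)" if "x \<in> \<Omega>" using that by (intro mult_right_mono) auto
      then show "norm (indicator \<Omega> x *\<^sub>R ?a n x) \<le> 4 * norm (bump_grad x0 \<rho> x)"
        by (auto split: split_indicator)
    qed
  qed auto
  then show ?thesis by (simp add: set_lebesgue_integral_def)
qed

text \<open>Both claims are instances of \<open>patch_flux_integral\<close>: with the norm, the
  normal part is merely bounded; with \<open>\<bar>F \<bullet> y\<bar>\<close> it is small on thin
  layers.\<close>

lemma patch_flux:
  fixes \<Omega> :: "'a::euclidean_space set"
  assumes bp: "boundary_patch \<Omega> U \<psi> x0 \<rho>" and \<Omega>: "open \<Omega>" "bounded \<Omega>"
  shows "\<exists>C. \<forall>n. (LBINT x:\<Omega>. norm (patch_grad U \<psi> x0 \<rho> (rise n) (rise' n) x)) \<le> C"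
    and "\<And>F. continuous_on (closure \<Omega>) F \<Longrightarrow> (\<And>x. x \<in> frontier \<Omega> \<Longrightarrow> F x \<bullet> outward_normal \<Omega> x = 0) \<Longrightarrow>
      (\<lambda>n. LBINT x:\<Omega>. \<bar>F x \<bullet> patch_grad U \<psi> x0 \<rho> (rise n) (rise' n) x\<bar>) \<longlonglongrightarrow> 0"
proof -
  have ldf: "local_defining_function \<Omega> U \<psi>" and \<rho>: "\<rho> > 0" and cb: "cball x0 (2 * \<rho>) \<subseteq> U"
    using bp by (simp_all add: boundary_patch_def)
  note D = local_defining_functionD[OF ldf]
  let ?p = "\<lambda>n. patch_grad U \<psi> x0 \<rho> (rise n) (rise' n)"
  let ?a = "\<lambda>n. LBINT x:\<Omega>. (if x \<in> U then \<bar>rise n (\<psi> x)\<bar> else 0) * norm (bump_grad x0 \<rho> x)"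
  obtain C0 where C0: "\<And>n. (\<integral>x. indicator (layer \<psi> x0 \<rho> n) x * (real n * bump x0 \<rho> x) \<partial>lborel) \<le> C0"
    using layer_bound[OF bp] by blast
  define C where "C = max C0 1"
  have C: "(\<integral>x. indicator (layer \<psi> x0 \<rho> n) x * (real n * bump x0 \<rho> x) \<partial>lborel) \<le> C" "C > 0" for n
    using C0[of n] by (auto simp: C_def)
  have cp: "continuous_on S (?p n)" for S n
    using patch_continuous(2)[OF bp rise_continuous] by (rule continuous_on_subset) auto
  have lim: "?a \<longlonglongrightarrow> 0" by (rule patch_rise_vanishes[OF bp \<Omega>(1)])
  show "\<exists>C. \<forall>n. (LBINT x:\<Omega>. norm (?p n x)) \<le> C"
  proof -
    have "bounded (grad \<psi> ` cball x0 (2 * \<rho>))"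
      using continuous_on_subset[OF D(3) cb] by (intro compact_imp_bounded compact_continuous_image) auto
    then obtain G where G: "\<And>x. x \<in> cball x0 (2 * \<rho>) \<Longrightarrow> norm (grad \<psi> x) \<le> G"
      unfolding bounded_iff by blast
    have G0: "G \<ge> 0" using order_trans[OF norm_ge_zero G[of x0]] \<rho> by simp
    obtain A where A: "\<And>n. ?a n \<le> A"
      using lim[THEN convergentI, THEN convergent_imp_Bseq] unfolding Bseq_def by (metis abs_le_D1 real_norm_def)
    have "(LBINT x:\<Omega>. norm (?p n x)) \<le> 1 * ?a n + 4 * G * C" for n
    proof (rule patch_flux_integral[OF bp \<Omega> C(1), where L = "\<lambda>_ y. y"])
      show "norm (grad \<psi> x) \<le> G" if "x \<in> \<Omega> \<inter> layer \<psi> x0 \<rho> n" for x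
        using that G by (auto simp: layer_def)
      show "set_integrable lborel \<Omega> (\<lambda>x. norm (?p n x))"
        by (intro set_integrable_continuous_closure \<Omega> continuous_intros cp)
    qed (use G0 bounded_linear.linear[OF bounded_linear_ident] in auto)
    then show ?thesis using A by (intro exI[of _ "A + 4 * G * C"] allI) (smt (verit, best))
  qed
  show "(\<lambda>n. LBINT x:\<Omega>. \<bar>F x \<bullet> ?p n x\<bar>) \<longlonglongrightarrow> 0"
    if F: "continuous_on (closure \<Omega>) F" and N: "\<And>x. x \<in> frontier \<Omega> \<Longrightarrow> F x \<bullet> outward_normal \<Omega> x = 0" for F
  proof (rule LIMSEQ_I)
    fix r :: real assume r: "0 < r"
    have "bounded (F ` closure \<Omega>)"
      using F \<Omega> by (intro compact_imp_bounded compact_continuous_image) (auto simp: compact_closure)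
    then obtain M0 where M0: "\<And>x. x \<in> closure \<Omega> \<Longrightarrow> norm (F x) \<le> M0" unfolding bounded_iff by blast
    define M where "M = max M0 1"
    have M: "M > 0" "norm (F x) \<le> M" if "x \<in> \<Omega>" for x
      using M0[of x] that closure_subset[of \<Omega>] by (auto simp: M_def)
    have Mp: "M > 0" by (simp add: M_def)
    \<comment> \<open>The layer then contributes at most \<open>4 * e * C = r / 2\<close>, and the
      bump part less than \<open>r / 2\<close>.\<close>
    define e where "e = r / (8 * C)"
    have e: "e > 0" using r C(2) by (simp add: e_def)
    have ev1: "\<forall>\<^sub>F n in sequentially. \<forall>x\<in>\<Omega> \<inter> layer \<psi> x0 \<rho> n. \<bar>F x \<bullet> grad \<psi> x\<bar> \<le> e"
      by (rule patch_flux_small[OF bp \<Omega>(1) F N e])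
    have ev2: "\<forall>\<^sub>F n in sequentially. ?a n < r / (2 * M)"
      using order_tendstoD(2)[OF lim, of "r / (2 * M)"] r Mp by simp
    have "\<forall>\<^sub>F n in sequentially. norm ((LBINT x:\<Omega>. \<bar>F x \<bullet> ?p n x\<bar>) - 0) < r"
      using ev1 ev2
    proof eventually_elim
      case (elim n)
      have "(LBINT x:\<Omega>. \<bar>F x \<bullet> ?p n x\<bar>) \<le> M * ?a n + 4 * e * C"
      proof (rule patch_flux_integral[OF bp \<Omega> C(1), where L = "\<lambda>x y. F x \<bullet> y"])
        show "linear (\<lambda>y. F x \<bullet> y)" for x by (simp add: bounded_linear.linear bounded_linear_inner_right)
        show "\<bar>F x \<bullet> y\<bar> \<le> M * norm y" if "x \<in> \<Omega>" for x y
          using Cauchy_Schwarz_ineq2[of "F x" y] mult_right_mono[OF M(2)[OF that], of "norm y"] by simp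
        show "set_integrable lborel \<Omega> (\<lambda>x. \<bar>F x \<bullet> ?p n x\<bar>)"
          by (intro set_integrable_continuous_closure \<Omega> continuous_intros cp F)
      qed (use Mp e elim(1) in auto)
      also have "\<dots> < M * (r / (2 * M)) + 4 * e * C"
        using elim(2) Mp by (intro add_strict_right_mono mult_strict_left_mono)
      also have "\<dots> = r" using Mp C(2) by (simp add: e_def)
      finally have "(LBINT x:\<Omega>. \<bar>F x \<bullet> ?p n x\<bar>) < r" .
      moreover have "0 \<le> (LBINT x:\<Omega>. \<bar>F x \<bullet> ?p n x\<bar>)"
        by (simp add: set_lebesgue_integral_def)
      ultimately show ?case by simp
    qed
    then show "\<exists>no. \<forall>n\<ge>no. norm ((LBINT x:\<Omega>. \<bar>F x \<bullet> ?p n x\<bar>) - 0) < r"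
      by (simp add: eventually_sequentially)
  qed
qed

text \<open>The gradients cannot stay bounded in the sup norm, because \<open>\<kappa> n\<close>
  climbs from 0 to nearly 1 in a layer of vanishing thickness; only their \<open>L\<^sup>1\<close>
  norm does. The last clause says that a tangential field has no flux through the boundary.\<close>

definition boundary_cutoffs :: "'a::euclidean_space set \<Rightarrow> (nat \<Rightarrow> 'a \<Rightarrow> real) \<Rightarrow> (nat \<Rightarrow> 'a \<Rightarrow> 'a) \<Rightarrow> bool" where
  "boundary_cutoffs \<Omega> \<kappa> \<kappa>' \<longleftrightarrow>
     (\<forall>n x. (\<kappa> n has_derivative (\<lambda>h. \<kappa>' n x \<bullet> h)) (at x)) \<and>
     (\<forall>n. continuous_on UNIV (\<kappa>' n)) \<and>
     (\<forall>n. \<exists>K. compact K \<and> K \<subseteq> \<Omega> \<and> (\<forall>x\<in>\<Omega> - K. \<kappa> n x = 0 \<and> \<kappa>' n x = 0)) \<and>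
     (\<forall>n x. 0 \<le> \<kappa> n x \<and> \<kappa> n x \<le> 1) \<and>
     (\<forall>x\<in>\<Omega>. (\<lambda>n. \<kappa> n x) \<longlonglongrightarrow> 1) \<and>
     (\<exists>C. \<forall>n. (LBINT x:\<Omega>. norm (\<kappa>' n x)) \<le> C) \<and>
     (\<forall>F. continuous_on (closure \<Omega>) F \<longrightarrow> (\<forall>x\<in>frontier \<Omega>. F x \<bullet> outward_normal \<Omega> x = 0) \<longrightarrow>
        (\<lambda>n. LBINT x:\<Omega>. \<bar>F x \<bullet> \<kappa>' n x\<bar>) \<longlonglongrightarrow> 0)"

text \<open>Finitely many patches cover the frontier. The sum \<open>b n\<close> of their functions
  exceeds 1 there and tends to 0 inside \<Omega>, so the squared positive part of
  \<open>1 - b n\<close> vanishes near the frontier and tends to 1 inside.\<close>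

lemma boundary_cutoffs_exist:
  fixes \<Omega> :: "'a::euclidean_space set"
  assumes dom: "smooth_bounded_domain \<Omega>"
  shows "\<exists>\<kappa> \<kappa>'. boundary_cutoffs \<Omega> \<kappa> \<kappa>'"
proof -
  have \<Omega>: "open \<Omega>" "bounded \<Omega>" using dom by (auto simp: smooth_bounded_domain_def)
  have "\<exists>U \<psi> \<rho>. boundary_patch \<Omega> U \<psi> x \<rho>" if x: "x \<in> frontier \<Omega>" for x
    using dom x boundary_patch_exists unfolding smooth_bounded_domain_def smooth_boundary_def by metis
  then obtain U \<psi> \<rho> where bp: "\<And>x. x \<in> frontier \<Omega> \<Longrightarrow> boundary_patch \<Omega> (U x) (\<psi> x) x (\<rho> x)" by metis
  have \<rho>: "\<rho> x > 0" if "x \<in> frontier \<Omega>" for x using bp[OF that] by (simp add: boundary_patch_def)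
  have "compact (frontier \<Omega>)" using \<Omega>(2) by (rule compact_frontier_bounded)
  moreover have "frontier \<Omega> \<subseteq> (\<Union>x\<in>frontier \<Omega>. ball x (\<rho> x))" using \<rho> by force
  ultimately obtain P where P: "P \<subseteq> frontier \<Omega>" "finite P" "frontier \<Omega> \<subseteq> (\<Union>x\<in>P. ball x (\<rho> x))"
    using compactE_image[of "frontier \<Omega>" "frontier \<Omega>" "\<lambda>x. ball x (\<rho> x)"] by (metis open_ball)
  have bpP: "boundary_patch \<Omega> (U j) (\<psi> j) j (\<rho> j)" if "j \<in> P" for j using that P(1) bp by blast
  define f where "f j n = patch_fun (U j) (\<psi> j) j (\<rho> j) (rise n)" for j n
  define f' where "f' j n = patch_grad (U j) (\<psi> j) j (\<rho> j) (rise n) (rise' n)" for j n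
  define b where "b n x = (\<Sum>j\<in>P. f j n x)" for n x
  define b' where "b' n x = (\<Sum>j\<in>P. f' j n x)" for n x
  define \<kappa> where "\<kappa> n x = (max 0 (1 - b n x))\<^sup>2" for n x
  define \<kappa>' where "\<kappa>' n x = (- 2 * max 0 (1 - b n x)) *\<^sub>R b' n x" for n x
  have fnn: "f j n x \<ge> 0" for j n x
    using bump_nonneg by (auto simp: f_def patch_fun_def rise_def intro!: mult_nonneg_nonneg)
  have bnn: "b n x \<ge> 0" for n x unfolding b_def using fnn by (intro sum_nonneg)
  have cf: "continuous_on S (f j n)" "continuous_on S (f' j n)" if "j \<in> P" for S j n
    using patch_continuous[OF bpP[OF that] rise_continuous] continuous_on_subset unfolding f_def f'_def by blast+
  have cb: "continuous_on S (b n)" "continuous_on S (b' n)" for S n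
    unfolding b_def b'_def by (intro continuous_intros cf; assumption)+
  have c\<kappa>': "continuous_on S (\<kappa>' n)" for S n
    unfolding \<kappa>'_def by (intro continuous_intros cb)
  have db: "(b n has_derivative (\<lambda>h. b' n x \<bullet> h)) (at x)" for n x
  proof -
    have "(f j n has_derivative (\<lambda>h. f' j n x \<bullet> h)) (at x)" if "j \<in> P" for j
      unfolding f_def f'_def by (rule patch_has_derivative[OF bpP[OF that] rise_has_derivative])
    then have "((\<lambda>x. \<Sum>j\<in>P. f j n x) has_derivative (\<lambda>h. \<Sum>j\<in>P. f' j n x \<bullet> h)) (at x)"
      by (rule has_derivative_sum)
    then show ?thesis unfolding b_def b'_def by (simp add: inner_sum_left)
  qed
  have d\<kappa>: "(\<kappa> n has_derivative (\<lambda>h. \<kappa>' n x \<bullet> h)) (at x)" for n x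
  proof -
    have "((\<lambda>x. 1 - b n x) has_derivative (\<lambda>h. - (b' n x \<bullet> h))) (at x)"
      using db[of n x] by (auto intro!: derivative_eq_intros)
    from DERIV_compose_FDERIV[OF max0_square_has_derivative this] show ?thesis
      unfolding \<kappa>_def \<kappa>'_def by (simp add: mult_ac)
  qed
  \<comment> \<open>On its inner ball the bump is at least 1, and the profile has the value 4 at
    \<psi> = 0.\<close>
  have bfr: "b n x > 1" if x: "x \<in> frontier \<Omega>" for n x
  proof -
    obtain j where j: "j \<in> P" "x \<in> ball j (\<rho> j)" using P(3) x by blast
    have ldf: "local_defining_function \<Omega> (U j) (\<psi> j)" and sub: "cball j (2 * \<rho> j) \<subseteq> U j" and r: "\<rho> j > 0"
      using bpP[OF j(1)] by (simp_all add: boundary_patch_def)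
    have xU: "x \<in> U j" using j(2) r by (intro subsetD[OF sub]) auto
    have "f j n x = bump j (\<rho> j) x * 4"
      using local_defining_function_frontier[OF ldf xU x \<Omega>(1)] xU by (simp add: f_def patch_fun_def rise_def)
    then have "f j n x > 1" using bump_ge_1[OF r j(2)] by simp
    also have "f j n x \<le> b n x" unfolding b_def using fnn P(2) j(1) by (intro member_le_sum) auto
    finally show ?thesis .
  qed
  show ?thesis
  proof (intro exI[of _ \<kappa>] exI[of _ \<kappa>'], unfold boundary_cutoffs_def, intro conjI allI ballI impI)
    show "(\<kappa> n has_derivative (\<lambda>h. \<kappa>' n x \<bullet> h)) (at x)" for n x by (rule d\<kappa>)
    show "continuous_on UNIV (\<kappa>' n)" for n by (rule c\<kappa>')
    \<comment> \<open>The set where \<open>b n \<le> 1\<close> in the closure: closed and bounded,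
      and inside \<Omega> because \<open>b n > 1\<close> on the frontier.\<close>
    show "\<exists>K. compact K \<and> K \<subseteq> \<Omega> \<and> (\<forall>x\<in>\<Omega> - K. \<kappa> n x = 0 \<and> \<kappa>' n x = 0)" for n
    proof (intro exI[of _ "closure \<Omega> \<inter> b n -` {..1}"] conjI ballI)
      have "closed (b n -` {..1})" by (rule continuous_closed_vimage) (use cb(1)[of UNIV n] in \<open>auto simp: continuous_on_eq_continuous_at\<close>)
      then show "compact (closure \<Omega> \<inter> b n -` {..1})"
        using \<Omega>(2) by (intro compact_Int_closed) (auto simp: compact_closure)
      show "closure \<Omega> \<inter> b n -` {..1} \<subseteq> \<Omega>"
        using bfr[of _ n] \<Omega>(1) by (force simp: frontier_def interior_open)
      fix x assume "x \<in> \<Omega> - (closure \<Omega> \<inter> b n -` {..1})"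
      then have "b n x > 1" using closure_subset[of \<Omega>] by auto
      then show "\<kappa> n x = 0" "\<kappa>' n x = 0" by (simp_all add: \<kappa>_def \<kappa>'_def)
    qed
    show "0 \<le> \<kappa> n x" for n x by (simp add: \<kappa>_def)
    show "\<kappa> n x \<le> 1" for n x
      unfolding \<kappa>_def using bnn[of n x] power_mono[of "max 0 (1 - b n x)" 1 2] by simp
    show "(\<lambda>n. \<kappa> n x) \<longlonglongrightarrow> 1" if x: "x \<in> \<Omega>" for x
    proof (rule tendsto_eventually)
      have "\<forall>j\<in>P. \<forall>\<^sub>F n in sequentially. f j n x = 0"
      proof
        fix j assume j: "j \<in> P"
        have ldf: "local_defining_function \<Omega> (U j) (\<psi> j)" using bpP[OF j] by (simp add: boundary_patch_def)
        show "\<forall>\<^sub>F n in sequentially. f j n x = 0"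
        proof (cases "x \<in> U j")
          case True
          then have "\<psi> j x < 0" using local_defining_functionD(5)[OF ldf True] x by simp
          from rise_eventually_0[OF this] show ?thesis by eventually_elim (simp add: f_def patch_fun_def)
        qed (simp add: f_def patch_fun_def)
      qed
      then have "\<forall>\<^sub>F n in sequentially. \<forall>j\<in>P. f j n x = 0" using P(2) by (simp add: eventually_ball_finite)
      then show "\<forall>\<^sub>F n in sequentially. \<kappa> n x = 1"
        by eventually_elim (simp add: \<kappa>_def b_def)
    qed
    have fac: "\<bar>- 2 * max 0 (1 - b n x)\<bar> \<le> 2" for n x using bnn[of n x] by auto
    have i1: "set_integrable lborel \<Omega> (\<lambda>x. norm (f' j n x))" if "j \<in> P" for j n
      by (intro set_integrable_continuous_closure \<Omega> continuous_intros cf that)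
    show "\<exists>C. \<forall>n. (LBINT x:\<Omega>. norm (\<kappa>' n x)) \<le> C"
    proof -
      obtain C where C: "\<And>j n. j \<in> P \<Longrightarrow> (LBINT x:\<Omega>. norm (f' j n x)) \<le> C j"
        using patch_flux(1)[OF bpP \<Omega>] unfolding f'_def by metis
      have "(LBINT x:\<Omega>. norm (\<kappa>' n x)) \<le> 2 * (\<Sum>j\<in>P. C j)" for n
      proof -
        have "(LBINT x:\<Omega>. norm (\<kappa>' n x)) \<le> (LBINT x:\<Omega>. 2 * (\<Sum>j\<in>P. norm (f' j n x)))"
        proof (rule set_integral_mono_on)
          show "set_integrable lborel \<Omega> (\<lambda>x. norm (\<kappa>' n x))"
            by (intro set_integrable_continuous_closure \<Omega> continuous_intros c\<kappa>')
          show "set_integrable lborel \<Omega> (\<lambda>x. 2 * (\<Sum>j\<in>P. norm (f' j n x)))"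
            by (intro set_integrable_continuous_closure \<Omega> continuous_intros cf)
          fix x
          have "norm (\<kappa>' n x) \<le> 2 * norm (b' n x)"
            unfolding \<kappa>'_def norm_scaleR using fac by (intro mult_right_mono) auto
          also have "norm (b' n x) \<le> (\<Sum>j\<in>P. norm (f' j n x))" unfolding b'_def by (rule norm_sum)
          finally show "norm (\<kappa>' n x) \<le> 2 * (\<Sum>j\<in>P. norm (f' j n x))" by simp
        qed
        also have "\<dots> = 2 * (\<Sum>j\<in>P. LBINT x:\<Omega>. norm (f' j n x))"
          using i1 by (simp add: set_lebesgue_integral_finite_sum)
        also have "\<dots> \<le> 2 * (\<Sum>j\<in>P. C j)" using C by (intro mult_left_mono sum_mono) auto
        finally show ?thesis .
      qed
      then show ?thesis by blast
    qed
    fix F :: "'a \<Rightarrow> 'a" assume F: "continuous_on (closure \<Omega>) F" and N: "\<forall>x\<in>frontier \<Omega>. F x \<bullet> outward_normal \<Omega> x = 0"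
    have i2: "set_integrable lborel \<Omega> (\<lambda>x. \<bar>F x \<bullet> f' j n x\<bar>)" if "j \<in> P" for j n
      by (intro set_integrable_continuous_closure \<Omega> continuous_intros cf that F)
    have le: "(LBINT x:\<Omega>. \<bar>F x \<bullet> \<kappa>' n x\<bar>) \<le> 2 * (\<Sum>j\<in>P. LBINT x:\<Omega>. \<bar>F x \<bullet> f' j n x\<bar>)" for n
    proof -
      have "(LBINT x:\<Omega>. \<bar>F x \<bullet> \<kappa>' n x\<bar>) \<le> (LBINT x:\<Omega>. 2 * (\<Sum>j\<in>P. \<bar>F x \<bullet> f' j n x\<bar>))"
      proof (rule set_integral_mono_on)
        show "set_integrable lborel \<Omega> (\<lambda>x. \<bar>F x \<bullet> \<kappa>' n x\<bar>)"
          by (intro set_integrable_continuous_closure \<Omega> continuous_intros c\<kappa>' F)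
        show "set_integrable lborel \<Omega> (\<lambda>x. 2 * (\<Sum>j\<in>P. \<bar>F x \<bullet> f' j n x\<bar>))"
          by (intro set_integrable_continuous_closure \<Omega> continuous_intros cf F)
        fix x
        have "\<bar>F x \<bullet> \<kappa>' n x\<bar> \<le> 2 * \<bar>F x \<bullet> b' n x\<bar>"
          unfolding \<kappa>'_def inner_scaleR_right abs_mult using fac by (intro mult_right_mono) (auto simp: abs_mult)
        also have "\<bar>F x \<bullet> b' n x\<bar> \<le> (\<Sum>j\<in>P. \<bar>F x \<bullet> f' j n x\<bar>)" unfolding b'_def inner_sum_right by (rule sum_abs)
        finally show "\<bar>F x \<bullet> \<kappa>' n x\<bar> \<le> 2 * (\<Sum>j\<in>P. \<bar>F x \<bullet> f' j n x\<bar>)" by simp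
      qed
      also have "\<dots> = 2 * (\<Sum>j\<in>P. LBINT x:\<Omega>. \<bar>F x \<bullet> f' j n x\<bar>)"
        using i2 by (simp add: set_lebesgue_integral_finite_sum)
      finally show ?thesis .
    qed
    have "(\<lambda>n. LBINT x:\<Omega>. \<bar>F x \<bullet> f' j n x\<bar>) \<longlonglongrightarrow> 0" if "j \<in> P" for j
      unfolding f'_def by (rule patch_flux(2)[OF bpP[OF that] \<Omega> F]) (use N in auto)
    then have "(\<lambda>n. 2 * (\<Sum>j\<in>P. LBINT x:\<Omega>. \<bar>F x \<bullet> f' j n x\<bar>)) \<longlonglongrightarrow> 2 * (\<Sum>j\<in>P. 0)"
      by (intro tendsto_intros)
    then have "(\<lambda>n. 2 * (\<Sum>j\<in>P. LBINT x:\<Omega>. \<bar>F x \<bullet> f' j n x\<bar>)) \<longlonglongrightarrow> 0" by simp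
    then show "(\<lambda>n. LBINT x:\<Omega>. \<bar>F x \<bullet> \<kappa>' n x\<bar>) \<longlonglongrightarrow> 0"
    proof (rule tendsto_sandwich[rotated 3])
      show "\<forall>\<^sub>F n in sequentially. 0 \<le> (LBINT x:\<Omega>. \<bar>F x \<bullet> \<kappa>' n x\<bar>)" by (simp add: set_lebesgue_integral_def)
    qed (use le in auto)
  qed
qed

section \<open>Integration by parts in the limit of the cutoffs\<close>

text \<open>Dominated convergence along sequences: a convergent sequence together with its limit is
  a compact set of parameters, on whose product with the closure \<open>v\<close> is bounded. The
  parameter set \<open>T\<close> itself may be open and unbounded.\<close>

lemma continuous_on_set_integral_param:
  fixes v :: "'b::heine_borel \<Rightarrow> 'a::euclidean_space \<Rightarrow> real"
  assumes \<Omega>: "open \<Omega>" "bounded \<Omega>" and v: "continuous_on (T \<times> closure \<Omega>) (\<lambda>(t, x). v t x)"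
  shows "continuous_on T (\<lambda>t. LBINT x:\<Omega>. v t x)"
  unfolding continuous_on_sequentially
proof (intro allI ballI impI, elim conjE)
  fix s :: "nat \<Rightarrow> 'b" and a assume a: "a \<in> T" and s: "\<forall>n. s n \<in> T" "s \<longlonglongrightarrow> a"
  define S where "S = insert a (range s)"
  have S: "compact S" "S \<subseteq> T" using compact_sequence_with_limit[OF s(2)] a s(1) by (auto simp: S_def)
  have "continuous_on (S \<times> closure \<Omega>) (\<lambda>(t, x). v t x)"
    by (rule continuous_on_subset[OF v]) (use S in auto)
  then have "bounded ((\<lambda>(t, x). v t x) ` (S \<times> closure \<Omega>))"
    using S(1) \<Omega>(2) by (intro compact_imp_bounded compact_continuous_image compact_Times) (auto simp: compact_closure)
  then obtain M where M: "\<And>t x. t \<in> S \<Longrightarrow> x \<in> closure \<Omega> \<Longrightarrow> \<bar>v t x\<bar> \<le> M" by (force simp: bounded_iff)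
  have cl: "x \<in> closure \<Omega>" if "x \<in> \<Omega>" for x using that closure_subset by blast
  have cv: "continuous_on \<Omega> (v t)" if "t \<in> T" for t
    using that cl by (intro continuous_on_compose2[OF v, where f = "\<lambda>x. (t, x)", simplified]) (auto intro!: continuous_intros)
  have "(\<lambda>n. \<integral>x. indicator \<Omega> x *\<^sub>R v (s n) x \<partial>lborel) \<longlonglongrightarrow> (\<integral>x. indicator \<Omega> x *\<^sub>R v a x \<partial>lborel)"
  proof (rule integral_dominated_convergence)
    show "(\<lambda>x. indicator \<Omega> x *\<^sub>R v a x) \<in> borel_measurable lborel" "(\<lambda>x. indicator \<Omega> x *\<^sub>R v (s n) x) \<in> borel_measurable lborel" for n
      using borel_measurable_continuous_on_indicator[OF _ cv] \<Omega>(1) a s(1) by auto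
    show "integrable lborel (\<lambda>x. indicator \<Omega> x *\<^sub>R M)"
      using \<Omega> emeasure_bounded_finite[OF \<Omega>(2)] by (intro integrable_scaleR_left integrable_real_indicator) auto
    show "AE x in lborel. (\<lambda>n. indicator \<Omega> x *\<^sub>R v (s n) x) \<longlonglongrightarrow> indicator \<Omega> x *\<^sub>R v a x"
    proof (intro AE_I2)
      fix x
      show "(\<lambda>n. indicator \<Omega> x *\<^sub>R v (s n) x) \<longlonglongrightarrow> indicator \<Omega> x *\<^sub>R v a x"
      proof (cases "x \<in> \<Omega>")
        case True
        have "continuous_on T (\<lambda>t. v t x)"
          using cl[OF True] by (intro continuous_on_compose2[OF v, where f = "\<lambda>t. (t, x)", simplified]) (auto intro!: continuous_intros)
        then have "(\<lambda>n. v (s n) x) \<longlonglongrightarrow> v a x"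
          using a s unfolding continuous_on_sequentially by (auto simp: o_def)
        then show ?thesis by (intro tendsto_intros)
      qed simp
    qed
    show "AE x in lborel. norm (indicator \<Omega> x *\<^sub>R v (s n) x) \<le> indicator \<Omega> x *\<^sub>R M" for n
      using M cl by (intro AE_I2) (auto simp: S_def split: split_indicator)
  qed
  then show "((\<lambda>t. LBINT x:\<Omega>. v t x) \<circ> s) \<longlonglongrightarrow> (LBINT x:\<Omega>. v a x)"
    by (simp add: set_lebesgue_integral_def o_def)
qed

lemma continuous_on_extend_by_0:
  fixes f :: "'a::euclidean_space \<Rightarrow> real"
  assumes "open \<Omega>" "compact K" "K \<subseteq> \<Omega>" "continuous_on \<Omega> f" "\<And>x. x \<in> \<Omega> - K \<Longrightarrow> f x = 0"
  shows "continuous_on UNIV (\<lambda>x. if x \<in> \<Omega> then f x else 0)"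
proof -
  have "continuous_on \<Omega> (\<lambda>x. if x \<in> \<Omega> then f x else 0)"
    by (rule continuous_on_eq[OF assms(4)]) auto
  moreover have "continuous_on (- K) (\<lambda>x. if x \<in> \<Omega> then f x else 0)"
    by (rule continuous_on_eq[of _ "\<lambda>_. 0"]) (use assms(5) in auto)
  moreover have "UNIV = \<Omega> \<union> - K" using assms(3) by auto
  ultimately show ?thesis
    using assms(1,2) by (metis compact_imp_closed continuous_on_open_Un open_Compl)
qed

lemma set_integrable_compact_support:
  fixes f :: "'a::euclidean_space \<Rightarrow> real"
  assumes "open \<Omega>" "compact K" "K \<subseteq> \<Omega>" "continuous_on \<Omega> f" "\<And>x. x \<in> \<Omega> - K \<Longrightarrow> f x = 0"
  shows "set_integrable lborel \<Omega> f"
proof -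
  have "integrable lborel (\<lambda>x. if x \<in> \<Omega> then f x else 0)"
    by (rule integrable_continuous_bounded_support[where S = K])
      (use continuous_on_extend_by_0[OF assms] assms compact_imp_bounded in auto)
  moreover have "(\<lambda>x. if x \<in> \<Omega> then f x else 0) = (\<lambda>x. indicator \<Omega> x *\<^sub>R f x)"
    by (auto split: split_indicator)
  ultimately show ?thesis by (simp add: set_integrable_def)
qed

text \<open>Each product \<open>k * w * (F \<bullet> b)\<close> extends by 0 to a function with
  compact support, so its derivative along \<open>b\<close> integrates to 0; the sum over the basis
  is the divergence of \<open>k w F\<close>. Thanks to the support, the derivatives of
  \<open>F\<close> enter only on a compact subset of \<Omega>.\<close>

lemma cutoff_integration_by_parts:
  fixes \<Omega> :: "'a::euclidean_space set" and F :: "'a \<Rightarrow> 'a"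
  assumes \<Omega>: "open \<Omega>" and K: "compact K" "K \<subseteq> \<Omega>" "\<And>x. x \<in> \<Omega> - K \<Longrightarrow> k x = 0 \<and> k' x = 0"
    and k: "\<And>x. (k has_derivative (\<lambda>h. k' x \<bullet> h)) (at x)" "continuous_on UNIV k'"
    and w: "\<And>x. x \<in> \<Omega> \<Longrightarrow> (w has_derivative (\<lambda>h. w' x \<bullet> h)) (at x)" "continuous_on \<Omega> w'"
    and F: "\<And>x. x \<in> \<Omega> \<Longrightarrow> F differentiable (at x)" "\<And>b. b \<in> Basis \<Longrightarrow> continuous_on \<Omega> (\<lambda>x. frechet_derivative F (at x) b)"
  shows "(LBINT x:\<Omega>. k x * (w x * divergence F x)) =
    - (LBINT x:\<Omega>. k x * (w' x \<bullet> F x)) - (LBINT x:\<Omega>. w x * (F x \<bullet> k' x))"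
proof -
  have ck: "continuous_on \<Omega> k"
    by (intro continuous_at_imp_continuous_on ballI has_derivative_continuous[OF k(1)])
  have ck': "continuous_on \<Omega> k'" using k(2) by (rule continuous_on_subset) simp
  have cw: "continuous_on \<Omega> w"
    by (intro continuous_at_imp_continuous_on ballI has_derivative_continuous[OF w(1)])
  have cF: "continuous_on \<Omega> F"
    by (intro continuous_at_imp_continuous_on ballI differentiable_imp_continuous_within F(1))
  have cdiv: "continuous_on \<Omega> (divergence F)"
    unfolding divergence_def by (intro continuous_intros F(2))
  define q where "q b x = (k' x \<bullet> b) * (w x * (F x \<bullet> b)) + k x * ((w' x \<bullet> b) * (F x \<bullet> b)) + k x * (w x * (frechet_derivative F (at x) b \<bullet> b))" for b x
  have cq: "continuous_on \<Omega> (q b)" if "b \<in> Basis" for b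
    unfolding q_def by (intro continuous_intros ck ck' cw w(2) cF F(2) that)
  have q0: "q b x = 0" if "x \<in> \<Omega> - K" for b x using K(3)[OF that] by (simp add: q_def)
  have "(LBINT x:\<Omega>. q b x) = 0" if b: "b \<in> Basis" for b
  proof -
    define p where "p x = (if x \<in> \<Omega> then k x * (w x * (F x \<bullet> b)) else 0)" for x
    define qq where "qq x = (if x \<in> \<Omega> then q b x else 0)" for x
    have "(\<integral>x. qq x \<partial>lborel) = 0"
    proof (rule integral_directional_derivative_eq_0[where p = p and v = b and S = K])
      show "((\<lambda>s. p (x + s *\<^sub>R b)) has_real_derivative qq x) (at 0)" for x
      proof (cases "x \<in> \<Omega>")
        case True
        have dF: "((\<lambda>x. F x \<bullet> b) has_derivative (\<lambda>h. frechet_derivative F (at x) h \<bullet> b)) (at x)"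
          using F(1)[OF True] by (intro derivative_intros) (simp add: frechet_derivative_works)
        note has_derivative_mult[OF k(1)[of x] has_derivative_mult[OF w(1)[OF True] dF]]
        then have "(p has_derivative (\<lambda>h. k x * (w x * (frechet_derivative F (at x) h \<bullet> b) + (w' x \<bullet> h) * (F x \<bullet> b)) + (k' x \<bullet> h) * (w x * (F x \<bullet> b)))) (at x)"
          by (rule has_derivative_transform_within_open[OF _ \<Omega> True]) (auto simp: p_def)
        from has_directional_derivative[OF this, of b] show ?thesis
          using True by (simp add: qq_def q_def algebra_simps)
      next
        case False
        have "((\<lambda>x. 0) has_derivative (\<lambda>h. 0)) (at x)" by simp
        then have "(p has_derivative (\<lambda>h. 0)) (at x)"
          by (rule has_derivative_transform_within_open[where s = "- K"])
            (use K False compact_imp_closed in \<open>auto simp: p_def\<close>)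
        from has_directional_derivative[OF this, of b] show ?thesis using False by (simp add: qq_def)
      qed
      show "continuous_on UNIV p" unfolding p_def
        by (rule continuous_on_extend_by_0[OF \<Omega> K(1,2)]) (use K(3) in \<open>auto intro!: continuous_intros ck ck' cw cF\<close>)
      show "continuous_on UNIV qq" unfolding qq_def
        by (rule continuous_on_extend_by_0[OF \<Omega> K(1,2) cq[OF b] q0])
      show "bounded K" using K(1) by (rule compact_imp_bounded)
      show "p x = 0" "qq x = 0" if "x \<notin> K" for x using that K(3) q0 by (auto simp: p_def qq_def)
    qed
    moreover have "qq = (\<lambda>x. indicator \<Omega> x *\<^sub>R q b x)" by (auto simp: qq_def split: split_indicator)
    ultimately show ?thesis by (simp add: set_lebesgue_integral_def)
  qed
  then have "0 = (\<Sum>b\<in>Basis. LBINT x:\<Omega>. q b x)" by simp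
  also have "\<dots> = (LBINT x:\<Omega>. (\<Sum>b\<in>Basis. q b x))"
    by (rule set_lebesgue_integral_finite_sum[symmetric], rule set_integrable_compact_support[OF \<Omega> K(1,2) cq q0])
  also have "\<dots> = (LBINT x:\<Omega>. w x * (F x \<bullet> k' x) + k x * (w' x \<bullet> F x) + k x * (w x * divergence F x))"
  proof (intro set_lebesgue_integral_cong)
    show "\<forall>x. x \<in> \<Omega> \<longrightarrow> (\<Sum>b\<in>Basis. q b x) = w x * (F x \<bullet> k' x) + k x * (w' x \<bullet> F x) + k x * (w x * divergence F x)"
    proof (intro allI impI)
      fix x
      have "F x \<bullet> k' x = (\<Sum>b\<in>Basis. (k' x \<bullet> b) * (F x \<bullet> b))" "w' x \<bullet> F x = (\<Sum>b\<in>Basis. (w' x \<bullet> b) * (F x \<bullet> b))"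
        by (subst euclidean_inner, simp add: mult.commute)+
      then show "(\<Sum>b\<in>Basis. q b x) = w x * (F x \<bullet> k' x) + k x * (w' x \<bullet> F x) + k x * (w x * divergence F x)"
        by (simp add: q_def divergence_def sum.distrib sum_distrib_left mult_ac)
    qed
  qed (use \<Omega> in auto)
  also have "\<dots> = (LBINT x:\<Omega>. w x * (F x \<bullet> k' x)) + (LBINT x:\<Omega>. k x * (w' x \<bullet> F x)) + (LBINT x:\<Omega>. k x * (w x * divergence F x))"
  proof -
    have "set_integrable lborel \<Omega> (\<lambda>x. w x * (F x \<bullet> k' x))" "set_integrable lborel \<Omega> (\<lambda>x. k x * (w' x \<bullet> F x))"
      "set_integrable lborel \<Omega> (\<lambda>x. k x * (w x * divergence F x))"
      by (intro set_integrable_compact_support[OF \<Omega> K(1,2)] continuous_intros ck ck' cw cF cdiv w(2); use K(3) in simp)+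
    then show ?thesis by (simp add: set_integral_add)
  qed
  finally show ?thesis by simp
qed

lemma cutoff_limit:
  fixes f :: "'a::euclidean_space \<Rightarrow> real"
  assumes k: "boundary_cutoffs \<Omega> k k'" and f: "set_integrable lborel \<Omega> f"
  shows "(\<lambda>n. LBINT x:\<Omega>. k n x * f x) \<longlonglongrightarrow> (LBINT x:\<Omega>. f x)"
proof -
  have kb: "0 \<le> k n x" "k n x \<le> 1" and kl: "x \<in> \<Omega> \<Longrightarrow> (\<lambda>n. k n x) \<longlonglongrightarrow> 1" for n x
    using k by (auto simp: boundary_cutoffs_def)
  have mk: "k n \<in> borel_measurable borel" for n
    using k unfolding boundary_cutoffs_def
    by (meson borel_measurable_continuous_onI continuous_at_imp_continuous_on has_derivative_continuous)
  have fi: "integrable lborel (\<lambda>x. indicator \<Omega> x *\<^sub>R f x)" using f by (simp add: set_integrable_def)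
  have "(\<lambda>n. \<integral>x. k n x * (indicator \<Omega> x *\<^sub>R f x) \<partial>lborel) \<longlonglongrightarrow> (\<integral>x. indicator \<Omega> x *\<^sub>R f x \<partial>lborel)"
  proof (rule integral_dominated_convergence)
    show "integrable lborel (\<lambda>x. norm (indicator \<Omega> x *\<^sub>R f x))" using fi by (rule integrable_norm)
    show "(\<lambda>x. indicator \<Omega> x *\<^sub>R f x) \<in> borel_measurable lborel" using fi by simp
    then show "(\<lambda>x. k n x * (indicator \<Omega> x *\<^sub>R f x)) \<in> borel_measurable lborel" for n
      using mk[of n] by (intro borel_measurable_times) auto
    show "AE x in lborel. (\<lambda>n. k n x * (indicator \<Omega> x *\<^sub>R f x)) \<longlonglongrightarrow> indicator \<Omega> x *\<^sub>R f x"
    proof (intro AE_I2)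
      fix x
      show "(\<lambda>n. k n x * (indicator \<Omega> x *\<^sub>R f x)) \<longlonglongrightarrow> indicator \<Omega> x *\<^sub>R f x"
        using tendsto_mult_right[OF kl, of x "indicator \<Omega> x *\<^sub>R f x"] by (cases "x \<in> \<Omega>") auto
    qed
    show "AE x in lborel. norm (k n x * (indicator \<Omega> x *\<^sub>R f x)) \<le> norm (indicator \<Omega> x *\<^sub>R f x)" for n
      using kb by (intro AE_I2) (auto simp: abs_mult intro!: mult_left_le_one_le split: split_indicator)
  qed
  then show ?thesis by (simp add: set_lebesgue_integral_def mult_ac)
qed

text \<open>The first bound sends the cutoff term to 0 for tangential \<open>F\<close>; combined
  with the second, it is uniform in \<open>n\<close>, as needed to dominate an integral over
  time.\<close>

lemma cutoff_flux_le:
  fixes \<Omega> :: "'a::euclidean_space set" and F :: "'a \<Rightarrow> 'a"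
  assumes k: "boundary_cutoffs \<Omega> k k'" and \<Omega>: "open \<Omega>" "bounded \<Omega>"
    and F: "continuous_on (closure \<Omega>) F" and w: "continuous_on \<Omega> w" "\<And>x. x \<in> \<Omega> \<Longrightarrow> \<bar>w x\<bar> \<le> W"
  shows "\<bar>LBINT x:\<Omega>. w x * (F x \<bullet> k' n x)\<bar> \<le> W * (LBINT x:\<Omega>. \<bar>F x \<bullet> k' n x\<bar>)"
    and "\<And>M. (\<And>x. x \<in> \<Omega> \<Longrightarrow> norm (F x) \<le> M) \<Longrightarrow> (LBINT x:\<Omega>. \<bar>F x \<bullet> k' n x\<bar>) \<le> M * (LBINT x:\<Omega>. norm (k' n x))"
proof -
  have ck: "continuous_on S (k' n)" for S
    using k continuous_on_subset unfolding boundary_cutoffs_def by blast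
  have iF: "set_integrable lborel \<Omega> (\<lambda>x. \<bar>F x \<bullet> k' n x\<bar>)" and ik: "set_integrable lborel \<Omega> (\<lambda>x. norm (k' n x))"
    by (intro set_integrable_continuous_closure \<Omega> continuous_intros ck F)+
  have le: "\<bar>w x * (F x \<bullet> k' n x)\<bar> \<le> W * \<bar>F x \<bullet> k' n x\<bar>" if "x \<in> \<Omega>" for x
    using w(2)[OF that] by (simp add: abs_mult mult_right_mono)
  have iw: "set_integrable lborel \<Omega> (\<lambda>x. w x * (F x \<bullet> k' n x))"
  proof (rule set_integrable_bound)
    show "set_integrable lborel \<Omega> (\<lambda>x. W * \<bar>F x \<bullet> k' n x\<bar>)" using iF by simp
    show "set_borel_measurable lborel \<Omega> (\<lambda>x. w x * (F x \<bullet> k' n x))"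
      using \<Omega> continuous_on_subset[OF F closure_subset]
      by (intro set_borel_measurable_continuous continuous_intros ck w) auto
    show "AE x in lborel. x \<in> \<Omega> \<longrightarrow> norm (w x * (F x \<bullet> k' n x)) \<le> norm (W * \<bar>F x \<bullet> k' n x\<bar>)"
      using le by (intro AE_I2) force
  qed
  have "\<bar>LBINT x:\<Omega>. w x * (F x \<bullet> k' n x)\<bar> \<le> (LBINT x:\<Omega>. \<bar>w x * (F x \<bullet> k' n x)\<bar>)"
    using set_integral_norm_bound[OF iw] by simp
  also have "\<dots> \<le> (LBINT x:\<Omega>. W * \<bar>F x \<bullet> k' n x\<bar>)"
    using iw iF le by (intro set_integral_mono_on set_integrable_abs) auto
  finally show "\<bar>LBINT x:\<Omega>. w x * (F x \<bullet> k' n x)\<bar> \<le> W * (LBINT x:\<Omega>. \<bar>F x \<bullet> k' n x\<bar>)" by simp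
  show "(LBINT x:\<Omega>. \<bar>F x \<bullet> k' n x\<bar>) \<le> M * (LBINT x:\<Omega>. norm (k' n x))"
    if M: "\<And>x. x \<in> \<Omega> \<Longrightarrow> norm (F x) \<le> M" for M
  proof -
    have "(LBINT x:\<Omega>. \<bar>F x \<bullet> k' n x\<bar>) \<le> (LBINT x:\<Omega>. M * norm (k' n x))"
    proof (rule set_integral_mono_on[OF iF])
      show "\<bar>F x \<bullet> k' n x\<bar> \<le> M * norm (k' n x)" if "x \<in> \<Omega>" for x
        using Cauchy_Schwarz_ineq2[of "F x" "k' n x"] mult_right_mono[OF M[OF that], of "norm (k' n x)"] by simp
    qed (use ik in simp)
    then show ?thesis by simp
  qed
qed

text \<open>The cutoff identity in the limit. The extension \<open>G\<close> of \<open>F\<close> to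
  the closure is tangential, so the cutoff term tends to 0; the bounded divergence makes the left
  side integrable.\<close>

lemma green_identity_neumann:
  fixes \<Omega> :: "'a::euclidean_space set" and F :: "'a \<Rightarrow> 'a"
  assumes k: "boundary_cutoffs \<Omega> k k'" and \<Omega>: "open \<Omega>" "bounded \<Omega>"
    and w: "C1_bounded \<Omega> w w'"
    and F: "\<And>x. x \<in> \<Omega> \<Longrightarrow> F differentiable (at x)" "\<And>b. b \<in> Basis \<Longrightarrow> continuous_on \<Omega> (\<lambda>x. frechet_derivative F (at x) b)"
      "bounded (divergence F ` \<Omega>)"
    and G: "continuous_on (closure \<Omega>) G" "\<And>x. x \<in> \<Omega> \<Longrightarrow> G x = F x" "\<And>x. x \<in> frontier \<Omega> \<Longrightarrow> G x \<bullet> outward_normal \<Omega> x = 0"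
  shows "(LBINT x:\<Omega>. w x * divergence F x) = - (LBINT x:\<Omega>. w' x \<bullet> F x)"
proof -
  have cw: "continuous_on \<Omega> w" "continuous_on \<Omega> w'" and bw: "bounded (w ` \<Omega>)" "bounded (w' ` \<Omega>)"
    using w C1_bounded_continuous by (auto simp: C1_bounded_def)
  from bw obtain W W' where W: "\<And>x. x \<in> \<Omega> \<Longrightarrow> \<bar>w x\<bar> \<le> W" and W': "\<And>x. x \<in> \<Omega> \<Longrightarrow> norm (w' x) \<le> W'"
    by (auto simp: bounded_iff)
  from F(3) obtain B where B: "\<And>x. x \<in> \<Omega> \<Longrightarrow> \<bar>divergence F x\<bar> \<le> B" by (auto simp: bounded_iff)
  have "bounded (G ` closure \<Omega>)"
    using G(1) \<Omega> by (intro compact_imp_bounded compact_continuous_image) (auto simp: compact_closure)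
  then obtain M where "\<And>x. x \<in> closure \<Omega> \<Longrightarrow> norm (G x) \<le> M" unfolding bounded_iff by blast
  then have M: "norm (F x) \<le> M" if "x \<in> \<Omega>" for x using that G(2)[OF that] closure_subset by (metis subsetD)
  have cF: "continuous_on \<Omega> F"
    by (intro continuous_at_imp_continuous_on ballI differentiable_imp_continuous_within F(1))
  have cdiv: "continuous_on \<Omega> (divergence F)"
    unfolding divergence_def by (intro continuous_intros F(2))
  have i1: "set_integrable lborel \<Omega> (\<lambda>x. w x * divergence F x)"
  proof (rule set_integrable_bounded[OF set_borel_measurable_continuous])
    show "norm (w x * divergence F x) \<le> W * B" if "x \<in> \<Omega>" for x
      using mult_mono[OF W[OF that] B[OF that]] W[OF that] by (simp add: abs_mult order_trans[OF abs_ge_zero])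
  qed (use \<Omega> in \<open>auto intro!: continuous_intros cw cdiv\<close>)
  have i2: "set_integrable lborel \<Omega> (\<lambda>x. w' x \<bullet> F x)"
  proof (rule set_integrable_bounded[OF set_borel_measurable_continuous])
    show "norm (w' x \<bullet> F x) \<le> W' * M" if "x \<in> \<Omega>" for x
      using Cauchy_Schwarz_ineq2[of "w' x" "F x"] mult_mono[OF W'[OF that] M[OF that]] W'[OF that]
      by (simp add: order_trans[OF norm_ge_zero])
  qed (use \<Omega> in \<open>auto intro!: continuous_intros cw cF\<close>)
  have parts: "(LBINT x:\<Omega>. k n x * (w x * divergence F x)) =
      - (LBINT x:\<Omega>. k n x * (w' x \<bullet> F x)) - (LBINT x:\<Omega>. w x * (F x \<bullet> k' n x))" for n
  proof -
    obtain K where "compact K" "K \<subseteq> \<Omega>" "\<And>x. x \<in> \<Omega> - K \<Longrightarrow> k n x = 0 \<and> k' n x = 0"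
      using k unfolding boundary_cutoffs_def by meson
    then show ?thesis
      by (rule cutoff_integration_by_parts[OF \<Omega>(1)]) (use k w F in \<open>auto simp: boundary_cutoffs_def C1_bounded_def\<close>)
  qed
  have "(\<lambda>n. LBINT x:\<Omega>. w x * (F x \<bullet> k' n x)) \<longlonglongrightarrow> 0"
  proof (rule Lim_null_comparison)
    show "(\<lambda>n. W * (LBINT x:\<Omega>. \<bar>G x \<bullet> k' n x\<bar>)) \<longlonglongrightarrow> 0"
      using k G(1,3) unfolding boundary_cutoffs_def by (intro tendsto_mult_right_zero) blast
    have "(LBINT x:\<Omega>. w x * (F x \<bullet> k' n x)) = (LBINT x:\<Omega>. w x * (G x \<bullet> k' n x))" for n
      using G(2) \<Omega> by (intro set_lebesgue_integral_cong) auto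
    then show "\<forall>\<^sub>F n in sequentially. norm (LBINT x:\<Omega>. w x * (F x \<bullet> k' n x)) \<le> W * (LBINT x:\<Omega>. \<bar>G x \<bullet> k' n x\<bar>)"
      using cutoff_flux_le(1)[OF k \<Omega> G(1) cw(1) W] by simp
  qed
  then have "(\<lambda>n. LBINT x:\<Omega>. k n x * (w x * divergence F x)) \<longlonglongrightarrow> - (LBINT x:\<Omega>. w' x \<bullet> F x) - 0"
    unfolding parts by (intro tendsto_intros cutoff_limit[OF k i2])
  from LIMSEQ_unique[OF cutoff_limit[OF k i1] this] show ?thesis by simp
qed

text \<open>The potential need not be differentiable in time. Its energy is differentiated through an identity
  \<open>e t - e s = \<integral>\<^sub>s\<^sup>t (L t \<tau> + L s \<tau>) d\<tau>\<close>, in which only the concentrations have been differentiated.\<close>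

lemma has_derivative_from_kernel:
  fixes e :: "real \<Rightarrow> real" and L :: "real \<Rightarrow> real \<Rightarrow> real"
  assumes L: "continuous_on ({0<..} \<times> {0<..}) (\<lambda>(a, b). L a b)"
    and e: "\<And>s t. 0 < s \<Longrightarrow> s < t \<Longrightarrow> ((\<lambda>\<tau>. L t \<tau> + L s \<tau>) has_integral (e t - e s)) {s..t}" and t: "t > 0"
  shows "(e has_real_derivative 2 * L t t) (at t)"
proof -
  have main: "\<exists>\<delta>>0. \<forall>h. h \<noteq> 0 \<and> \<bar>h\<bar> < \<delta> \<longrightarrow> \<bar>(e (t + h) - e t) / h - 2 * L t t\<bar> < r" if r: "r > 0" for r
  proof -
    have "open ({0<..} \<times> {0<..} :: (real \<times> real) set)" by (intro open_Times) auto
    then have "isCont (\<lambda>(a, b). L a b) (t, t)" using L t by (simp add: continuous_on_eq_continuous_at)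
    then obtain d where d: "d > 0" "\<And>p. dist p (t, t) < d \<Longrightarrow> dist (case p of (a, b) \<Rightarrow> L a b) (L t t) < r / 4"
      using r unfolding continuous_at_eps_delta by (metis case_prod_conv divide_pos_pos zero_less_numeral)
    have near: "\<bar>L a b - L t t\<bar> < r / 4" if "\<bar>a - t\<bar> < d / 2" "\<bar>b - t\<bar> < d / 2" for a b
    proof -
      have "dist (a, b) (t, t) \<le> \<bar>a - t\<bar> + \<bar>b - t\<bar>"
        using sqrt_sum_squares_le_sum_abs[of "a - t" "b - t"] by (simp add: dist_Pair_Pair dist_real_def)
      then show ?thesis using d(2)[of "(a, b)"] that by (simp add: dist_real_def)
    qed
    \<comment> \<open>\<open>d / 2\<close> in each argument stays in the ball where the kernel
      varies by less than \<open>r / 4\<close>; the bound by \<open>t\<close> keeps the left end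
      point positive.\<close>
    define \<delta> where "\<delta> = min (d / 2) t"
    have "\<delta> \<le> d / 2" by (simp add: \<delta>_def)
    have bound: "\<bar>(e b - e a) - (b - a) * (2 * L t t)\<bar> \<le> r / 2 * (b - a)"
      if ab: "t - \<delta> < a" "a < b" "b < t + \<delta>" for a b
    proof -
      have a0: "0 < a" using ab by (auto simp: \<delta>_def)
      have "((\<lambda>\<tau>. (L b \<tau> + L a \<tau>) - 2 * L t t) has_integral (e b - e a) - (b - a) * (2 * L t t)) {a..b}"
        using has_integral_const_real[of "2 * L t t" a b] ab by (intro has_integral_diff e a0) auto
      moreover have "norm ((L b \<tau> + L a \<tau>) - 2 * L t t) \<le> r / 2" if "\<tau> \<in> {a..b}" for \<tau>
      proof -
        have "\<bar>L b \<tau> - L t t\<bar> < r / 4" "\<bar>L a \<tau> - L t t\<bar> < r / 4"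
        proof -
          have "\<bar>b - t\<bar> < d / 2" "\<bar>a - t\<bar> < d / 2" "\<bar>\<tau> - t\<bar> < d / 2"
            using ab that[unfolded atLeastAtMost_iff] \<open>\<delta> \<le> d / 2\<close> unfolding abs_less_iff by linarith+
          then show "\<bar>L b \<tau> - L t t\<bar> < r / 4" "\<bar>L a \<tau> - L t t\<bar> < r / 4" using near by blast+
        qed
        then show ?thesis unfolding real_norm_def by linarith
      qed
      ultimately have "norm ((e b - e a) - (b - a) * (2 * L t t)) \<le> r / 2 * measure lborel {a..b}"
        using r by (intro has_integral_bound_real[where S = "{}"]) auto
      then have "norm ((e b - e a) - (b - a) * (2 * L t t)) \<le> r / 2 * (b - a)" using ab by simp
      then show ?thesis by simp
    qed
    have "\<bar>(e (t + h) - e t) / h - 2 * L t t\<bar> < r" if h: "h \<noteq> 0" "\<bar>h\<bar> < \<delta>" for h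
    proof -
      have "\<bar>(e (t + h) - e t) - h * (2 * L t t)\<bar> \<le> r / 2 * \<bar>h\<bar>"
      proof (cases "h > 0")
        case True
        then show ?thesis using bound[of t "t + h"] h by simp
      next
        case False
        then show ?thesis using bound[of "t + h" t] h by (simp add: abs_minus_commute algebra_simps abs_le_iff)
      qed
      then have "\<bar>(e (t + h) - e t) - h * (2 * L t t)\<bar> / \<bar>h\<bar> \<le> r / 2" using h by (simp add: field_simps)
      moreover have "\<bar>(e (t + h) - e t) - h * (2 * L t t)\<bar> / \<bar>h\<bar> = \<bar>(e (t + h) - e t) / h - 2 * L t t\<bar>"
        using h by (simp add: abs_divide[symmetric] diff_divide_distrib)
      ultimately show ?thesis using r by linarith
    qed
    moreover have "\<delta> > 0" using d t by (simp add: \<delta>_def)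
    ultimately show ?thesis by blast
  qed
  then show ?thesis
    unfolding DERIV_def LIM_eq by simp
qed

section \<open>Conservation laws\<close>

lemma C1_bounded_weighted_composition:
  assumes w: "C1_bounded \<Omega> w w'"
    and u: "C1_bounded \<Omega> u u'" "\<And>x. x \<in> \<Omega> \<Longrightarrow> u x \<ge> 0"
    and H: "\<And>s. s \<ge> 0 \<Longrightarrow> (H' has_real_derivative H'' s) (at s)" "continuous_on {0..} H''"
  shows "C1_bounded \<Omega> (\<lambda>x. w x * H' (u x)) (\<lambda>x. H' (u x) *\<^sub>R w' x + (w x * H'' (u x)) *\<^sub>R u' x)"
proof -
  have cw: "continuous_on \<Omega> w" "continuous_on \<Omega> w'" and bw: "bounded (w ` \<Omega>)" "bounded (w' ` \<Omega>)"
    using w C1_bounded_continuous by (auto simp: C1_bounded_def)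
  have cu: "continuous_on \<Omega> u" "continuous_on \<Omega> u'" and bu: "bounded (u ` \<Omega>)" "bounded (u' ` \<Omega>)"
    using u C1_bounded_continuous by (auto simp: C1_bounded_def)
  have cH': "continuous_on {0..} H'"
    using H(1) by (intro continuous_at_imp_continuous_on) (auto intro: DERIV_isCont)
  have cHu: "continuous_on \<Omega> (\<lambda>x. H' (u x))" "continuous_on \<Omega> (\<lambda>x. H'' (u x))"
    using u(2) by (auto intro!: continuous_on_compose2[OF cH' cu(1)] continuous_on_compose2[OF H(2) cu(1)])
  from bu(1) obtain M where M: "\<And>x. x \<in> \<Omega> \<Longrightarrow> \<bar>u x\<bar> \<le> M" by (auto simp: bounded_iff)
  have "bounded (H' ` {0..M})" "bounded (H'' ` {0..M})"
    using continuous_on_subset[OF cH'] continuous_on_subset[OF H(2)]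
    by (intro compact_imp_bounded compact_continuous_image; auto)+
  then obtain A B where A: "\<And>s. s \<in> {0..M} \<Longrightarrow> \<bar>H' s\<bar> \<le> A" and B: "\<And>s. s \<in> {0..M} \<Longrightarrow> \<bar>H'' s\<bar> \<le> B"
    unfolding bounded_iff by (metis imageI real_norm_def)
  from bw(1) obtain W where W: "\<And>x. x \<in> \<Omega> \<Longrightarrow> \<bar>w x\<bar> \<le> W" by (auto simp: bounded_iff)
  from bw(2) obtain W' where W': "\<And>x. x \<in> \<Omega> \<Longrightarrow> norm (w' x) \<le> W'" by (auto simp: bounded_iff)
  from bu(2) obtain M' where M': "\<And>x. x \<in> \<Omega> \<Longrightarrow> norm (u' x) \<le> M'" by (auto simp: bounded_iff)
  have uM: "u x \<in> {0..M}" if "x \<in> \<Omega>" for x using M[OF that] u(2)[OF that] by simp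
  show ?thesis
    unfolding C1_bounded_def
  proof (intro conjI ballI)
    fix x assume x: "x \<in> \<Omega>"
    have dw: "(w has_derivative (\<lambda>h. w' x \<bullet> h)) (at x)" and du: "(u has_derivative (\<lambda>h. u' x \<bullet> h)) (at x)"
      using w u(1) x by (auto simp: C1_bounded_def)
    have "((\<lambda>x. H' (u x)) has_derivative (\<lambda>h. (u' x \<bullet> h) * H'' (u x))) (at x)"
      by (rule DERIV_compose_FDERIV[OF H(1)[OF u(2)[OF x]] du])
    from has_derivative_mult[OF dw this]
    show "((\<lambda>x. w x * H' (u x)) has_derivative (\<lambda>h. (H' (u x) *\<^sub>R w' x + (w x * H'' (u x)) *\<^sub>R u' x) \<bullet> h)) (at x)"
      by (rule has_derivative_eq_rhs) (auto simp: inner_add_left algebra_simps)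
  next
    show "continuous_on \<Omega> (\<lambda>x. H' (u x) *\<^sub>R w' x + (w x * H'' (u x)) *\<^sub>R u' x)"
      by (intro continuous_intros cHu cw cu)
    show "bounded ((\<lambda>x. w x * H' (u x)) ` \<Omega>)"
    proof (rule boundedI)
      fix y assume "y \<in> (\<lambda>x. w x * H' (u x)) ` \<Omega>"
      then obtain x where x: "x \<in> \<Omega>" "y = w x * H' (u x)" by auto
      show "norm y \<le> W * A"
        unfolding x(2) real_norm_def abs_mult using W[OF x(1)] A[OF uM[OF x(1)]] by (intro mult_mono) auto
    qed
    show "bounded ((\<lambda>x. H' (u x) *\<^sub>R w' x + (w x * H'' (u x)) *\<^sub>R u' x) ` \<Omega>)"
    proof (rule boundedI)
      fix y assume "y \<in> (\<lambda>x. H' (u x) *\<^sub>R w' x + (w x * H'' (u x)) *\<^sub>R u' x) ` \<Omega>"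
      then obtain x where x: "x \<in> \<Omega>" "y = H' (u x) *\<^sub>R w' x + (w x * H'' (u x)) *\<^sub>R u' x" by auto
      have "norm y \<le> \<bar>H' (u x)\<bar> * norm (w' x) + \<bar>w x\<bar> * \<bar>H'' (u x)\<bar> * norm (u' x)"
        unfolding x(2) using norm_triangle_ineq[of "H' (u x) *\<^sub>R w' x" "(w x * H'' (u x)) *\<^sub>R u' x"] by (simp add: abs_mult)
      also have "\<dots> \<le> A * W' + W * B * M'"
        using W[OF x(1)] W'[OF x(1)] M'[OF x(1)] A[OF uM[OF x(1)]] B[OF uM[OF x(1)]]
        by (intro add_mono mult_mono) auto
      finally show "norm y \<le> A * W' + W * B * M'" .
    qed
  qed
qed

text \<open>One equation \<open>\<partial>\<^sub>t u = div F\<close> without flux through the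
  boundary. Here \<open>u'\<close> is the gradient of \<open>u\<close> in space, and
  \<open>u\<^sub>c\<close> and \<open>G\<close> are the continuous extensions of \<open>u\<close>
  and \<open>F\<close> to the closure, whereas the derivatives of \<open>F\<close> are continuous
  only inside \<Omega>.\<close>

locale conservation_law =
  fixes \<Omega> :: "'a::euclidean_space set" and u :: "real \<Rightarrow> 'a \<Rightarrow> real" and u' F G u\<^sub>c :: "real \<Rightarrow> 'a \<Rightarrow> _"
    and k :: "nat \<Rightarrow> 'a \<Rightarrow> real" and k' :: "nat \<Rightarrow> 'a \<Rightarrow> 'a"
  assumes k: "boundary_cutoffs \<Omega> k k'" and \<Omega>: "open \<Omega>" "bounded \<Omega>"
    and u: "\<And>t x. t > 0 \<Longrightarrow> x \<in> \<Omega> \<Longrightarrow> (u t has_derivative (\<lambda>h. u' t x \<bullet> h)) (at x)"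
    and u_cont: "continuous_on ({0<..} \<times> closure \<Omega>) (\<lambda>(t, x). u\<^sub>c t x)" "\<And>t x. t > 0 \<Longrightarrow> x \<in> \<Omega> \<Longrightarrow> u\<^sub>c t x = u t x"
    and u'_cont: "continuous_on ({0<..} \<times> closure \<Omega>) (\<lambda>(t, x). u' t x)"
    and u_nonneg: "\<And>t x. t > 0 \<Longrightarrow> x \<in> \<Omega> \<Longrightarrow> u t x \<ge> 0"
    and u_eq: "\<And>t x. t > 0 \<Longrightarrow> x \<in> \<Omega> \<Longrightarrow> ((\<lambda>s. u s x) has_real_derivative divergence (F t) x) (at t)"
    and F_diff: "\<And>t x. t > 0 \<Longrightarrow> x \<in> \<Omega> \<Longrightarrow> F t differentiable (at x)"
    and F_cont: "\<And>b. b \<in> Basis \<Longrightarrow> continuous_on ({0<..} \<times> \<Omega>) (\<lambda>(t, x). frechet_derivative (F t) (at x) b)"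
    and G: "continuous_on ({0<..} \<times> closure \<Omega>) (\<lambda>(t, x). G t x)" "\<And>t x. t > 0 \<Longrightarrow> x \<in> \<Omega> \<Longrightarrow> G t x = F t x"
      "\<And>t x. t > 0 \<Longrightarrow> x \<in> frontier \<Omega> \<Longrightarrow> G t x \<bullet> outward_normal \<Omega> x = 0"
begin

lemma in_closure: "x \<in> \<Omega> \<Longrightarrow> x \<in> closure \<Omega>"
  using closure_subset by blast

lemma slice:
  fixes f :: "real \<Rightarrow> 'a \<Rightarrow> 'b::euclidean_space"
  assumes "continuous_on ({0<..} \<times> S) (\<lambda>(t, x). f t x)" "t > 0" "S' \<subseteq> S"
  shows "continuous_on S' (f t)"
  using assms by (intro continuous_on_compose2[OF assms(1), where f = "\<lambda>x. (t, x)", simplified]) (auto intro!: continuous_intros)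

lemma slice_bounded:
  fixes f :: "real \<Rightarrow> 'a \<Rightarrow> 'b::euclidean_space"
  assumes "continuous_on ({0<..} \<times> closure \<Omega>) (\<lambda>(t, x). f t x)" "t > 0"
  shows "bounded (f t ` \<Omega>)"
proof -
  have "bounded (f t ` closure \<Omega>)"
    using slice[OF assms, of "closure \<Omega>"] \<Omega> by (intro compact_imp_bounded compact_continuous_image) (auto simp: compact_closure)
  then show ?thesis using closure_subset by (metis bounded_subset image_mono)
qed

lemma C1_bounded_u: "t > 0 \<Longrightarrow> C1_bounded \<Omega> (u t) (u' t)"
proof -
  assume t: "t > 0"
  have "u t ` \<Omega> = u\<^sub>c t ` \<Omega>" using u_cont(2)[OF t] by (metis image_cong)
  then show ?thesis
    unfolding C1_bounded_def
    using u[OF t] slice[OF u'_cont t closure_subset] slice_bounded[OF u'_cont t] slice_bounded[OF u_cont(1) t] by auto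
qed

text \<open>Formally, \<open>\<integral> w H(u)\<close> has the time derivative
  \<open>\<integral> w H'(u) div F\<close>, which is minus the integral of the gradient of
  \<open>w H'(u)\<close> against \<open>F\<close>. The middle expression is used only under a
  cutoff: there Fubini and the fundamental theorem of calculus in time give the increment,
  integration by parts in space gives the right side, and the cutoff is removed by dominated
  convergence in time. The choice of \<open>w\<close> and \<open>H\<close> covers mass, entropy and
  electric energy.\<close>

lemma weak_form:
  fixes w H :: "_ \<Rightarrow> real"
  assumes w: "C1_bounded \<Omega> w w'" and wc: "continuous_on (closure \<Omega>) wc'" "\<And>x. x \<in> \<Omega> \<Longrightarrow> wc' x = w' x"
      "continuous_on (closure \<Omega>) wc" "\<And>x. x \<in> \<Omega> \<Longrightarrow> wc x = w x"
    and H: "\<And>s. s \<ge> 0 \<Longrightarrow> (H has_real_derivative H' s) (at s)" "\<And>s. s \<ge> 0 \<Longrightarrow> (H' has_real_derivative H'' s) (at s)"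
      "continuous_on {0..} H''"
    and st: "0 < s" "s < t"
  shows "((\<lambda>\<tau>. - (LBINT x:\<Omega>. (H' (u \<tau> x) *\<^sub>R w' x + (w x * H'' (u \<tau> x)) *\<^sub>R u' \<tau> x) \<bullet> F \<tau> x)) has_integral
     ((LBINT x:\<Omega>. w x * H (u t x)) - (LBINT x:\<Omega>. w x * H (u s x)))) {s..t}"
proof -
  define y where "y \<tau> x = w x * H' (u \<tau> x)" for \<tau> x
  define y' where "y' \<tau> x = H' (u \<tau> x) *\<^sub>R w' x + (w x * H'' (u \<tau> x)) *\<^sub>R u' \<tau> x" for \<tau> x
  have Y: "C1_bounded \<Omega> (y \<tau>) (y' \<tau>)" if "\<tau> > 0" for \<tau>
    unfolding y_def y'_def
    by (rule C1_bounded_weighted_composition[OF w C1_bounded_u[OF that] u_nonneg[OF that] H(2,3)])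
  have uc_nonneg: "u\<^sub>c \<tau> x \<ge> 0" if "\<tau> > 0" "x \<in> closure \<Omega>" for \<tau> x
  proof -
    have "u\<^sub>c \<tau> ` closure \<Omega> \<subseteq> {0..}"
      using slice[OF u_cont(1) that(1), of "closure \<Omega>"] u_nonneg[OF that(1)] u_cont(2)[OF that(1)]
      by (intro image_closure_subset) auto
    then show ?thesis using that by auto
  qed
  have cH': "continuous_on {0..} H'"
    using H(2) by (intro continuous_at_imp_continuous_on) (auto intro: DERIV_isCont)
  have cH: "continuous_on {0..} H"
    using H(1) by (intro continuous_at_imp_continuous_on) (auto intro: DERIV_isCont)
  have cU: "continuous_on ({0<..} \<times> closure \<Omega>) (\<lambda>p. u\<^sub>c (fst p) (snd p))"
    and cU': "continuous_on ({0<..} \<times> closure \<Omega>) (\<lambda>p. u' (fst p) (snd p))"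
    and cG: "continuous_on ({0<..} \<times> closure \<Omega>) (\<lambda>p. G (fst p) (snd p))"
    using u_cont(1) u'_cont G(1) by (simp_all add: split_beta')
  have cHU: "continuous_on ({0<..} \<times> closure \<Omega>) (\<lambda>p. H' (u\<^sub>c (fst p) (snd p)))"
    "continuous_on ({0<..} \<times> closure \<Omega>) (\<lambda>p. H'' (u\<^sub>c (fst p) (snd p)))"
    using uc_nonneg by (auto intro!: continuous_on_compose2[OF cH' cU] continuous_on_compose2[OF H(3) cU])
  have cw: "continuous_on ({0<..} \<times> closure \<Omega>) (\<lambda>p::real \<times> 'a. wc (snd p))"
    "continuous_on ({0<..} \<times> closure \<Omega>) (\<lambda>p::real \<times> 'a. wc' (snd p))"
    by (intro continuous_on_compose2[OF wc(3)] continuous_on_compose2[OF wc(1)] continuous_intros; auto)+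
  \<comment> \<open>Written with the extensions, the limit integrand is continuous on the compact
    set \<open>{s..t} \<times> closure \<Omega>\<close> and hence bounded uniformly in time.\<close>
  define I where "I \<tau> x = (H' (u\<^sub>c \<tau> x) *\<^sub>R wc' x + (wc x * H'' (u\<^sub>c \<tau> x)) *\<^sub>R u' \<tau> x) \<bullet> G \<tau> x" for \<tau> x
  have cI: "continuous_on ({0<..} \<times> closure \<Omega>) (\<lambda>(\<tau>, x). I \<tau> x)"
    unfolding I_def split_beta' by (intro continuous_intros cHU cw cU' cG)
  have I_eq: "I \<tau> x = y' \<tau> x \<bullet> F \<tau> x" if "\<tau> > 0" "x \<in> \<Omega>" for \<tau> x
    using that u_cont(2) G(2) wc(2,4) by (simp add: I_def y'_def)
  have cI': "continuous_on {s..t} (\<lambda>\<tau>. LBINT x:\<Omega>. I \<tau> x)"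
    by (rule continuous_on_set_integral_param[OF \<Omega>], rule continuous_on_subset[OF cI]) (use st in auto)
  have compact_st: "compact ({s..t} \<times> closure \<Omega>)" using \<Omega>(2) by (auto intro!: compact_Times simp: compact_closure)
  have sub_st: "{s..t} \<times> closure \<Omega> \<subseteq> {0<..} \<times> closure \<Omega>" using st by auto
  obtain MI where MI: "\<And>\<tau> x. \<tau> \<in> {s..t} \<Longrightarrow> x \<in> closure \<Omega> \<Longrightarrow> \<bar>I \<tau> x\<bar> \<le> MI"
  proof -
    have "bounded ((\<lambda>(\<tau>, x). I \<tau> x) ` ({s..t} \<times> closure \<Omega>))"
      by (intro compact_imp_bounded compact_continuous_image continuous_on_subset[OF cI sub_st] compact_st)
    then show ?thesis using that by (force simp: bounded_iff)
  qed
  obtain MG where MG: "\<And>\<tau> x. \<tau> \<in> {s..t} \<Longrightarrow> x \<in> closure \<Omega> \<Longrightarrow> norm (G \<tau> x) \<le> MG"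
  proof -
    have "bounded ((\<lambda>(\<tau>, x). G \<tau> x) ` ({s..t} \<times> closure \<Omega>))"
      by (intro compact_imp_bounded compact_continuous_image continuous_on_subset[OF G(1) sub_st] compact_st)
    then show ?thesis using that by (force simp: bounded_iff)
  qed
  obtain MY where MY: "\<And>\<tau> x. \<tau> \<in> {s..t} \<Longrightarrow> x \<in> \<Omega> \<Longrightarrow> \<bar>y \<tau> x\<bar> \<le> MY"
  proof -
    have "bounded ((\<lambda>p. wc (snd p) * H' (u\<^sub>c (fst p) (snd p))) ` ({s..t} \<times> closure \<Omega>))"
      by (intro compact_imp_bounded compact_continuous_image continuous_on_subset[OF _ sub_st] compact_st continuous_intros cw cHU)
    then obtain M where M: "\<And>\<tau> x. \<tau> \<in> {s..t} \<Longrightarrow> x \<in> closure \<Omega> \<Longrightarrow> \<bar>wc x * H' (u\<^sub>c \<tau> x)\<bar> \<le> M" by (force simp: bounded_iff)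
    have "\<bar>y \<tau> x\<bar> \<le> M" if "\<tau> \<in> {s..t}" "x \<in> \<Omega>" for \<tau> x
      using M[OF that(1) in_closure[OF that(2)]] that st u_cont(2) wc(4) by (simp add: y_def)
    then show ?thesis using that by blast
  qed
  obtain Ck where Ck: "\<And>n. (LBINT x:\<Omega>. norm (k' n x)) \<le> Ck" using k by (auto simp: boundary_cutoffs_def)
  define g where "g n \<tau> = (LBINT x:\<Omega>. k n x * (y \<tau> x * divergence (F \<tau>) x))" for n \<tau>
  have cFt: "continuous_on \<Omega> (\<lambda>x. frechet_derivative (F \<tau>) (at x) b)" if "\<tau> > 0" "b \<in> Basis" for \<tau> b
    using slice[OF F_cont[OF that(2)] that(1), of \<Omega>] by simp
  have ck: "continuous_on S (k n)" "continuous_on S (k' n)" for S n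
  proof -
    show "continuous_on S (k n)"
      using k by (intro continuous_at_imp_continuous_on ballI has_derivative_continuous) (auto simp: boundary_cutoffs_def)
    show "continuous_on S (k' n)" using k by (auto simp: boundary_cutoffs_def intro: continuous_on_subset)
  qed
  have kb: "0 \<le> k n x" "k n x \<le> 1" for n x using k by (auto simp: boundary_cutoffs_def)
  have iI: "set_integrable lborel \<Omega> (\<lambda>x. y' \<tau> x \<bullet> F \<tau> x)" if "\<tau> \<in> {s..t}" for \<tau>
  proof -
    have "set_integrable lborel \<Omega> (I \<tau>)"
      using that st by (intro set_integrable_continuous_closure \<Omega> slice[OF cI]) auto
    then show ?thesis using I_eq that st by (simp cong: set_integrable_cong)
  qed
  have parts: "g n \<tau> = - (LBINT x:\<Omega>. k n x * (y' \<tau> x \<bullet> F \<tau> x)) - (LBINT x:\<Omega>. y \<tau> x * (F \<tau> x \<bullet> k' n x))"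
    if "\<tau> \<in> {s..t}" for n \<tau>
  proof -
    have \<tau>: "\<tau> > 0" using that st by auto
    obtain K where "compact K" "K \<subseteq> \<Omega>" "\<And>x. x \<in> \<Omega> - K \<Longrightarrow> k n x = 0 \<and> k' n x = 0"
      using k unfolding boundary_cutoffs_def by meson
    then show ?thesis unfolding g_def
      by (rule cutoff_integration_by_parts[OF \<Omega>(1)])
        (use k Y[OF \<tau>] F_diff[OF \<tau>] cFt[OF \<tau>] in \<open>auto simp: boundary_cutoffs_def C1_bounded_def\<close>)
  qed
  have flux_eq: "(LBINT x:\<Omega>. y \<tau> x * (F \<tau> x \<bullet> k' n x)) = (LBINT x:\<Omega>. y \<tau> x * (G \<tau> x \<bullet> k' n x))"
    if "\<tau> \<in> {s..t}" for n \<tau>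
    using that st G(2) \<Omega> by (intro set_lebesgue_integral_cong) auto
  have flux: "\<bar>LBINT x:\<Omega>. y \<tau> x * (F \<tau> x \<bullet> k' n x)\<bar> \<le> MY * (LBINT x:\<Omega>. \<bar>G \<tau> x \<bullet> k' n x\<bar>)"
    and flux': "(LBINT x:\<Omega>. \<bar>G \<tau> x \<bullet> k' n x\<bar>) \<le> MG * (LBINT x:\<Omega>. norm (k' n x))"
    if \<tau>: "\<tau> \<in> {s..t}" for n \<tau>
  proof -
    have \<tau>0: "\<tau> > 0" using \<tau> st by auto
    have cG\<tau>: "continuous_on (closure \<Omega>) (G \<tau>)" by (rule slice[OF G(1) \<tau>0 order_refl])
    have cy: "continuous_on \<Omega> (y \<tau>)" by (rule C1_bounded_continuous[OF Y[OF \<tau>0]])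
    show "\<bar>LBINT x:\<Omega>. y \<tau> x * (F \<tau> x \<bullet> k' n x)\<bar> \<le> MY * (LBINT x:\<Omega>. \<bar>G \<tau> x \<bullet> k' n x\<bar>)"
      unfolding flux_eq[OF \<tau>] by (rule cutoff_flux_le(1)[OF k \<Omega> cG\<tau> cy MY[OF \<tau>]])
    show "(LBINT x:\<Omega>. \<bar>G \<tau> x \<bullet> k' n x\<bar>) \<le> MG * (LBINT x:\<Omega>. norm (k' n x))"
      by (rule cutoff_flux_le(2)[OF k \<Omega> cG\<tau> cy MY[OF \<tau>]]) (use MG[OF \<tau>] in_closure in auto)
  qed
  have MY0: "MY \<ge> 0" if "x \<in> \<Omega>" for x using MY[of s x] that st by (auto intro: order_trans[OF abs_ge_zero])
  have g_lim: "(\<lambda>n. g n \<tau>) \<longlonglongrightarrow> - (LBINT x:\<Omega>. y' \<tau> x \<bullet> F \<tau> x)" if \<tau>: "\<tau> \<in> {s..t}" for \<tau>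
  proof -
    have \<tau>0: "\<tau> > 0" using \<tau> st by auto
    have "(\<lambda>n. LBINT x:\<Omega>. y \<tau> x * (F \<tau> x \<bullet> k' n x)) \<longlonglongrightarrow> 0"
    proof (rule Lim_null_comparison)
      show "(\<lambda>n. MY * (LBINT x:\<Omega>. \<bar>G \<tau> x \<bullet> k' n x\<bar>)) \<longlonglongrightarrow> 0"
        using k G(3)[OF \<tau>0] slice[OF G(1) \<tau>0 order_refl]
        unfolding boundary_cutoffs_def by (intro tendsto_mult_right_zero) blast
      show "\<forall>\<^sub>F n in sequentially. norm (LBINT x:\<Omega>. y \<tau> x * (F \<tau> x \<bullet> k' n x)) \<le> MY * (LBINT x:\<Omega>. \<bar>G \<tau> x \<bullet> k' n x\<bar>)"
        using flux[OF \<tau>] by simp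
    qed
    then have "(\<lambda>n. g n \<tau>) \<longlonglongrightarrow> - (LBINT x:\<Omega>. y' \<tau> x \<bullet> F \<tau> x) - 0"
      unfolding parts[OF \<tau>] by (intro tendsto_intros cutoff_limit[OF k iI[OF \<tau>]])
    then show ?thesis by simp
  qed
  \<comment> \<open>The summands bound the volume term and the cutoff term, the latter uniformly in
    \<open>n\<close> through the \<open>L\<^sup>1\<close> bound \<open>Ck\<close> on the gradients
    of the cutoffs.\<close>
  define B where "B = \<bar>MI\<bar> * measure lborel \<Omega> + \<bar>MY\<bar> * (\<bar>MG\<bar> * \<bar>Ck\<bar>)"
  have g_bound: "\<bar>g n \<tau>\<bar> \<le> B" if \<tau>: "\<tau> \<in> {s..t}" for n \<tau>
  proof -
    have ik: "set_integrable lborel \<Omega> (\<lambda>x. k n x * (y' \<tau> x \<bullet> F \<tau> x))"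
    proof (rule set_integrable_bound[OF iI[OF \<tau>]])
      show "set_borel_measurable lborel \<Omega> (\<lambda>x. k n x * (y' \<tau> x \<bullet> F \<tau> x))"
      proof -
        have "(\<lambda>x. k n x * (indicator \<Omega> x *\<^sub>R (y' \<tau> x \<bullet> F \<tau> x))) \<in> borel_measurable lborel"
          using iI[OF \<tau>] ck(1)[of UNIV n] by (intro borel_measurable_times) (auto simp: set_integrable_def intro: borel_measurable_continuous_onI)
        then show ?thesis by (simp add: set_borel_measurable_def mult_ac)
      qed
      show "AE x in lborel. x \<in> \<Omega> \<longrightarrow> norm (k n x * (y' \<tau> x \<bullet> F \<tau> x)) \<le> norm (y' \<tau> x \<bullet> F \<tau> x)"
        using kb by (intro AE_I2) (auto simp: abs_mult intro!: mult_left_le_one_le)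
    qed
    have iM: "set_integrable lborel \<Omega> (\<lambda>x. \<bar>MI\<bar>)"
      using \<Omega> emeasure_bounded_finite[OF \<Omega>(2)] by (auto simp: set_integrable_def)
    have "\<bar>LBINT x:\<Omega>. k n x * (y' \<tau> x \<bullet> F \<tau> x)\<bar> \<le> (LBINT x:\<Omega>. \<bar>k n x * (y' \<tau> x \<bullet> F \<tau> x)\<bar>)"
      using set_integral_norm_bound[OF ik] by simp
    also have "\<dots> \<le> (LBINT x:\<Omega>. \<bar>MI\<bar>)"
    proof (rule set_integral_mono_on[OF set_integrable_abs[OF ik] iM])
      fix x assume x: "x \<in> \<Omega>"
      have "\<bar>y' \<tau> x \<bullet> F \<tau> x\<bar> \<le> \<bar>MI\<bar>"
        using MI[OF \<tau> in_closure[OF x]] I_eq[of \<tau> x] \<tau> st x by auto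
      then show "\<bar>k n x * (y' \<tau> x \<bullet> F \<tau> x)\<bar> \<le> \<bar>MI\<bar>"
        using mult_mono[of "\<bar>k n x\<bar>" 1 "\<bar>y' \<tau> x \<bullet> F \<tau> x\<bar>" "\<bar>MI\<bar>"] kb[of n x] by (simp add: abs_mult)
    qed
    also have "\<dots> = \<bar>MI\<bar> * measure lborel \<Omega>" by (simp add: set_lebesgue_integral_def mult.commute)
    finally have 1: "\<bar>LBINT x:\<Omega>. k n x * (y' \<tau> x \<bullet> F \<tau> x)\<bar> \<le> \<bar>MI\<bar> * measure lborel \<Omega>" .
    have nn: "0 \<le> (LBINT x:\<Omega>. \<bar>G \<tau> x \<bullet> k' n x\<bar>)" "0 \<le> (LBINT x:\<Omega>. norm (k' n x))"
      by (simp_all add: set_lebesgue_integral_def)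
    have "(LBINT x:\<Omega>. \<bar>G \<tau> x \<bullet> k' n x\<bar>) \<le> \<bar>MG\<bar> * \<bar>Ck\<bar>"
      by (rule order_trans[OF flux'[OF \<tau>, of n] mult_mono[OF abs_ge_self order_trans[OF Ck abs_ge_self] abs_ge_zero nn(2)]])
    then have "MY * (LBINT x:\<Omega>. \<bar>G \<tau> x \<bullet> k' n x\<bar>) \<le> \<bar>MY\<bar> * (\<bar>MG\<bar> * \<bar>Ck\<bar>)"
      using nn by (intro mult_mono) auto
    then show ?thesis unfolding parts[OF \<tau>] B_def using 1 flux[OF \<tau>, of n] by linarith
  qed
  have fub: "(LBINT x:\<Omega>. k n x * (w x * (H (u t x) - H (u s x)))) = (LBINT \<tau>:{s..t}. g n \<tau>)"
    and g_meas: "(\<lambda>\<tau>. indicator {s..t} \<tau> *\<^sub>R g n \<tau>) \<in> borel_measurable lborel" for n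
  proof -
    obtain K where K: "compact K" "K \<subseteq> \<Omega>" "\<And>x. x \<in> \<Omega> - K \<Longrightarrow> k n x = 0 \<and> k' n x = 0"
      using k unfolding boundary_cutoffs_def by meson
    \<comment> \<open>Restricted to the compact \<open>K\<close>, this is jointly continuous in time
      and space, hence integrable. Integration in the two orders gives \<open>g n\<close> and the
      increment of \<open>H (u \<tau> x)\<close>.\<close>
    define h where "h \<tau> x = k n x * (wc x * H' (u\<^sub>c \<tau> x) * divergence (F \<tau>) x)" for \<tau> x
    have sK: "{s..t} \<times> K \<subseteq> {0<..} \<times> closure \<Omega>" "{s..t} \<times> K \<subseteq> {0<..} \<times> \<Omega>" using st K(2) closure_subset by fastforce+
    have "continuous_on ({0<..} \<times> \<Omega>) (\<lambda>p. frechet_derivative (F (fst p)) (at (snd p)) b)" if "b \<in> Basis" for b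
      using F_cont[OF that] by (simp add: split_beta')
    then have cd: "continuous_on ({s..t} \<times> K) (\<lambda>p. divergence (F (fst p)) (snd p))"
      unfolding divergence_def using sK(2) by (intro continuous_intros) (auto intro: continuous_on_subset)
    have ckk: "continuous_on ({s..t} \<times> K) (\<lambda>p::real \<times> 'a. k n (snd p))"
      by (rule continuous_on_compose2[OF ck(1)[of UNIV n]]) (auto intro!: continuous_intros)
    have "continuous_on ({s..t} \<times> K) (\<lambda>p. h (fst p) (snd p))"
      unfolding h_def by (intro continuous_intros cd ckk continuous_on_subset[OF cw(1) sK(1)] continuous_on_subset[OF cHU(1) sK(1)])
    then have "set_integrable lborel ({s..t} \<times> K) (\<lambda>p. h (fst p) (snd p))"
      using borel_integrable_compact[of "{s..t} \<times> K" "\<lambda>p. h (fst p) (snd p)"] K(1)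
      by (simp add: set_integrable_def compact_Times)
    then have int: "integrable (lborel \<Otimes>\<^sub>M lborel) (\<lambda>(\<tau>, x). indicator {s..t} \<tau> * (indicator K x * h \<tau> x))"
      unfolding set_integrable_def lborel_prod by (simp add: split_beta' indicator_times mult_ac)
    have inner: "(\<integral>x. indicator {s..t} \<tau> * (indicator K x * h \<tau> x) \<partial>lborel) = indicator {s..t} \<tau> *\<^sub>R g n \<tau>" for \<tau>
    proof (cases "\<tau> \<in> {s..t}")
      case True
      have "indicator K x * h \<tau> x = indicator \<Omega> x *\<^sub>R (k n x * (y \<tau> x * divergence (F \<tau>) x))" for x
        using K(2,3) True st u_cont(2) wc(4) by (auto simp: h_def y_def split: split_indicator)
      then show ?thesis using True by (simp add: g_def set_lebesgue_integral_def)
    qed simp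
    have outer: "(\<integral>\<tau>. indicator {s..t} \<tau> * (indicator K x * h \<tau> x) \<partial>lborel) = indicator \<Omega> x *\<^sub>R (k n x * (w x * (H (u t x) - H (u s x))))" for x
    proof (cases "x \<in> K")
      case True
      then have x: "x \<in> \<Omega>" using K(2) by auto
      have "continuous_on {s..t} (\<lambda>\<tau>. (\<tau>, x))" by (intro continuous_intros)
      then have ch: "continuous_on {s..t} (\<lambda>\<tau>. h \<tau> x)"
        using continuous_on_compose2[OF \<open>continuous_on ({s..t} \<times> K) (\<lambda>p. h (fst p) (snd p))\<close>, of "{s..t}" "\<lambda>\<tau>. (\<tau>, x)"] True by auto
      have "((\<lambda>\<tau>. h \<tau> x) has_integral (k n x * (w x * H (u t x)) - k n x * (w x * H (u s x)))) {s..t}"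
      proof (rule fundamental_theorem_of_calculus)
        fix \<tau> assume \<tau>: "\<tau> \<in> {s..t}"
        then have "\<tau> > 0" using st by auto
        have "((\<lambda>\<tau>. H (u \<tau> x)) has_real_derivative H' (u \<tau> x) * divergence (F \<tau>) x) (at \<tau>)"
          by (rule DERIV_chain2[OF H(1) u_eq]) (use \<open>\<tau> > 0\<close> x u_nonneg in auto)
        then have "((\<lambda>\<tau>. k n x * (w x * H (u \<tau> x))) has_real_derivative k n x * (w x * (H' (u \<tau> x) * divergence (F \<tau>) x))) (at \<tau>)"
          by (intro DERIV_cmult)
        moreover have "h \<tau> x = k n x * (w x * (H' (u \<tau> x) * divergence (F \<tau>) x))"
          using u_cont(2) wc(4) \<open>\<tau> > 0\<close> x by (simp add: h_def)
        ultimately show "((\<lambda>\<tau>. k n x * (w x * H (u \<tau> x))) has_vector_derivative h \<tau> x) (at \<tau> within {s..t})"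
          by (auto simp: has_real_derivative_iff_has_vector_derivative intro: has_vector_derivative_at_within)
      qed (use st in auto)
      moreover have "set_integrable lborel {s..t} (\<lambda>\<tau>. h \<tau> x)"
        using ch by (intro set_integrable_continuous_bounded compact_imp_bounded compact_continuous_image) auto
      ultimately have "(LBINT \<tau>:{s..t}. h \<tau> x) = k n x * (w x * H (u t x)) - k n x * (w x * H (u s x))"
        using set_borel_integral_eq_integral(2) integral_unique by metis
      then show ?thesis using True x by (simp add: set_lebesgue_integral_def right_diff_distrib)
    next
      case False
      then show ?thesis using K(3)[of x] by (cases "x \<in> \<Omega>") auto
    qed
    have "integrable lborel (\<lambda>\<tau>. \<integral>x. indicator {s..t} \<tau> * (indicator K x * h \<tau> x) \<partial>lborel)"
      by (rule lborel_pair.integrable_fst[OF int])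
    then show "(\<lambda>\<tau>. indicator {s..t} \<tau> *\<^sub>R g n \<tau>) \<in> borel_measurable lborel"
      unfolding inner by (rule borel_measurable_integrable)
    show "(LBINT x:\<Omega>. k n x * (w x * (H (u t x) - H (u s x)))) = (LBINT \<tau>:{s..t}. g n \<tau>)"
      using lborel_pair.Fubini_integral[OF int] unfolding inner outer by (simp add: set_lebesgue_integral_def)
  qed
  have iw: "set_integrable lborel \<Omega> (\<lambda>x. w x * H (u \<tau> x))" if "\<tau> > 0" for \<tau>
  proof -
    have "continuous_on (closure \<Omega>) (\<lambda>x. H (u\<^sub>c \<tau> x))"
      by (rule continuous_on_compose2[OF cH slice[OF u_cont(1) that order_refl]]) (use uc_nonneg that in auto)
    then have "set_integrable lborel \<Omega> (\<lambda>x. wc x * H (u\<^sub>c \<tau> x))"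
      by (intro set_integrable_continuous_closure \<Omega> continuous_intros wc)
    then show ?thesis using u_cont(2) wc(4) that by (simp cong: set_integrable_cong)
  qed
  have "(\<lambda>n. \<integral>\<tau>. indicator {s..t} \<tau> *\<^sub>R g n \<tau> \<partial>lborel) \<longlonglongrightarrow> (\<integral>\<tau>. indicator {s..t} \<tau> *\<^sub>R - (LBINT x:\<Omega>. I \<tau> x) \<partial>lborel)"
  proof (rule integral_dominated_convergence)
    show "(\<lambda>\<tau>. indicator {s..t} \<tau> *\<^sub>R - (LBINT x:\<Omega>. I \<tau> x)) \<in> borel_measurable lborel"
      using borel_measurable_continuous_on_indicator[OF _ continuous_on_minus[OF cI']] by simp
    show "integrable lborel (\<lambda>\<tau>. indicator {s..t} \<tau> *\<^sub>R B)"
      using st by (intro integrable_scaleR_left integrable_real_indicator) auto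
    show "AE \<tau> in lborel. (\<lambda>n. indicator {s..t} \<tau> *\<^sub>R g n \<tau>) \<longlonglongrightarrow> indicator {s..t} \<tau> *\<^sub>R - (LBINT x:\<Omega>. I \<tau> x)"
    proof (rule AE_I2)
      fix \<tau>
      have "(LBINT x:\<Omega>. I \<tau> x) = (LBINT x:\<Omega>. y' \<tau> x \<bullet> F \<tau> x)" if "\<tau> \<in> {s..t}"
        using that st I_eq \<Omega> by (intro set_lebesgue_integral_cong) auto
      then show "(\<lambda>n. indicator {s..t} \<tau> *\<^sub>R g n \<tau>) \<longlonglongrightarrow> indicator {s..t} \<tau> *\<^sub>R - (LBINT x:\<Omega>. I \<tau> x)"
        using g_lim[of \<tau>] by (cases "\<tau> \<in> {s..t}") (auto intro!: tendsto_intros)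
    qed
    show "AE \<tau> in lborel. norm (indicator {s..t} \<tau> *\<^sub>R g n \<tau>) \<le> indicator {s..t} \<tau> *\<^sub>R B" for n
      using g_bound by (intro AE_I2) (auto split: split_indicator)
  qed (rule g_meas)
  then have lim1: "(\<lambda>n. LBINT \<tau>:{s..t}. g n \<tau>) \<longlonglongrightarrow> (LBINT \<tau>:{s..t}. - (LBINT x:\<Omega>. I \<tau> x))"
    by (simp add: set_lebesgue_integral_def)
  have "set_integrable lborel \<Omega> (\<lambda>x. w x * H (u t x) - w x * H (u s x))"
    using iw st by (intro set_integral_diff) auto
  then have "set_integrable lborel \<Omega> (\<lambda>x. w x * (H (u t x) - H (u s x)))" by (simp add: right_diff_distrib)
  from LIMSEQ_unique[OF lim1 cutoff_limit[OF k this, unfolded fub]]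
  have eq: "(LBINT \<tau>:{s..t}. - (LBINT x:\<Omega>. I \<tau> x)) = (LBINT x:\<Omega>. w x * H (u t x)) - (LBINT x:\<Omega>. w x * H (u s x))"
    using iw st by (simp add: right_diff_distrib set_integral_diff)
  have "set_integrable lborel {s..t} (\<lambda>\<tau>. - (LBINT x:\<Omega>. I \<tau> x))"
    using continuous_on_minus[OF cI'] by (intro set_integrable_continuous_bounded compact_imp_bounded compact_continuous_image) auto
  from set_borel_integral_eq_integral[OF this]
  have "((\<lambda>\<tau>. - (LBINT x:\<Omega>. I \<tau> x)) has_integral ((LBINT x:\<Omega>. w x * H (u t x)) - (LBINT x:\<Omega>. w x * H (u s x)))) {s..t}"
    unfolding eq by (simp add: has_integral_integral)
  then show ?thesis
  proof (rule has_integral_eq[rotated])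
    fix \<tau> assume "\<tau> \<in> {s..t}"
    then have "(LBINT x:\<Omega>. I \<tau> x) = (LBINT x:\<Omega>. y' \<tau> x \<bullet> F \<tau> x)"
      using st I_eq \<Omega> by (intro set_lebesgue_integral_cong) auto
    then show "- (LBINT x:\<Omega>. I \<tau> x) = - (LBINT x:\<Omega>. (H' (u \<tau> x) *\<^sub>R w' x + (w x * H'' (u \<tau> x)) *\<^sub>R u' \<tau> x) \<bullet> F \<tau> x)"
      by (simp add: y'_def)
  qed
qed

end

section \<open>The Nernst-Planck system\<close>

definition boundary_ext :: "real set \<Rightarrow> 'a::euclidean_space set \<Rightarrow> (real \<Rightarrow> 'a \<Rightarrow> 'b::topological_space) \<Rightarrow> real \<Rightarrow> 'a \<Rightarrow> 'b" where
  "boundary_ext T \<Omega> u = (SOME v. continuous_on (T \<times> closure \<Omega>) (\<lambda>(t, x). v t x) \<and> (\<forall>t\<in>T. \<forall>x\<in>\<Omega>. v t x = u t x))"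

lemma boundary_ext:
  assumes "continuous_up_to_boundary T \<Omega> u"
  shows "continuous_on (T \<times> closure \<Omega>) (\<lambda>(t, x). boundary_ext T \<Omega> u t x)"
    and "\<And>t x. t \<in> T \<Longrightarrow> x \<in> \<Omega> \<Longrightarrow> boundary_ext T \<Omega> u t x = u t x"
proof -
  have "\<exists>v. continuous_on (T \<times> closure \<Omega>) (\<lambda>(t, x). v t x) \<and> (\<forall>t\<in>T. \<forall>x\<in>\<Omega>. v t x = u t x)"
    using assms by (simp add: continuous_up_to_boundary_def)
  from someI_ex[OF this]
  show "continuous_on (T \<times> closure \<Omega>) (\<lambda>(t, x). boundary_ext T \<Omega> u t x)"
    "\<And>t x. t \<in> T \<Longrightarrow> x \<in> \<Omega> \<Longrightarrow> boundary_ext T \<Omega> u t x = u t x"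
    unfolding boundary_ext_def by blast+
qed

lemma continuous_on_slice:
  assumes "continuous_on (T \<times> S) (\<lambda>(t, x). f t x)" "t \<in> T"
  shows "continuous_on S (f t)"
  using assms(2) by (intro continuous_on_compose2[OF assms(1), where f = "\<lambda>x. (t, x)", simplified]) (auto intro!: continuous_intros)

text \<open>A frontier point of an open set is a limit point of it, so the limit in
  \<open>normal_derivative\<close> is unique and equals the value of a continuous extension of the
  gradient.\<close>

lemma normal_derivative_eq:
  assumes "open \<Omega>" "x \<in> frontier \<Omega>" "continuous_on (closure \<Omega>) g" "\<And>y. y \<in> \<Omega> \<Longrightarrow> g y = grad f y"
  shows "normal_derivative \<Omega> f x = outward_normal \<Omega> x \<bullet> g x"
proof -
  have x: "x \<in> closure \<Omega>" "x \<notin> \<Omega>" using assms(1,2) by (auto simp: frontier_def interior_open)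
  have "(g \<longlongrightarrow> g x) (at x within closure \<Omega>)"
    using assms(3) x by (simp add: continuous_on_def)
  then have "(g \<longlongrightarrow> g x) (at x within \<Omega>)"
    by (rule tendsto_within_subset) (rule closure_subset)
  moreover have "\<forall>\<^sub>F y in at x within \<Omega>. g y = grad f y"
    using assms(4) by (auto simp: eventually_at_filter)
  ultimately have "(grad f \<longlongrightarrow> g x) (at x within \<Omega>)" by (rule Lim_transform_eventually)
  moreover have "\<not> trivial_limit (at x within \<Omega>)"
    using x by (simp add: trivial_limit_within closure_def)
  ultimately have "Lim (at x within \<Omega>) (grad f) = g x" by (intro tendsto_Lim)
  then show ?thesis by (simp add: normal_derivative_def)
qed

lemma set_integral_eq_0_imp:
  fixes f :: "'a::euclidean_space \<Rightarrow> real"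
  assumes \<Omega>: "open \<Omega>" "bounded \<Omega>" and f: "continuous_on \<Omega> f" "set_integrable lborel \<Omega> f" "\<And>x. x \<in> \<Omega> \<Longrightarrow> f x \<ge> 0"
    and z: "(LBINT x:\<Omega>. f x) = 0" and x: "x \<in> \<Omega>"
  shows "f x = 0"
proof (rule ccontr)
  assume "f x \<noteq> 0"
  then have pos: "f x > 0" using f(3)[OF x] by simp
  define W where "W = \<Omega> \<inter> f -` {f x / 2<..}"
  have W: "open W" "x \<in> W" "W \<subseteq> \<Omega>"
    using continuous_open_preimage[OF f(1) \<Omega>(1) open_greaterThan, of "f x / 2"] x pos by (auto simp: W_def)
  have bW: "bounded W" using \<Omega>(2) W(3) bounded_subset by blast
  have mW: "measure lborel W > 0" using measure_open_pos W bW by blast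
  have iW: "set_integrable lborel W f" using W by (intro set_integrable_subset[OF f(2)]) auto
  have "(LBINT y:W. f x / 2) \<le> (LBINT y:W. f y)"
    using iW W(1) emeasure_bounded_finite[OF bW] by (intro set_integral_mono_on) (auto simp: W_def set_integrable_def)
  also have "\<dots> \<le> (LBINT y:\<Omega>. f y)"
    using W f by (intro set_integral_mono_set) auto
  finally have "measure lborel W * (f x / 2) \<le> 0" using z by (simp add: set_lebesgue_integral_def)
  then show False using mW pos by (simp add: mult_le_0_iff)
qed

text \<open>Here \<open>s\<close>, \<open>p\<close> and \<open>e\<close> stand for the
  concentration, its gradient and the gradient of the potential. With \<open>q = s + d\<close> and
  \<open>a = p / q + z e\<close>, the flux is \<open>D (q a - d z e)\<close>, so the product is
  \<open>D q (norm a)\<^sup>2\<close> up to \<open>d z (a \<bullet> e)\<close>. This defect is paid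
  with half of the square, which is the origin of \<open>Dm / 2\<close>; the other half is expanded
  and its nonnegative term in \<open>z\<^sup>2 (norm e)\<^sup>2\<close> discarded.\<close>

lemma dissipation_pointwise:
  fixes p e :: "'a::real_inner"
  assumes "Dm > 0" "Dm \<le> D" "s \<ge> 0" "d > 0"
  shows "((1 / (s + d)) *\<^sub>R p + z *\<^sub>R e) \<bullet> (D *\<^sub>R (p + (z * s) *\<^sub>R e)) \<ge>
    Dm / 2 * ((norm p)\<^sup>2 / (s + d) + 2 * (z * (p \<bullet> e))) - d * (D * z\<^sup>2 / 2 * (norm e)\<^sup>2)"
proof -
  define q where "q = s + d"
  have q: "q > 0" "d \<le> q" using assms by (auto simp: q_def)
  define a where "a = (1 / q) *\<^sub>R p + z *\<^sub>R e"
  have na: "q * (norm a)\<^sup>2 = (norm p)\<^sup>2 / q + 2 * (z * (p \<bullet> e)) + q * (z\<^sup>2 * (norm e)\<^sup>2)"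
    unfolding power2_norm_eq_inner a_def using q(1)
    by (simp add: inner_add_left inner_add_right inner_commute[of e p] field_simps) (simp add: power2_eq_square algebra_simps)
  have eq: "p + (z * s) *\<^sub>R e = q *\<^sub>R a - (d * z) *\<^sub>R e"
    using q by (simp add: a_def q_def scaleR_add_right scaleR_add_left algebra_simps)
  have "0 \<le> (norm (q *\<^sub>R a - (d * z) *\<^sub>R e))\<^sup>2" by simp
  also have "\<dots> = q\<^sup>2 * (norm a)\<^sup>2 - 2 * (q * (d * z * (a \<bullet> e))) + d\<^sup>2 * (z\<^sup>2 * (norm e)\<^sup>2)"
    unfolding power2_norm_eq_inner by (simp add: inner_diff_left inner_diff_right inner_commute[of e a] power2_eq_square algebra_simps)
  finally have "q * (d * z * (a \<bullet> e)) \<le> q * (q * (norm a)\<^sup>2 / 2) + d * (d * (z\<^sup>2 * (norm e)\<^sup>2)) / 2"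
    by (simp add: power2_eq_square algebra_simps)
  also have "\<dots> \<le> q * (q * (norm a)\<^sup>2 / 2) + q * (d * (z\<^sup>2 * (norm e)\<^sup>2)) / 2"
    using q assms(4) by (intro add_mono divide_right_mono mult_right_mono) auto
  also have "\<dots> = q * (q * (norm a)\<^sup>2 / 2 + d * (z\<^sup>2 * (norm e)\<^sup>2) / 2)" by (simp add: algebra_simps)
  finally have le: "d * z * (a \<bullet> e) \<le> q * (norm a)\<^sup>2 / 2 + d * (z\<^sup>2 * (norm e)\<^sup>2) / 2"
    using q(1) by (simp add: mult_le_cancel_left_pos)
  have "a \<bullet> (p + (z * s) *\<^sub>R e) = q * (norm a)\<^sup>2 - d * z * (a \<bullet> e)"
    unfolding eq by (simp add: inner_diff_right power2_norm_eq_inner)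
  then have "a \<bullet> (p + (z * s) *\<^sub>R e) \<ge> q * (norm a)\<^sup>2 / 2 - d * (z\<^sup>2 * (norm e)\<^sup>2) / 2" using le by simp
  then have "D * (a \<bullet> (p + (z * s) *\<^sub>R e)) \<ge> D * (q * (norm a)\<^sup>2 / 2 - d * (z\<^sup>2 * (norm e)\<^sup>2) / 2)"
    using assms by (intro mult_left_mono) auto
  moreover have "D * (q * (norm a)\<^sup>2 / 2) \<ge> Dm * (q * (norm a)\<^sup>2 / 2)"
    using assms q by (intro mult_right_mono) auto
  moreover have "Dm * (q * (norm a)\<^sup>2 / 2) \<ge> Dm * (((norm p)\<^sup>2 / q + 2 * (z * (p \<bullet> e))) / 2)"
    unfolding na using assms q by (intro mult_left_mono divide_right_mono) auto
  ultimately have "D * (a \<bullet> (p + (z * s) *\<^sub>R e)) \<ge>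
      Dm * (((norm p)\<^sup>2 / q + 2 * (z * (p \<bullet> e))) / 2) - D * (d * (z\<^sup>2 * (norm e)\<^sup>2) / 2)"
    unfolding right_diff_distrib by linarith
  then show ?thesis by (simp add: a_def q_def mult_ac)
qed

text \<open>The cutoffs are parameters because they come from \<Omega> alone and are obtained once,
  before any solution is fixed.\<close>

locale nernst_planck =
  fixes \<Omega> :: "'a::euclidean_space set" and N :: nat and D :: "nat \<Rightarrow> real" and \<epsilon> :: real and z :: "nat \<Rightarrow> real"
    and c :: "nat \<Rightarrow> real \<Rightarrow> 'a \<Rightarrow> real" and \<Phi> :: "real \<Rightarrow> 'a \<Rightarrow> real"
    and k :: "nat \<Rightarrow> 'a \<Rightarrow> real" and k' :: "nat \<Rightarrow> 'a \<Rightarrow> 'a"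
  assumes k: "boundary_cutoffs \<Omega> k k'" and dom: "smooth_bounded_domain \<Omega>"
    and D: "\<And>i. i < N \<Longrightarrow> D i > 0" and eps: "\<epsilon> > 0" and sol: "nernst_planck_solution \<Omega> N D \<epsilon> z c \<Phi>"
begin

lemma \<Omega>: "open \<Omega>" "bounded \<Omega>" "\<Omega> \<noteq> {}"
  using dom by (auto simp: smooth_bounded_domain_def)

text \<open>Continuous extensions to the closure make the integrands continuous on a compact set,
  hence integrable, and change nothing on \<Omega>. Only \<open>gc\<close> is restricted to positive
  times, where alone the gradients of the concentrations are controlled.\<close>

definition "cc i = boundary_ext {0..} \<Omega> (c i)"
definition "gc i = boundary_ext {0<..} \<Omega> (\<lambda>t. grad (c i t))"
definition "pc = boundary_ext {0..} \<Omega> \<Phi>"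
definition "gp = boundary_ext {0..} \<Omega> (\<lambda>t. grad (\<Phi> t))"
definition "flux i t y = D i *\<^sub>R (grad (c i t) y + (z i * c i t y) *\<^sub>R grad (\<Phi> t) y)"
definition "flux_ext i t y = D i *\<^sub>R (gc i t y + (z i * cc i t y) *\<^sub>R gp t y)"
definition "\<rho> t x = (\<Sum>i<N. z i * cc i t x)"

lemma cc: "i < N \<Longrightarrow> continuous_on ({0..} \<times> closure \<Omega>) (\<lambda>(t, x). cc i t x)"
    "i < N \<Longrightarrow> t \<ge> 0 \<Longrightarrow> x \<in> \<Omega> \<Longrightarrow> cc i t x = c i t x"
  and gc: "i < N \<Longrightarrow> continuous_on ({0<..} \<times> closure \<Omega>) (\<lambda>(t, x). gc i t x)"
    "i < N \<Longrightarrow> t > 0 \<Longrightarrow> x \<in> \<Omega> \<Longrightarrow> gc i t x = grad (c i t) x"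
  and pc: "continuous_on ({0..} \<times> closure \<Omega>) (\<lambda>(t, x). pc t x)"
    "t \<ge> 0 \<Longrightarrow> x \<in> \<Omega> \<Longrightarrow> pc t x = \<Phi> t x"
  and gp: "continuous_on ({0..} \<times> closure \<Omega>) (\<lambda>(t, x). gp t x)"
    "t \<ge> 0 \<Longrightarrow> x \<in> \<Omega> \<Longrightarrow> gp t x = grad (\<Phi> t) x"
  using sol boundary_ext[of "{0..}" \<Omega> "c i"] boundary_ext[of "{0<..}" \<Omega> "\<lambda>t. grad (c i t)"]
    boundary_ext[of "{0..}" \<Omega> \<Phi>] boundary_ext[of "{0..}" \<Omega> "\<lambda>t. grad (\<Phi> t)"]
  unfolding nernst_planck_solution_def cc_def gc_def pc_def gp_def by auto

lemma cc_pos: "i < N \<Longrightarrow> continuous_on ({0<..} \<times> closure \<Omega>) (\<lambda>(t, x). cc i t x)"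
  and gp_pos: "continuous_on ({0<..} \<times> closure \<Omega>) (\<lambda>(t, x). gp t x)"
  by (rule continuous_on_subset[OF cc(1)], assumption, force) (rule continuous_on_subset[OF gp(1)], force)

lemma c_nonneg: "i < N \<Longrightarrow> t \<ge> 0 \<Longrightarrow> x \<in> \<Omega> \<Longrightarrow> c i t x \<ge> 0"
  using sol by (auto simp: nernst_planck_solution_def)

lemma slices:
  assumes "i < N" "t \<ge> 0"
  shows "continuous_on (closure \<Omega>) (cc i t)" "t > 0 \<Longrightarrow> continuous_on (closure \<Omega>) (gc i t)"
  using assms by (auto intro: continuous_on_slice[OF cc(1)] continuous_on_slice[OF gc(1)])

lemma slices':
  assumes "t \<ge> 0"
  shows "continuous_on (closure \<Omega>) (pc t)" "continuous_on (closure \<Omega>) (gp t)"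
  using assms by (auto intro: continuous_on_slice[OF pc(1)] continuous_on_slice[OF gp(1)])

lemma cc_nonneg: "i < N \<Longrightarrow> t \<ge> 0 \<Longrightarrow> x \<in> closure \<Omega> \<Longrightarrow> cc i t x \<ge> 0"
proof -
  assume a: "i < N" "t \<ge> 0" "x \<in> closure \<Omega>"
  have "cc i t ` closure \<Omega> \<subseteq> {0..}"
    using slices(1)[OF a(1,2)] cc(2)[OF a(1,2)] c_nonneg[OF a(1,2)] by (intro image_closure_subset) auto
  then show ?thesis using a(3) by auto
qed

lemma C2_c: "i < N \<Longrightarrow> C2_in_space {0<..} \<Omega> (c i)" and C2_\<Phi>: "C2_in_space {0<..} \<Omega> \<Phi>"
  using sol by (auto simp: nernst_planck_solution_def)

lemma derivatives:
  assumes "t > 0" "x \<in> \<Omega>"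
  shows "i < N \<Longrightarrow> (c i t has_derivative (\<lambda>h. gc i t x \<bullet> h)) (at x)" "(\<Phi> t has_derivative (\<lambda>h. gp t x \<bullet> h)) (at x)"
  using C2_c[of i] C2_\<Phi> assms gc(2) gp(2) has_derivative_grad[of "c i t" x] has_derivative_grad[of "\<Phi> t" x]
  by (auto simp: C2_in_space_def)

lemma in_cl: "x \<in> \<Omega> \<Longrightarrow> x \<in> closure \<Omega>"
  using closure_subset by blast

lemma C1_bounded_ext:
  assumes "continuous_on (closure \<Omega>) f" "continuous_on (closure \<Omega>) f'"
    and "\<And>x. x \<in> \<Omega> \<Longrightarrow> (g has_derivative (\<lambda>h. f' x \<bullet> h)) (at x)" "\<And>x. x \<in> \<Omega> \<Longrightarrow> g x = f x"
  shows "C1_bounded \<Omega> g f'"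
proof -
  have cp: "compact (closure \<Omega>)" using \<Omega> by (simp add: compact_closure)
  have "bounded (f ` closure \<Omega>)" "bounded (f' ` closure \<Omega>)"
    using assms(1,2) cp by (auto intro!: compact_imp_bounded compact_continuous_image)
  moreover have "g ` \<Omega> = f ` \<Omega>" using assms(4) by (metis image_cong)
  ultimately have "bounded (g ` \<Omega>)" "bounded (f' ` \<Omega>)"
    using closure_subset by (metis bounded_subset image_mono)+
  then show ?thesis
    unfolding C1_bounded_def using assms(3) continuous_on_subset[OF assms(2) closure_subset] by auto
qed

lemma C1_bounded_\<Phi>: "t > 0 \<Longrightarrow> C1_bounded \<Omega> (\<Phi> t) (gp t)"
  using slices'[of t] pc(2)[of t] derivatives(2)[of t] by (intro C1_bounded_ext[of "pc t"]) auto

lemma C1_bounded_c: "t > 0 \<Longrightarrow> i < N \<Longrightarrow> C1_bounded \<Omega> (c i t) (gc i t)"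
  using slices[of i t] cc(2)[of i t] derivatives(1)[of t] by (intro C1_bounded_ext[of "cc i t"]) auto

lemma normal_c: "i < N \<Longrightarrow> t > 0 \<Longrightarrow> x \<in> frontier \<Omega> \<Longrightarrow> gc i t x \<bullet> outward_normal \<Omega> x = 0"
  and normal_\<Phi>: "t > 0 \<Longrightarrow> x \<in> frontier \<Omega> \<Longrightarrow> gp t x \<bullet> outward_normal \<Omega> x = 0"
proof -
  assume t: "t > 0" and x: "x \<in> frontier \<Omega>"
  show "gc i t x \<bullet> outward_normal \<Omega> x = 0" if i: "i < N"
    using normal_derivative_eq[OF \<Omega>(1) x slices(2)[OF i, of t], of "c i t"] sol t x i gc(2)
    by (simp add: nernst_planck_solution_def inner_commute)
  show "gp t x \<bullet> outward_normal \<Omega> x = 0"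
    using normal_derivative_eq[OF \<Omega>(1) x slices'(2)[of t], of "\<Phi> t"] sol t x gp(2)
    by (simp add: nernst_planck_solution_def inner_commute)
qed

lemma flux_has_derivative:
  assumes "i < N" "t > 0" "x \<in> \<Omega>"
  defines "f' \<equiv> \<lambda>h. frechet_derivative (grad (c i t)) (at x) h + (z i * c i t x) *\<^sub>R frechet_derivative (grad (\<Phi> t)) (at x) h + (z i * (gc i t x \<bullet> h)) *\<^sub>R gp t x"
  shows "((\<lambda>y. grad (c i t) y + (z i * c i t y) *\<^sub>R grad (\<Phi> t) y) has_derivative f') (at x)"
    and "(flux i t has_derivative (\<lambda>h. D i *\<^sub>R f' h)) (at x)"
proof -
  have "(grad (c i t) has_derivative frechet_derivative (grad (c i t)) (at x)) (at x)"
    "(grad (\<Phi> t) has_derivative frechet_derivative (grad (\<Phi> t)) (at x)) (at x)"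
    using C2_c[OF assms(1)] C2_\<Phi> assms(2,3) by (auto simp: C2_in_space_def frechet_derivative_works)
  note d = this derivatives(1)[OF assms(2,3,1)]
  show *: "((\<lambda>y. grad (c i t) y + (z i * c i t y) *\<^sub>R grad (\<Phi> t) y) has_derivative f') (at x)"
    unfolding f'_def using assms gp(2)
    by (auto intro!: derivative_eq_intros d simp: algebra_simps)
  show "(flux i t has_derivative (\<lambda>h. D i *\<^sub>R f' h)) (at x)"
    unfolding flux_def by (rule has_derivative_scaleR_right[OF *])
qed

lemma conservation: "i < N \<Longrightarrow> conservation_law \<Omega> (c i) (gc i) (flux i) (flux_ext i) (cc i) k k'"
proof unfold_locales
  assume i: "i < N"
  show "boundary_cutoffs \<Omega> k k'" "open \<Omega>" "bounded \<Omega>" using k \<Omega> by auto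
  show "continuous_on ({0<..} \<times> closure \<Omega>) (\<lambda>(t, x). cc i t x)"
    "continuous_on ({0<..} \<times> closure \<Omega>) (\<lambda>(t, x). gc i t x)" using cc_pos gc(1) i by auto
  have "continuous_on ({0<..} \<times> closure \<Omega>) (\<lambda>p. cc i (fst p) (snd p))" "continuous_on ({0<..} \<times> closure \<Omega>) (\<lambda>p. gc i (fst p) (snd p))"
    "continuous_on ({0<..} \<times> closure \<Omega>) (\<lambda>p. gp (fst p) (snd p))"
    using cc_pos[OF i] gc(1)[OF i] gp_pos by (simp_all add: split_beta')
  note cont = this
  show "continuous_on ({0<..} \<times> closure \<Omega>) (\<lambda>(t, x). flux_ext i t x)"
    unfolding flux_ext_def split_beta' by (intro continuous_intros cont)
  fix t :: real and x assume t: "t > 0"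
  show "x \<in> frontier \<Omega> \<Longrightarrow> flux_ext i t x \<bullet> outward_normal \<Omega> x = 0"
    using normal_c[OF i t] normal_\<Phi>[OF t] by (simp add: flux_ext_def inner_add_left)
  assume x: "x \<in> \<Omega>"
  show "(c i t has_derivative (\<lambda>h. gc i t x \<bullet> h)) (at x)" "cc i t x = c i t x" "c i t x \<ge> 0" "flux_ext i t x = flux i t x"
    using derivatives(1)[OF t x i] cc(2)[OF i] c_nonneg[OF i] gc(2)[OF i] gp(2) t x by (auto simp: flux_ext_def flux_def)
  note fd = flux_has_derivative[OF i t x]
  show "flux i t differentiable (at x)" using fd(2) by (auto simp: differentiable_def)
  have "divergence (flux i t) x = D i * divergence (\<lambda>y. grad (c i t) y + (z i * c i t y) *\<^sub>R grad (\<Phi> t) y) x"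
    unfolding divergence_def frechet_derivative_at[OF fd(1), symmetric] frechet_derivative_at[OF fd(2), symmetric]
    by (simp add: sum_distrib_left)
  then show "((\<lambda>s. c i s x) has_real_derivative divergence (flux i t) x) (at t)"
    using sol i t x by (simp add: nernst_planck_solution_def)
next
  assume i: "i < N"
  fix b :: 'a assume b: "b \<in> Basis"
  have sub: "{0<..} \<times> \<Omega> \<subseteq> ({0<..} \<times> closure \<Omega> :: (real \<times> 'a) set)" using in_cl by auto
  have "continuous_on ({0<..} \<times> \<Omega>) (\<lambda>p. cc i (fst p) (snd p))" "continuous_on ({0<..} \<times> \<Omega>) (\<lambda>p. gc i (fst p) (snd p))"
    "continuous_on ({0<..} \<times> \<Omega>) (\<lambda>p. gp (fst p) (snd p))"
    "continuous_on ({0<..} \<times> \<Omega>) (\<lambda>p. frechet_derivative (grad (c i (fst p))) (at (snd p)) b)"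
    "continuous_on ({0<..} \<times> \<Omega>) (\<lambda>p. frechet_derivative (grad (\<Phi> (fst p))) (at (snd p)) b)"
    using continuous_on_subset[OF cc_pos[OF i] sub] continuous_on_subset[OF gc(1)[OF i] sub] continuous_on_subset[OF gp_pos sub]
      C2_c[OF i] C2_\<Phi> b by (auto simp: split_beta' C2_in_space_def)
  note cont = this
  have "continuous_on ({0<..} \<times> \<Omega>) (\<lambda>p. D i *\<^sub>R (frechet_derivative (grad (c i (fst p))) (at (snd p)) b +
      (z i * cc i (fst p) (snd p)) *\<^sub>R frechet_derivative (grad (\<Phi> (fst p))) (at (snd p)) b + (z i * (gc i (fst p) (snd p) \<bullet> b)) *\<^sub>R gp (fst p) (snd p)))"
    by (intro continuous_intros cont)
  then show "continuous_on ({0<..} \<times> \<Omega>) (\<lambda>(t, x). frechet_derivative (flux i t) (at x) b)"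
  proof (rule continuous_on_eq)
    fix p :: "real \<times> 'a" assume "p \<in> {0<..} \<times> \<Omega>"
    then have p: "fst p > 0" "snd p \<in> \<Omega>" by auto
    show "D i *\<^sub>R (frechet_derivative (grad (c i (fst p))) (at (snd p)) b +
      (z i * cc i (fst p) (snd p)) *\<^sub>R frechet_derivative (grad (\<Phi> (fst p))) (at (snd p)) b + (z i * (gc i (fst p) (snd p) \<bullet> b)) *\<^sub>R gp (fst p) (snd p)) =
      (case p of (t, x) \<Rightarrow> frechet_derivative (flux i t) (at x) b)"
      using frechet_derivative_at[OF flux_has_derivative(2)[OF i p], symmetric] cc(2)[OF i _ p(2), of "fst p"] p
      by (simp add: split_beta')
  qed
qed

lemma ci: "continuous_on (closure \<Omega>) f \<Longrightarrow> set_integrable lborel \<Omega> f" for f :: "'a \<Rightarrow> real"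
  using \<Omega> by (intro set_integrable_continuous_closure)

lemma cong: "(\<And>x. x \<in> \<Omega> \<Longrightarrow> f x = g x) \<Longrightarrow> (LBINT x:\<Omega>. f x) = (LBINT x:\<Omega>. g x)" for f g :: "'a \<Rightarrow> real"
  using \<Omega> by (intro set_lebesgue_integral_cong) auto

text \<open>The weak form with \<open>w = 1\<close> and \<open>H s = s\<close> has integrand 0, so
  the mass is constant at positive times; continuity of the extension carries this down to time
  0.\<close>

lemma mass_conserved:
  assumes i: "i < N" and t: "t \<ge> 0"
  shows "(LBINT x:\<Omega>. cc i t x) = (LBINT x:\<Omega>. c i 0 x)"
proof -
  interpret conservation_law \<Omega> "c i" "gc i" "flux i" "flux_ext i" "cc i" k k' by (rule conservation[OF i])
  define m where "m t = (LBINT x:\<Omega>. cc i t x)" for t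
  have cm: "continuous_on {0..} m" unfolding m_def by (rule continuous_on_set_integral_param[OF \<Omega>(1,2) cc(1)[OF i]])
  have "m s = m r" if "0 < s" "s < r" for s r
  proof -
    have "((\<lambda>\<tau>. - (LBINT x:\<Omega>. ((\<lambda>_. 1) (c i \<tau> x) *\<^sub>R (\<lambda>_. 0) x + (1 * (\<lambda>_. 0) (c i \<tau> x)) *\<^sub>R gc i \<tau> x) \<bullet> flux i \<tau> x)) has_integral
       ((LBINT x:\<Omega>. 1 * c i r x) - (LBINT x:\<Omega>. 1 * c i s x))) {s..r}"
      by (rule weak_form[where w = "\<lambda>_. 1" and wc = "\<lambda>_. 1" and wc' = "\<lambda>_. 0" and H = "\<lambda>s. s"])
        (use that in \<open>auto simp: C1_bounded_def image_constant_conv\<close>)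
    then have "((\<lambda>\<tau>. 0) has_integral ((LBINT x:\<Omega>. c i r x) - (LBINT x:\<Omega>. c i s x))) {s..r}" by simp
    then have "(LBINT x:\<Omega>. c i r x) = (LBINT x:\<Omega>. c i s x)" using has_integral_0_eq by fastforce
    moreover have "m \<tau> = (LBINT x:\<Omega>. c i \<tau> x)" if "\<tau> > 0" for \<tau>
      unfolding m_def using cc(2)[OF i] that by (intro cong) auto
    ultimately show ?thesis using that by simp
  qed
  then have m1: "m s = m 1" if "s \<in> {0<..}" for s using that by (cases s "1::real" rule: linorder_cases) auto
  have m1': "m s = m 1" if "s \<ge> 0" for s
  proof (rule continuous_constant_on_closure[of "{0<..}" m])
    show "continuous_on (closure {0<..}) m" using cm by (simp only: closure_greaterThan)
    show "s \<in> closure {0<..}" using that by (simp only: closure_greaterThan atLeast_iff)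
  qed (rule m1)
  have "m t = m 0" using m1'[OF t] m1'[of 0] by simp
  moreover have "m 0 = (LBINT x:\<Omega>. c i 0 x)"
    unfolding m_def using cc(2)[OF i] by (intro cong) auto
  ultimately show ?thesis by (simp add: m_def)
qed


lemma vol: "measure lborel \<Omega> > 0"
  using measure_open_pos \<Omega> by blast

lemma mean_nonneg: "i < N \<Longrightarrow> mean \<Omega> (c i 0) \<ge> 0"
proof -
  assume i: "i < N"
  have "(LBINT x:\<Omega>. (0::real)) \<le> (LBINT x:\<Omega>. cc i 0 x)"
    using cc_nonneg[OF i, of 0] in_cl by (intro set_integral_mono_on ci slices i) auto
  then show ?thesis using mass_conserved[OF i, of 0] vol by (simp add: mean_def set_lebesgue_integral_def)
qed

section \<open>The regularised energy and its time derivative\<close>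

text \<open>Reference and argument are shifted by the same \<open>d\<close>: the mean of the shifted
  concentration is then the shifted mean, as the logarithmic Sobolev inequality requires, and the
  shifted concentration is bounded below by \<open>d\<close>.\<close>

definition "entropy i d t = (LBINT x:\<Omega>. entropy_density (mean \<Omega> (c i 0) + d) (cc i t x + d))"
definition "electric t = \<epsilon> / 2 * (LBINT x:\<Omega>. (norm (gp t x))\<^sup>2)"

lemma entropy_continuous:
  assumes "i < N" "d > 0"
  shows "continuous_on {0..} (entropy i d)"
  unfolding entropy_def
proof (rule continuous_on_set_integral_param[OF \<Omega>(1,2)])
  have "continuous_on ({0..} \<times> closure \<Omega>) (\<lambda>p. cc i (fst p) (snd p))" using cc(1)[OF assms(1)] by (simp add: split_beta')
  moreover have "mean \<Omega> (c i 0) + d > 0" using mean_nonneg[OF assms(1)] assms(2) by simp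
  moreover have "cc i (fst p) (snd p) + d > 0" if "p \<in> {0..} \<times> closure \<Omega>" for p
    using cc_nonneg[OF assms(1), of "fst p" "snd p"] that assms(2) by auto
  ultimately show "continuous_on ({0..} \<times> closure \<Omega>) (\<lambda>(t, x). entropy_density (mean \<Omega> (c i 0) + d) (cc i t x + d))"
    unfolding entropy_density_def split_beta'
    by (intro continuous_intros) (auto simp: less_imp_neq[THEN not_sym])
qed

lemma gp_square_continuous: "continuous_on {0..} (\<lambda>t. LBINT x:\<Omega>. (norm (gp t x))\<^sup>2)"
proof (rule continuous_on_set_integral_param[OF \<Omega>(1,2)])
  have "continuous_on ({0..} \<times> closure \<Omega>) (\<lambda>p. gp (fst p) (snd p))" using gp(1) by (simp add: split_beta')
  then show "continuous_on ({0..} \<times> closure \<Omega>) (\<lambda>(t, x). (norm (gp t x))\<^sup>2)"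
    unfolding split_beta' by (intro continuous_intros)
qed

lemma electric_continuous: "continuous_on {0..} electric"
  unfolding electric_def by (intro continuous_intros gp_square_continuous)

lemma flux_ext_continuous: "i < N \<Longrightarrow> continuous_on ({0<..} \<times> closure \<Omega>) (\<lambda>(t, x). flux_ext i t x)"
  using conservation_law.G(1)[OF conservation] .

text \<open>The weak form with \<open>w = 1\<close> and
  \<open>H s = entropy_density m (s + d)\<close>, hence \<open>H'' s = 1 / (s + d)\<close>, makes
  the increment of the entropy a time integral of a continuous function.\<close>

lemma entropy_derivative:
  assumes i: "i < N" and d: "d > 0" and t: "t > 0"
  shows "(entropy i d has_real_derivative - (LBINT x:\<Omega>. ((1 / (cc i t x + d)) *\<^sub>R gc i t x) \<bullet> flux_ext i t x)) (at t)"
proof -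
  interpret conservation_law \<Omega> "c i" "gc i" "flux i" "flux_ext i" "cc i" k k' by (rule conservation[OF i])
  define m where "m = mean \<Omega> (c i 0) + d"
  have m: "m > 0" using mean_nonneg[OF i] d by (simp add: m_def)
  define Q where "Q t = (LBINT x:\<Omega>. ((1 / (cc i t x + d)) *\<^sub>R gc i t x) \<bullet> flux_ext i t x)" for t
  have cQ: "continuous_on {0<..} Q"
    unfolding Q_def
  proof (rule continuous_on_set_integral_param[OF \<Omega>(1,2)])
    have "continuous_on ({0<..} \<times> closure \<Omega>) (\<lambda>p. cc i (fst p) (snd p))" "continuous_on ({0<..} \<times> closure \<Omega>) (\<lambda>p. gc i (fst p) (snd p))"
      "continuous_on ({0<..} \<times> closure \<Omega>) (\<lambda>p. flux_ext i (fst p) (snd p))"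
      using cc_pos[OF i] gc(1)[OF i] flux_ext_continuous[OF i] by (simp_all add: split_beta')
    moreover have "cc i (fst p) (snd p) + d \<noteq> 0" if "p \<in> {0<..} \<times> closure \<Omega>" for p
      using cc_nonneg[OF i, of "fst p" "snd p"] that d by auto
    ultimately show "continuous_on ({0<..} \<times> closure \<Omega>) (\<lambda>(t, x). ((1 / (cc i t x + d)) *\<^sub>R gc i t x) \<bullet> flux_ext i t x)"
      unfolding split_beta' by (intro continuous_intros) auto
  qed
  \<comment> \<open>The kernel does not depend on its first argument; halving it compensates its
    double occurrence in \<open>has_derivative_from_kernel\<close>.\<close>
  have "(entropy i d has_real_derivative 2 * ((\<lambda>_ \<tau>. - Q \<tau> / 2) t t)) (at t)"
  proof (rule has_derivative_from_kernel[OF _ _ t])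
    have "continuous_on ({0<..} \<times> {0<..}) (\<lambda>p::real \<times> real. Q (snd p))"
      by (rule continuous_on_compose2[OF cQ]) (auto intro!: continuous_intros)
    then show "continuous_on ({0<..} \<times> {0<..}) (\<lambda>(a::real, b). - Q b / 2)"
      unfolding split_beta' by (intro continuous_intros) auto
    fix s t :: real assume st: "0 < s" "s < t"
    have der1: "((\<lambda>s. entropy_density m (s + d)) has_real_derivative ln ((s + d) / m)) (at s)" if "s \<ge> 0" for s
    proof -
      have "((\<lambda>s. s + d) has_real_derivative 1) (at s)" by (auto intro!: derivative_eq_intros)
      from DERIV_chain2[OF entropy_density_has_derivative[OF m, of "s + d"] this] show ?thesis using that d by simp
    qed
    have der2: "((\<lambda>s. ln ((s + d) / m)) has_real_derivative 1 / (s + d)) (at s)" if "s \<ge> 0" for s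
      using that d m by (auto intro!: derivative_eq_intros simp: field_simps)
    have "((\<lambda>\<tau>. - (LBINT x:\<Omega>. (ln ((c i \<tau> x + d) / m) *\<^sub>R 0 + (1 * (1 / (c i \<tau> x + d))) *\<^sub>R gc i \<tau> x) \<bullet> flux i \<tau> x)) has_integral
       ((LBINT x:\<Omega>. 1 * entropy_density m (c i t x + d)) - (LBINT x:\<Omega>. 1 * entropy_density m (c i s x + d)))) {s..t}"
      by (rule weak_form[where w = "\<lambda>_. 1" and w' = "\<lambda>_. 0" and wc = "\<lambda>_. 1" and wc' = "\<lambda>_. 0" and H = "\<lambda>s. entropy_density m (s + d)"
          and H' = "\<lambda>s. ln ((s + d) / m)" and H'' = "\<lambda>s. 1 / (s + d)"])
        (use st d der1 der2 in \<open>auto simp: C1_bounded_def image_constant_conv intro!: continuous_intros\<close>)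
    moreover have "(LBINT x:\<Omega>. 1 * entropy_density m (c i \<tau> x + d)) = entropy i d \<tau>" if "\<tau> > 0" for \<tau>
      unfolding entropy_def m_def using cc(2)[OF i] that by (intro cong) auto
    ultimately have "((\<lambda>\<tau>. - (LBINT x:\<Omega>. (ln ((c i \<tau> x + d) / m) *\<^sub>R 0 + (1 * (1 / (c i \<tau> x + d))) *\<^sub>R gc i \<tau> x) \<bullet> flux i \<tau> x)) has_integral
       (entropy i d t - entropy i d s)) {s..t}" using st by simp
    then show "((\<lambda>\<tau>. - Q \<tau> / 2 + - Q \<tau> / 2) has_integral (entropy i d t - entropy i d s)) {s..t}"
    proof (rule has_integral_eq[rotated])
      fix \<tau> assume "\<tau> \<in> {s..t}"
      then have "(LBINT x:\<Omega>. (ln ((c i \<tau> x + d) / m) *\<^sub>R 0 + (1 * (1 / (c i \<tau> x + d))) *\<^sub>R gc i \<tau> x) \<bullet> flux i \<tau> x) = Q \<tau>"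
        unfolding Q_def using st cc(2)[OF i] G(2) by (intro cong) auto
      then show "- (LBINT x:\<Omega>. (ln ((c i \<tau> x + d) / m) *\<^sub>R 0 + (1 * (1 / (c i \<tau> x + d))) *\<^sub>R gc i \<tau> x) \<bullet> flux i \<tau> x) = - Q \<tau> / 2 + - Q \<tau> / 2"
        by simp
    qed
  qed
  then show ?thesis by (simp add: Q_def)
qed

lemma \<rho>_continuous: "t \<ge> 0 \<Longrightarrow> continuous_on (closure \<Omega>) (\<rho> t)"
  unfolding \<rho>_def by (intro continuous_intros slices) auto

text \<open>By the Poisson equation the divergence of \<open>grad (\<Phi> t)\<close> is
  \<open>- \<rho> t / \<epsilon>\<close>, which is bounded, so the Green identity with Neumann
  condition applies.\<close>

lemma green_\<Phi>:
  assumes w: "C1_bounded \<Omega> w w'" and t: "t > 0"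
  shows "(LBINT x:\<Omega>. w x * \<rho> t x) = \<epsilon> * (LBINT x:\<Omega>. w' x \<bullet> gp t x)"
proof -
  have div: "divergence (grad (\<Phi> t)) x = - \<rho> t x / \<epsilon>" if x: "x \<in> \<Omega>" for x
  proof -
    have "- \<epsilon> * divergence (grad (\<Phi> t)) x = (\<Sum>i<N. z i * c i t x)"
      using sol t x by (auto simp: nernst_planck_solution_def laplacian_def)
    also have "\<dots> = \<rho> t x" unfolding \<rho>_def using cc(2) t x by (intro sum.cong) auto
    finally show ?thesis using eps by (simp add: field_simps)
  qed
  have "bounded ((\<lambda>x. - \<rho> t x / \<epsilon>) ` closure \<Omega>)"
    using \<Omega> t eps by (intro compact_imp_bounded compact_continuous_image continuous_intros \<rho>_continuous) (auto simp: compact_closure)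
  then have "bounded ((\<lambda>x. - \<rho> t x / \<epsilon>) ` \<Omega>)" using closure_subset by (metis bounded_subset image_mono)
  then have bd: "bounded (divergence (grad (\<Phi> t)) ` \<Omega>)" using div by (metis (no_types, lifting) image_cong)
  have "(LBINT x:\<Omega>. w x * divergence (grad (\<Phi> t)) x) = - (LBINT x:\<Omega>. w' x \<bullet> grad (\<Phi> t) x)"
  proof (rule green_identity_neumann[OF k \<Omega>(1,2) w _ _ bd])
    show "grad (\<Phi> t) differentiable (at x)" if "x \<in> \<Omega>" for x using C2_\<Phi> t that by (auto simp: C2_in_space_def)
    show "continuous_on \<Omega> (\<lambda>x. frechet_derivative (grad (\<Phi> t)) (at x) b)" if "b \<in> Basis" for b
      using C2_\<Phi> t that by (auto simp: C2_in_space_def intro!: continuous_on_slice[of "{0<..}" \<Omega> "\<lambda>t x. frechet_derivative (grad (\<Phi> t)) (at x) b" t])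
    show "continuous_on (closure \<Omega>) (gp t)" using slices'(2) t by simp
    show "gp t x = grad (\<Phi> t) x" if "x \<in> \<Omega>" for x using gp(2) t that by simp
    show "gp t x \<bullet> outward_normal \<Omega> x = 0" if "x \<in> frontier \<Omega>" for x using normal_\<Phi> t that by simp
  qed
  moreover have "(LBINT x:\<Omega>. w x * divergence (grad (\<Phi> t)) x) = (- 1 / \<epsilon>) * (LBINT x:\<Omega>. w x * \<rho> t x)"
  proof -
    have "(LBINT x:\<Omega>. w x * divergence (grad (\<Phi> t)) x) = (LBINT x:\<Omega>. (- 1 / \<epsilon>) * (w x * \<rho> t x))"
      using div by (intro cong) auto
    also have "\<dots> = (- 1 / \<epsilon>) * (LBINT x:\<Omega>. w x * \<rho> t x)" by (rule set_integral_mult_right)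
    finally show ?thesis .
  qed
  moreover have "(LBINT x:\<Omega>. w' x \<bullet> grad (\<Phi> t) x) = (LBINT x:\<Omega>. w' x \<bullet> gp t x)"
    using gp(2) t by (intro cong) auto
  ultimately show ?thesis using eps by (simp add: field_simps)
qed

lemma C1_bounded_add:
  "C1_bounded \<Omega> f f' \<Longrightarrow> C1_bounded \<Omega> g g' \<Longrightarrow> C1_bounded \<Omega> (\<lambda>x. f x + g x) (\<lambda>x. f' x + g' x)"
  unfolding C1_bounded_def
  by (auto intro!: continuous_intros bounded_plus_comp derivative_eq_intros simp: inner_add_left)

text \<open>With \<open>y = \<Phi> t + \<Phi> s\<close>, the difference of squares factorises and
  the increment of the electric energy is \<open>\<epsilon> / 2\<close> times \<open>\<integral>
  \<nabla>y \<bullet> (\<nabla>\<Phi> t - \<nabla>\<Phi> s)\<close>. The Poisson equation turns this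
  into half of \<open>\<integral> y (\<rho> t - \<rho> s)\<close>, where \<open>y\<close> is a
  weight fixed in time, and the weak form of each species with this weight applies. The kernel
  \<open>L a b\<close> pairs the potential at time \<open>a\<close> with the fluxes at time
  \<open>b\<close>.\<close>

lemma electric_derivative:
  assumes t: "t > 0"
  shows "(electric has_real_derivative - (\<Sum>i<N. z i * (LBINT x:\<Omega>. gp t x \<bullet> flux_ext i t x))) (at t)"
proof -
  define L where "L a b = - (\<Sum>i<N. z i * (LBINT x:\<Omega>. gp a x \<bullet> flux_ext i b x)) / 2" for a b
  have "(electric has_real_derivative 2 * L t t) (at t)"
  proof (rule has_derivative_from_kernel[where L = L, OF _ _ t])
    have "continuous_on ({0<..} \<times> {0<..}) (\<lambda>p. LBINT x:\<Omega>. gp (fst p) x \<bullet> flux_ext i (snd p) x)" if i: "i < N" for i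
    proof (rule continuous_on_set_integral_param[OF \<Omega>(1,2)])
      have g: "continuous_on ({0<..} \<times> closure \<Omega>) (\<lambda>p. gp (fst p) (snd p))" and f: "continuous_on ({0<..} \<times> closure \<Omega>) (\<lambda>p. flux_ext i (fst p) (snd p))"
        using gp_pos flux_ext_continuous[OF i] by (simp_all add: split_beta')
      have "continuous_on (({0<..} \<times> {0<..}) \<times> closure \<Omega>) (\<lambda>q. gp (fst (fst q)) (snd q))"
        by (rule continuous_on_compose2[OF g, of _ "\<lambda>q. (fst (fst q), snd q)", simplified]) (auto intro!: continuous_intros)
      moreover have "continuous_on (({0<..} \<times> {0<..}) \<times> closure \<Omega>) (\<lambda>q. flux_ext i (snd (fst q)) (snd q))"
        by (rule continuous_on_compose2[OF f, of _ "\<lambda>q. (snd (fst q), snd q)", simplified]) (auto intro!: continuous_intros)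
      ultimately show "continuous_on (({0<..} \<times> {0<..}) \<times> closure \<Omega>) (\<lambda>(p, x). gp (fst p) x \<bullet> flux_ext i (snd p) x)"
        unfolding split_beta' by (intro continuous_intros)
    qed
    then show "continuous_on ({0<..} \<times> {0<..}) (\<lambda>(a, b). L a b)"
      unfolding L_def split_beta' by (intro continuous_intros) auto
    fix s t :: real assume st: "0 < s" "s < t"
    define y where "y = (\<lambda>x. \<Phi> t x + \<Phi> s x)"
    define y' where "y' = (\<lambda>x. gp t x + gp s x)"
    have Y: "C1_bounded \<Omega> y y'"
      unfolding y_def y'_def using st by (intro C1_bounded_add C1_bounded_\<Phi>) auto
    have y': "continuous_on (closure \<Omega>) y'" unfolding y'_def using st by (intro continuous_intros slices') auto
    have yc: "continuous_on (closure \<Omega>) (\<lambda>x. pc t x + pc s x)" using st by (intro continuous_intros slices') auto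
    have yeq: "pc t x + pc s x = y x" if "x \<in> \<Omega>" for x using pc(2) st that by (simp add: y_def)
    have w: "((\<lambda>\<tau>. - (LBINT x:\<Omega>. y' x \<bullet> flux_ext i \<tau> x)) has_integral
        ((LBINT x:\<Omega>. y x * c i t x) - (LBINT x:\<Omega>. y x * c i s x))) {s..t}" if i: "i < N" for i
    proof -
      interpret conservation_law \<Omega> "c i" "gc i" "flux i" "flux_ext i" "cc i" k k' by (rule conservation[OF i])
      have "((\<lambda>\<tau>. - (LBINT x:\<Omega>. (1 *\<^sub>R y' x + (y x * 0) *\<^sub>R gc i \<tau> x) \<bullet> flux i \<tau> x)) has_integral
         ((LBINT x:\<Omega>. y x * c i t x) - (LBINT x:\<Omega>. y x * c i s x))) {s..t}"
        by (rule weak_form[OF Y y' refl yc yeq, where H = "\<lambda>s. s" and H' = "\<lambda>_. 1" and H'' = "\<lambda>_. 0"]) (use st in auto)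
      then show ?thesis
      proof (rule has_integral_eq[rotated])
        fix \<tau> assume "\<tau> \<in> {s..t}"
        then have "(LBINT x:\<Omega>. (1 *\<^sub>R y' x + (y x * 0) *\<^sub>R gc i \<tau> x) \<bullet> flux i \<tau> x) = (LBINT x:\<Omega>. y' x \<bullet> flux_ext i \<tau> x)"
          using st G(2) by (intro cong) auto
        then show "- (LBINT x:\<Omega>. (1 *\<^sub>R y' x + (y x * 0) *\<^sub>R gc i \<tau> x) \<bullet> flux i \<tau> x) = - (LBINT x:\<Omega>. y' x \<bullet> flux_ext i \<tau> x)"
          by simp
      qed
    qed
    have "((\<lambda>\<tau>. \<Sum>i<N. z i / 2 * - (LBINT x:\<Omega>. y' x \<bullet> flux_ext i \<tau> x)) has_integral
        (\<Sum>i<N. z i / 2 * ((LBINT x:\<Omega>. y x * c i t x) - (LBINT x:\<Omega>. y x * c i s x)))) {s..t}"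
      by (intro has_integral_sum has_integral_mult_right w) auto
    moreover have "(\<Sum>i<N. z i / 2 * ((LBINT x:\<Omega>. y x * c i t x) - (LBINT x:\<Omega>. y x * c i s x))) = electric t - electric s"
    proof -
      have split: "(\<Sum>i<N. z i * (LBINT x:\<Omega>. y x * c i \<tau> x)) = \<epsilon> * (LBINT x:\<Omega>. y' x \<bullet> gp \<tau> x)" if \<tau>: "\<tau> > 0" for \<tau>
      proof -
        have "(\<Sum>i<N. z i * (LBINT x:\<Omega>. y x * c i \<tau> x)) = (\<Sum>i<N. LBINT x:\<Omega>. z i * ((pc t x + pc s x) * cc i \<tau> x))"
        proof (rule sum.cong[OF refl])
          fix i assume "i \<in> {..<N}"
          then have "(LBINT x:\<Omega>. y x * c i \<tau> x) = (LBINT x:\<Omega>. (pc t x + pc s x) * cc i \<tau> x)"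
            using yeq cc(2)[of i \<tau>] \<tau> by (intro cong) auto
          then show "z i * (LBINT x:\<Omega>. y x * c i \<tau> x) = (LBINT x:\<Omega>. z i * ((pc t x + pc s x) * cc i \<tau> x))" by simp
        qed
        also have "\<dots> = (LBINT x:\<Omega>. (\<Sum>i<N. z i * ((pc t x + pc s x) * cc i \<tau> x)))"
          using \<tau> by (intro set_lebesgue_integral_finite_sum[symmetric] ci continuous_intros slices yc) auto
        also have "\<dots> = (LBINT x:\<Omega>. y x * \<rho> \<tau> x)"
          using yeq by (intro cong) (simp add: \<rho>_def sum_distrib_left mult_ac)
        finally show ?thesis using green_\<Phi>[OF Y \<tau>] by simp
      qed
      have ig: "set_integrable lborel \<Omega> (\<lambda>x. y' x \<bullet> gp \<tau> x)" "set_integrable lborel \<Omega> (\<lambda>x. (norm (gp \<tau> x))\<^sup>2)" if "\<tau> > 0" for \<tau>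
        using that by (auto intro!: ci continuous_intros y' slices')
      have "(LBINT x:\<Omega>. y' x \<bullet> gp t x) - (LBINT x:\<Omega>. y' x \<bullet> gp s x) = (LBINT x:\<Omega>. y' x \<bullet> gp t x - y' x \<bullet> gp s x)"
        using ig st by (intro set_integral_diff(2)[symmetric]) auto
      also have "\<dots> = (LBINT x:\<Omega>. (norm (gp t x))\<^sup>2 - (norm (gp s x))\<^sup>2)"
        by (intro cong) (simp add: y'_def power2_norm_eq_inner inner_add_left inner_commute[of "gp s _" "gp t _"])
      also have "\<dots> = (LBINT x:\<Omega>. (norm (gp t x))\<^sup>2) - (LBINT x:\<Omega>. (norm (gp s x))\<^sup>2)"
        using ig st by (intro set_integral_diff(2)) auto
      finally have d: "(LBINT x:\<Omega>. y' x \<bullet> gp t x) - (LBINT x:\<Omega>. y' x \<bullet> gp s x) =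
        (LBINT x:\<Omega>. (norm (gp t x))\<^sup>2) - (LBINT x:\<Omega>. (norm (gp s x))\<^sup>2)" .
      have "(\<Sum>i<N. z i / 2 * ((LBINT x:\<Omega>. y x * c i t x) - (LBINT x:\<Omega>. y x * c i s x))) =
        1 / 2 * ((\<Sum>i<N. z i * (LBINT x:\<Omega>. y x * c i t x)) - (\<Sum>i<N. z i * (LBINT x:\<Omega>. y x * c i s x)))"
        by (simp add: sum_subtractf[symmetric] sum_distrib_left right_diff_distrib)
      also have "\<dots> = 1 / 2 * (\<epsilon> * ((LBINT x:\<Omega>. y' x \<bullet> gp t x) - (LBINT x:\<Omega>. y' x \<bullet> gp s x)))"
        using split st by (simp add: right_diff_distrib)
      also have "\<dots> = electric t - electric s" unfolding d electric_def by (simp add: right_diff_distrib)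
      finally show ?thesis .
    qed
    ultimately have "((\<lambda>\<tau>. \<Sum>i<N. z i / 2 * - (LBINT x:\<Omega>. y' x \<bullet> flux_ext i \<tau> x)) has_integral (electric t - electric s)) {s..t}"
      by simp
    then show "((\<lambda>\<tau>. L t \<tau> + L s \<tau>) has_integral (electric t - electric s)) {s..t}"
    proof (rule has_integral_eq[rotated])
      fix \<tau> assume \<tau>: "\<tau> \<in> {s..t}"
      have "(LBINT x:\<Omega>. y' x \<bullet> flux_ext i \<tau> x) = (LBINT x:\<Omega>. gp t x \<bullet> flux_ext i \<tau> x) + (LBINT x:\<Omega>. gp s x \<bullet> flux_ext i \<tau> x)" if "i < N" for i
      proof -
        have f: "continuous_on (closure \<Omega>) (flux_ext i \<tau>)"
          using continuous_on_slice[OF flux_ext_continuous[OF that]] \<tau> st by auto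
        have "set_integrable lborel \<Omega> (\<lambda>x. gp t x \<bullet> flux_ext i \<tau> x)" "set_integrable lborel \<Omega> (\<lambda>x. gp s x \<bullet> flux_ext i \<tau> x)"
          using st by (auto intro!: ci continuous_intros slices' f)
        then show ?thesis by (simp add: y'_def inner_add_left set_integral_add)
      qed
      then have "(\<Sum>i<N. z i / 2 * - (LBINT x:\<Omega>. y' x \<bullet> flux_ext i \<tau> x)) =
        (\<Sum>i<N. z i / 2 * - ((LBINT x:\<Omega>. gp t x \<bullet> flux_ext i \<tau> x) + (LBINT x:\<Omega>. gp s x \<bullet> flux_ext i \<tau> x)))"
        by (intro sum.cong) auto
      also have "\<dots> = L t \<tau> + L s \<tau>"
        by (simp add: L_def sum_divide_distrib right_diff_distrib diff_divide_distrib sum_subtractf sum_negf)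
      finally show "(\<Sum>i<N. z i / 2 * - (LBINT x:\<Omega>. y' x \<bullet> flux_ext i \<tau> x)) = L t \<tau> + L s \<tau>" .
    qed
  qed
  then show ?thesis by (simp add: L_def)
qed

end

section \<open>Lower bound on the dissipation\<close>

text \<open>As a predicate, the constant can be fixed from \<Omega> alone before any solution is
  considered, which keeps the rate independent of the solution.\<close>

definition log_sobolev_constant :: "'a::euclidean_space set \<Rightarrow> real \<Rightarrow> bool" where
  "log_sobolev_constant \<Omega> K \<longleftrightarrow> K > 0 \<and> (\<forall>g g'. C1_bounded \<Omega> g g' \<longrightarrow> (\<exists>\<delta>>0. \<forall>x\<in>\<Omega>. \<delta> \<le> g x) \<longrightarrow>
     (LBINT x:\<Omega>. entropy_density (mean \<Omega> g) (g x)) \<le> K * (LBINT x:\<Omega>. (norm (g' x))\<^sup>2 / g x))"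

definition poincare_constant :: "'a::euclidean_space set \<Rightarrow> real \<Rightarrow> bool" where
  "poincare_constant \<Omega> K \<longleftrightarrow> K > 0 \<and> (\<forall>f f'. C1_bounded \<Omega> f f' \<longrightarrow> (LBINT x:\<Omega>. f x) = 0 \<longrightarrow>
     (LBINT x:\<Omega>. (f x)\<^sup>2) \<le> K * (LBINT x:\<Omega>. (norm (f' x))\<^sup>2))"

lemma log_sobolev_constantD:
  assumes "log_sobolev_constant \<Omega> K"
  shows "K > 0" "\<And>g g'. C1_bounded \<Omega> g g' \<Longrightarrow> \<exists>\<delta>>0. \<forall>x\<in>\<Omega>. \<delta> \<le> g x \<Longrightarrow>
    (LBINT x:\<Omega>. entropy_density (mean \<Omega> g) (g x)) \<le> K * (LBINT x:\<Omega>. (norm (g' x))\<^sup>2 / g x)"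
  using assms unfolding log_sobolev_constant_def by simp_all

lemma poincare_constantD:
  assumes "poincare_constant \<Omega> K"
  shows "K > 0" "\<And>f f'. C1_bounded \<Omega> f f' \<Longrightarrow> (LBINT x:\<Omega>. f x) = 0 \<Longrightarrow>
    (LBINT x:\<Omega>. (f x)\<^sup>2) \<le> K * (LBINT x:\<Omega>. (norm (f' x))\<^sup>2)"
  using assms unfolding poincare_constant_def by simp_all

lemma log_sobolev_constant_exists:
  assumes "smooth_bounded_domain \<Omega>"
  shows "\<exists>K. log_sobolev_constant \<Omega> K"
proof (rule log_sobolev_inequality[OF assms])
  fix K :: real
  assume "K > 0" "\<And>g g'. C1_bounded \<Omega> g g' \<Longrightarrow> \<exists>\<delta>>0. \<forall>x\<in>\<Omega>. \<delta> \<le> g x \<Longrightarrow>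
    (LBINT x:\<Omega>. entropy_density (mean \<Omega> g) (g x)) \<le> K * (LBINT x:\<Omega>. (norm (g' x))\<^sup>2 / g x)"
  then show ?thesis unfolding log_sobolev_constant_def by (intro exI[of _ K]) simp
qed

lemma poincare_constant_exists:
  assumes "smooth_bounded_domain \<Omega>"
  shows "\<exists>K. poincare_constant \<Omega> K"
proof (rule poincare_inequality[OF assms])
  fix K :: real
  assume "K > 0" "\<And>f f'. C1_bounded \<Omega> f f' \<Longrightarrow> (LBINT x:\<Omega>. f x) = 0 \<Longrightarrow>
    (LBINT x:\<Omega>. (f x)\<^sup>2) \<le> K * (LBINT x:\<Omega>. (norm (f' x))\<^sup>2)"
  then show ?thesis unfolding poincare_constant_def by (intro exI[of _ K]) simp
qed

context nernst_planck begin

lemma entropy_nonneg: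
  assumes "i < N" "d > 0" "t \<ge> 0"
  shows "entropy i d t \<ge> 0"
proof -
  have "entropy_density (mean \<Omega> (c i 0) + d) (cc i t x + d) \<ge> 0" if "x \<in> \<Omega>" for x
    using mean_nonneg[OF assms(1)] cc_nonneg[OF assms(1,3) in_cl[OF that]] assms(2) by (intro entropy_density_nonneg) auto
  then show ?thesis
    unfolding entropy_def set_lebesgue_integral_def
    by (intro Bochner_Integration.integral_nonneg) (auto split: split_indicator)
qed

lemma gp_square_nonneg: "0 \<le> (LBINT x:\<Omega>. (norm (gp t x))\<^sup>2)"
  by (simp add: set_lebesgue_integral_def)

lemma electric_nonneg: "electric t \<ge> 0"
  using eps gp_square_nonneg by (simp add: electric_def)

lemma C1_bounded_\<rho>:
  assumes t: "t > 0"
  shows "C1_bounded \<Omega> (\<lambda>x. \<Sum>i<N. z i * c i t x) (\<lambda>x. \<Sum>i<N. z i *\<^sub>R gc i t x)"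
proof (rule C1_bounded_ext[of "\<rho> t"])
  show "continuous_on (closure \<Omega>) (\<rho> t)" using t by (intro \<rho>_continuous) simp
  show "continuous_on (closure \<Omega>) (\<lambda>x. \<Sum>i<N. z i *\<^sub>R gc i t x)"
    using t by (intro continuous_intros slices) auto
  fix x assume x: "x \<in> \<Omega>"
  show "(\<Sum>i<N. z i * c i t x) = \<rho> t x" unfolding \<rho>_def using cc(2)[of _ t x] t x by (intro sum.cong) auto
  have "((\<lambda>x. \<Sum>i<N. z i * c i t x) has_derivative (\<lambda>h. \<Sum>i<N. z i * (gc i t x \<bullet> h))) (at x)"
    by (intro has_derivative_sum has_derivative_mult_right derivatives(1)[OF t x]) auto
  then show "((\<lambda>x. \<Sum>i<N. z i * c i t x) has_derivative (\<lambda>h. (\<Sum>i<N. z i *\<^sub>R gc i t x) \<bullet> h)) (at x)"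
    by (simp add: inner_sum_left)
qed

text \<open>\<open>green_\<Phi>\<close> tested with the charge density itself, which is as regular
  as the concentrations.\<close>

lemma cross_term:
  assumes t: "t > 0"
  shows "\<epsilon> * (\<Sum>i<N. z i * (LBINT x:\<Omega>. gc i t x \<bullet> gp t x)) = (LBINT x:\<Omega>. (\<rho> t x)\<^sup>2)"
proof -
  have "(LBINT x:\<Omega>. (\<rho> t x)\<^sup>2) = (LBINT x:\<Omega>. (\<Sum>i<N. z i * c i t x) * \<rho> t x)"
  proof (rule cong)
    fix x assume "x \<in> \<Omega>"
    then have "(\<Sum>i<N. z i * c i t x) = \<rho> t x" unfolding \<rho>_def using cc(2)[of _ t x] t by (intro sum.cong) auto
    then show "(\<rho> t x)\<^sup>2 = (\<Sum>i<N. z i * c i t x) * \<rho> t x" by (simp add: power2_eq_square)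
  qed
  also have "\<dots> = \<epsilon> * (LBINT x:\<Omega>. (\<Sum>i<N. z i *\<^sub>R gc i t x) \<bullet> gp t x)"
    by (rule green_\<Phi>[OF C1_bounded_\<rho>[OF t] t])
  also have "(LBINT x:\<Omega>. (\<Sum>i<N. z i *\<^sub>R gc i t x) \<bullet> gp t x) = (LBINT x:\<Omega>. (\<Sum>i<N. z i * (gc i t x \<bullet> gp t x)))"
    by (intro cong) (simp add: inner_sum_left)
  also have "\<dots> = (\<Sum>i<N. LBINT x:\<Omega>. z i * (gc i t x \<bullet> gp t x))"
    using t by (intro set_lebesgue_integral_finite_sum ci continuous_intros slices slices') auto
  finally show ?thesis by simp
qed

text \<open>The Poisson equation tested with \<Phi> gives \<open>\<epsilon> \<integral>
  \<bar>\<nabla>\<Phi>\<bar>\<^sup>2 = \<integral> \<Phi> \<rho>\<close>. Young's inequality is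
  weighted so that the Poincare inequality for \<Phi>, normalised to integral 0, bounds the
  potential term by half of the left side.\<close>

lemma electric_le_charge:
  assumes t: "t > 0" and KP: "poincare_constant \<Omega> KP"
  shows "electric t \<le> KP / (2 * \<epsilon>) * (LBINT x:\<Omega>. (\<rho> t x)\<^sup>2)"
proof -
  note P = poincare_constantD(2)[OF KP]
  note KP = poincare_constantD(1)[OF KP]
  define G where "G = (LBINT x:\<Omega>. (norm (gp t x))\<^sup>2)"
  define R where "R = (LBINT x:\<Omega>. (\<rho> t x)\<^sup>2)"
  define Q where "Q = (LBINT x:\<Omega>. (pc t x)\<^sup>2)"
  have t0: "t \<ge> 0" using t by simp
  have i: "set_integrable lborel \<Omega> (\<lambda>x. (pc t x)\<^sup>2)" "set_integrable lborel \<Omega> (\<lambda>x. (\<rho> t x)\<^sup>2)" "set_integrable lborel \<Omega> (\<lambda>x. pc t x * \<rho> t x)"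
    by (intro ci continuous_intros slices' \<rho>_continuous t0)+
  have Phi0: "(LBINT x:\<Omega>. \<Phi> t x) = 0" using sol t0 by (simp add: nernst_planck_solution_def)
  have "(LBINT x:\<Omega>. (\<Phi> t x)\<^sup>2) \<le> KP * G" unfolding G_def by (rule P[OF C1_bounded_\<Phi>[OF t] Phi0])
  moreover have "(LBINT x:\<Omega>. (\<Phi> t x)\<^sup>2) = Q" unfolding Q_def using pc(2)[OF t0] by (intro cong) auto
  ultimately have Q: "Q \<le> KP * G" by simp
  have "\<epsilon> * G = (LBINT x:\<Omega>. \<Phi> t x * \<rho> t x)"
    using green_\<Phi>[OF C1_bounded_\<Phi>[OF t] t] by (simp add: G_def power2_norm_eq_inner)
  also have "\<dots> = (LBINT x:\<Omega>. pc t x * \<rho> t x)" using pc(2)[OF t0] by (intro cong) auto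
  also have "\<dots> \<le> (LBINT x:\<Omega>. KP / (2 * \<epsilon>) * (\<rho> t x)\<^sup>2 + \<epsilon> / (2 * KP) * (pc t x)\<^sup>2)"
  proof (rule set_integral_mono_on)
    show "set_integrable lborel \<Omega> (\<lambda>x. KP / (2 * \<epsilon>) * (\<rho> t x)\<^sup>2 + \<epsilon> / (2 * KP) * (pc t x)\<^sup>2)"
      using i by (intro set_integral_add set_integrable_mult_right) auto
    fix x
    have "0 \<le> (KP * \<rho> t x - \<epsilon> * pc t x)\<^sup>2" by simp
    then have "2 * (KP * \<epsilon>) * (pc t x * \<rho> t x) \<le> KP\<^sup>2 * (\<rho> t x)\<^sup>2 + \<epsilon>\<^sup>2 * (pc t x)\<^sup>2"
      by (simp add: power2_diff power_mult_distrib mult_ac)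
    also have "\<dots> = 2 * (KP * \<epsilon>) * (KP / (2 * \<epsilon>) * (\<rho> t x)\<^sup>2 + \<epsilon> / (2 * KP) * (pc t x)\<^sup>2)"
      using KP eps by (simp add: field_simps power2_eq_square)
    finally show "pc t x * \<rho> t x \<le> KP / (2 * \<epsilon>) * (\<rho> t x)\<^sup>2 + \<epsilon> / (2 * KP) * (pc t x)\<^sup>2"
      using KP eps by (simp add: mult_le_cancel_left_pos)
  qed (rule i)
  also have "\<dots> = KP / (2 * \<epsilon>) * R + \<epsilon> / (2 * KP) * Q"
    unfolding R_def Q_def using i by (subst set_integral_add) auto
  also have "\<epsilon> / (2 * KP) * Q \<le> \<epsilon> / (2 * KP) * (KP * G)" using Q KP eps by (intro mult_left_mono) auto
  also have "\<epsilon> / (2 * KP) * (KP * G) = \<epsilon> / 2 * G" using KP by simp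
  finally show ?thesis unfolding electric_def G_def[symmetric] R_def[symmetric] by simp
qed

text \<open>The inequality is applied to \<open>c i t + d\<close>, bounded below by
  \<open>d\<close>. By conservation of mass its mean is the shifted initial mean, which is the
  reference in \<open>entropy\<close>.\<close>

lemma entropy_le_fisher:
  assumes i: "i < N" and t: "t > 0" and d: "d > 0"
    and K: "log_sobolev_constant \<Omega> K"
  shows "entropy i d t \<le> K * (LBINT x:\<Omega>. (norm (gc i t x))\<^sup>2 / (cc i t x + d))"
proof -
  have t0: "t \<ge> 0" using t by simp
  define g where "g x = c i t x + d" for x
  have g: "C1_bounded \<Omega> g (gc i t)"
  proof (rule C1_bounded_ext[of "\<lambda>x. cc i t x + d"])
    show "continuous_on (closure \<Omega>) (\<lambda>x. cc i t x + d)" "continuous_on (closure \<Omega>) (gc i t)"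
      using slices[OF i t0] t by (auto intro!: continuous_intros)
    show "(g has_derivative (\<lambda>h. gc i t x \<bullet> h)) (at x)" if "x \<in> \<Omega>" for x
      unfolding g_def using derivatives(1)[OF t that i] by (auto intro!: derivative_eq_intros)
    show "g x = cc i t x + d" if "x \<in> \<Omega>" for x using cc(2)[OF i t0 that] by (simp add: g_def)
  qed
  have "(LBINT x:\<Omega>. g x) = (LBINT x:\<Omega>. cc i t x + d)"
    using cc(2)[OF i t0] by (intro cong) (auto simp: g_def)
  also have "\<dots> = (LBINT x:\<Omega>. c i 0 x) + d * measure lborel \<Omega>"
    using mass_conserved[OF i t0] slices(1)[OF i t0]
    by (subst set_integral_add) (auto intro!: ci simp: set_lebesgue_integral_def)
  finally have m: "mean \<Omega> g = mean \<Omega> (c i 0) + d" using vol by (simp add: mean_def add_divide_distrib)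
  have "entropy i d t = (LBINT x:\<Omega>. entropy_density (mean \<Omega> g) (g x))"
    unfolding entropy_def m using cc(2)[OF i t0] by (intro cong) (auto simp: g_def)
  also have "\<dots> \<le> K * (LBINT x:\<Omega>. (norm (gc i t x))\<^sup>2 / g x)"
    by (rule log_sobolev_constantD(2)[OF K g]) (use c_nonneg[OF i t0] d in \<open>auto simp: g_def intro!: exI[of _ d]\<close>)
  also have "(LBINT x:\<Omega>. (norm (gc i t x))\<^sup>2 / g x) = (LBINT x:\<Omega>. (norm (gc i t x))\<^sup>2 / (cc i t x + d))"
    using cc(2)[OF i t0] by (intro cong) (auto simp: g_def)
  finally show ?thesis .
qed

definition "energy_reg d t = (\<Sum>i<N. entropy i d t) + electric t"
text \<open>The entropy gradient carries \<open>1 / (c + d)\<close> while the flux carries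
  \<open>c\<close>, so the integrand is not a perfect square; \<open>defect\<close> bounds what is
  missing, per unit of \<open>d\<close>.\<close>

definition "dissipation d t = (\<Sum>i<N. LBINT x:\<Omega>. ((1 / (cc i t x + d)) *\<^sub>R gc i t x) \<bullet> flux_ext i t x) +
  (\<Sum>i<N. z i * (LBINT x:\<Omega>. gp t x \<bullet> flux_ext i t x))"
definition "defect t = (\<Sum>i<N. D i * (z i)\<^sup>2 / 2) * (LBINT x:\<Omega>. (norm (gp t x))\<^sup>2)"

lemma energy_reg_derivative:
  "d > 0 \<Longrightarrow> t > 0 \<Longrightarrow> (energy_reg d has_real_derivative - dissipation d t) (at t)"
  unfolding energy_reg_def dissipation_def
  by (auto intro!: derivative_eq_intros entropy_derivative electric_derivative simp: sum_negf)

lemma energy_reg_continuous: "d > 0 \<Longrightarrow> continuous_on {0..} (energy_reg d)"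
  unfolding energy_reg_def by (intro continuous_intros entropy_continuous electric_continuous) auto

text \<open>Integration of \<open>dissipation_pointwise\<close>, where the cross terms add up to
  \<open>2 / \<epsilon>\<close> times the integral of the squared charge density. The electric
  energy is at most \<open>KP / (2 * \<epsilon>)\<close> times that integral, so it allows the rate
  \<open>4 / KP\<close> and \<epsilon> drops out; the entropies allow the rate
  \<open>1 / K\<close>.\<close>

lemma dissipation_lower_bound:
  assumes t: "t > 0" and d: "d > 0" and Dm: "Dm > 0" "\<And>i. i < N \<Longrightarrow> Dm \<le> D i"
    and K: "log_sobolev_constant \<Omega> K"
    and KP: "poincare_constant \<Omega> KP"
  shows "dissipation d t \<ge> Dm / 2 * min (1 / K) (4 / KP) * energy_reg d t - d * defect t"
proof -
  have t0: "t \<ge> 0" using t by simp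
  define J where "J i = (LBINT x:\<Omega>. (norm (gc i t x))\<^sup>2 / (cc i t x + d))" for i
  define X where "X i = (LBINT x:\<Omega>. gc i t x \<bullet> gp t x)" for i
  define P where "P = (LBINT x:\<Omega>. (norm (gp t x))\<^sup>2)"
  define R where "R = (LBINT x:\<Omega>. (\<rho> t x)\<^sup>2)"
  define S where "S i = (LBINT x:\<Omega>. ((1 / (cc i t x + d)) *\<^sub>R gc i t x) \<bullet> flux_ext i t x) + z i * (LBINT x:\<Omega>. gp t x \<bullet> flux_ext i t x)" for i
  have S: "S i \<ge> Dm / 2 * (J i + 2 * (z i * X i)) - d * (D i * (z i)\<^sup>2 / 2 * P)" if i: "i < N" for i
  proof -
    have ne: "cc i t x + d \<noteq> 0" if "x \<in> closure \<Omega>" for x using cc_nonneg[OF i t0 that] d by simp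
    have f: "continuous_on (closure \<Omega>) (flux_ext i t)" using continuous_on_slice[OF flux_ext_continuous[OF i]] t by auto
    note s = slices(1)[OF i t0] slices(2)[OF i t0 t] slices'[OF t0] f
    have i1: "set_integrable lborel \<Omega> (\<lambda>x. ((1 / (cc i t x + d)) *\<^sub>R gc i t x) \<bullet> flux_ext i t x)"
      "set_integrable lborel \<Omega> (\<lambda>x. gp t x \<bullet> flux_ext i t x)"
      "set_integrable lborel \<Omega> (\<lambda>x. (norm (gc i t x))\<^sup>2 / (cc i t x + d))" "set_integrable lborel \<Omega> (\<lambda>x. gc i t x \<bullet> gp t x)"
      "set_integrable lborel \<Omega> (\<lambda>x. (norm (gp t x))\<^sup>2)"
      by (intro ci continuous_intros s; use ne in simp)+
    have i2: "set_integrable lborel \<Omega> (\<lambda>x. (norm (gc i t x))\<^sup>2 / (cc i t x + d) + 2 * (z i * (gc i t x \<bullet> gp t x)))"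
      using i1 by (intro set_integral_add set_integrable_mult_right) auto
    have "Dm / 2 * (J i + 2 * (z i * X i)) - d * (D i * (z i)\<^sup>2 / 2 * P) =
      (LBINT x:\<Omega>. Dm / 2 * ((norm (gc i t x))\<^sup>2 / (cc i t x + d) + 2 * (z i * (gc i t x \<bullet> gp t x))) - d * (D i * (z i)\<^sup>2 / 2 * (norm (gp t x))\<^sup>2))"
    proof -
      have "(LBINT x:\<Omega>. (norm (gc i t x))\<^sup>2 / (cc i t x + d) + 2 * (z i * (gc i t x \<bullet> gp t x))) = J i + 2 * (z i * X i)"
        unfolding J_def X_def using i1 by (subst set_integral_add) auto
      then show ?thesis
        unfolding P_def using i1 i2 by (subst set_integral_diff) (auto simp del: distrib_left)
    qed
    also have "\<dots> \<le> (LBINT x:\<Omega>. ((1 / (cc i t x + d)) *\<^sub>R gc i t x + z i *\<^sub>R gp t x) \<bullet> flux_ext i t x)"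
    proof (rule set_integral_mono_on)
      show "set_integrable lborel \<Omega> (\<lambda>x. Dm / 2 * ((norm (gc i t x))\<^sup>2 / (cc i t x + d) + 2 * (z i * (gc i t x \<bullet> gp t x))) - d * (D i * (z i)\<^sup>2 / 2 * (norm (gp t x))\<^sup>2))"
        using i1 i2 by (intro set_integral_diff set_integrable_mult_right) auto
      show "set_integrable lborel \<Omega> (\<lambda>x. ((1 / (cc i t x + d)) *\<^sub>R gc i t x + z i *\<^sub>R gp t x) \<bullet> flux_ext i t x)"
        by (intro ci continuous_intros s) (use ne in simp)
      show "Dm / 2 * ((norm (gc i t x))\<^sup>2 / (cc i t x + d) + 2 * (z i * (gc i t x \<bullet> gp t x))) - d * (D i * (z i)\<^sup>2 / 2 * (norm (gp t x))\<^sup>2)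
          \<le> ((1 / (cc i t x + d)) *\<^sub>R gc i t x + z i *\<^sub>R gp t x) \<bullet> flux_ext i t x" if "x \<in> \<Omega>" for x
        unfolding flux_ext_def using cc_nonneg[OF i t0 in_cl[OF that]] d Dm i by (intro dissipation_pointwise) auto
    qed
    also have "\<dots> = S i"
    proof -
      have "(LBINT x:\<Omega>. ((1 / (cc i t x + d)) *\<^sub>R gc i t x + z i *\<^sub>R gp t x) \<bullet> flux_ext i t x) =
        (LBINT x:\<Omega>. ((1 / (cc i t x + d)) *\<^sub>R gc i t x) \<bullet> flux_ext i t x + z i * (gp t x \<bullet> flux_ext i t x))"
        by (intro cong) (simp add: inner_add_left)
      also have "\<dots> = S i" unfolding S_def using i1 by (subst set_integral_add) auto
      finally show ?thesis .
    qed
    finally show ?thesis .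
  qed
  have X: "(\<Sum>i<N. z i * X i) = R / \<epsilon>"
    using cross_term[OF t] eps unfolding X_def R_def by (simp add: field_simps)
  have el: "electric t \<le> KP / (2 * \<epsilon>) * R" unfolding R_def by (rule electric_le_charge[OF t KP])
  note KP0 = poincare_constantD(1)[OF KP] and K0 = log_sobolev_constantD(1)[OF K]
  have en: "entropy i d t \<le> K * J i" if "i < N" for i
    unfolding J_def by (rule entropy_le_fisher[OF that t d K])
  define r where "r = min (1 / K) (4 / KP)"
  have r: "r \<le> 1 / K" "r \<le> 4 / KP" "r > 0" using K0 KP0 by (auto simp: r_def)
  have "(\<Sum>i<N. r * entropy i d t) \<le> (\<Sum>i<N. J i)"
  proof (rule sum_mono)
    fix i assume "i \<in> {..<N}"
    then have i: "i < N" by simp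
    have "r * entropy i d t \<le> 1 / K * entropy i d t" using r entropy_nonneg[OF i d t0] by (intro mult_right_mono) auto
    also have "\<dots> \<le> J i" using en[OF i] K0 by (simp add: field_simps)
    finally show "r * entropy i d t \<le> J i" .
  qed
  moreover have "r * electric t \<le> 2 * (R / \<epsilon>)"
  proof -
    have "r * electric t \<le> 4 / KP * electric t" using r electric_nonneg by (intro mult_right_mono) auto
    also have "\<dots> \<le> 4 / KP * (KP / (2 * \<epsilon>) * R)" using el KP0 by (intro mult_left_mono) auto
    also have "\<dots> = 2 * (R / \<epsilon>)" using KP0 by simp
    finally show ?thesis .
  qed
  ultimately have "r * energy_reg d t \<le> (\<Sum>i<N. J i) + 2 * (R / \<epsilon>)"
    unfolding energy_reg_def by (simp add: distrib_left sum_distrib_left)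
  then have "Dm / 2 * (r * energy_reg d t) \<le> Dm / 2 * ((\<Sum>i<N. J i) + 2 * (R / \<epsilon>))"
    using Dm(1) by (intro mult_left_mono) auto
  also have "\<dots> = (\<Sum>i<N. Dm / 2 * (J i + 2 * (z i * X i)))"
    by (simp only: X[symmetric] sum_distrib_left[symmetric] sum.distrib)
  also have "\<dots> \<le> (\<Sum>i<N. S i + d * (D i * (z i)\<^sup>2 / 2 * P))"
  proof (rule sum_mono)
    fix i assume "i \<in> {..<N}"
    then show "Dm / 2 * (J i + 2 * (z i * X i)) \<le> S i + d * (D i * (z i)\<^sup>2 / 2 * P)" using S[of i] by simp
  qed
  also have "\<dots> = dissipation d t + d * defect t"
    unfolding dissipation_def defect_def S_def P_def[symmetric]
    by (simp only: sum.distrib sum_distrib_left[symmetric] sum_distrib_right[symmetric])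
  finally show ?thesis by (simp add: r_def mult.assoc)
qed

text \<open>\<open>exp (r * t) * (E t - b / r)\<close> does not increase. Derivatives are available
  at positive times only; continuity includes time 0.\<close>

lemma gronwall_defect:
  fixes E E' :: "real \<Rightarrow> real"
  assumes "0 \<le> T" "r > 0" and E: "continuous_on {0..} E" "\<And>t. 0 < t \<Longrightarrow> (E has_real_derivative - E' t) (at t)"
    and le: "\<And>t. 0 < t \<Longrightarrow> t \<le> T \<Longrightarrow> E' t \<ge> r * E t - b"
  shows "E T \<le> E 0 * exp (- r * T) + b / r * (1 - exp (- r * T))"
proof -
  define f where "f t = exp (r * t) * (E t - b / r)" for t
  have "f T \<le> f 0"
  proof (rule DERIV_nonpos_imp_decreasing_open[OF \<open>0 \<le> T\<close>])
    fix t assume t: "0 < t" "t < T"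
    have "(f has_real_derivative (exp (r * t) * r) * (E t - b / r) + exp (r * t) * (- E' t)) (at t)"
      unfolding f_def using t by (auto intro!: derivative_eq_intros E(2))
    moreover have "(exp (r * t) * r) * (E t - b / r) + exp (r * t) * (- E' t) = exp (r * t) * (r * E t - b - E' t)"
      using assms(2) by (simp add: algebra_simps)
    moreover have "\<dots> \<le> 0" using le[of t] t by (simp add: mult_le_0_iff)
    ultimately show "\<exists>y. (f has_real_derivative y) (at t) \<and> y \<le> 0" by metis
    next
    show "continuous_on {0..T} f"
      unfolding f_def using continuous_on_subset[OF E(1), of "{0..T}"] by (intro continuous_intros) auto
  qed
  then have "exp (- r * T) * (exp (r * T) * (E T - b / r)) \<le> exp (- r * T) * (E 0 - b / r)"
    by (intro mult_left_mono) (auto simp: f_def)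
  moreover have "exp (- r * T) * (exp (r * T) * (E T - b / r)) = E T - b / r"
    by (simp add: mult.assoc[symmetric] exp_add[symmetric])
  ultimately show ?thesis by (simp add: algebra_simps)
qed

text \<open>The mass stays 0, and a continuous nonnegative function with integral 0
  vanishes.\<close>

lemma absent_species:
  assumes i: "i < N" and m: "mean \<Omega> (c i 0) = 0" and t: "t \<ge> 0" and x: "x \<in> \<Omega>"
  shows "c i t x = 0"
proof -
  have "cc i t x = 0"
  proof (rule set_integral_eq_0_imp[OF \<Omega>(1,2)])
    show "continuous_on \<Omega> (cc i t)" using slices(1)[OF i t] closure_subset by (rule continuous_on_subset)
    show "set_integrable lborel \<Omega> (cc i t)" using slices(1)[OF i t] by (rule ci)
    show "(LBINT x:\<Omega>. cc i t x) = 0" using mass_conserved[OF i t] m vol by (simp add: mean_def)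
    show "0 \<le> cc i t x" if "x \<in> \<Omega>" for x using cc_nonneg[OF i t in_cl[OF that]] .
  qed (rule x)
  then show ?thesis using cc(2)[OF i t x] by simp
qed

section \<open>Removal of the regularisation and consequences of the decay\<close>

text \<open>The affine terms of the entropy density cancel in the integral by conservation of
  mass.\<close>

lemma relative_entropy_eq:
  assumes i: "i < N" and m: "mean \<Omega> (c i 0) > 0" and t: "t \<ge> 0"
  shows "set_integrable lborel \<Omega> (\<lambda>x. entropy_density (mean \<Omega> (c i 0)) (cc i t x))"
    and "relative_entropy \<Omega> (c i t) (mean \<Omega> (c i 0)) = (LBINT x:\<Omega>. entropy_density (mean \<Omega> (c i 0)) (cc i t x))"
proof -
  have "continuous_on (closure \<Omega>) (\<lambda>x. cc i t x * ln (cc i t x / mean \<Omega> (c i 0)))"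
    by (rule continuous_on_compose2[OF continuous_on_mult_ln slices(1)[OF i t]]) (use cc_nonneg[OF i t] in auto)
  then have i1: "set_integrable lborel \<Omega> (\<lambda>x. cc i t x * ln (cc i t x / mean \<Omega> (c i 0)))" by (rule ci)
  have i2: "set_integrable lborel \<Omega> (cc i t)" by (rule ci[OF slices(1)[OF i t]])
  have i3: "set_integrable lborel \<Omega> (\<lambda>_. mean \<Omega> (c i 0))" by (rule ci) simp
  show "set_integrable lborel \<Omega> (\<lambda>x. entropy_density (mean \<Omega> (c i 0)) (cc i t x))"
    unfolding entropy_density_def by (intro set_integral_add set_integral_diff i1 i2 i3)
  have "(LBINT x:\<Omega>. entropy_density (mean \<Omega> (c i 0)) (cc i t x)) =
    (LBINT x:\<Omega>. cc i t x * ln (cc i t x / mean \<Omega> (c i 0))) - (LBINT x:\<Omega>. cc i t x) + (LBINT x:\<Omega>. mean \<Omega> (c i 0))"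
    unfolding entropy_density_def using i1 i2 i3
    by (subst set_integral_add(2)) (auto intro!: set_integral_diff)
  also have "(LBINT x:\<Omega>. mean \<Omega> (c i 0)) = (LBINT x:\<Omega>. cc i t x)"
    using mass_conserved[OF i t] vol by (simp add: mean_def set_lebesgue_integral_def)
  finally show "relative_entropy \<Omega> (c i t) (mean \<Omega> (c i 0)) = (LBINT x:\<Omega>. entropy_density (mean \<Omega> (c i 0)) (cc i t x))"
    unfolding relative_entropy_def using cc(2)[OF i t] by (simp cong: cong)
qed

text \<open>An absent species has entropy 0 for every \<open>d\<close>. Otherwise the shifted mean
  stays away from 0, and \<open>s * ln s\<close> is continuous down to 0, so the integral is
  continuous in \<open>d\<close> up to and including \<open>d = 0\<close>.\<close>

lemma entropy_limit:
  assumes i: "i < N" and t: "t \<ge> 0"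
  shows "((\<lambda>d. entropy i d t) \<longlongrightarrow> relative_entropy \<Omega> (c i t) (mean \<Omega> (c i 0))) (at_right 0)"
proof (cases "mean \<Omega> (c i 0) = 0")
  case True
  have "relative_entropy \<Omega> (c i t) (mean \<Omega> (c i 0)) = 0" using True by (simp add: relative_entropy_def)
  moreover have "entropy i d t = 0" if "d > 0" for d
  proof -
    have "entropy i d t = (LBINT x:\<Omega>. 0)"
      unfolding entropy_def using absent_species[OF i True t] cc(2)[OF i t] that True
      by (intro cong) (auto simp: entropy_density_def)
    then show ?thesis by simp
  qed
  then have "\<forall>\<^sub>F d in at_right 0. entropy i d t = 0" by (intro eventually_at_rightI[of 0 1]) auto
  ultimately show ?thesis by (simp add: tendsto_eventually)
next
  case False
  then have m: "mean \<Omega> (c i 0) > 0" using mean_nonneg[OF i] by simp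
  \<comment> \<open>Splitting the logarithm isolates \<open>s * ln s\<close> with
    \<open>s = cc i t x + d\<close>, which is jointly continuous even where the concentration
    vanishes and \<open>d = 0\<close>.\<close>
  define v where "v d x = (cc i t x + d) * ln (cc i t x + d) - (cc i t x + d) * ln (mean \<Omega> (c i 0) + d) - cc i t x + mean \<Omega> (c i 0)" for d x
  have "continuous_on {0..} (\<lambda>d. LBINT x:\<Omega>. v d x)"
  proof (rule continuous_on_set_integral_param[OF \<Omega>(1,2)])
    have c1: "continuous_on ({0..} \<times> closure \<Omega>) (\<lambda>p::real \<times> 'a. cc i t (snd p))"
      by (rule continuous_on_compose2[OF slices(1)[OF i t]]) (auto intro!: continuous_intros)
    have "continuous_on ({0..} \<times> closure \<Omega>) (\<lambda>p::real \<times> 'a. (cc i t (snd p) + fst p) * ln ((cc i t (snd p) + fst p) / 1))"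
      by (rule continuous_on_compose2[OF continuous_on_mult_ln]) (use cc_nonneg[OF i t] in \<open>auto intro!: continuous_intros c1\<close>)
    then have c2: "continuous_on ({0..} \<times> closure \<Omega>) (\<lambda>p::real \<times> 'a. (cc i t (snd p) + fst p) * ln (cc i t (snd p) + fst p))"
      by simp
    show "continuous_on ({0..} \<times> closure \<Omega>) (\<lambda>(d, x). v d x)"
      unfolding v_def split_beta' using m by (intro continuous_intros c1 c2) (auto simp: less_imp_neq[THEN not_sym])
  qed
  then have "((\<lambda>d. LBINT x:\<Omega>. v d x) \<longlongrightarrow> (LBINT x:\<Omega>. v 0 x)) (at 0 within {0..})"
    by (simp add: continuous_on_def)
  then have "((\<lambda>d. LBINT x:\<Omega>. v d x) \<longlongrightarrow> (LBINT x:\<Omega>. v 0 x)) (at_right 0)"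
    by (rule tendsto_within_subset) auto
  moreover have "(LBINT x:\<Omega>. v 0 x) = relative_entropy \<Omega> (c i t) (mean \<Omega> (c i 0))"
    unfolding relative_entropy_eq(2)[OF i m t]
  proof (rule cong)
    fix x assume "x \<in> \<Omega>"
    then have "cc i t x \<ge> 0" using cc_nonneg[OF i t in_cl] by simp
    then show "v 0 x = entropy_density (mean \<Omega> (c i 0)) (cc i t x)"
      using m by (cases "cc i t x = 0") (auto simp: v_def entropy_density_def ln_div algebra_simps)
  qed
  moreover have "(LBINT x:\<Omega>. v d x) = entropy i d t" if d: "d > 0" for d
    unfolding entropy_def
  proof (rule cong)
    fix x assume "x \<in> \<Omega>"
    then have "cc i t x + d > 0" using cc_nonneg[OF i t in_cl] d by force
    then show "v d x = entropy_density (mean \<Omega> (c i 0) + d) (cc i t x + d)"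
      using m d by (simp add: v_def entropy_density_def ln_div algebra_simps)
  qed
  then have "\<forall>\<^sub>F d in at_right 0. (LBINT x:\<Omega>. v d x) = entropy i d t" by (intro eventually_at_rightI[of 0 1]) auto
  ultimately show ?thesis using Lim_transform_eventually by fastforce
qed

lemma energy_reg_limit:
  assumes t: "t \<ge> 0"
  shows "((\<lambda>d. energy_reg d t) \<longlongrightarrow> energy \<Omega> N \<epsilon> c \<Phi> t) (at_right 0)"
proof -
  have "(LBINT x:\<Omega>. (norm (gp t x))\<^sup>2) = (LBINT x:\<Omega>. (norm (grad (\<Phi> t) x))\<^sup>2)"
    using gp(2)[OF t] by (intro cong) auto
  then have "energy \<Omega> N \<epsilon> c \<Phi> t = (\<Sum>i<N. relative_entropy \<Omega> (c i t) (mean \<Omega> (c i 0))) + electric t"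
    by (simp add: energy_def electric_def)
  then show ?thesis
    unfolding energy_reg_def using t by (auto intro!: tendsto_intros entropy_limit)
qed

text \<open>For fixed \<open>T\<close> the defect is bounded on \<open>{0..T}\<close> and costs at
  most \<open>d * M / r\<close> in the Gronwall estimate. \<open>M\<close> may depend on
  \<open>T\<close> and on the solution, since this term disappears as \<open>d\<close> tends to
  0.\<close>

lemma energy_decay:
  assumes T: "T \<ge> 0" and Dm: "Dm > 0" "\<And>i. i < N \<Longrightarrow> Dm \<le> D i"
    and K: "log_sobolev_constant \<Omega> K"
    and KP: "poincare_constant \<Omega> KP"
  defines "r \<equiv> Dm / 2 * min (1 / K) (4 / KP)"
  shows "energy \<Omega> N \<epsilon> c \<Phi> T \<le> energy \<Omega> N \<epsilon> c \<Phi> 0 * exp (- r * T)"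
proof -
  have r: "r > 0" using Dm(1) log_sobolev_constantD(1)[OF K] poincare_constantD(1)[OF KP] by (simp add: r_def)
  have "continuous_on {0..T} defect"
    unfolding defect_def by (intro continuous_intros continuous_on_subset[OF gp_square_continuous]) auto
  then have "bounded (defect ` {0..T})" by (intro compact_imp_bounded compact_continuous_image) auto
  then obtain M where M: "\<And>t. t \<in> {0..T} \<Longrightarrow> \<bar>defect t\<bar> \<le> M"
    unfolding bounded_iff real_norm_def by blast
  have reg: "energy_reg d T \<le> energy_reg d 0 * exp (- r * T) + (d * M) / r * (1 - exp (- r * T))" if d: "d > 0" for d
  proof (rule gronwall_defect[OF T r energy_reg_continuous[OF d] energy_reg_derivative[OF d]])
    fix t assume t: "0 < t" "t \<le> T"
    have "d * defect t \<le> d * M" using M[of t] t d by (intro mult_left_mono) auto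
    with dissipation_lower_bound[OF t(1) d Dm K KP]
    show "dissipation d t \<ge> r * energy_reg d t - d * M" unfolding r_def by linarith
  qed
  have lim: "((\<lambda>d. energy_reg d 0 * exp (- r * T) + (d * M) / r * (1 - exp (- r * T))) \<longlongrightarrow>
      energy \<Omega> N \<epsilon> c \<Phi> 0 * exp (- r * T) + (0 * M) / r * (1 - exp (- r * T))) (at_right 0)"
    using r by (intro tendsto_intros energy_reg_limit) auto
  have "energy \<Omega> N \<epsilon> c \<Phi> T \<le> energy \<Omega> N \<epsilon> c \<Phi> 0 * exp (- r * T) + (0 * M) / r * (1 - exp (- r * T))"
  proof (rule tendsto_le[OF _ lim energy_reg_limit[OF T]])
    show "\<forall>\<^sub>F d in at_right 0. energy_reg d T \<le> energy_reg d 0 * exp (- r * T) + (d * M) / r * (1 - exp (- r * T))"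
      by (rule eventually_at_rightI[of 0 1]) (use reg in auto)
  qed simp
  then show ?thesis by simp
qed

lemma relative_entropy_nonneg:
  assumes "i < N" "t \<ge> 0"
  shows "relative_entropy \<Omega> (c i t) (mean \<Omega> (c i 0)) \<ge> 0"
proof (rule tendsto_lowerbound[OF entropy_limit[OF assms]])
  show "\<forall>\<^sub>F d in at_right 0. 0 \<le> entropy i d t"
    by (rule eventually_at_rightI[of 0 1]) (use entropy_nonneg[OF assms(1) _ assms(2)] in auto)
qed simp

text \<open>Factorisation \<open>\<bar>c - m\<bar> = \<bar>sqrt c - sqrt m\<bar> * (sqrt c + sqrt
  m)\<close> and Cauchy-Schwarz. The entropy controls the square of the first factor; that of the
  second is at most \<open>2 * (c + m)\<close>, whose integral is
  \<open>4 * m * measure lborel \<Omega>\<close> by conservation of mass.\<close>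

lemma csiszar_kullback:
  assumes i: "i < N" and t: "t \<ge> 0"
  shows "(L1_norm \<Omega> (\<lambda>x. c i t x - mean \<Omega> (c i 0)))\<^sup>2 \<le>
    4 * measure lborel \<Omega> * mean \<Omega> (c i 0) * relative_entropy \<Omega> (c i t) (mean \<Omega> (c i 0))"
proof (cases "mean \<Omega> (c i 0) = 0")
  case True
  have "L1_norm \<Omega> (\<lambda>x. c i t x - mean \<Omega> (c i 0)) = (LBINT x:\<Omega>. 0)"
    unfolding L1_norm_def using absent_species[OF i True t] True by (intro cong) auto
  then show ?thesis using True by simp
next
  case False
  define m where "m = mean \<Omega> (c i 0)"
  have m: "m > 0" using False mean_nonneg[OF i] by (simp add: m_def)
  define f where "f x = \<bar>sqrt (cc i t x) - sqrt m\<bar>" for x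
  define h where "h x = sqrt (cc i t x) + sqrt m" for x
  have cont: "continuous_on (closure \<Omega>) f" "continuous_on (closure \<Omega>) h"
    unfolding f_def h_def by (intro continuous_intros slices[OF i t])+
  have ccn: "cc i t x \<ge> 0" if "x \<in> \<Omega>" for x using cc_nonneg[OF i t in_cl[OF that]] .
  have "L1_norm \<Omega> (\<lambda>x. c i t x - m) = (LBINT x:\<Omega>. f x * h x)"
    unfolding L1_norm_def
  proof (rule cong)
    fix x assume x: "x \<in> \<Omega>"
    have "f x * h x = \<bar>(sqrt (cc i t x) - sqrt m) * (sqrt (cc i t x) + sqrt m)\<bar>"
      using ccn[OF x] m by (simp add: f_def h_def abs_mult)
    also have "(sqrt (cc i t x) - sqrt m) * (sqrt (cc i t x) + sqrt m) = cc i t x - m"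
      using ccn[OF x] m by (simp add: algebra_simps)
    finally show "\<bar>c i t x - m\<bar> = f x * h x" using cc(2)[OF i t x] by simp
  qed
  then have "(L1_norm \<Omega> (\<lambda>x. c i t x - m))\<^sup>2 \<le> (LBINT x:\<Omega>. (f x)\<^sup>2) * (LBINT x:\<Omega>. (h x)\<^sup>2)"
    using set_integral_Cauchy_Schwarz[of lborel \<Omega> f h] cont by (auto intro!: ci continuous_intros)
  also have "\<dots> \<le> relative_entropy \<Omega> (c i t) m * (4 * measure lborel \<Omega> * m)"
  proof (rule mult_mono)
    show "(LBINT x:\<Omega>. (f x)\<^sup>2) \<le> relative_entropy \<Omega> (c i t) m"
      unfolding m_def relative_entropy_eq(2)[OF i m[unfolded m_def] t]
    proof (rule set_integral_mono_on)
      show "set_integrable lborel \<Omega> (\<lambda>x. (f x)\<^sup>2)" by (intro ci continuous_intros cont)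
      show "(f x)\<^sup>2 \<le> entropy_density (mean \<Omega> (c i 0)) (cc i t x)" if "x \<in> \<Omega>" for x
        using sqrt_diff_le_entropy_density[OF m ccn[OF that]] by (simp add: f_def m_def)
    qed (rule relative_entropy_eq(1)[OF i m[unfolded m_def] t])
    have "(LBINT x:\<Omega>. (h x)\<^sup>2) \<le> (LBINT x:\<Omega>. 2 * (cc i t x + m))"
    proof (rule set_integral_mono_on)
      show "set_integrable lborel \<Omega> (\<lambda>x. (h x)\<^sup>2)" "set_integrable lborel \<Omega> (\<lambda>x. 2 * (cc i t x + m))"
        by (intro ci continuous_intros cont slices[OF i t])+
      fix x assume x: "x \<in> \<Omega>"
      have "0 \<le> (sqrt (cc i t x) - sqrt m)\<^sup>2" by simp
      then have "2 * (sqrt (cc i t x) * sqrt m) \<le> cc i t x + m"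
        using ccn[OF x] m by (simp add: power2_diff)
      then show "(h x)\<^sup>2 \<le> 2 * (cc i t x + m)"
        using ccn[OF x] m by (simp add: h_def power2_sum)
    qed
    also have "\<dots> = 2 * ((LBINT x:\<Omega>. cc i t x) + m * measure lborel \<Omega>)"
      using slices(1)[OF i t] by (simp, subst set_integral_add) (auto intro!: ci simp: set_lebesgue_integral_def)
    also have "(LBINT x:\<Omega>. cc i t x) = m * measure lborel \<Omega>"
      using mass_conserved[OF i t] vol by (simp add: m_def mean_def)
    finally show "(LBINT x:\<Omega>. (h x)\<^sup>2) \<le> 4 * measure lborel \<Omega> * m" by (simp add: mult_ac)
    show "0 \<le> relative_entropy \<Omega> (c i t) m" unfolding m_def by (rule relative_entropy_nonneg[OF i t])
    show "0 \<le> (LBINT x:\<Omega>. (h x)\<^sup>2)" by (simp add: set_lebesgue_integral_def)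
  qed
  finally show ?thesis by (simp add: m_def mult_ac)
qed

lemma energy_dominates:
  assumes t: "t \<ge> 0"
  shows "i < N \<Longrightarrow> relative_entropy \<Omega> (c i t) (mean \<Omega> (c i 0)) \<le> energy \<Omega> N \<epsilon> c \<Phi> t"
    and "(\<Sum>i<N. relative_entropy \<Omega> (c i t) (mean \<Omega> (c i 0))) \<le> energy \<Omega> N \<epsilon> c \<Phi> t"
    and "\<epsilon> / 2 * (L2_norm \<Omega> (grad (\<Phi> t)))\<^sup>2 \<le> energy \<Omega> N \<epsilon> c \<Phi> t"
proof -
  have n: "0 \<le> (LBINT x:\<Omega>. (norm (grad (\<Phi> t) x))\<^sup>2)" by (simp add: set_lebesgue_integral_def)
  have s: "0 \<le> (\<Sum>i<N. relative_entropy \<Omega> (c i t) (mean \<Omega> (c i 0)))"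
    using relative_entropy_nonneg t by (intro sum_nonneg) auto
  show 2: "(\<Sum>i<N. relative_entropy \<Omega> (c i t) (mean \<Omega> (c i 0))) \<le> energy \<Omega> N \<epsilon> c \<Phi> t"
    using n eps by (simp add: energy_def)
  show "\<epsilon> / 2 * (L2_norm \<Omega> (grad (\<Phi> t)))\<^sup>2 \<le> energy \<Omega> N \<epsilon> c \<Phi> t"
    using n s by (simp add: energy_def L2_norm_def)
  assume "i < N"
  then have "relative_entropy \<Omega> (c i t) (mean \<Omega> (c i 0)) \<le> (\<Sum>i<N. relative_entropy \<Omega> (c i t) (mean \<Omega> (c i 0)))"
    using relative_entropy_nonneg t by (intro member_le_sum) auto
  with 2 show "relative_entropy \<Omega> (c i t) (mean \<Omega> (c i 0)) \<le> energy \<Omega> N \<epsilon> c \<Phi> t" by linarith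
qed

end

lemma tendsto_0_of_square_le:
  fixes f g :: "real \<Rightarrow> real"
  assumes "(g \<longlongrightarrow> 0) at_top" "\<And>t. t \<ge> 0 \<Longrightarrow> (f t)\<^sup>2 \<le> g t"
  shows "(f \<longlongrightarrow> 0) at_top"
proof -
  have "((\<lambda>t. (f t)\<^sup>2) \<longlongrightarrow> 0) at_top"
  proof (rule tendsto_sandwich[OF _ _ tendsto_const assms(1)])
    show "\<forall>\<^sub>F t in at_top. (f t)\<^sup>2 \<le> g t" using eventually_ge_at_top[of 0] by eventually_elim (rule assms(2))
  qed simp
  from tendsto_real_sqrt[OF this] have "((\<lambda>t. \<bar>f t\<bar>) \<longlongrightarrow> 0) at_top" by simp
  then show ?thesis by (rule tendsto_rabs_zero_cancel)
qed

text \<open>The order of the quantifiers expresses the dependence of the constants: \<open>C\<close>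
  is chosen from \<Omega> alone and \<open>r\<close> from \<Omega>, \<open>N\<close> and
  \<open>D\<close>, both before \<epsilon>, the valences and the solution.\<close>

theorem theorem2:
  fixes \<Omega> :: "'a::euclidean_space set"
  assumes "DIM('a) \<ge> 2"
    and "smooth_bounded_domain \<Omega>"
  shows "\<exists>C>0. \<forall>(N::nat) (D::nat \<Rightarrow> real). (\<forall>i<N. D i > 0) \<longrightarrow>
    (\<exists>r>0. \<forall>(\<epsilon>::real) (z::nat \<Rightarrow> real) (c::nat \<Rightarrow> real \<Rightarrow> 'a \<Rightarrow> real) (\<Phi>::real \<Rightarrow> 'a \<Rightarrow> real).
      \<epsilon> > 0 \<longrightarrow> nernst_planck_solution \<Omega> N D \<epsilon> z c \<Phi> \<longrightarrow>
      (\<Sum>i<N. z i * mean \<Omega> (c i 0)) = 0 \<longrightarrow>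
        (\<forall>i<N. ((\<lambda>t. relative_entropy \<Omega> (c i t) (mean \<Omega> (c i 0))) \<longlongrightarrow> 0) at_top) \<and>
        ((\<lambda>t. L2_norm \<Omega> (grad (\<Phi> t))) \<longlongrightarrow> 0) at_top \<and>
        (\<forall>t\<ge>0. energy \<Omega> N \<epsilon> c \<Phi> t \<le> energy \<Omega> N \<epsilon> c \<Phi> 0 * exp (- r * t)) \<and>
        (\<forall>i<N. ((\<lambda>t. L1_norm \<Omega> (\<lambda>x. c i t x - mean \<Omega> (c i 0))) \<longlongrightarrow> 0) at_top) \<and>
        (\<forall>t\<ge>0. (\<Sum>i<N. (L1_norm \<Omega> (\<lambda>x. c i t x - mean \<Omega> (c i 0)))\<^sup>2 / mean \<Omega> (c i 0))
                  \<le> C * energy \<Omega> N \<epsilon> c \<Phi> 0 * exp (- r * t)))"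
proof -
  have \<Omega>: "open \<Omega>" "bounded \<Omega>" "\<Omega> \<noteq> {}" using assms(2) by (auto simp: smooth_bounded_domain_def)
  have vol: "measure lborel \<Omega> > 0" by (rule measure_open_pos[OF \<Omega>(1,3,2)])
  obtain k k' where k: "boundary_cutoffs \<Omega> k k'" using boundary_cutoffs_exist[OF assms(2)] by blast
  obtain K where K: "log_sobolev_constant \<Omega> K" using log_sobolev_constant_exists[OF assms(2)] ..
  obtain KP where KP: "poincare_constant \<Omega> KP" using poincare_constant_exists[OF assms(2)] ..
  define C where "C = 4 * measure lborel \<Omega>"
  show ?thesis
  proof (rule exI[of _ C], intro conjI allI impI)
    show C: "C > 0" using vol by (simp add: C_def)
    fix N :: nat and D :: "nat \<Rightarrow> real" assume D: "\<forall>i<N. D i > 0"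
    \<comment> \<open>Inserting 1 makes this the minimum of a nonempty set even for
      \<open>N = 0\<close>.\<close>
    define Dm where "Dm = Min (insert 1 (D ` {..<N}))"
    have Dm: "Dm > 0" "\<And>i. i < N \<Longrightarrow> Dm \<le> D i" using D by (auto simp: Dm_def)
    define r where "r = Dm / 2 * min (1 / K) (4 / KP)"
    have r: "r > 0" using Dm(1) log_sobolev_constantD(1)[OF K] poincare_constantD(1)[OF KP] by (simp add: r_def)
    show "\<exists>r>0. \<forall>(\<epsilon>::real) (z::nat \<Rightarrow> real) (c::nat \<Rightarrow> real \<Rightarrow> 'a \<Rightarrow> real) (\<Phi>::real \<Rightarrow> 'a \<Rightarrow> real).
      \<epsilon> > 0 \<longrightarrow> nernst_planck_solution \<Omega> N D \<epsilon> z c \<Phi> \<longrightarrow>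
      (\<Sum>i<N. z i * mean \<Omega> (c i 0)) = 0 \<longrightarrow>
        (\<forall>i<N. ((\<lambda>t. relative_entropy \<Omega> (c i t) (mean \<Omega> (c i 0))) \<longlongrightarrow> 0) at_top) \<and>
        ((\<lambda>t. L2_norm \<Omega> (grad (\<Phi> t))) \<longlongrightarrow> 0) at_top \<and>
        (\<forall>t\<ge>0. energy \<Omega> N \<epsilon> c \<Phi> t \<le> energy \<Omega> N \<epsilon> c \<Phi> 0 * exp (- r * t)) \<and>
        (\<forall>i<N. ((\<lambda>t. L1_norm \<Omega> (\<lambda>x. c i t x - mean \<Omega> (c i 0))) \<longlongrightarrow> 0) at_top) \<and>
        (\<forall>t\<ge>0. (\<Sum>i<N. (L1_norm \<Omega> (\<lambda>x. c i t x - mean \<Omega> (c i 0)))\<^sup>2 / mean \<Omega> (c i 0))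
                  \<le> C * energy \<Omega> N \<epsilon> c \<Phi> 0 * exp (- r * t))"
    proof (rule exI[of _ r], intro conjI, rule r, intro allI impI)
      fix \<epsilon> :: real and z c and \<Phi> :: "real \<Rightarrow> 'a \<Rightarrow> real"
      assume eps: "\<epsilon> > 0" and sol: "nernst_planck_solution \<Omega> N D \<epsilon> z c \<Phi>"
      interpret nernst_planck \<Omega> N D \<epsilon> z c \<Phi> k k'
        by unfold_locales (use k assms(2) D eps sol in auto)
      let ?E = "energy \<Omega> N \<epsilon> c \<Phi>"
      have decay: "?E t \<le> ?E 0 * exp (- r * t)" if "t \<ge> 0" for t
        unfolding r_def by (rule energy_decay[OF that Dm K KP])
      have "filterlim (\<lambda>t. - r * t) at_bot at_top"
        using filterlim_tendsto_neg_mult_at_bot[OF tendsto_const _ filterlim_ident, of "- r"] r by simp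
      then have "((\<lambda>t. exp (- r * t)) \<longlongrightarrow> 0) at_top" by (rule filterlim_compose[OF exp_at_bot])
      from tendsto_mult_right_zero[OF this, of "?E 0"]
      have lim: "((\<lambda>t. ?E 0 * exp (- r * t)) \<longlongrightarrow> 0) at_top" .
      have ent: "((\<lambda>t. relative_entropy \<Omega> (c i t) (mean \<Omega> (c i 0))) \<longlongrightarrow> 0) at_top" if i: "i < N" for i
      proof (rule tendsto_sandwich[OF _ _ tendsto_const lim])
        show "\<forall>\<^sub>F t in at_top. 0 \<le> relative_entropy \<Omega> (c i t) (mean \<Omega> (c i 0))"
          using eventually_ge_at_top[of 0] by eventually_elim (rule relative_entropy_nonneg[OF i])
        show "\<forall>\<^sub>F t in at_top. relative_entropy \<Omega> (c i t) (mean \<Omega> (c i 0)) \<le> ?E 0 * exp (- r * t)"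
          using eventually_ge_at_top[of 0] by eventually_elim (rule order_trans[OF energy_dominates(1)[OF _ i] decay])
      qed
      have "((\<lambda>t. L2_norm \<Omega> (grad (\<Phi> t))) \<longlongrightarrow> 0) at_top"
      proof (rule tendsto_0_of_square_le)
        show "((\<lambda>t. 2 / \<epsilon> * (?E 0 * exp (- r * t))) \<longlongrightarrow> 0) at_top" by (rule tendsto_mult_right_zero[OF lim])
        fix t :: real assume t: "t \<ge> 0"
        have "\<epsilon> / 2 * (L2_norm \<Omega> (grad (\<Phi> t)))\<^sup>2 \<le> ?E 0 * exp (- r * t)"
          using energy_dominates(3)[OF t] decay[OF t] by linarith
        then show "(L2_norm \<Omega> (grad (\<Phi> t)))\<^sup>2 \<le> 2 / \<epsilon> * (?E 0 * exp (- r * t))"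
          using eps by (simp add: field_simps)
      qed
      moreover have "((\<lambda>t. L1_norm \<Omega> (\<lambda>x. c i t x - mean \<Omega> (c i 0))) \<longlongrightarrow> 0) at_top" if i: "i < N" for i
      proof (rule tendsto_0_of_square_le)
        show "((\<lambda>t. 4 * measure lborel \<Omega> * mean \<Omega> (c i 0) * relative_entropy \<Omega> (c i t) (mean \<Omega> (c i 0))) \<longlongrightarrow> 0) at_top"
          by (rule tendsto_mult_right_zero[OF ent[OF i]])
      qed (rule csiszar_kullback[OF i])
      moreover have "(\<Sum>i<N. (L1_norm \<Omega> (\<lambda>x. c i t x - mean \<Omega> (c i 0)))\<^sup>2 / mean \<Omega> (c i 0)) \<le> C * ?E 0 * exp (- r * t)"
        if t: "t \<ge> 0" for t
      proof -
        have "(\<Sum>i<N. (L1_norm \<Omega> (\<lambda>x. c i t x - mean \<Omega> (c i 0)))\<^sup>2 / mean \<Omega> (c i 0)) \<le>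
            (\<Sum>i<N. C * relative_entropy \<Omega> (c i t) (mean \<Omega> (c i 0)))"
        proof (rule sum_mono)
          fix i assume "i \<in> {..<N}"
          then have i: "i < N" by simp
          show "(L1_norm \<Omega> (\<lambda>x. c i t x - mean \<Omega> (c i 0)))\<^sup>2 / mean \<Omega> (c i 0) \<le> C * relative_entropy \<Omega> (c i t) (mean \<Omega> (c i 0))"
          proof (cases "mean \<Omega> (c i 0) = 0")
            \<comment> \<open>Division by 0 yields 0, so an absent species contributes nothing to
              the left side.\<close>
            case True
            then show ?thesis using relative_entropy_nonneg[OF i t] C by simp
          next
            case False
            then have "mean \<Omega> (c i 0) > 0" using mean_nonneg[OF i] by simp
            then show ?thesis using csiszar_kullback[OF i t] by (simp add: C_def field_simps)
          qed
        qed
        also have "\<dots> \<le> C * (?E 0 * exp (- r * t))"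
          unfolding sum_distrib_left[symmetric] using C order_trans[OF energy_dominates(2)[OF t] decay[OF t]]
          by (intro mult_left_mono) auto
        finally show ?thesis by (simp add: mult.assoc)
      qed
      ultimately show "(\<forall>i<N. ((\<lambda>t. relative_entropy \<Omega> (c i t) (mean \<Omega> (c i 0))) \<longlongrightarrow> 0) at_top) \<and>
        ((\<lambda>t. L2_norm \<Omega> (grad (\<Phi> t))) \<longlongrightarrow> 0) at_top \<and>
        (\<forall>t\<ge>0. ?E t \<le> ?E 0 * exp (- r * t)) \<and>
        (\<forall>i<N. ((\<lambda>t. L1_norm \<Omega> (\<lambda>x. c i t x - mean \<Omega> (c i 0))) \<longlongrightarrow> 0) at_top) \<and>
        (\<forall>t\<ge>0. (\<Sum>i<N. (L1_norm \<Omega> (\<lambda>x. c i t x - mean \<Omega> (c i 0)))\<^sup>2 / mean \<Omega> (c i 0))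
                  \<le> C * ?E 0 * exp (- r * t))"
        using ent decay by blast
    qed
  qed
qed

end
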